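(* (i) Being $s$-smooth is a local property: if $X$ is a monoid scheme of finite type and $(U_i)_{i\in I}$ is an open cover of $X$, then $X$ is $s$-smooth if and only if every open monoid subscheme $U_i$ is $s$-smooth. (ii) If $X$ and $Y$ are $s$-smooth monoid schemes, then $X\times Y$ is also $s$-smooth. (iii) Any smooth monoid scheme is $s$-smooth.
   Context: All monoids are commutative, multiplicative, with unit (no zero element is required). An ideal of a monoid $M$ is a (possibly empty) subset $I$ with $IM\subset I$; it is prime if $M\setminus I$ is a submonoid (so $\emptyset$ is prime). $\mathrm{Spec}(M)$ is the set of prime ideals with basis of open sets $D(f)=\{\mathfrak p : f\notin\mathfrak p\}$, $f\in M$, and sheaf of monoids $\mathcal{O}_M$ with $\mathcal{O}_M(D(f))=M_f$. A monoid scheme is a topological space $X$ with a sheaf of monoids $\mathcal{O}_X$ that is locally isomorphic to some $(\mathrm{Spec}(M),\mathcal{O}_M)$; morphisms are local, as for usual schemes. Finite products exist; locally $\mathrm{Spec}(M)\times\mathrm{Spec}(N)=\mathrm{Spec}(M\times N)$. $X$ is of finite type if it has a finite open cover by affine schemes $\mathrm{Spec}(M_i)$ with all $M_i$ finitely generated; then $X$ is a finite $T_0$-space, regarded as a poset with $x\le y$ iff $\overline{\{y\}}\subset\overline{\{x\}}$ (open sets are the downward closed subsets). Sheaves $F$ on $X$ correspond to contravariant functors $x\mapsto F_x$ on this poset, with $F(U)=\lim_{x\in U}F_x$. An element $a$ of a monoid $M$ is $s$-regular if for all $u,v\in M$ and $m\in\mathbb N$ with $a^mu=a^mv$ there is $n\in\mathbb{N}=\{0,1,2,\dots\}$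 with $u(uv)^n=v(uv)^n$. The set ${\sf S}(M)$ of $s$-regular elements is a submonoid of $M$, and the localization maps $\mathcal{O}_{X,y}\to\mathcal{O}_{X,x}$ ($x\le y$) preserve $s$-regular elements. $s\mathcal{M}_X$ is the sheaf corresponding to the contravariant functor $x\mapsto(\mathcal{O}_{X,x})_{{\sf S}(\mathcal{O}_{X,x})}$. $\mathcal{O}_X^*$, $s\mathcal{M}_X^*$ are the subsheaves of invertible elements; the natural map $\mathcal{O}_X^*\to s\mathcal{M}_X^*$ is injective. $X$ is $s$-cancellative if for any $x\le y$ in $X$ the induced map $\mathcal{O}_{X,y}^*\to\mathcal{O}_{X,x}^*$ is injective. A sheaf $F$ of abelian groups on a topological space $X$ is $s$-flasque if for every open $U\subset X$ the restriction $F(X)\to F(U)$ has a section (a right inverse group homomorphism). An $s$-cancellative monoid scheme $X$ of finite type is $s$-smooth if the sheaf $s\mathcal{M}_X^*/\mathcal{O}_X^*$ is $s$-flasque. A monoid scheme of finite type is smooth if it has an open cover by affine monoid schemes of the type $\mathrm{Spec}(\mathbb{N}^r\times\mathbb{Z}^s)$ (with $\mathbb N,\mathbb Z$ additive). *)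

theory Defs
  imports
    "HOL-Analysis.Analysis"
    "HOL-Algebra.Coset"
    "HOL-Algebra.Elementary_Groups"
    "HOL-Algebra.Product_Groups"
begin

section \<open>Commutative monoids: ideals, localization, regularity\<close>

text \<open>Monoids are \<open>comm_monoid\<close>s of HOL-Algebra. (The library name \<open>monoid_scheme\<close> is the
  extensible record type of monoids and has nothing to do with monoid schemes.)\<close>

definition monoid_prime :: "('a, 'm) monoid_scheme \<Rightarrow> 'a set \<Rightarrow> bool" where
  "monoid_prime M P \<longleftrightarrow>
     P \<subseteq> carrier M \<and> (\<forall>x\<in>P. \<forall>m\<in>carrier M. x \<otimes>\<^bsub>M\<^esub> m \<in> P) \<and> submonoid (carrier M - P) M"

definition monoid_finitely_generated :: "('a, 'm) monoid_scheme \<Rightarrow> bool" where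
  "monoid_finitely_generated M \<longleftrightarrow>
     (\<exists>A. finite A \<and> A \<subseteq> carrier M \<and> \<Inter>{H. submonoid H M \<and> A \<subseteq> H} = carrier M)"

definition frac_rel :: "('a, 'm) monoid_scheme \<Rightarrow> 'a set \<Rightarrow> (('a \<times> 'a) \<times> ('a \<times> 'a)) set" where
  "frac_rel M S = {((a, s), (b, t)). a \<in> carrier M \<and> s \<in> S \<and> b \<in> carrier M \<and> t \<in> S \<and>
     (\<exists>u\<in>S. u \<otimes>\<^bsub>M\<^esub> (a \<otimes>\<^bsub>M\<^esub> t) = u \<otimes>\<^bsub>M\<^esub> (b \<otimes>\<^bsub>M\<^esub> s))}"

text \<open>The fraction \<open>a / s\<close>.\<close>

definition fraction :: "('a, 'm) monoid_scheme \<Rightarrow> 'a set \<Rightarrow> 'a \<Rightarrow> 'a \<Rightarrow> ('a \<times> 'a) set" where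
  "fraction M S a s = frac_rel M S `` {(a, s)}"

text \<open>The union in the multiplication is over equal sets (all representatives give the same class);
  the same encoding of well-defined operations on classes is used throughout.\<close>

definition localization :: "('a, 'm) monoid_scheme \<Rightarrow> 'a set \<Rightarrow> ('a \<times> 'a) set monoid" where
  "localization M S =
     \<lparr>carrier = (carrier M \<times> S) // frac_rel M S,
      mult = (\<lambda>A B. \<Union>(a, s)\<in>A. \<Union>(b, t)\<in>B. fraction M S (a \<otimes>\<^bsub>M\<^esub> b) (s \<otimes>\<^bsub>M\<^esub> t)),
      one = fraction M S \<one>\<^bsub>M\<^esub> \<one>\<^bsub>M\<^esub>\<rparr>"

text \<open>The map of localizations into \<open>localization N T\<close> induced by a homomorphism \<open>h\<close>,
  i.e. \<open>a / s \<mapsto> h a / h s\<close>.\<close>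

definition localization_map ::
    "('b, 'n) monoid_scheme \<Rightarrow> 'b set \<Rightarrow> ('a \<Rightarrow> 'b) \<Rightarrow> ('a \<times> 'a) set \<Rightarrow> ('b \<times> 'b) set" where
  "localization_map N T h A = (\<Union>(a, s)\<in>A. fraction N T (h a) (h s))"

definition s_regular :: "('a, 'm) monoid_scheme \<Rightarrow> 'a \<Rightarrow> bool" where
  "s_regular M a \<longleftrightarrow> a \<in> carrier M \<and>
     (\<forall>u\<in>carrier M. \<forall>v\<in>carrier M. \<forall>m::nat.
        a [^]\<^bsub>M\<^esub> m \<otimes>\<^bsub>M\<^esub> u = a [^]\<^bsub>M\<^esub> m \<otimes>\<^bsub>M\<^esub> v \<longrightarrow>
        (\<exists>n::nat. u \<otimes>\<^bsub>M\<^esub> (u \<otimes>\<^bsub>M\<^esub> v) [^]\<^bsub>M\<^esub> n = v \<otimes>\<^bsub>M\<^esub> (u \<otimes>\<^bsub>M\<^esub> v) [^]\<^bsub>M\<^esub> n))"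

definition s_regulars :: "('a, 'm) monoid_scheme \<Rightarrow> 'a set" where
  "s_regulars M = {a. s_regular M a}"

definition nat_monoid :: "nat monoid" where
  "nat_monoid = \<lparr>carrier = UNIV, mult = (+), one = 0\<rparr>"

text \<open>The monoid \<open>\<nat>\<^sup>r \<times> \<int>\<^sup>s\<close>.\<close>

definition free_NZ :: "nat \<Rightarrow> nat \<Rightarrow> ((nat \<Rightarrow> nat) \<times> (nat \<Rightarrow> int)) monoid" where
  "free_NZ r s =
     product_group {..<r} (\<lambda>_. nat_monoid) \<times>\<times> product_group {..<s} (\<lambda>_. integer_group)"


section \<open>Sheaves of monoids\<close>

text \<open>A space with the data of a presheaf of monoids: \<open>sec X U\<close> is the monoid of sections over
  \<open>U\<close> and \<open>res X U V\<close> the restriction from \<open>U\<close> to \<open>V\<close>. Only open sets \<open>U\<close>, \<open>V\<close> with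
  \<open>V \<subseteq> U\<close> and elements of the carriers matter.\<close>

record ('p, 'a) monoid_space =
  base :: "'p topology"
  sec :: "'p set \<Rightarrow> 'a monoid"
  res :: "'p set \<Rightarrow> 'p set \<Rightarrow> 'a \<Rightarrow> 'a"

definition presheaf_of_monoids :: "('p, 'a) monoid_space \<Rightarrow> bool" where
  "presheaf_of_monoids X \<longleftrightarrow>
     (\<forall>U. openin (base X) U \<longrightarrow> comm_monoid (sec X U)) \<and>
     (\<forall>U V. openin (base X) U \<longrightarrow> openin (base X) V \<longrightarrow> V \<subseteq> U \<longrightarrow>
        res X U V \<in> hom (sec X U) (sec X V) \<and>
        res X U V \<one>\<^bsub>sec X U\<^esub> = \<one>\<^bsub>sec X V\<^esub>) \<and>
     (\<forall>U. openin (base X) U \<longrightarrow> (\<forall>s\<in>carrier (sec X U). res X U U s = s)) \<and>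
     (\<forall>U V W. openin (base X) U \<longrightarrow> openin (base X) V \<longrightarrow> openin (base X) W \<longrightarrow>
        V \<subseteq> U \<longrightarrow> W \<subseteq> V \<longrightarrow>
        (\<forall>s\<in>carrier (sec X U). res X V W (res X U V s) = res X U W s))"

text \<open>The empty cover is allowed, so there is exactly one section over the empty set.\<close>

definition sheaf_of_monoids :: "('p, 'a) monoid_space \<Rightarrow> bool" where
  "sheaf_of_monoids X \<longleftrightarrow> presheaf_of_monoids X \<and>
     (\<forall>\<U>. (\<forall>U\<in>\<U>. openin (base X) U) \<longrightarrow>
        (\<forall>s\<in>carrier (sec X (\<Union>\<U>)). \<forall>t\<in>carrier (sec X (\<Union>\<U>)).
           (\<forall>U\<in>\<U>. res X (\<Union>\<U>) U s = res X (\<Union>\<U>) U t) \<longrightarrow> s = t)) \<and>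
     (\<forall>\<U> s. (\<forall>U\<in>\<U>. openin (base X) U \<and> s U \<in> carrier (sec X U)) \<longrightarrow>
        (\<forall>U\<in>\<U>. \<forall>V\<in>\<U>. res X U (U \<inter> V) (s U) = res X V (U \<inter> V) (s V)) \<longrightarrow>
        (\<exists>t\<in>carrier (sec X (\<Union>\<U>)). \<forall>U\<in>\<U>. res X (\<Union>\<U>) U t = s U))"

definition open_subspace :: "('p, 'a) monoid_space \<Rightarrow> 'p set \<Rightarrow> ('p, 'a) monoid_space" where
  "open_subspace X U = X\<lparr>base := subtopology (base X) U\<rparr>"

text \<open>Isomorphism of spaces with sheaves of monoids: a homeomorphism \<open>f\<close> and an isomorphism of
  sheaves \<open>\<O>\<^sub>Y \<cong> f\<^sub>*\<O>\<^sub>X\<close>. Locality of the maps on stalks is automatic for isomorphisms.\<close>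

definition isomorphic_spaces :: "('p, 'a) monoid_space \<Rightarrow> ('q, 'b) monoid_space \<Rightarrow> bool" where
  "isomorphic_spaces X Y \<longleftrightarrow>
     (\<exists>f \<phi>. homeomorphic_map (base X) (base Y) f \<and>
       (\<forall>V. openin (base Y) V \<longrightarrow>
          \<phi> V \<in> iso (sec Y V) (sec X {x \<in> topspace (base X). f x \<in> V})) \<and>
       (\<forall>V W. openin (base Y) V \<longrightarrow> openin (base Y) W \<longrightarrow> W \<subseteq> V \<longrightarrow>
          (\<forall>s\<in>carrier (sec Y V).
             res X {x \<in> topspace (base X). f x \<in> V} {x \<in> topspace (base X). f x \<in> W} (\<phi> V s)
             = \<phi> W (res Y V W s))))"


subsection \<open>Stalks\<close>

definition germ_rel ::
    "('p, 'a) monoid_space \<Rightarrow> 'p \<Rightarrow> (('p set \<times> 'a) \<times> ('p set \<times> 'a)) set" where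
  "germ_rel X x = {((U, s), (V, t)).
     openin (base X) U \<and> x \<in> U \<and> s \<in> carrier (sec X U) \<and>
     openin (base X) V \<and> x \<in> V \<and> t \<in> carrier (sec X V) \<and>
     (\<exists>W. openin (base X) W \<and> x \<in> W \<and> W \<subseteq> U \<inter> V \<and> res X U W s = res X V W t)}"

definition germ :: "('p, 'a) monoid_space \<Rightarrow> 'p \<Rightarrow> 'p set \<Rightarrow> 'a \<Rightarrow> ('p set \<times> 'a) set" where
  "germ X x U s = germ_rel X x `` {(U, s)}"

definition stalk :: "('p, 'a) monoid_space \<Rightarrow> 'p \<Rightarrow> ('p set \<times> 'a) set monoid" where
  "stalk X x =
     \<lparr>carrier = {(U, s). openin (base X) U \<and> x \<in> U \<and> s \<in> carrier (sec X U)} // germ_rel X x,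
      mult = (\<lambda>A B. \<Union>(U, s)\<in>A. \<Union>(V, t)\<in>B.
        germ X x (U \<inter> V) (res X U (U \<inter> V) s \<otimes>\<^bsub>sec X (U \<inter> V)\<^esub> res X V (U \<inter> V) t)),
      one = germ X x (topspace (base X)) \<one>\<^bsub>sec X (topspace (base X))\<^esub>\<rparr>"

definition point_le :: "'p topology \<Rightarrow> 'p \<Rightarrow> 'p \<Rightarrow> bool" where
  "point_le T x y \<longleftrightarrow> x \<in> topspace T \<and> y \<in> topspace T \<and>
     T closure_of {y} \<subseteq> T closure_of {x}"

text \<open>For \<open>x \<le> y\<close> every neighbourhood of \<open>y\<close> contains \<open>x\<close>; \<open>stalk_map X x\<close> is the resulting
  map from the stalk at any such \<open>y\<close> to the stalk at \<open>x\<close>.\<close>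

definition stalk_map ::
    "('p, 'a) monoid_space \<Rightarrow> 'p \<Rightarrow> ('p set \<times> 'a) set \<Rightarrow> ('p set \<times> 'a) set" where
  "stalk_map X x A = (\<Union>(U, s)\<in>A. germ X x U s)"


section \<open>Monoid schemes\<close>

definition basic_open :: "('a, 'm) monoid_scheme \<Rightarrow> 'a \<Rightarrow> 'a set set" where
  "basic_open M f = {P. monoid_prime M P \<and> f \<notin> P}"

definition Spec_topology :: "('a, 'm) monoid_scheme \<Rightarrow> 'a set topology" where
  "Spec_topology M = topology_generated_by (basic_open M ` carrier M)"

text \<open>Sections over \<open>U\<close> are the families of elements of the stalks \<open>M\<^sub>P\<close>, \<open>P \<in> U\<close>, that are
  locally given by one fraction. This is the sheaf with sections \<open>M\<^sub>f\<close> over \<open>basic_open M f\<close>: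
  that set has a largest element \<open>P\<close>, every neighbourhood of \<open>P\<close> contains \<open>basic_open M f\<close>,
  and \<open>M\<^sub>P = M\<^sub>f\<close>.\<close>

definition Spec_sections ::
    "('a, 'm) monoid_scheme \<Rightarrow> 'a set set \<Rightarrow> ('a set \<Rightarrow> ('a \<times> 'a) set) monoid" where
  "Spec_sections M U =
     \<lparr>carrier = {\<sigma> \<in> (\<Pi>\<^sub>E P\<in>U. carrier (localization M (carrier M - P))).
        \<forall>P\<in>U. \<exists>V a f. openin (Spec_topology M) V \<and> P \<in> V \<and> V \<subseteq> U \<and>
          a \<in> carrier M \<and> f \<in> carrier M \<and>
          (\<forall>Q\<in>V. f \<notin> Q \<and> \<sigma> Q = fraction M (carrier M - Q) a f)},
      mult = (\<lambda>\<sigma> \<tau>. \<lambda>P\<in>U. \<sigma> P \<otimes>\<^bsub>localization M (carrier M - P)\<^esub> \<tau> P),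
      one = (\<lambda>P\<in>U. \<one>\<^bsub>localization M (carrier M - P)\<^esub>)\<rparr>"

definition Spec ::
    "('a, 'm) monoid_scheme \<Rightarrow> ('a set, 'a set \<Rightarrow> ('a \<times> 'a) set) monoid_space" where
  "Spec M =
     \<lparr>base = Spec_topology M, sec = Spec_sections M, res = (\<lambda>U V \<sigma>. restrict \<sigma> V)\<rparr>"

text \<open>In the next two definitions \<open>M\<close> ranges over monoids on the type of sections of \<open>X\<close>. This
  is no restriction: an open subspace \<open>U\<close> that is isomorphic to \<open>Spec M\<close> for a monoid \<open>M\<close> on
  any type is isomorphic to the spectrum of \<open>sec X U \<cong> M\<close>.\<close>

definition is_monoid_scheme :: "('p, 'a) monoid_space \<Rightarrow> bool" where
  "is_monoid_scheme X \<longleftrightarrow> sheaf_of_monoids X \<and>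
     (\<forall>x\<in>topspace (base X). \<exists>U. openin (base X) U \<and> x \<in> U \<and>
        (\<exists>M :: 'a monoid. comm_monoid M \<and> isomorphic_spaces (open_subspace X U) (Spec M)))"

definition finite_type :: "('p, 'a) monoid_space \<Rightarrow> bool" where
  "finite_type X \<longleftrightarrow>
     (\<exists>\<U>. finite \<U> \<and> (\<forall>U\<in>\<U>. openin (base X) U) \<and> \<Union>\<U> = topspace (base X) \<and>
        (\<forall>U\<in>\<U>. \<exists>M :: 'a monoid. comm_monoid M \<and> monoid_finitely_generated M \<and>
           isomorphic_spaces (open_subspace X U) (Spec M)))"

definition smooth :: "('p, 'a) monoid_space \<Rightarrow> bool" where
  "smooth X \<longleftrightarrow> is_monoid_scheme X \<and> finite_type X \<and>
     (\<exists>\<U>. (\<forall>U\<in>\<U>. openin (base X) U) \<and> \<Union>\<U> = topspace (base X) \<and>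
        (\<forall>U\<in>\<U>. \<exists>r s. isomorphic_spaces (open_subspace X U) (Spec (free_NZ r s))))"

text \<open>The product of monoid schemes. Every prime ideal of \<open>M \<times> N\<close> is the complement of a product
  of complements of prime ideals of \<open>M\<close> and \<open>N\<close>, the basic open set of \<open>(f, g)\<close> is the product
  of those of \<open>f\<close> and \<open>g\<close>, and \<open>M \<times> N\<close> is the coproduct of commutative monoids. So, unlike
  for usual schemes, the product lives on the product space and its stalks are the products of the
  stalks: the structure sheaf is the sheafification of \<open>U \<times> V \<mapsto> \<O>\<^sub>X(U) \<times> \<O>\<^sub>Y(V)\<close>.\<close>

definition product_sections ::
    "('p, 'a) monoid_space \<Rightarrow> ('q, 'b) monoid_space \<Rightarrow> ('p \<times> 'q) set \<Rightarrow>
      ('p \<times> 'q \<Rightarrow> ('p set \<times> 'a) set \<times> ('q set \<times> 'b) set) monoid" where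
  "product_sections X Y W =
     \<lparr>carrier = {\<sigma> \<in> (\<Pi>\<^sub>E z\<in>W. carrier (stalk X (fst z) \<times>\<times> stalk Y (snd z))).
        \<forall>z\<in>W. \<exists>U V a b. openin (base X) U \<and> openin (base Y) V \<and> z \<in> U \<times> V \<and> U \<times> V \<subseteq> W \<and>
          a \<in> carrier (sec X U) \<and> b \<in> carrier (sec Y V) \<and>
          (\<forall>x\<in>U. \<forall>y\<in>V. \<sigma> (x, y) = (germ X x U a, germ Y y V b))},
      mult = (\<lambda>\<sigma> \<tau>. \<lambda>z\<in>W. \<sigma> z \<otimes>\<^bsub>stalk X (fst z) \<times>\<times> stalk Y (snd z)\<^esub> \<tau> z),
      one = (\<lambda>z\<in>W. \<one>\<^bsub>stalk X (fst z) \<times>\<times> stalk Y (snd z)\<^esub>)\<rparr>"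

definition product_space ::
    "('p, 'a) monoid_space \<Rightarrow> ('q, 'b) monoid_space \<Rightarrow>
      ('p \<times> 'q, 'p \<times> 'q \<Rightarrow> ('p set \<times> 'a) set \<times> ('q set \<times> 'b) set) monoid_space" where
  "product_space X Y =
     \<lparr>base = prod_topology (base X) (base Y), sec = product_sections X Y,
      res = (\<lambda>U V \<sigma>. restrict \<sigma> V)\<rparr>"


section \<open>Sheaves on finite posets as contravariant functors\<close>

text \<open>\<open>arr F y x\<close> is the map \<open>obj F y \<rightarrow> obj F x\<close> for \<open>x \<le> y\<close>.\<close>

record ('p, 'b) point_functor =
  obj :: "'p \<Rightarrow> 'b monoid"
  arr :: "'p \<Rightarrow> 'p \<Rightarrow> 'b \<Rightarrow> 'b"

definition limit_sections :: "'p topology \<Rightarrow> ('p, 'b) point_functor \<Rightarrow> 'p set \<Rightarrow> ('p \<Rightarrow> 'b) monoid"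
  where
  "limit_sections T F U =
     \<lparr>carrier = {\<sigma> \<in> (\<Pi>\<^sub>E x\<in>U. carrier (obj F x)).
        \<forall>x\<in>U. \<forall>y\<in>U. point_le T x y \<longrightarrow> arr F y x (\<sigma> y) = \<sigma> x},
      mult = (\<lambda>\<sigma> \<tau>. \<lambda>x\<in>U. \<sigma> x \<otimes>\<^bsub>obj F x\<^esub> \<tau> x),
      one = (\<lambda>x\<in>U. \<one>\<^bsub>obj F x\<^esub>)\<rparr>"

definition sheaf_of_functor ::
    "'p topology \<Rightarrow> ('p, 'b) point_functor \<Rightarrow> ('p, 'p \<Rightarrow> 'b) monoid_space" where
  "sheaf_of_functor T F =
     \<lparr>base = T, sec = limit_sections T F, res = (\<lambda>U V \<sigma>. restrict \<sigma> V)\<rparr>"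

definition units_functor :: "('p, 'b) point_functor \<Rightarrow> ('p, 'b) point_functor" where
  "units_functor F = \<lparr>obj = (\<lambda>x. units_of (obj F x)), arr = arr F\<rparr>"

text \<open>The quotient of a functor of abelian groups by a subfunctor with values \<open>H x\<close>: a coset of
  \<open>H y\<close> is sent to the coset of \<open>H x\<close> containing its image.\<close>

definition quotient_functor ::
    "('p, 'b) point_functor \<Rightarrow> ('p \<Rightarrow> 'b set) \<Rightarrow> ('p, 'b set) point_functor" where
  "quotient_functor F H =
     \<lparr>obj = (\<lambda>x. obj F x Mod H x), arr = (\<lambda>y x C. H x <#>\<^bsub>obj F x\<^esub> (arr F y x ` C))\<rparr>"

definition s_flasque :: "('p, 'b) monoid_space \<Rightarrow> bool" where
  "s_flasque F \<longleftrightarrow>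
     (\<forall>U. openin (base F) U \<longrightarrow>
        (\<exists>\<sigma>\<in>hom (sec F U) (sec F (topspace (base F))).
           \<forall>s\<in>carrier (sec F U). res F (topspace (base F)) U (\<sigma> s) = s))"


section \<open>s-smoothness\<close>

definition sM_functor ::
    "('p, 'a) monoid_space \<Rightarrow> ('p, (('p set \<times> 'a) set \<times> ('p set \<times> 'a) set) set) point_functor"
  where
  "sM_functor X =
     \<lparr>obj = (\<lambda>x. localization (stalk X x) (s_regulars (stalk X x))),
      arr = (\<lambda>y x. localization_map (stalk X x) (s_regulars (stalk X x)) (stalk_map X x))\<rparr>"

text \<open>The image of \<open>\<O>\<^sup>*\<close> in \<open>s\<M>\<^sup>*\<close>, stalkwise.\<close>

definition O_units :: "('p, 'a) monoid_space \<Rightarrow> 'p \<Rightarrow>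
    (('p set \<times> 'a) set \<times> ('p set \<times> 'a) set) set set" where
  "O_units X x =
     (\<lambda>a. fraction (stalk X x) (s_regulars (stalk X x)) a \<one>\<^bsub>stalk X x\<^esub>) ` Units (stalk X x)"

text \<open>The sheaf \<open>s\<M>\<^sup>*/\<O>\<^sup>*\<close>: a quotient of sheaves has the quotients of the stalks as its stalks.\<close>

definition sM_units_mod_O_units ::
    "('p, 'a) monoid_space \<Rightarrow>
      ('p, 'p \<Rightarrow> (('p set \<times> 'a) set \<times> ('p set \<times> 'a) set) set set) monoid_space" where
  "sM_units_mod_O_units X =
     sheaf_of_functor (base X) (quotient_functor (units_functor (sM_functor X)) (O_units X))"

definition s_cancellative :: "('p, 'a) monoid_space \<Rightarrow> bool" where
  "s_cancellative X \<longleftrightarrow>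
     (\<forall>x y. point_le (base X) x y \<longrightarrow> inj_on (stalk_map X x) (Units (stalk X y)))"

definition s_smooth :: "('p, 'a) monoid_space \<Rightarrow> bool" where
  "s_smooth X \<longleftrightarrow> is_monoid_scheme X \<and> finite_type X \<and> s_cancellative X \<and>
     s_flasque (sM_units_mod_O_units X)"

end

theory Submission
  imports Defs
begin

text \<open>A monoid scheme of finite type is recovered from the finite poset of its points \<open>y\<close> together
  with the monoids \<open>A y\<close> of sections over their minimal neighbourhoods: each restriction
  \<open>A y \<rightarrow> A x\<close> is a localization, and the points \<open>x \<le> y\<close> correspond to the faces of \<open>A y\<close>, the
  complements of its prime ideals. Sheaf-theoretic statements then become statements about functors.

  The stalk of \<open>s\<M>\<^sup>*/\<O>\<^sup>*\<close> at \<open>y\<close> is the group of fractions of the s-regular elements of \<open>A y\<close> modulo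
  the units of \<open>A y\<close>; this is characterized up to unique isomorphism by its map from the s-regular
  elements. A sheaf on a finite poset is s-flasque if and only if, for every \<open>x\<close>, its stalk at \<open>x\<close>
  maps onto the sections over the minimal neighbourhood punctured at \<open>x\<close> by a split map: sections
  extend one point at a time. This condition only sees the minimal neighbourhood of \<open>x\<close>, whence (i).

  For (ii), localizations, faces and s-regular elements of a product are products, so the sheaf of
  \<open>X \<times> Y\<close> is the sum of the pullbacks of the two sheaves; since every point has a unique generic
  point below it, a section of a pullback is determined by its values on the generic fibre.
  For (iii), the stalks are \<open>\<int>\<^sup>E\<close> with \<open>E\<close> the set of prime coordinates at the point, and the \<open>i\<close>-th
  coordinate of a section is read off at the point of height one where only \<open>i\<close> is not invertible.\<close>

section \<open>Homomorphisms and localizations of commutative monoids\<close>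


text \<open>The obstacle is that one mathematical object occurs on many types. Germs remember the
  ambient space, so an open subscheme and the whole space have different sets as stalks; the stalks
  of a product consist of germs of families of pairs of germs; the charts of a smooth scheme come
  from monoids on yet another type. Concrete quotients are therefore never compared directly.
  Localizations, groups of fractions modulo units and the functors made of them are described by
  predicates (\<open>is_localization\<close>, \<open>regular_quotient\<close>,
  \<open>quotient_model\<close>) that hold for every isomorphic copy, and splittings are carried
  from one copy to another. Two algebraic facts make this work: the s-regular elements form a face,
  so that a fraction is invertible exactly when its numerator is s-regular, and they stay s-regular
  under localization. The generic points that split pullbacks come from the empty prime ideal, whose
  complement is the whole monoid.\<close>

definition unital_hom :: "('a, 'm) monoid_scheme \<Rightarrow> ('b, 'n) monoid_scheme \<Rightarrow> ('a \<Rightarrow> 'b) \<Rightarrow> bool" where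
  "unital_hom M N h \<longleftrightarrow> h \<in> hom M N \<and> h \<one>\<^bsub>M\<^esub> = \<one>\<^bsub>N\<^esub>"

lemma unital_homD:
  assumes "unital_hom M N h"
  shows "a \<in> carrier M \<Longrightarrow> h a \<in> carrier N"
    and "a \<in> carrier M \<Longrightarrow> b \<in> carrier M \<Longrightarrow> h (a \<otimes>\<^bsub>M\<^esub> b) = h a \<otimes>\<^bsub>N\<^esub> h b"
    and "h \<one>\<^bsub>M\<^esub> = \<one>\<^bsub>N\<^esub>"
  using assms by (auto simp: unital_hom_def hom_def)

lemma unital_hom_pow:
  assumes "comm_monoid M" "comm_monoid N" "unital_hom M N h" "a \<in> carrier M"
  shows "h (a [^]\<^bsub>M\<^esub> (n::nat)) = h a [^]\<^bsub>N\<^esub> n"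
proof -
  interpret M: comm_monoid M by fact
  interpret N: comm_monoid N by fact
  show ?thesis
    by (induction n) (simp_all add: unital_homD[OF assms(3)] assms(4))
qed

lemma unital_hom_Units:
  assumes "comm_monoid M" "unital_hom M N h" "a \<in> Units M"
  shows "h a \<in> Units N"
proof -
  interpret M: comm_monoid M by fact
  note h = unital_homD[OF assms(2)]
  obtain b where b: "b \<in> carrier M" "a \<in> carrier M" "b \<otimes>\<^bsub>M\<^esub> a = \<one>\<^bsub>M\<^esub>" "a \<otimes>\<^bsub>M\<^esub> b = \<one>\<^bsub>M\<^esub>"
    using assms(3) by (auto simp: Units_def)
  have "h b \<otimes>\<^bsub>N\<^esub> h a = \<one>\<^bsub>N\<^esub>" "h a \<otimes>\<^bsub>N\<^esub> h b = \<one>\<^bsub>N\<^esub>"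
    using b h by metis+
  then show ?thesis using b h by (auto simp: Units_def)
qed

lemma unital_hom_comp:
  assumes "unital_hom M N h" "unital_hom N K k" shows "unital_hom M K (k \<circ> h)"
  using assms by (auto simp: unital_hom_def hom_def Pi_iff)

text \<open>If \<open>c\<close> inverts \<open>a b\<close>, then \<open>c b\<close> inverts
  \<open>a\<close> and \<open>c a\<close> inverts \<open>b\<close>. So the units form a face, and so
  does their preimage under any homomorphism.\<close>

lemma (in comm_monoid) Units_mult_iff:
  assumes "a \<in> carrier G" "b \<in> carrier G"
  shows "a \<otimes> b \<in> Units G \<longleftrightarrow> a \<in> Units G \<and> b \<in> Units G"
proof
  assume *: "a \<otimes> b \<in> Units G"
  obtain c where c: "c \<in> carrier G" "c \<otimes> (a \<otimes> b) = \<one>"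
    using * by (auto simp: Units_def)
  have "(c \<otimes> b) \<otimes> a = \<one>" "a \<otimes> (c \<otimes> b) = \<one>" "(c \<otimes> a) \<otimes> b = \<one>" "b \<otimes> (c \<otimes> a) = \<one>"
    using c assms by (simp_all add: m_ac)
  then show "a \<in> Units G \<and> b \<in> Units G"
    using c assms by (auto simp: Units_def intro: m_closed)
qed auto

lemma (in comm_monoid) Units_cancel:
  assumes "s \<in> Units G" "a \<in> carrier G" "b \<in> carrier G" "a \<otimes> s = b \<otimes> s"
  shows "a = b"
  using assms by (metis Units_closed Units_l_cancel m_comm)

lemma (in comm_monoid) Units_pow:
  assumes "a \<in> Units G" shows "a [^] (n::nat) \<in> Units G"
  using assms by (induction n) auto

text \<open>These are the submonoids closed under divisors, the complements of the prime ideals. The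
  whole carrier is one of them and belongs to the empty ideal.\<close>

definition face :: "('a, 'm) monoid_scheme \<Rightarrow> 'a set \<Rightarrow> bool" where
  "face M S \<longleftrightarrow> S \<subseteq> carrier M \<and> \<one>\<^bsub>M\<^esub> \<in> S \<and>
     (\<forall>a\<in>carrier M. \<forall>b\<in>carrier M. a \<otimes>\<^bsub>M\<^esub> b \<in> S \<longleftrightarrow> a \<in> S \<and> b \<in> S)"

lemma faceD:
  assumes "face M S"
  shows "a \<in> S \<Longrightarrow> a \<in> carrier M" "\<one>\<^bsub>M\<^esub> \<in> S"
    "a \<in> carrier M \<Longrightarrow> b \<in> carrier M \<Longrightarrow> a \<otimes>\<^bsub>M\<^esub> b \<in> S \<longleftrightarrow> a \<in> S \<and> b \<in> S"
  using assms by (auto simp: face_def)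

text \<open>The equivalence inside \<open>face\<close> packs two facts: closure under products makes
  the complement of the ideal a submonoid, and closure under divisors says that the ideal
  absorbs.\<close>

lemma monoid_prime_iff_face:
  assumes "comm_monoid M"
  shows "monoid_prime M P \<longleftrightarrow> P \<subseteq> carrier M \<and> face M (carrier M - P)"
proof -
  interpret M: comm_monoid M by fact
  show ?thesis
    unfolding monoid_prime_def face_def submonoid_def
    by auto (metis M.m_comm)+
qed

definition unit_face ::
    "('a, 'm) monoid_scheme \<Rightarrow> ('b, 'n) monoid_scheme \<Rightarrow> ('a \<Rightarrow> 'b) \<Rightarrow> 'a set" where
  "unit_face M N h = {a \<in> carrier M. h a \<in> Units N}"

lemma face_unit_face:
  assumes "comm_monoid M" "comm_monoid N" "unital_hom M N h"
  shows "face M (unit_face M N h)"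
proof -
  interpret M: comm_monoid M by fact
  interpret N: comm_monoid N by fact
  show ?thesis
    using unital_homD[OF assms(3)] by (auto simp: face_def unit_face_def N.Units_mult_iff)
qed

text \<open>Up to isomorphism, \<open>N\<close> is the localization of \<open>M\<close> at the
  elements that become invertible; no construction is chosen. The denominators are all of
  \<open>unit_face\<close>, so they always form a face and the map \<open>h\<close> alone records
  them.\<close>

definition is_localization ::
    "('a, 'm) monoid_scheme \<Rightarrow> ('b, 'n) monoid_scheme \<Rightarrow> ('a \<Rightarrow> 'b) \<Rightarrow> bool" where
  "is_localization M N h \<longleftrightarrow> unital_hom M N h \<and>
     (\<forall>n\<in>carrier N. \<exists>a\<in>carrier M. \<exists>s\<in>unit_face M N h. n \<otimes>\<^bsub>N\<^esub> h s = h a) \<and>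
     (\<forall>a\<in>carrier M. \<forall>b\<in>carrier M. h a = h b \<longrightarrow>
        (\<exists>u\<in>unit_face M N h. u \<otimes>\<^bsub>M\<^esub> a = u \<otimes>\<^bsub>M\<^esub> b))"

lemma is_localizationD:
  assumes "is_localization M N h"
  shows "unital_hom M N h"
    and "n \<in> carrier N \<Longrightarrow>
      \<exists>a s. a \<in> carrier M \<and> s \<in> carrier M \<and> h s \<in> Units N \<and> n \<otimes>\<^bsub>N\<^esub> h s = h a"
    and "a \<in> carrier M \<Longrightarrow> b \<in> carrier M \<Longrightarrow> h a = h b \<Longrightarrow>
      \<exists>u. u \<in> carrier M \<and> h u \<in> Units N \<and> u \<otimes>\<^bsub>M\<^esub> a = u \<otimes>\<^bsub>M\<^esub> b"
  using assms unfolding is_localization_def unit_face_def by blast+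

text \<open>Every element of \<open>N\<close> is some \<open>g a\<close> divided by a unit
  \<open>g s\<close>, and \<open>k\<close> preserves units, so fractions and relations over
  \<open>M\<close> can be moved to \<open>N\<close>. A chart \<open>M\<close> is localized at every
  point; this turns it into localizations between the sections at two points.\<close>

lemma is_localization_cancel:
  assumes "comm_monoid M" "comm_monoid N" "comm_monoid K"
    and g: "is_localization M N g" and gk: "is_localization M K gk"
    and k: "unital_hom N K k" and comp: "\<And>a. a \<in> carrier M \<Longrightarrow> k (g a) = gk a"
  shows "is_localization N K k"
proof -
  interpret M: comm_monoid M by fact
  interpret N: comm_monoid N by fact
  interpret K: comm_monoid K by fact
  have hg: "unital_hom M N g" using g by (auto simp: is_localization_def)
  have hgk: "unital_hom M K gk" using gk by (auto simp: is_localization_def)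
  note g' = unital_homD[OF hg] note gk' = unital_homD[OF hgk] note k' = unital_homD[OF k]
  show ?thesis
    unfolding is_localization_def
  proof (intro conjI ballI impI k)
    fix n assume "n \<in> carrier K"
    then obtain a s where *: "a \<in> carrier M" "s \<in> unit_face M K gk" "n \<otimes>\<^bsub>K\<^esub> gk s = gk a"
      using gk by (auto simp: is_localization_def)
    have "g s \<in> unit_face N K k" "g a \<in> carrier N" "n \<otimes>\<^bsub>K\<^esub> k (g s) = k (g a)"
      using * by (auto simp: unit_face_def comp g')
    then show "\<exists>a\<in>carrier N. \<exists>s\<in>unit_face N K k. n \<otimes>\<^bsub>K\<^esub> k s = k a" by blast
  next
    fix n1 n2 assume n: "n1 \<in> carrier N" "n2 \<in> carrier N" and eq: "k n1 = k n2"
    obtain a s where a: "a \<in> carrier M" "s \<in> unit_face M N g" "n1 \<otimes>\<^bsub>N\<^esub> g s = g a"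
      using g n by (auto simp: is_localization_def)
    obtain b t where b: "b \<in> carrier M" "t \<in> unit_face M N g" "n2 \<otimes>\<^bsub>N\<^esub> g t = g b"
      using g n by (auto simp: is_localization_def)
    have st: "s \<in> carrier M" "t \<in> carrier M" "g s \<in> Units N" "g t \<in> Units N"
      using a b by (auto simp: unit_face_def)
    \<comment> \<open>Cross-multiplication clears the denominators: the equality of the images of
      \<open>n1\<close> and \<open>n2\<close> in \<open>K\<close> becomes one between images of
      elements of \<open>M\<close>.\<close>
    have "gk (a \<otimes>\<^bsub>M\<^esub> t) = k (n1 \<otimes>\<^bsub>N\<^esub> (g s \<otimes>\<^bsub>N\<^esub> g t))"
      using a b st n by (simp add: comp[symmetric] g' N.m_assoc[symmetric])
    also have "\<dots> = k (n2 \<otimes>\<^bsub>N\<^esub> (g t \<otimes>\<^bsub>N\<^esub> g s))"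
      using n st g' by (simp add: k' eq N.m_comm)
    also have "\<dots> = gk (b \<otimes>\<^bsub>M\<^esub> s)"
      using a b st n by (simp add: comp[symmetric] g' N.m_assoc[symmetric])
    finally obtain u where u: "u \<in> unit_face M K gk"
      "u \<otimes>\<^bsub>M\<^esub> (a \<otimes>\<^bsub>M\<^esub> t) = u \<otimes>\<^bsub>M\<^esub> (b \<otimes>\<^bsub>M\<^esub> s)"
      using is_localizationD(3)[OF gk, of "a \<otimes>\<^bsub>M\<^esub> t" "b \<otimes>\<^bsub>M\<^esub> s"] a b st
      by (auto simp: unit_face_def)
    have uc: "u \<in> carrier M" using u by (auto simp: unit_face_def)
    have "(g u \<otimes>\<^bsub>N\<^esub> n1) \<otimes>\<^bsub>N\<^esub> (g s \<otimes>\<^bsub>N\<^esub> g t) = g (u \<otimes>\<^bsub>M\<^esub> (a \<otimes>\<^bsub>M\<^esub> t))"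
      using a b st n uc g' by (simp add: N.m_assoc[symmetric] flip: a(3))
    also have "\<dots> = (g u \<otimes>\<^bsub>N\<^esub> n2) \<otimes>\<^bsub>N\<^esub> (g t \<otimes>\<^bsub>N\<^esub> g s)"
      unfolding u using a b st n uc g' by (simp add: N.m_assoc[symmetric] flip: b(3))
    also have "\<dots> = (g u \<otimes>\<^bsub>N\<^esub> n2) \<otimes>\<^bsub>N\<^esub> (g s \<otimes>\<^bsub>N\<^esub> g t)"
      using st g' by (simp add: N.m_comm)
    finally have eq': "(g u \<otimes>\<^bsub>N\<^esub> n1) \<otimes>\<^bsub>N\<^esub> (g s \<otimes>\<^bsub>N\<^esub> g t) = (g u \<otimes>\<^bsub>N\<^esub> n2) \<otimes>\<^bsub>N\<^esub> (g s \<otimes>\<^bsub>N\<^esub> g t)" .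
    have "g u \<otimes>\<^bsub>N\<^esub> n1 = g u \<otimes>\<^bsub>N\<^esub> n2"
      by (rule N.Units_cancel[OF _ _ _ eq']) (use st uc g'(1) n in auto)
    moreover have "g u \<in> unit_face N K k"
      using u uc by (auto simp: unit_face_def comp g')
    ultimately show "\<exists>u\<in>unit_face N K k. u \<otimes>\<^bsub>N\<^esub> n1 = u \<otimes>\<^bsub>N\<^esub> n2" by blast
  qed
qed

section \<open>Isomorphisms of monoids\<close>

definition unital_iso :: "('a, 'm) monoid_scheme \<Rightarrow> ('b, 'n) monoid_scheme \<Rightarrow> ('a \<Rightarrow> 'b) \<Rightarrow> bool" where
  "unital_iso M N h \<longleftrightarrow> unital_hom M N h \<and> bij_betw h (carrier M) (carrier N)"

text \<open>The set \<open>iso\<close> asks only for a multiplicative bijection. If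
  \<open>h e\<close> is the unit of \<open>N\<close>, then
  \<open>h 1 = h 1 h e = h (1 e) = h e\<close>, so the unit is preserved all the same.\<close>

lemma unital_isoI_iso:
  assumes "comm_monoid M" "comm_monoid N" "h \<in> iso M N"
  shows "unital_iso M N h"
proof -
  interpret M: comm_monoid M by fact
  interpret N: comm_monoid N by fact
  have h: "h \<in> hom M N" "bij_betw h (carrier M) (carrier N)"
    using assms by (auto simp: iso_def)
  obtain e where e: "e \<in> carrier M" "h e = \<one>\<^bsub>N\<^esub>"
    using h(2) by (metis N.one_closed bij_betw_iff_bijections)
  have "h \<one>\<^bsub>M\<^esub> = h \<one>\<^bsub>M\<^esub> \<otimes>\<^bsub>N\<^esub> h e"
    using e h(1) by (simp add: hom_def Pi_iff)
  also have "\<dots> = h (\<one>\<^bsub>M\<^esub> \<otimes>\<^bsub>M\<^esub> e)"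
    using e h(1) by (simp only: hom_mult M.one_closed)
  finally show ?thesis using h e by (simp add: unital_iso_def unital_hom_def)
qed

lemma unital_iso_inv:
  assumes "comm_monoid M" "unital_iso M N h"
  shows "unital_iso N M (inv_into (carrier M) h)"
proof -
  interpret M: comm_monoid M by fact
  have b: "bij_betw h (carrier M) (carrier N)" and h: "unital_hom M N h"
    using assms by (auto simp: unital_iso_def)
  let ?g = "inv_into (carrier M) h"
  note h' = unital_homD[OF h]
  have g: "?g n \<in> carrier M" "h (?g n) = n" if "n \<in> carrier N" for n
    using b that by (auto simp: bij_betw_def inv_into_into f_inv_into_f)
  have gh: "?g (h a) = a" if "a \<in> carrier M" for a
    using b that by (auto simp: bij_betw_def)
  have "?g (m \<otimes>\<^bsub>N\<^esub> n) = ?g m \<otimes>\<^bsub>M\<^esub> ?g n" if "m \<in> carrier N" "n \<in> carrier N" for m n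
  proof -
    have "m \<otimes>\<^bsub>N\<^esub> n = h (?g m \<otimes>\<^bsub>M\<^esub> ?g n)" using that g h' by simp
    then show ?thesis using gh g that by simp
  qed
  then show ?thesis
    using g gh[of "\<one>\<^bsub>M\<^esub>"] h' b
    by (auto simp: unital_iso_def unital_hom_def hom_def bij_betw_inv_into)
qed

lemma unital_iso_Units:
  assumes "comm_monoid M" "comm_monoid N" "unital_iso M N h" "a \<in> carrier M"
  shows "h a \<in> Units N \<longleftrightarrow> a \<in> Units M"
proof
  have h: "unital_hom M N h" and b: "bij_betw h (carrier M) (carrier N)"
    using assms by (auto simp: unital_iso_def)
  show "a \<in> Units M \<Longrightarrow> h a \<in> Units N" by (rule unital_hom_Units[OF assms(1) h])
  assume "h a \<in> Units N"
  then have "inv_into (carrier M) h (h a) \<in> Units M"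
    using unital_iso_inv[OF assms(1,3)] assms(2) by (auto simp: unital_iso_def intro: unital_hom_Units)
  then show "a \<in> Units M" using b assms(4) by (auto simp: bij_betw_def)
qed

lemma is_localization_unital_iso:
  assumes "comm_monoid M" "comm_monoid N" "unital_iso M N h"
  shows "is_localization M N h"
proof -
  interpret M: comm_monoid M by fact
  interpret N: comm_monoid N by fact
  have b: "bij_betw h (carrier M) (carrier N)" and h: "unital_hom M N h"
    using assms by (auto simp: unital_iso_def)
  have 1: "\<one>\<^bsub>M\<^esub> \<in> unit_face M N h"
    using unital_homD[OF h] by (auto simp: unit_face_def)
  show ?thesis unfolding is_localization_def
  proof (intro conjI ballI impI h)
    fix n assume n: "n \<in> carrier N"
    then obtain a where "a \<in> carrier M" "h a = n"
      using b by (metis bij_betw_iff_bijections)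
    then show "\<exists>a\<in>carrier M. \<exists>s\<in>unit_face M N h. n \<otimes>\<^bsub>N\<^esub> h s = h a"
      using 1 n unital_homD(3)[OF h] by (metis N.r_one)
  next
    fix x y assume "x \<in> carrier M" "y \<in> carrier M" "h x = h y"
    then show "\<exists>u\<in>unit_face M N h. u \<otimes>\<^bsub>M\<^esub> x = u \<otimes>\<^bsub>M\<^esub> y"
      using b 1 by (auto simp: bij_betw_def inj_on_def)
  qed
qed

text \<open>An isomorphism neither creates nor destroys units, so the denominators are the same
  before and after it.\<close>

lemma is_localization_comp_iso:
  assumes "comm_monoid M" "comm_monoid N" "comm_monoid K"
    and h: "is_localization M N h" and k: "unital_iso N K k"
  shows "is_localization M K (k \<circ> h)" "unit_face M K (k \<circ> h) = unit_face M N h"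
proof -
  have hh: "unital_hom M N h" using h by (auto simp: is_localization_def)
  have kk: "unital_hom N K k" and kb: "bij_betw k (carrier N) (carrier K)"
    using k by (auto simp: unital_iso_def)
  show uf: "unit_face M K (k \<circ> h) = unit_face M N h"
    using unital_homD(1)[OF hh] unital_iso_Units[OF assms(2,3) k] by (auto simp: unit_face_def)
  show "is_localization M K (k \<circ> h)"
    unfolding is_localization_def uf
  proof (intro conjI ballI impI unital_hom_comp[OF hh kk])
    fix n assume "n \<in> carrier K"
    then obtain m where m: "m \<in> carrier N" "k m = n"
      using kb by (metis bij_betw_iff_bijections)
    then obtain a s where as: "a \<in> carrier M" "s \<in> unit_face M N h" "m \<otimes>\<^bsub>N\<^esub> h s = h a"
      using h by (auto simp: is_localization_def)
    have "h s \<in> carrier N" using as(2) unital_homD(1)[OF hh] by (auto simp: unit_face_def)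
    then have "n \<otimes>\<^bsub>K\<^esub> (k \<circ> h) s = (k \<circ> h) a"
      unfolding o_def as(3)[symmetric] using unital_homD(2)[OF kk m(1)] m(2) by simp
    with as show "\<exists>a\<in>carrier M. \<exists>s\<in>unit_face M N h. n \<otimes>\<^bsub>K\<^esub> (k \<circ> h) s = (k \<circ> h) a"
      by blast
  next
    fix a b assume "a \<in> carrier M" "b \<in> carrier M" "(k \<circ> h) a = (k \<circ> h) b"
    then show "\<exists>u\<in>unit_face M N h. u \<otimes>\<^bsub>M\<^esub> a = u \<otimes>\<^bsub>M\<^esub> b"
      using h kb unital_homD(1)[OF hh] by (auto simp: is_localization_def bij_betw_def inj_on_def)
  qed
qed

section \<open>s-regular elements\<close>

text \<open>Named apart because the closure properties of s-regular elements compose it: whenever a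
  power of an s-regular \<open>a\<close> identifies \<open>u\<close> and \<open>v\<close>, they must
  agree up to a power of \<open>u v\<close>.\<close>

definition s_equal :: "('a, 'm) monoid_scheme \<Rightarrow> 'a \<Rightarrow> 'a \<Rightarrow> bool" where
  "s_equal M u v \<longleftrightarrow>
     (\<exists>n::nat. u \<otimes>\<^bsub>M\<^esub> (u \<otimes>\<^bsub>M\<^esub> v) [^]\<^bsub>M\<^esub> n = v \<otimes>\<^bsub>M\<^esub> (u \<otimes>\<^bsub>M\<^esub> v) [^]\<^bsub>M\<^esub> n)"

lemma s_regular_iff_s_equal:
  "s_regular M a \<longleftrightarrow> a \<in> carrier M \<and> (\<forall>u\<in>carrier M. \<forall>v\<in>carrier M. \<forall>m::nat.
     a [^]\<^bsub>M\<^esub> m \<otimes>\<^bsub>M\<^esub> u = a [^]\<^bsub>M\<^esub> m \<otimes>\<^bsub>M\<^esub> v \<longrightarrow> s_equal M u v)"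
  by (simp add: s_regular_def s_equal_def)

lemma (in comm_monoid) s_equal_mono:
  assumes "u \<in> carrier G" "v \<in> carrier G" "n \<le> n'"
    and "u \<otimes> (u \<otimes> v) [^] (n::nat) = v \<otimes> (u \<otimes> v) [^] n"
  shows "u \<otimes> (u \<otimes> v) [^] (n'::nat) = v \<otimes> (u \<otimes> v) [^] n'"
proof -
  obtain k where k: "n' = n + k" using assms(3) le_Suc_ex by blast
  show ?thesis using assms(1,2,4)
    by (simp add: k nat_pow_mult[symmetric] m_assoc[symmetric])
qed

text \<open>Since \<open>(c u)(c v)\<close> is the square of \<open>c\<close> times
  \<open>u v\<close>, the factors \<open>c\<close> can be collected in front. With exponent
  \<open>n\<close> in the hypothesis the power of \<open>c\<close> is \<open>2 n + 1\<close>: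
  \<open>2 n\<close> from the power and one from the leading factor.\<close>

lemma (in comm_monoid) s_equal_mult_right:
  assumes "u \<in> carrier G" "v \<in> carrier G" "c \<in> carrier G" "s_equal G (c \<otimes> u) (c \<otimes> v)"
  shows "\<exists>(n::nat) (m::nat). c [^] m \<otimes> (u \<otimes> (u \<otimes> v) [^] n) = c [^] m \<otimes> (v \<otimes> (u \<otimes> v) [^] n)"
proof -
  obtain n where n: "(c \<otimes> u) \<otimes> ((c \<otimes> u) \<otimes> (c \<otimes> v)) [^] (n::nat) = (c \<otimes> v) \<otimes> ((c \<otimes> u) \<otimes> (c \<otimes> v)) [^] n"
    using assms by (auto simp: s_equal_def)
  have e: "(c \<otimes> u) \<otimes> (c \<otimes> v) = c [^] (2::nat) \<otimes> (u \<otimes> v)"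
    using assms by (simp add: m_ac numeral_2_eq_2)
  have p: "((c \<otimes> u) \<otimes> (c \<otimes> v)) [^] n = c [^] (2 * n) \<otimes> (u \<otimes> v) [^] n"
    unfolding e using assms by (simp add: pow_mult_distrib m_comm nat_pow_pow)
  have "c [^] (2 * n + 1) \<otimes> (u \<otimes> (u \<otimes> v) [^] n) = c [^] (2 * n + 1) \<otimes> (v \<otimes> (u \<otimes> v) [^] n)"
    using n assms unfolding p by (simp add: m_ac)
  then show ?thesis by blast
qed

text \<open>The relation may be tested after multiplication by a power of \<open>u v\<close>. Taking
  this power for \<open>c\<close> in \<open>s_equal_mult_right\<close> leaves nothing but powers of
  \<open>u v\<close>, which merge into the exponent \<open>n m + k\<close>.\<close>

lemma (in comm_monoid) s_equal_of_multiple: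
  assumes "u \<in> carrier G" "v \<in> carrier G"
    and "s_equal G (u \<otimes> (u \<otimes> v) [^] (n::nat)) (v \<otimes> (u \<otimes> v) [^] n)"
  shows "s_equal G u v"
proof -
  let ?w = "(u \<otimes> v) [^] n"
  have "s_equal G (?w \<otimes> u) (?w \<otimes> v)" using assms by (simp add: m_comm)
  then obtain k m where k: "?w [^] (m::nat) \<otimes> (u \<otimes> (u \<otimes> v) [^] (k::nat)) = ?w [^] m \<otimes> (v \<otimes> (u \<otimes> v) [^] k)"
    using s_equal_mult_right[of u v ?w] assms by blast
  have "u \<otimes> (u \<otimes> v) [^] (n * m + k) = v \<otimes> (u \<otimes> v) [^] (n * m + k)"
    using k assms by (simp add: nat_pow_pow m_ac nat_pow_mult[symmetric])
  then show ?thesis by (auto simp: s_equal_def)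
qed

text \<open>For a divisor, the equation is multiplied by a power of the cofactor. For a product,
  regularity of \<open>a\<close> applies to \<open>b^m u\<close> and \<open>b^m v\<close> and leaves
  a relation up to a power of \<open>b\<close>; regularity of \<open>b\<close> then applies to the
  multiples of \<open>u\<close> and \<open>v\<close> by a power of \<open>u v\<close>, and
  \<open>s_equal_of_multiple\<close> removes that power.\<close>

lemma (in comm_monoid) face_s_regulars: "face G (s_regulars G)"
proof -
  have closed: "a \<in> carrier G" if "s_regular G a" for a using that by (simp add: s_regular_def)
  have one: "s_regular G \<one>" unfolding s_regular_def
    by (auto intro: exI[of _ "0::nat"])
  have div: "s_regular G a" if ab: "a \<in> carrier G" "b \<in> carrier G" "s_regular G (a \<otimes> b)" for a b
    unfolding s_regular_iff_s_equal
  proof (intro conjI ab ballI allI impI)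
    fix u v m assume *: "u \<in> carrier G" "v \<in> carrier G" "a [^] (m::nat) \<otimes> u = a [^] m \<otimes> v"
    have "(a \<otimes> b) [^] m \<otimes> u = b [^] m \<otimes> (a [^] m \<otimes> u)"
      using ab *(1,2) by (simp add: pow_mult_distrib m_ac)
    also have "\<dots> = (a \<otimes> b) [^] m \<otimes> v"
      unfolding * using ab *(1,2) by (simp add: pow_mult_distrib m_ac)
    finally show "s_equal G u v" using ab * by (auto simp: s_regular_iff_s_equal)
  qed
  have mult: "s_regular G (a \<otimes> b)" if ab: "s_regular G a" "s_regular G b" for a b
    unfolding s_regular_iff_s_equal
  proof (intro conjI ballI allI impI)
    have abc: "a \<in> carrier G" "b \<in> carrier G" using ab closed by auto
    show "a \<otimes> b \<in> carrier G" using abc by auto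
    fix u v m assume *: "u \<in> carrier G" "v \<in> carrier G" "(a \<otimes> b) [^] (m::nat) \<otimes> u = (a \<otimes> b) [^] m \<otimes> v"
    have "a [^] m \<otimes> (b [^] m \<otimes> u) = a [^] m \<otimes> (b [^] m \<otimes> v)"
      using *(3) *(1,2) abc by (simp add: pow_mult_distrib[OF m_comm] m_assoc)
    then have "s_equal G (b [^] m \<otimes> u) (b [^] m \<otimes> v)"
      using ab(1) abc * unfolding s_regular_iff_s_equal by (meson m_closed nat_pow_closed)
    then obtain n k where n: "(b [^] m) [^] (k::nat) \<otimes> (u \<otimes> (u \<otimes> v) [^] (n::nat)) = (b [^] m) [^] k \<otimes> (v \<otimes> (u \<otimes> v) [^] n)"
      using s_equal_mult_right[of u v "b [^] m"] abc * by blast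
    then have "s_equal G (u \<otimes> (u \<otimes> v) [^] n) (v \<otimes> (u \<otimes> v) [^] n)"
      using ab(2) abc * unfolding s_regular_iff_s_equal nat_pow_pow[OF abc(2)] by (meson m_closed nat_pow_closed)
    then show "s_equal G u v" using * by (auto intro: s_equal_of_multiple)
  qed
  show ?thesis
    unfolding face_def s_regulars_def
  proof (intro conjI ballI)
    fix a b assume ab: "a \<in> carrier G" "b \<in> carrier G"
    show "a \<otimes> b \<in> {a. s_regular G a} \<longleftrightarrow> a \<in> {a. s_regular G a} \<and> b \<in> {a. s_regular G a}"
      using div[OF ab] div[OF ab(2,1)] m_comm[OF ab] mult[of a b] by auto
  qed (use closed one in auto)
qed

lemma (in comm_monoid) Units_subset_face:
  assumes "face G S" shows "Units G \<subseteq> S"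
proof
  fix a assume "a \<in> Units G"
  then obtain b where "a \<in> carrier G" "b \<in> carrier G" "a \<otimes> b = \<one>" by (auto simp: Units_def)
  then show "a \<in> S" using faceD[OF assms] by metis
qed

text \<open>The elements \<open>u\<close> and \<open>v\<close> of \<open>N\<close> are brought to a
  common denominator, and the equation between the numerators holds in \<open>M\<close> after
  multiplication by some \<open>w\<close> that becomes a unit. Regularity is used in
  \<open>M\<close>; then the images of \<open>w\<close> and of the denominator are cancelled in
  \<open>N\<close>.\<close>

lemma s_regular_localization:
  assumes "comm_monoid M" "comm_monoid N" and h: "is_localization M N h" and a: "s_regular M a"
  shows "s_regular N (h a)"
proof -
  interpret M: comm_monoid M by fact
  interpret N: comm_monoid N by fact
  have hh: "unital_hom M N h" using h by (auto simp: is_localization_def)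
  note h' = unital_homD[OF hh] note hp = unital_hom_pow[OF assms(1,2) hh]
  have ac: "a \<in> carrier M" using a by (simp add: s_regular_def)
  show ?thesis unfolding s_regular_iff_s_equal
  proof (intro conjI ballI allI impI)
    show "h a \<in> carrier N" using ac h' by auto
    fix u v m assume uv: "u \<in> carrier N" "v \<in> carrier N"
      and eq: "h a [^]\<^bsub>N\<^esub> (m::nat) \<otimes>\<^bsub>N\<^esub> u = h a [^]\<^bsub>N\<^esub> m \<otimes>\<^bsub>N\<^esub> v"
    obtain b s where b: "b \<in> carrier M" "s \<in> unit_face M N h" "u \<otimes>\<^bsub>N\<^esub> h s = h b"
      using h uv by (auto simp: is_localization_def)
    obtain c t where c: "c \<in> carrier M" "t \<in> unit_face M N h" "v \<otimes>\<^bsub>N\<^esub> h t = h c"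
      using h uv by (auto simp: is_localization_def)
    have st: "s \<in> carrier M" "t \<in> carrier M" "h s \<in> Units N" "h t \<in> Units N"
      using b c by (auto simp: unit_face_def)
    \<comment> \<open>The common denominator of \<open>u\<close> and \<open>v\<close>; the
      numerators over it are \<open>u'\<close> and \<open>v'\<close>.\<close>
    define e where "e = s \<otimes>\<^bsub>M\<^esub> t"
    have e: "e \<in> carrier M" "h e \<in> Units N" using st h' by (auto simp: e_def)
    define u' v' where "u' = b \<otimes>\<^bsub>M\<^esub> t" and "v' = c \<otimes>\<^bsub>M\<^esub> s"
    have u': "u' \<in> carrier M" "h u' = h e \<otimes>\<^bsub>N\<^esub> u"
      using b st uv h' by (auto simp: u'_def e_def N.m_ac simp flip: b(3))
    have v': "v' \<in> carrier M" "h v' = h e \<otimes>\<^bsub>N\<^esub> v"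
      using c st uv h' by (auto simp: v'_def e_def N.m_ac simp flip: c(3))
    have "h (a [^]\<^bsub>M\<^esub> m \<otimes>\<^bsub>M\<^esub> u') = h e \<otimes>\<^bsub>N\<^esub> (h a [^]\<^bsub>N\<^esub> m \<otimes>\<^bsub>N\<^esub> u)"
      using ac u' e h' uv by (simp add: hp N.m_ac)
    also have "\<dots> = h (a [^]\<^bsub>M\<^esub> m \<otimes>\<^bsub>M\<^esub> v')"
      unfolding eq using ac v' e h' uv by (simp add: hp N.m_ac)
    finally obtain w where w: "w \<in> unit_face M N h"
       "w \<otimes>\<^bsub>M\<^esub> (a [^]\<^bsub>M\<^esub> m \<otimes>\<^bsub>M\<^esub> u') = w \<otimes>\<^bsub>M\<^esub> (a [^]\<^bsub>M\<^esub> m \<otimes>\<^bsub>M\<^esub> v')"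
      using is_localizationD(3)[OF h, of "a [^]\<^bsub>M\<^esub> m \<otimes>\<^bsub>M\<^esub> u'" "a [^]\<^bsub>M\<^esub> m \<otimes>\<^bsub>M\<^esub> v'"] ac u' v'
      by (auto simp: unit_face_def)
    have wc: "w \<in> carrier M" "h w \<in> Units N" using w by (auto simp: unit_face_def)
    \<comment> \<open>The factor \<open>w\<close> is attached to \<open>u'\<close> and
      \<open>v'\<close>, because regularity of \<open>a\<close> allows only powers of
      \<open>a\<close> in front.\<close>
    have "a [^]\<^bsub>M\<^esub> m \<otimes>\<^bsub>M\<^esub> (w \<otimes>\<^bsub>M\<^esub> u') = a [^]\<^bsub>M\<^esub> m \<otimes>\<^bsub>M\<^esub> (w \<otimes>\<^bsub>M\<^esub> v')"
      using w(2) ac u'(1) v'(1) wc by (simp add: M.m_lcomm)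
    then have "s_equal M (w \<otimes>\<^bsub>M\<^esub> u') (w \<otimes>\<^bsub>M\<^esub> v')"
      using a ac u'(1) v'(1) wc unfolding s_regular_iff_s_equal by (meson M.m_closed)
    then obtain k l where k: "w [^]\<^bsub>M\<^esub> (l::nat) \<otimes>\<^bsub>M\<^esub> (u' \<otimes>\<^bsub>M\<^esub> (u' \<otimes>\<^bsub>M\<^esub> v') [^]\<^bsub>M\<^esub> (k::nat))
       = w [^]\<^bsub>M\<^esub> l \<otimes>\<^bsub>M\<^esub> (v' \<otimes>\<^bsub>M\<^esub> (u' \<otimes>\<^bsub>M\<^esub> v') [^]\<^bsub>M\<^esub> k)"
      using M.s_equal_mult_right[of u' v' w] u' v' wc by blast
    have "h w [^]\<^bsub>N\<^esub> l \<otimes>\<^bsub>N\<^esub> (h u' \<otimes>\<^bsub>N\<^esub> (h u' \<otimes>\<^bsub>N\<^esub> h v') [^]\<^bsub>N\<^esub> k)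
       = h w [^]\<^bsub>N\<^esub> l \<otimes>\<^bsub>N\<^esub> (h v' \<otimes>\<^bsub>N\<^esub> (h u' \<otimes>\<^bsub>N\<^esub> h v') [^]\<^bsub>N\<^esub> k)"
      using arg_cong[OF k, of h] wc u'(1) v'(1) by (simp add: h' hp)
    moreover have "h w [^]\<^bsub>N\<^esub> l \<in> Units N" using wc by (simp add: N.Units_pow)
    ultimately have "h u' \<otimes>\<^bsub>N\<^esub> (h u' \<otimes>\<^bsub>N\<^esub> h v') [^]\<^bsub>N\<^esub> k = h v' \<otimes>\<^bsub>N\<^esub> (h u' \<otimes>\<^bsub>N\<^esub> h v') [^]\<^bsub>N\<^esub> k"
      using u'(1) v'(1) wc h' by (metis N.Units_l_cancel N.m_closed N.nat_pow_closed)
    then have "s_equal N (h e \<otimes>\<^bsub>N\<^esub> u) (h e \<otimes>\<^bsub>N\<^esub> v)"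
      unfolding u'(2) v'(2) by (auto simp: s_equal_def)
    then obtain k l where k: "h e [^]\<^bsub>N\<^esub> (l::nat) \<otimes>\<^bsub>N\<^esub> (u \<otimes>\<^bsub>N\<^esub> (u \<otimes>\<^bsub>N\<^esub> v) [^]\<^bsub>N\<^esub> (k::nat))
       = h e [^]\<^bsub>N\<^esub> l \<otimes>\<^bsub>N\<^esub> (v \<otimes>\<^bsub>N\<^esub> (u \<otimes>\<^bsub>N\<^esub> v) [^]\<^bsub>N\<^esub> k)"
      using N.s_equal_mult_right[of u v "h e"] uv e h' by blast
    moreover have "h e [^]\<^bsub>N\<^esub> l \<in> Units N" using e by (simp add: N.Units_pow)
    ultimately show "s_equal N u v"
      using uv unfolding s_equal_def by (metis N.Units_l_cancel N.m_closed N.nat_pow_closed)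
  qed
qed

lemma s_regular_unital_iso:
  assumes "comm_monoid M" "comm_monoid N" "unital_iso M N h" "a \<in> carrier M"
  shows "s_regular N (h a) \<longleftrightarrow> s_regular M a"
proof
  show "s_regular M a \<Longrightarrow> s_regular N (h a)"
    using assms by (metis is_localization_unital_iso s_regular_localization)
  assume "s_regular N (h a)"
  then have "s_regular M (inv_into (carrier M) h (h a))"
    using assms by (metis is_localization_unital_iso s_regular_localization unital_iso_inv)
  then show "s_regular M a" using assms(3,4) by (simp add: unital_iso_def bij_betw_def)
qed

section \<open>s-regular elements and units of products\<close>

lemma comm_monoid_DirProd:
  assumes "comm_monoid M" "comm_monoid N" shows "comm_monoid (M \<times>\<times> N)"
proof -
  interpret M: comm_monoid M by fact
  interpret N: comm_monoid N by fact
  show ?thesis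
    by (rule comm_monoidI) (auto simp: DirProd_def M.m_ac N.m_ac)
qed

lemma nat_pow_DirProd:
  "(a, b) [^]\<^bsub>M \<times>\<times> N\<^esub> (n::nat) = (a [^]\<^bsub>M\<^esub> n, b [^]\<^bsub>N\<^esub> n)"
  by (induction n) (auto simp: nat_pow_def DirProd_def)

text \<open>An equation in one factor is tested on pairs whose other entry is the unit. Conversely,
  the two factors give two exponents, and \<open>s_equal_mono\<close> allows the larger one in
  both.\<close>

lemma s_regulars_DirProd:
  assumes "comm_monoid M" "comm_monoid N"
  shows "s_regulars (M \<times>\<times> N) = s_regulars M \<times> s_regulars N"
proof -
  interpret M: comm_monoid M by fact
  interpret N: comm_monoid N by fact
  have "s_regular (M \<times>\<times> N) (a, b) \<longleftrightarrow> s_regular M a \<and> s_regular N b" for a b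
  proof (intro iffI conjI)
    assume *: "s_regular (M \<times>\<times> N) (a, b)"
    then have ab: "a \<in> carrier M" "b \<in> carrier N" by (auto simp: s_regular_def)
    have eq: "\<exists>n::nat. (u, u') \<otimes>\<^bsub>M \<times>\<times> N\<^esub> ((u, u') \<otimes>\<^bsub>M \<times>\<times> N\<^esub> (v, v')) [^]\<^bsub>M \<times>\<times> N\<^esub> n
        = (v, v') \<otimes>\<^bsub>M \<times>\<times> N\<^esub> ((u, u') \<otimes>\<^bsub>M \<times>\<times> N\<^esub> (v, v')) [^]\<^bsub>M \<times>\<times> N\<^esub> n"
      if "u \<in> carrier M" "v \<in> carrier M" "a [^]\<^bsub>M\<^esub> (m::nat) \<otimes>\<^bsub>M\<^esub> u = a [^]\<^bsub>M\<^esub> m \<otimes>\<^bsub>M\<^esub> v"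
        "u' \<in> carrier N" "v' \<in> carrier N" "b [^]\<^bsub>N\<^esub> m \<otimes>\<^bsub>N\<^esub> u' = b [^]\<^bsub>N\<^esub> m \<otimes>\<^bsub>N\<^esub> v'"
      for u u' v v' m
    proof -
      have "(u, u') \<in> carrier (M \<times>\<times> N)" "(v, v') \<in> carrier (M \<times>\<times> N)"
        "(a, b) [^]\<^bsub>M \<times>\<times> N\<^esub> m \<otimes>\<^bsub>M \<times>\<times> N\<^esub> (u, u') = (a, b) [^]\<^bsub>M \<times>\<times> N\<^esub> m \<otimes>\<^bsub>M \<times>\<times> N\<^esub> (v, v')"
        using that by (auto simp: nat_pow_DirProd)
      then show ?thesis using * unfolding s_regular_def by blast
    qed
    show "s_regular M a" unfolding s_regular_def
    proof (intro conjI ab ballI allI impI)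
      fix u v m assume "u \<in> carrier M" "v \<in> carrier M" "a [^]\<^bsub>M\<^esub> (m::nat) \<otimes>\<^bsub>M\<^esub> u = a [^]\<^bsub>M\<^esub> m \<otimes>\<^bsub>M\<^esub> v"
      then show "\<exists>n::nat. u \<otimes>\<^bsub>M\<^esub> (u \<otimes>\<^bsub>M\<^esub> v) [^]\<^bsub>M\<^esub> n = v \<otimes>\<^bsub>M\<^esub> (u \<otimes>\<^bsub>M\<^esub> v) [^]\<^bsub>M\<^esub> n"
        using eq[where u' = "\<one>\<^bsub>N\<^esub>" and v' = "\<one>\<^bsub>N\<^esub>"] ab by (auto simp: nat_pow_DirProd)
    qed
    show "s_regular N b" unfolding s_regular_def
    proof (intro conjI ab ballI allI impI)
      fix u v m assume "u \<in> carrier N" "v \<in> carrier N" "b [^]\<^bsub>N\<^esub> (m::nat) \<otimes>\<^bsub>N\<^esub> u = b [^]\<^bsub>N\<^esub> m \<otimes>\<^bsub>N\<^esub> v"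
      then show "\<exists>n::nat. u \<otimes>\<^bsub>N\<^esub> (u \<otimes>\<^bsub>N\<^esub> v) [^]\<^bsub>N\<^esub> n = v \<otimes>\<^bsub>N\<^esub> (u \<otimes>\<^bsub>N\<^esub> v) [^]\<^bsub>N\<^esub> n"
        using eq[where u = "\<one>\<^bsub>M\<^esub>" and v = "\<one>\<^bsub>M\<^esub>"] ab by (auto simp: nat_pow_DirProd)
    qed
  next
    assume *: "s_regular M a \<and> s_regular N b"
    show "s_regular (M \<times>\<times> N) (a, b)" unfolding s_regular_def
    proof (intro conjI ballI allI impI)
      show "(a, b) \<in> carrier (M \<times>\<times> N)" using * by (auto simp: s_regular_def)
      fix u v m
      assume uv: "u \<in> carrier (M \<times>\<times> N)" "v \<in> carrier (M \<times>\<times> N)"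
        and eq: "(a, b) [^]\<^bsub>M \<times>\<times> N\<^esub> (m::nat) \<otimes>\<^bsub>M \<times>\<times> N\<^esub> u = (a, b) [^]\<^bsub>M \<times>\<times> N\<^esub> m \<otimes>\<^bsub>M \<times>\<times> N\<^esub> v"
      obtain u1 u2 v1 v2 where [simp]: "u = (u1, u2)" "v = (v1, v2)" by (meson surj_pair)
      have c: "u1 \<in> carrier M" "v1 \<in> carrier M" "u2 \<in> carrier N" "v2 \<in> carrier N" using uv by auto
      obtain n1::nat where "u1 \<otimes>\<^bsub>M\<^esub> (u1 \<otimes>\<^bsub>M\<^esub> v1) [^]\<^bsub>M\<^esub> n1 = v1 \<otimes>\<^bsub>M\<^esub> (u1 \<otimes>\<^bsub>M\<^esub> v1) [^]\<^bsub>M\<^esub> n1"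
        using * eq c unfolding s_regular_def by (simp add: nat_pow_DirProd) blast
      then have n1: "u1 \<otimes>\<^bsub>M\<^esub> (u1 \<otimes>\<^bsub>M\<^esub> v1) [^]\<^bsub>M\<^esub> n = v1 \<otimes>\<^bsub>M\<^esub> (u1 \<otimes>\<^bsub>M\<^esub> v1) [^]\<^bsub>M\<^esub> n" if "n1 \<le> n" for n
        using M.s_equal_mono c that by blast
      obtain n2::nat where "u2 \<otimes>\<^bsub>N\<^esub> (u2 \<otimes>\<^bsub>N\<^esub> v2) [^]\<^bsub>N\<^esub> n2 = v2 \<otimes>\<^bsub>N\<^esub> (u2 \<otimes>\<^bsub>N\<^esub> v2) [^]\<^bsub>N\<^esub> n2"
        using * eq c unfolding s_regular_def by (simp add: nat_pow_DirProd) blast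
      then have n2: "u2 \<otimes>\<^bsub>N\<^esub> (u2 \<otimes>\<^bsub>N\<^esub> v2) [^]\<^bsub>N\<^esub> n = v2 \<otimes>\<^bsub>N\<^esub> (u2 \<otimes>\<^bsub>N\<^esub> v2) [^]\<^bsub>N\<^esub> n" if "n2 \<le> n" for n
        using N.s_equal_mono c that by blast
      show "\<exists>n::nat. u \<otimes>\<^bsub>M \<times>\<times> N\<^esub> (u \<otimes>\<^bsub>M \<times>\<times> N\<^esub> v) [^]\<^bsub>M \<times>\<times> N\<^esub> n = v \<otimes>\<^bsub>M \<times>\<times> N\<^esub> (u \<otimes>\<^bsub>M \<times>\<times> N\<^esub> v) [^]\<^bsub>M \<times>\<times> N\<^esub> n"
        using n1[of "max n1 n2"] n2[of "max n1 n2"]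
        by (intro exI[of _ "max n1 n2"]) (simp add: nat_pow_DirProd)
    qed
  qed
  then show ?thesis by (auto simp: s_regulars_def)
qed

lemma Units_DirProd: "Units (M \<times>\<times> N) = Units M \<times> Units N"
proof -
  have "(a, b) \<in> Units (M \<times>\<times> N) \<longleftrightarrow> a \<in> Units M \<and> b \<in> Units N" for a b
    by (simp add: Units_def) blast
  then show ?thesis by auto
qed

lemma (in comm_monoid) s_regulars_cancellative:
  assumes "\<And>a b c. a \<in> carrier G \<Longrightarrow> b \<in> carrier G \<Longrightarrow> c \<in> carrier G \<Longrightarrow> c \<otimes> a = c \<otimes> b \<Longrightarrow> a = b"
  shows "s_regulars G = carrier G"
  by (auto simp: s_regulars_def s_regular_iff_s_equal s_equal_def dest: assms[rotated 3])


section \<open>Localization at a face\<close>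

text \<open>Both kinds of localization that occur, at the complement of a prime and at the s-regular
  elements, have a face as their set of denominators.\<close>

locale monoid_face = comm_monoid M for M (structure) +
  fixes S
  assumes face: "face M S"
begin

lemma S_closed [simp]: "s \<in> S \<Longrightarrow> s \<in> carrier M"
  using faceD[OF face] by blast

lemma S_one [simp]: "\<one> \<in> S"
  using faceD[OF face] by blast

lemma S_mult_iff [simp]: "a \<in> carrier M \<Longrightarrow> b \<in> carrier M \<Longrightarrow> a \<otimes> b \<in> S \<longleftrightarrow> a \<in> S \<and> b \<in> S"
  using faceD[OF face] by blast

abbreviation L where "L \<equiv> localization M S"
abbreviation frac where "frac \<equiv> fraction M S"

lemma frac_rel_iff:
  "((a, s), (b, t)) \<in> frac_rel M S \<longleftrightarrow> a \<in> carrier M \<and> s \<in> S \<and> b \<in> carrier M \<and> t \<in> S \<and>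
     (\<exists>u\<in>S. u \<otimes> (a \<otimes> t) = u \<otimes> (b \<otimes> s))"
  by (simp add: frac_rel_def)

lemma equiv_frac_rel: "equiv (carrier M \<times> S) (frac_rel M S)"
proof (rule equivI)
  show "frac_rel M S \<subseteq> (carrier M \<times> S) \<times> (carrier M \<times> S)" by (auto simp: frac_rel_def)
  show "refl_on (carrier M \<times> S) (frac_rel M S)"
    by (auto simp: refl_on_def frac_rel_def intro: bexI[of _ \<one>])
  show "sym (frac_rel M S)"
    unfolding sym_def by (auto simp: frac_rel_def) metis
  show "trans (frac_rel M S)"
  proof (rule transI)
    fix x y z assume "(x, y) \<in> frac_rel M S" "(y, z) \<in> frac_rel M S"
    moreover obtain a s b t c r where [simp]: "x = (a, s)" "y = (b, t)" "z = (c, r)"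
      by (meson surj_pair)
    ultimately obtain u v where
      u: "a \<in> carrier M" "b \<in> carrier M" "c \<in> carrier M" "s \<in> S" "t \<in> S" "r \<in> S" "u \<in> S" "v \<in> S"
      "u \<otimes> (a \<otimes> t) = u \<otimes> (b \<otimes> s)" "v \<otimes> (b \<otimes> r) = v \<otimes> (c \<otimes> t)"
      by (auto simp: frac_rel_iff)
    \<comment> \<open>The witness is \<open>u v t\<close>. The factor \<open>t\<close> enters
      because the middle fraction is eliminated only after multiplying by its denominator.\<close>
    have "(u \<otimes> v \<otimes> t) \<otimes> (a \<otimes> r) = (v \<otimes> r) \<otimes> (u \<otimes> (a \<otimes> t))"
      using u(1-8) by (simp add: m_ac)
    also have "\<dots> = (u \<otimes> s) \<otimes> (v \<otimes> (b \<otimes> r))"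
      unfolding u(9) using u(1-8) by (simp add: m_ac)
    also have "\<dots> = (u \<otimes> v \<otimes> t) \<otimes> (c \<otimes> s)"
      unfolding u(10) using u(1-8) by (simp add: m_ac)
    finally show "(x, z) \<in> frac_rel M S"
      using u(1-8) by (auto simp: frac_rel_iff intro!: bexI[of _ "u \<otimes> v \<otimes> t"])
  qed
qed

lemma mem_frac_iff: "(b, t) \<in> frac a s \<longleftrightarrow> ((a, s), (b, t)) \<in> frac_rel M S"
  by (simp add: fraction_def)

lemma frac_eq_iff:
  assumes "a \<in> carrier M" "b \<in> carrier M" "s \<in> S" "t \<in> S"
  shows "frac a s = frac b t \<longleftrightarrow> (\<exists>u\<in>S. u \<otimes> (a \<otimes> t) = u \<otimes> (b \<otimes> s))"
  using eq_equiv_class_iff[OF equiv_frac_rel, of "(a, s)" "(b, t)"] assms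
  by (simp add: fraction_def frac_rel_iff)

lemma frac_eqI:
  assumes "a \<in> carrier M" "b \<in> carrier M" "s \<in> S" "t \<in> S" "a \<otimes> t = b \<otimes> s"
  shows "frac a s = frac b t"
  using assms by (auto simp: frac_eq_iff intro: bexI[of _ \<one>])

lemma frac_closed [simp]: "a \<in> carrier M \<Longrightarrow> s \<in> S \<Longrightarrow> frac a s \<in> carrier L"
  by (auto simp: localization_def fraction_def intro: quotientI)

lemma L_cases:
  assumes "C \<in> carrier L" obtains a s where "a \<in> carrier M" "s \<in> S" "C = frac a s"
  using assms by (auto simp: localization_def fraction_def elim!: quotientE)

lemma frac_rep:
  assumes "a \<in> carrier M" "s \<in> S" "(b, t) \<in> frac a s"
  shows "b \<in> carrier M \<and> t \<in> S \<and> frac b t = frac a s"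
proof -
  have *: "b \<in> carrier M" "t \<in> S" "((a, s), (b, t)) \<in> frac_rel M S"
    using assms by (auto simp: mem_frac_iff frac_rel_iff)
  then show ?thesis
    using equiv_class_eq[OF equiv_frac_rel *(3)] by (simp add: fraction_def)
qed

lemma frac_self: "a \<in> carrier M \<Longrightarrow> s \<in> S \<Longrightarrow> (a, s) \<in> frac a s"
  by (auto simp: mem_frac_iff frac_rel_iff intro: bexI[of _ \<one>])

lemma frac_mult_cong:
  assumes "a \<in> carrier M" "s \<in> S" "b \<in> carrier M" "t \<in> S"
    "a' \<in> carrier M" "s' \<in> S" "b' \<in> carrier M" "t' \<in> S"
    "frac a s = frac a' s'" "frac b t = frac b' t'"
  shows "frac (a \<otimes> b) (s \<otimes> t) = frac (a' \<otimes> b') (s' \<otimes> t')"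
proof -
  obtain u v where u: "u \<in> S" "u \<otimes> (a \<otimes> s') = u \<otimes> (a' \<otimes> s)"
    and v: "v \<in> S" "v \<otimes> (b \<otimes> t') = v \<otimes> (b' \<otimes> t)"
    using assms by (auto simp: frac_eq_iff)
  have "(u \<otimes> v) \<otimes> ((a \<otimes> b) \<otimes> (s' \<otimes> t')) = (u \<otimes> (a \<otimes> s')) \<otimes> (v \<otimes> (b \<otimes> t'))"
    using assms(1-8) u(1) v(1) by (simp add: m_ac)
  also have "\<dots> = (u \<otimes> v) \<otimes> ((a' \<otimes> b') \<otimes> (s \<otimes> t))"
    unfolding u(2) v(2) using assms(1-8) u(1) v(1) by (simp add: m_ac)
  finally show ?thesis
    using assms(1-8) u(1) v(1) by (auto simp: frac_eq_iff intro!: bexI[of _ "u \<otimes> v"])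
qed

text \<open>The union that defines the product runs over equal sets by
  \<open>frac_mult_cong\<close>, and over at least one set because a fraction contains its own
  representative.\<close>

lemma L_mult [simp]:
  assumes "a \<in> carrier M" "s \<in> S" "b \<in> carrier M" "t \<in> S"
  shows "frac a s \<otimes>\<^bsub>L\<^esub> frac b t = frac (a \<otimes> b) (s \<otimes> t)"
proof -
  have c: "frac (a' \<otimes> b') (s' \<otimes> t') = frac (a \<otimes> b) (s \<otimes> t)"
    if "(a', s') \<in> frac a s" "(b', t') \<in> frac b t" for a' s' b' t'
    using frac_rep[OF assms(1,2) that(1)] frac_rep[OF assms(3,4) that(2)] assms
    by (intro frac_mult_cong) simp_all
  show ?thesis
  proof (rule Set.set_eqI)
    fix x
    have "x \<in> frac a s \<otimes>\<^bsub>L\<^esub> frac b t \<longleftrightarrow> (\<exists>a' s' b' t'. (a', s') \<in> frac a s \<and> (b', t') \<in> frac b t \<and>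
        x \<in> frac (a' \<otimes> b') (s' \<otimes> t'))"
      by (auto simp: localization_def)
    also have "\<dots> \<longleftrightarrow> x \<in> frac (a \<otimes> b) (s \<otimes> t)"
      using c frac_self[OF assms(1,2)] frac_self[OF assms(3,4)] by blast
    finally show "x \<in> frac a s \<otimes>\<^bsub>L\<^esub> frac b t \<longleftrightarrow> x \<in> frac (a \<otimes> b) (s \<otimes> t)" .
  qed
qed

lemma L_one: "\<one>\<^bsub>L\<^esub> = frac \<one> \<one>"
  by (simp add: localization_def)

lemma comm_monoid_L: "comm_monoid L"
proof (rule comm_monoidI)
  show "\<one>\<^bsub>L\<^esub> \<in> carrier L" by (simp add: L_one)
next
  fix x y assume "x \<in> carrier L" "y \<in> carrier L"
  then show "x \<otimes>\<^bsub>L\<^esub> y \<in> carrier L" "x \<otimes>\<^bsub>L\<^esub> y = y \<otimes>\<^bsub>L\<^esub> x"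
    by (auto elim!: L_cases simp: m_comm)
next
  fix x y z assume "x \<in> carrier L" "y \<in> carrier L" "z \<in> carrier L"
  then show "x \<otimes>\<^bsub>L\<^esub> y \<otimes>\<^bsub>L\<^esub> z = x \<otimes>\<^bsub>L\<^esub> (y \<otimes>\<^bsub>L\<^esub> z)"
    by (auto elim!: L_cases simp: m_assoc)
next
  fix x assume "x \<in> carrier L"
  then show "\<one>\<^bsub>L\<^esub> \<otimes>\<^bsub>L\<^esub> x = x" by (auto elim!: L_cases simp: L_one)
qed

text \<open>If \<open>b / t\<close> inverts \<open>a / s\<close>, some \<open>u\<close> in
  \<open>S\<close> satisfies \<open>u b a = u t s\<close>. The right side lies in \<open>S\<close>,
  and \<open>S\<close> is closed under divisors, so \<open>a\<close> lies in
  \<open>S\<close>.\<close>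

lemma frac_Units_iff:
  assumes "a \<in> carrier M" "s \<in> S" shows "frac a s \<in> Units L \<longleftrightarrow> a \<in> S"
proof
  assume "frac a s \<in> Units L"
  then obtain C where C: "C \<in> carrier L" "C \<otimes>\<^bsub>L\<^esub> frac a s = \<one>\<^bsub>L\<^esub>" by (auto simp: Units_def)
  then obtain b t where b: "b \<in> carrier M" "t \<in> S" "C = frac b t" by (auto elim: L_cases)
  then have "frac (b \<otimes> a) (t \<otimes> s) = frac \<one> \<one>" using C assms by (simp add: L_one)
  then obtain u where "u \<in> S" "u \<otimes> (b \<otimes> a) = u \<otimes> (t \<otimes> s)"
    using b assms by (auto simp: frac_eq_iff)
  then have "u \<otimes> (b \<otimes> a) \<in> S" using b assms by simp
  then show "a \<in> S" using b assms \<open>u \<in> S\<close> by simp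
next
  assume a: "a \<in> S"
  have "frac s a \<otimes>\<^bsub>L\<^esub> frac a s = \<one>\<^bsub>L\<^esub>" "frac a s \<otimes>\<^bsub>L\<^esub> frac s a = \<one>\<^bsub>L\<^esub>"
    using a assms by (auto simp: L_one m_comm frac_eq_iff intro: bexI[of _ \<one>])
  then show "frac a s \<in> Units L"
    using a assms by (auto simp: Units_def simp del: L_mult intro!: bexI[of _ "frac s a"])
qed

end

text \<open>The union in \<open>localization_map\<close> runs over equal sets: \<open>h\<close> maps
  a witness for an equality of fractions to such a witness in \<open>T\<close>.\<close>

lemma localization_map_frac:
  assumes "monoid_face M S" "monoid_face N T" "unital_hom M N h" "h ` S \<subseteq> T"
    and "a \<in> carrier M" "s \<in> S"
  shows "localization_map N T h (fraction M S a s) = fraction N T (h a) (h s)"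
proof -
  interpret M: monoid_face M S by fact
  interpret N: monoid_face N T by fact
  note h = unital_homD[OF assms(3)]
  have "fraction N T (h b) (h t) = fraction N T (h a) (h s)" if "(b, t) \<in> fraction M S a s" for b t
  proof -
    have *: "b \<in> carrier M" "t \<in> S" "fraction M S b t = fraction M S a s"
      using M.frac_rep[OF assms(5,6) that] by auto
    then obtain u where u: "u \<in> S" "u \<otimes>\<^bsub>M\<^esub> (b \<otimes>\<^bsub>M\<^esub> s) = u \<otimes>\<^bsub>M\<^esub> (a \<otimes>\<^bsub>M\<^esub> t)"
      using assms by (auto simp: M.frac_eq_iff)
    have "h u \<otimes>\<^bsub>N\<^esub> (h b \<otimes>\<^bsub>N\<^esub> h s) = h (u \<otimes>\<^bsub>M\<^esub> (b \<otimes>\<^bsub>M\<^esub> s))"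
      using u(1) *(1,2) assms by (simp add: h)
    also have "\<dots> = h u \<otimes>\<^bsub>N\<^esub> (h a \<otimes>\<^bsub>N\<^esub> h t)"
      unfolding u(2) using u(1) *(1,2) assms by (simp add: h)
    finally show ?thesis
      using u(1) * assms h(1) by (subst N.frac_eq_iff) auto
  qed
  then have "localization_map N T h (fraction M S a s) = (\<Union>_\<in>fraction M S a s. fraction N T (h a) (h s))"
    unfolding localization_map_def by (intro SUP_cong refl) auto
  then show ?thesis using M.frac_self[OF assms(5,6)] by auto
qed

lemma localization_map_mult:
  assumes "monoid_face M S" "monoid_face N T" "unital_hom M N h" "h ` S \<subseteq> T"
    and "x \<in> carrier (localization M S)" "y \<in> carrier (localization M S)"
  shows "localization_map N T h x \<in> carrier (localization N T)"
    and "localization_map N T h (x \<otimes>\<^bsub>localization M S\<^esub> y)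
       = localization_map N T h x \<otimes>\<^bsub>localization N T\<^esub> localization_map N T h y"
proof -
  interpret M: monoid_face M S by fact
  interpret N: monoid_face N T by fact
  note h = unital_homD[OF assms(3)] note lm = localization_map_frac[OF assms(1-4)]
  obtain a s where a: "a \<in> carrier M" "s \<in> S" "x = fraction M S a s" using assms(5) by (rule M.L_cases)
  obtain b t where b: "b \<in> carrier M" "t \<in> S" "y = fraction M S b t" using assms(6) by (rule M.L_cases)
  have st: "h s \<in> T" "h t \<in> T" using a b assms(4) by auto
  show "localization_map N T h x \<in> carrier (localization N T)" using a h st by (simp add: lm)
  show "localization_map N T h (x \<otimes>\<^bsub>localization M S\<^esub> y)
       = localization_map N T h x \<otimes>\<^bsub>localization N T\<^esub> localization_map N T h y"
    using a b h st by (simp add: lm)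
qed

lemma localization_map_Units:
  assumes "monoid_face M S" "monoid_face N T" "unital_hom M N h" "h ` S \<subseteq> T"
    and "x \<in> Units (localization M S)"
  shows "localization_map N T h x \<in> Units (localization N T)"
proof -
  interpret M: monoid_face M S by fact
  interpret N: monoid_face N T by fact
  obtain a s where a: "a \<in> carrier M" "s \<in> S" "x = fraction M S a s"
    using assms(5) by (auto simp: Units_def elim: M.L_cases)
  then have "a \<in> S" using assms(5) M.frac_Units_iff by auto
  then have "h a \<in> T" "h s \<in> T" using a assms(4) by auto
  then show ?thesis using a by (simp add: localization_map_frac[OF assms(1-4)] N.frac_Units_iff)
qed

section \<open>The quotient of the group of fractions of s-regular elements by the units\<close>

text \<open>Describes \<open>G\<close> as the group of fractions of the s-regular elements modulo
  the units of \<open>M\<close>, with \<open>q a\<close> the class of \<open>a / 1\<close>. The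
  right side of the last clause mentions neither \<open>G\<close> nor \<open>q\<close>, so the
  relations among the generators are the same in all models. Values of \<open>q\<close> off the
  s-regular elements are left open.\<close>

definition regular_quotient ::
    "('a, 'm) monoid_scheme \<Rightarrow> ('g, 'n) monoid_scheme \<Rightarrow> ('a \<Rightarrow> 'g) \<Rightarrow> bool" where
  "regular_quotient M G q \<longleftrightarrow> comm_group G \<and>
     (\<forall>a\<in>s_regulars M. q a \<in> carrier G) \<and>
     (\<forall>a\<in>s_regulars M. \<forall>b\<in>s_regulars M. q (a \<otimes>\<^bsub>M\<^esub> b) = q a \<otimes>\<^bsub>G\<^esub> q b) \<and>
     (\<forall>g\<in>carrier G. \<exists>a\<in>s_regulars M. \<exists>b\<in>s_regulars M. g \<otimes>\<^bsub>G\<^esub> q b = q a) \<and>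
     (\<forall>a\<in>s_regulars M. \<forall>b\<in>s_regulars M. q a = q b \<longleftrightarrow>
        (\<exists>u\<in>s_regulars M. \<exists>c\<in>Units M. u \<otimes>\<^bsub>M\<^esub> a = u \<otimes>\<^bsub>M\<^esub> (b \<otimes>\<^bsub>M\<^esub> c)))"

lemma regular_quotientD:
  assumes "regular_quotient M G q"
  shows "comm_group G"
    and "a \<in> s_regulars M \<Longrightarrow> q a \<in> carrier G"
    and "a \<in> s_regulars M \<Longrightarrow> b \<in> s_regulars M \<Longrightarrow> q (a \<otimes>\<^bsub>M\<^esub> b) = q a \<otimes>\<^bsub>G\<^esub> q b"
    and "g \<in> carrier G \<Longrightarrow> \<exists>a b. a \<in> s_regulars M \<and> b \<in> s_regulars M \<and> g \<otimes>\<^bsub>G\<^esub> q b = q a"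
    and "a \<in> s_regulars M \<Longrightarrow> b \<in> s_regulars M \<Longrightarrow> q a = q b \<longleftrightarrow>
        (\<exists>u\<in>s_regulars M. \<exists>c\<in>Units M. u \<otimes>\<^bsub>M\<^esub> a = u \<otimes>\<^bsub>M\<^esub> (b \<otimes>\<^bsub>M\<^esub> c))"
  using assms unfolding regular_quotient_def by blast+

lemma regular_quotient_unital_iso:
  assumes "comm_monoid M" "comm_monoid N" "unital_iso M N h" and q: "regular_quotient N G q"
  shows "regular_quotient M G (q \<circ> h)"
proof -
  interpret M: comm_monoid M by fact
  interpret N: comm_monoid N by fact
  have h: "unital_hom M N h" and b: "bij_betw h (carrier M) (carrier N)"
    using assms by (auto simp: unital_iso_def)
  have inj: "h x = h y \<longleftrightarrow> x = y" if "x \<in> carrier M" "y \<in> carrier M" for x y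
    using b that by (auto simp: bij_betw_def inj_on_def)
  note h' = unital_homD[OF h] note q' = regular_quotientD[OF q]
  have Mc: "s_regulars M \<subseteq> carrier M" "s_regulars N \<subseteq> carrier N" by (auto simp: s_regulars_def s_regular_def)
  have Siff: "h a \<in> s_regulars N \<longleftrightarrow> a \<in> s_regulars M" if "a \<in> carrier M" for a
    using s_regular_unital_iso[OF assms(1-3) that] by (simp add: s_regulars_def)
  have hsurj: "\<exists>a. a \<in> carrier M \<and> h a = x" if "x \<in> carrier N" for x
    using b that by (metis bij_betw_iff_bijections)
  have S: "h a \<in> s_regulars N" if "a \<in> s_regulars M" for a
    using that Siff Mc by blast
  have Sx: "\<exists>a. a \<in> s_regulars M \<and> h a = x" if "x \<in> s_regulars N" for x
    using that Siff hsurj Mc by blast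
  have Ux: "\<exists>a. a \<in> Units M \<and> h a = x" if "x \<in> Units N" for x
    using that unital_iso_Units[OF assms(1-3)] hsurj N.Units_closed by blast
  show ?thesis
    unfolding regular_quotient_def
  proof (intro conjI ballI)
    show "comm_group G" by (rule q')
    fix a assume a: "a \<in> s_regulars M"
    show "(q \<circ> h) a \<in> carrier G" using a S q' by auto
    fix b assume b: "b \<in> s_regulars M"
    show "(q \<circ> h) (a \<otimes>\<^bsub>M\<^esub> b) = (q \<circ> h) a \<otimes>\<^bsub>G\<^esub> (q \<circ> h) b"
      using a b S q'(3) h' Mc by (simp add: subset_iff)
    have "(\<exists>u\<in>s_regulars N. \<exists>c\<in>Units N. u \<otimes>\<^bsub>N\<^esub> h a = u \<otimes>\<^bsub>N\<^esub> (h b \<otimes>\<^bsub>N\<^esub> c))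
      \<longleftrightarrow> (\<exists>u\<in>s_regulars M. \<exists>c\<in>Units M. h u \<otimes>\<^bsub>N\<^esub> h a = h u \<otimes>\<^bsub>N\<^esub> (h b \<otimes>\<^bsub>N\<^esub> h c))"
      using S Sx Ux unital_hom_Units[OF assms(1) h] by metis
    also have "\<dots> \<longleftrightarrow> (\<exists>u\<in>s_regulars M. \<exists>c\<in>Units M. u \<otimes>\<^bsub>M\<^esub> a = u \<otimes>\<^bsub>M\<^esub> (b \<otimes>\<^bsub>M\<^esub> c))"
    proof (intro bex_cong refl)
      fix u c assume "u \<in> s_regulars M" "c \<in> Units M"
      then have "u \<in> carrier M" "c \<in> carrier M" "a \<in> carrier M" "b \<in> carrier M"
        using a b Mc by auto
      then show "(h u \<otimes>\<^bsub>N\<^esub> h a = h u \<otimes>\<^bsub>N\<^esub> (h b \<otimes>\<^bsub>N\<^esub> h c)) = (u \<otimes>\<^bsub>M\<^esub> a = u \<otimes>\<^bsub>M\<^esub> (b \<otimes>\<^bsub>M\<^esub> c))"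
        by (simp add: h'(2)[symmetric] inj)
    qed
    finally show "(q \<circ> h) a = (q \<circ> h) b \<longleftrightarrow>
        (\<exists>u\<in>s_regulars M. \<exists>c\<in>Units M. u \<otimes>\<^bsub>M\<^esub> a = u \<otimes>\<^bsub>M\<^esub> (b \<otimes>\<^bsub>M\<^esub> c))"
      using q'(5)[of "h a" "h b"] a b S by simp
  next
    fix g assume "g \<in> carrier G"
    then obtain a b where "a \<in> s_regulars N" "b \<in> s_regulars N" "g \<otimes>\<^bsub>G\<^esub> q b = q a" using q'(4) by blast
    then show "\<exists>a\<in>s_regulars M. \<exists>b\<in>s_regulars M. g \<otimes>\<^bsub>G\<^esub> (q \<circ> h) b = (q \<circ> h) a"
      using Sx by (metis comp_apply)
  qed
qed

text \<open>The condition for equal values splits into the two factors, because the s-regular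
  elements and the units of a product are pairs of such elements.\<close>

lemma regular_quotient_DirProd:
  assumes "comm_monoid M" "comm_monoid N" and q: "regular_quotient M G q" and r: "regular_quotient N H r"
  shows "regular_quotient (M \<times>\<times> N) (G \<times>\<times> H) (map_prod q r)"
proof -
  interpret M: comm_monoid M by fact
  interpret N: comm_monoid N by fact
  interpret G: comm_group G by (rule regular_quotientD[OF q])
  interpret H: comm_group H by (rule regular_quotientD[OF r])
  have cg: "comm_group (G \<times>\<times> H)"
    using DirProd_group[OF G.is_group H.is_group] comm_monoid_DirProd[OF G.comm_monoid_axioms H.comm_monoid_axioms]
    by (simp add: comm_group_def)
  note q' = regular_quotientD[OF q] note r' = regular_quotientD[OF r]
  show ?thesis
    unfolding regular_quotient_def s_regulars_DirProd[OF assms(1,2)] Units_DirProd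
  proof (intro conjI ballI cg)
    fix a assume a: "a \<in> s_regulars M \<times> s_regulars N"
    show "map_prod q r a \<in> carrier (G \<times>\<times> H)" using a q' r' by auto
    fix b assume b: "b \<in> s_regulars M \<times> s_regulars N"
    show "map_prod q r (a \<otimes>\<^bsub>M \<times>\<times> N\<^esub> b) = map_prod q r a \<otimes>\<^bsub>G \<times>\<times> H\<^esub> map_prod q r b"
      using a b q' r' by auto
    obtain a1 a2 b1 b2 where [simp]: "a = (a1, a2)" "b = (b1, b2)" by (meson surj_pair)
    have "map_prod q r a = map_prod q r b \<longleftrightarrow> q a1 = q b1 \<and> r a2 = r b2" by simp
    also have "\<dots> \<longleftrightarrow> (\<exists>u\<in>s_regulars M \<times> s_regulars N. \<exists>c\<in>Units M \<times> Units N.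
        u \<otimes>\<^bsub>M \<times>\<times> N\<^esub> a = u \<otimes>\<^bsub>M \<times>\<times> N\<^esub> (b \<otimes>\<^bsub>M \<times>\<times> N\<^esub> c))"
      using a b q'(5)[of a1 b1] r'(5)[of a2 b2] by auto
    finally show "map_prod q r a = map_prod q r b \<longleftrightarrow> \<dots>" .
  next
    fix g assume "g \<in> carrier (G \<times>\<times> H)"
    then obtain g1 g2 where g: "g = (g1, g2)" "g1 \<in> carrier G" "g2 \<in> carrier H" by auto
    obtain a1 b1 where 1: "a1 \<in> s_regulars M" "b1 \<in> s_regulars M" "g1 \<otimes>\<^bsub>G\<^esub> q b1 = q a1"
      using q'(4) g by blast
    obtain a2 b2 where 2: "a2 \<in> s_regulars N" "b2 \<in> s_regulars N" "g2 \<otimes>\<^bsub>H\<^esub> r b2 = r a2"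
      using r'(4) g by blast
    show "\<exists>a\<in>s_regulars M \<times> s_regulars N. \<exists>b\<in>s_regulars M \<times> s_regulars N.
        g \<otimes>\<^bsub>G \<times>\<times> H\<^esub> map_prod q r b = map_prod q r a"
      using 1 2 by (intro bexI[of _ "(a1, a2)"] bexI[of _ "(b1, b2)"]) (auto simp: g)
  qed
qed

lemma regular_quotient_one:
  assumes "comm_monoid M" "regular_quotient M G q"
  shows "q \<one>\<^bsub>M\<^esub> = \<one>\<^bsub>G\<^esub>"
proof -
  interpret M: comm_monoid M by fact
  interpret G: comm_group G by (rule regular_quotientD[OF assms(2)])
  have 1: "\<one>\<^bsub>M\<^esub> \<in> s_regulars M" using faceD[OF M.face_s_regulars] by auto
  have "q \<one>\<^bsub>M\<^esub> = q \<one>\<^bsub>M\<^esub> \<otimes>\<^bsub>G\<^esub> q \<one>\<^bsub>M\<^esub>"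
    using regular_quotientD(3)[OF assms(2) 1 1] by simp
  then show ?thesis using regular_quotientD(2)[OF assms(2) 1] by (metis G.r_cancel_one')
qed

lemma (in comm_group) mult_inv_eq_mult_inv:
  assumes "x \<in> carrier G" "y \<in> carrier G" "z \<in> carrier G" "w \<in> carrier G" "x \<otimes> w = z \<otimes> y"
  shows "x \<otimes> inv y = z \<otimes> inv w"
proof -
  have "x \<otimes> inv y = (x \<otimes> w) \<otimes> (inv w \<otimes> inv y)"
    using assms(1-4) by (simp add: m_assoc flip: m_assoc[of w])
  also have "\<dots> = (z \<otimes> y) \<otimes> (inv y \<otimes> inv w)"
    using assms by (simp add: m_comm)
  also have "\<dots> = z \<otimes> inv w"
    using assms(1-4) by (simp add: m_assoc flip: m_assoc[of y])
  finally show ?thesis .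
qed

text \<open>The homomorphism is forced to send \<open>q a / q b\<close> to \<open>r a / r b\<close>.
  It is well defined because an equality of two products of values of \<open>q\<close> is an
  equality of two values of \<open>q\<close>, which is decided by the same relation in
  \<open>M\<close> as for \<open>r\<close>. Exchanging \<open>q\<close> and \<open>r\<close> gives
  the inverse.\<close>

lemma regular_quotient_unique:
  assumes M: "comm_monoid M" and q: "regular_quotient M G q" and r: "regular_quotient M H r"
  shows "\<exists>\<theta>. \<theta> \<in> hom G H \<and> (\<forall>a\<in>s_regulars M. \<theta> (q a) = r a)"
proof -
  interpret M: comm_monoid M by fact
  interpret G: comm_group G by (rule regular_quotientD[OF q])
  interpret H: comm_group H by (rule regular_quotientD[OF r])
  note q' = regular_quotientD[OF q] note r' = regular_quotientD[OF r]
  note face = faceD[OF M.face_s_regulars]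
  have qr: "r a \<otimes>\<^bsub>H\<^esub> r d = r c \<otimes>\<^bsub>H\<^esub> r b"
    if "a \<in> s_regulars M" "b \<in> s_regulars M" "c \<in> s_regulars M" "d \<in> s_regulars M"
      "q a \<otimes>\<^bsub>G\<^esub> q d = q c \<otimes>\<^bsub>G\<^esub> q b" for a b c d
  proof -
    have "a \<otimes>\<^bsub>M\<^esub> d \<in> s_regulars M" "c \<otimes>\<^bsub>M\<^esub> b \<in> s_regulars M" using that face by auto
    then have "q (a \<otimes>\<^bsub>M\<^esub> d) = q (c \<otimes>\<^bsub>M\<^esub> b) \<longleftrightarrow> r (a \<otimes>\<^bsub>M\<^esub> d) = r (c \<otimes>\<^bsub>M\<^esub> b)"
      using q'(5) r'(5) by simp
    then show ?thesis using that q'(3) r'(3) by simp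
  qed
  have "\<forall>g\<in>carrier G. \<exists>ab. fst ab \<in> s_regulars M \<and> snd ab \<in> s_regulars M \<and> g \<otimes>\<^bsub>G\<^esub> q (snd ab) = q (fst ab)"
    using q'(4) by auto
  then obtain f where f: "\<And>g. g \<in> carrier G \<Longrightarrow> fst (f g) \<in> s_regulars M \<and> snd (f g) \<in> s_regulars M
      \<and> g \<otimes>\<^bsub>G\<^esub> q (snd (f g)) = q (fst (f g))" by metis
  \<comment> \<open>A pair of numerator and denominator is chosen for every \<open>g\<close>;
    \<open>th\<close> shows that any other pair gives the same value.\<close>
  define \<theta> where "\<theta> g = r (fst (f g)) \<otimes>\<^bsub>H\<^esub> inv\<^bsub>H\<^esub> r (snd (f g))" for g
  have th: "\<theta> g = r a \<otimes>\<^bsub>H\<^esub> inv\<^bsub>H\<^esub> r b"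
    if "g \<in> carrier G" "a \<in> s_regulars M" "b \<in> s_regulars M" "g \<otimes>\<^bsub>G\<^esub> q b = q a" for g a b
  proof -
    note fg = f[OF that(1)]
    have mem: "q (fst (f g)) \<in> carrier G" "q (snd (f g)) \<in> carrier G" "q a \<in> carrier G" "q b \<in> carrier G"
      using fg that q'(2) by auto
    have "q (fst (f g)) \<otimes>\<^bsub>G\<^esub> q b = g \<otimes>\<^bsub>G\<^esub> q (snd (f g)) \<otimes>\<^bsub>G\<^esub> q b" using fg by simp
    also have "\<dots> = (g \<otimes>\<^bsub>G\<^esub> q b) \<otimes>\<^bsub>G\<^esub> q (snd (f g))"
      using that(1) mem by (simp add: G.m_ac)
    also have "\<dots> = q a \<otimes>\<^bsub>G\<^esub> q (snd (f g))" by (simp only: that(4))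
    finally have "r (fst (f g)) \<otimes>\<^bsub>H\<^esub> r b = r a \<otimes>\<^bsub>H\<^esub> r (snd (f g))"
      using qr that fg by blast
    then show ?thesis unfolding \<theta>_def
      using that fg r'(2) by (intro H.mult_inv_eq_mult_inv) auto
  qed
  have one: "\<one>\<^bsub>M\<^esub> \<in> s_regulars M" by (rule face)
  have closed: "\<theta> g \<in> carrier H" if "g \<in> carrier G" for g
    using f[OF that] r' by (simp add: \<theta>_def)
  have mult: "\<theta> (x \<otimes>\<^bsub>G\<^esub> y) = \<theta> x \<otimes>\<^bsub>H\<^esub> \<theta> y" if "x \<in> carrier G" "y \<in> carrier G" for x y
  proof -
    note fx = f[OF that(1)] and fy = f[OF that(2)]
    let ?a = "fst (f x) \<otimes>\<^bsub>M\<^esub> fst (f y)" and ?b = "snd (f x) \<otimes>\<^bsub>M\<^esub> snd (f y)"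
    have ab: "?a \<in> s_regulars M" "?b \<in> s_regulars M" using fx fy face by auto
    have mem: "q (snd (f x)) \<in> carrier G" "q (snd (f y)) \<in> carrier G" using fx fy q'(2) by auto
    have "q ?a = (x \<otimes>\<^bsub>G\<^esub> q (snd (f x))) \<otimes>\<^bsub>G\<^esub> (y \<otimes>\<^bsub>G\<^esub> q (snd (f y)))"
      using fx fy by (simp add: q'(3))
    also have "\<dots> = x \<otimes>\<^bsub>G\<^esub> y \<otimes>\<^bsub>G\<^esub> q ?b"
      using that mem fx[THEN conjunct2, THEN conjunct1] fy[THEN conjunct2, THEN conjunct1] by (simp add: q'(3) G.m_ac)
    finally have "\<theta> (x \<otimes>\<^bsub>G\<^esub> y) = r ?a \<otimes>\<^bsub>H\<^esub> inv\<^bsub>H\<^esub> r ?b"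
      using th[of "x \<otimes>\<^bsub>G\<^esub> y" ?a ?b] that ab by simp
    also have "\<dots> = \<theta> x \<otimes>\<^bsub>H\<^esub> \<theta> y"
      unfolding \<theta>_def using fx fy r'(2) by (simp add: r'(3) H.inv_mult H.m_ac)
    finally show ?thesis .
  qed
  have "\<theta> (q a) = r a" if "a \<in> s_regulars M" for a
    using th[of "q a" a "\<one>\<^bsub>M\<^esub>"] that one q'(2) r'(2)
      regular_quotient_one[OF M q] regular_quotient_one[OF M r] by simp
  then show ?thesis using closed mult by (intro exI[of _ \<theta>]) (auto simp: hom_def)
qed

section \<open>The canonical model: invertible fractions modulo units\<close>

definition frac_units :: "('a, 'm) monoid_scheme \<Rightarrow> ('a \<times> 'a) set set" where
  "frac_units M = (\<lambda>a. fraction M (s_regulars M) a \<one>\<^bsub>M\<^esub>) ` Units M"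

abbreviation regular_fractions :: "('a, 'm) monoid_scheme \<Rightarrow> ('a \<times> 'a) set monoid" where
  "regular_fractions M \<equiv> units_of (localization M (s_regulars M))"

lemma monoid_face_s_regulars: "comm_monoid M \<Longrightarrow> monoid_face M (s_regulars M)"
  by (simp add: monoid_face_def monoid_face_axioms_def comm_monoid.face_s_regulars)

lemma subgroup_frac_units:
  assumes "comm_monoid M" shows "comm_group (regular_fractions M)" "subgroup (frac_units M) (regular_fractions M)"
proof -
  interpret F: monoid_face M "s_regulars M" using assms by (rule monoid_face_s_regulars)
  interpret L: comm_monoid F.L by (rule F.comm_monoid_L)
  interpret U: comm_group "regular_fractions M" by (rule L.units_comm_group)
  show "comm_group (regular_fractions M)" by (rule U.comm_group_axioms)
  have US: "Units M \<subseteq> s_regulars M" using F.Units_subset_face[OF F.face] .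
  show "subgroup (frac_units M) (regular_fractions M)"
  proof (rule U.subgroupI)
    show "frac_units M \<subseteq> carrier (regular_fractions M)"
      using US by (auto simp: frac_units_def units_of_def F.frac_Units_iff)
    show "frac_units M \<noteq> {}" by (auto simp: frac_units_def intro: F.Units_one_closed)
    fix x assume "x \<in> frac_units M"
    then obtain a where a: "a \<in> Units M" "x = F.frac a \<one>\<^bsub>M\<^esub>" by (auto simp: frac_units_def)
    define y where "y = F.frac (inv\<^bsub>M\<^esub> a) \<one>\<^bsub>M\<^esub>"
    have "inv\<^bsub>M\<^esub> a \<in> Units M" using a by auto
    then have y: "y \<in> frac_units M" "y \<in> carrier (regular_fractions M)"
      using US by (auto simp: frac_units_def y_def units_of_def F.frac_Units_iff)
    have "y \<otimes>\<^bsub>F.L\<^esub> x = \<one>\<^bsub>F.L\<^esub>" using a US by (simp add: y_def F.L_one F.Units_closed)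
    then have "inv\<^bsub>regular_fractions M\<^esub> x = y"
      using y a US by (intro U.inv_equality) (auto simp: units_of_def F.frac_Units_iff)
    then show "inv\<^bsub>regular_fractions M\<^esub> x \<in> frac_units M" using y by simp
    fix z assume "z \<in> frac_units M"
    then obtain b where b: "b \<in> Units M" "z = F.frac b \<one>\<^bsub>M\<^esub>" by (auto simp: frac_units_def)
    have "x \<otimes>\<^bsub>F.L\<^esub> z = F.frac (a \<otimes>\<^bsub>M\<^esub> b) \<one>\<^bsub>M\<^esub>" using a b US by (simp add: F.Units_closed)
    then show "x \<otimes>\<^bsub>regular_fractions M\<^esub> z \<in> frac_units M"
      using a b by (auto simp: units_of_def frac_units_def)
  qed
qed

text \<open>An invertible fraction \<open>a / s\<close> has an s-regular numerator, so its class is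
  \<open>q a / q s\<close>. The classes of \<open>a / 1\<close> and \<open>b / 1\<close> agree when
  these fractions differ by some \<open>c / 1\<close> with \<open>c\<close> a unit, and equality of
  fractions brings in the factor \<open>u\<close>.\<close>

lemma regular_quotient_canonical:
  assumes "comm_monoid M"
  shows "regular_quotient M (regular_fractions M Mod frac_units M)
     (\<lambda>a. frac_units M #>\<^bsub>regular_fractions M\<^esub> fraction M (s_regulars M) a \<one>\<^bsub>M\<^esub>)"
proof -
  interpret F: monoid_face M "s_regulars M" using assms by (rule monoid_face_s_regulars)
  interpret L: comm_monoid F.L by (rule F.comm_monoid_L)
  interpret U: comm_group "regular_fractions M" by (rule subgroup_frac_units[OF assms])
  let ?U = "regular_fractions M" and ?H = "frac_units M"
  have H: "subgroup ?H ?U" by (rule subgroup_frac_units[OF assms])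
  have N: "?H \<lhd> ?U" using H by (rule U.subgroup_imp_normal)
  have US: "Units M \<subseteq> s_regulars M" using F.Units_subset_face[OF F.face] .
  have fU: "F.frac a s \<in> carrier ?U" if "a \<in> s_regulars M" "s \<in> s_regulars M" for a s
    using that by (simp add: units_of_def F.frac_Units_iff)
  have Um: "F.frac a s \<otimes>\<^bsub>?U\<^esub> F.frac b t = F.frac (a \<otimes>\<^bsub>M\<^esub> b) (s \<otimes>\<^bsub>M\<^esub> t)"
    if "a \<in> s_regulars M" "s \<in> s_regulars M" "b \<in> s_regulars M" "t \<in> s_regulars M" for a b s t
    using that by (simp add: units_of_def)
  have mm: "(?H #>\<^bsub>?U\<^esub> x) \<otimes>\<^bsub>?U Mod ?H\<^esub> (?H #>\<^bsub>?U\<^esub> y) = ?H #>\<^bsub>?U\<^esub> (x \<otimes>\<^bsub>?U\<^esub> y)"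
    if "x \<in> carrier ?U" "y \<in> carrier ?U" for x y
    using normal.rcos_sum[OF N that] by (simp add: FactGroup_def)
  show ?thesis
    unfolding regular_quotient_def
  proof (intro conjI ballI)
    show "comm_group (?U Mod ?H)" by (rule U.abelian_FactGroup[OF H])
    fix a assume a: "a \<in> s_regulars M"
    show "?H #>\<^bsub>?U\<^esub> F.frac a \<one>\<^bsub>M\<^esub> \<in> carrier (?U Mod ?H)"
      using fU[OF a] by (auto simp: FactGroup_def RCOSETS_def)
    fix b assume b: "b \<in> s_regulars M"
    show "?H #>\<^bsub>?U\<^esub> F.frac (a \<otimes>\<^bsub>M\<^esub> b) \<one>\<^bsub>M\<^esub>
       = (?H #>\<^bsub>?U\<^esub> F.frac a \<one>\<^bsub>M\<^esub>) \<otimes>\<^bsub>?U Mod ?H\<^esub> (?H #>\<^bsub>?U\<^esub> F.frac b \<one>\<^bsub>M\<^esub>)"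
      using a b by (simp add: mm fU Um del: mult_FactGroup)
    have "?H #>\<^bsub>?U\<^esub> F.frac a \<one>\<^bsub>M\<^esub> = ?H #>\<^bsub>?U\<^esub> F.frac b \<one>\<^bsub>M\<^esub>
      \<longleftrightarrow> F.frac a \<one>\<^bsub>M\<^esub> \<in> ?H #>\<^bsub>?U\<^esub> F.frac b \<one>\<^bsub>M\<^esub>"
      using fU a b H by (metis F.S_one U.repr_independence U.rcos_self)
    also have "\<dots> \<longleftrightarrow> (\<exists>c\<in>Units M. F.frac a \<one>\<^bsub>M\<^esub> = F.frac (c \<otimes>\<^bsub>M\<^esub> b) \<one>\<^bsub>M\<^esub>)"
      using b US by (auto simp: r_coset_def frac_units_def subset_iff Um)
    also have "\<dots> \<longleftrightarrow> (\<exists>c\<in>Units M. \<exists>u\<in>s_regulars M. u \<otimes>\<^bsub>M\<^esub> a = u \<otimes>\<^bsub>M\<^esub> (b \<otimes>\<^bsub>M\<^esub> c))"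
      using a b by (intro bex_cong refl) (simp add: F.frac_eq_iff F.m_comm F.Units_closed)
    finally show "?H #>\<^bsub>?U\<^esub> F.frac a \<one>\<^bsub>M\<^esub> = ?H #>\<^bsub>?U\<^esub> F.frac b \<one>\<^bsub>M\<^esub> \<longleftrightarrow>
       (\<exists>u\<in>s_regulars M. \<exists>c\<in>Units M. u \<otimes>\<^bsub>M\<^esub> a = u \<otimes>\<^bsub>M\<^esub> (b \<otimes>\<^bsub>M\<^esub> c))" by blast
  next
    fix g assume "g \<in> carrier (?U Mod ?H)"
    then obtain x where x: "x \<in> Units F.L" "g = ?H #>\<^bsub>?U\<^esub> x"
      by (auto simp: FactGroup_def RCOSETS_def units_of_def)
    then obtain a s where as: "a \<in> carrier M" "s \<in> s_regulars M" "x = F.frac a s"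
      using L.Units_closed by (metis F.L_cases)
    then have a: "a \<in> s_regulars M" using x F.frac_Units_iff by auto
    have "F.frac (a \<otimes>\<^bsub>M\<^esub> s) s = F.frac a \<one>\<^bsub>M\<^esub>" using as by (intro F.frac_eqI) auto
    then have "g \<otimes>\<^bsub>?U Mod ?H\<^esub> (?H #>\<^bsub>?U\<^esub> F.frac s \<one>\<^bsub>M\<^esub>) = ?H #>\<^bsub>?U\<^esub> F.frac a \<one>\<^bsub>M\<^esub>"
      using a as by (simp add: x mm fU Um del: mult_FactGroup)
    then show "\<exists>a\<in>s_regulars M. \<exists>b\<in>s_regulars M.
      g \<otimes>\<^bsub>?U Mod ?H\<^esub> (?H #>\<^bsub>?U\<^esub> F.frac b \<one>\<^bsub>M\<^esub>) = ?H #>\<^bsub>?U\<^esub> F.frac a \<one>\<^bsub>M\<^esub>"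
      using a as by blast
  qed
qed

text \<open>Here \<open>cm\<close> is the arrow of \<open>quotient_functor\<close>, a product of two
  sets. Units of \<open>M\<close> go to units of \<open>N\<close>, so the image of a coset lies in a
  single coset, and the product with \<open>frac_units N\<close> fills that coset.\<close>

lemma regular_quotient_map:
  assumes M: "comm_monoid M" and N: "comm_monoid N" and h: "unital_hom M N h"
    and hS: "h ` s_regulars M \<subseteq> s_regulars N"
  defines "cm \<equiv> \<lambda>C. frac_units N <#>\<^bsub>regular_fractions N\<^esub> (localization_map N (s_regulars N) h ` C)"
  shows "cm \<in> hom (regular_fractions M Mod frac_units M) (regular_fractions N Mod frac_units N)"
    and "a \<in> s_regulars M \<Longrightarrow>
      cm (frac_units M #>\<^bsub>regular_fractions M\<^esub> fraction M (s_regulars M) a \<one>\<^bsub>M\<^esub>)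
      = frac_units N #>\<^bsub>regular_fractions N\<^esub> fraction N (s_regulars N) (h a) \<one>\<^bsub>N\<^esub>"
proof -
  have mf: "monoid_face M (s_regulars M)" "monoid_face N (s_regulars N)"
    using M N by (auto intro: monoid_face_s_regulars)
  interpret F: monoid_face M "s_regulars M" by fact
  interpret E: monoid_face N "s_regulars N" by fact
  let ?U = "regular_fractions M" and ?H = "frac_units M" and ?V = "regular_fractions N" and ?K = "frac_units N"
  let ?l = "localization_map N (s_regulars N) h"
  interpret U: comm_group ?U by (rule subgroup_frac_units[OF M])
  interpret V: comm_group ?V by (rule subgroup_frac_units[OF N])
  have H: "subgroup ?H ?U" by (rule subgroup_frac_units[OF M])
  have K: "subgroup ?K ?V" by (rule subgroup_frac_units[OF N])
  have NH: "?H \<lhd> ?U" using H by (rule U.subgroup_imp_normal)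
  have NK: "?K \<lhd> ?V" using K by (rule V.subgroup_imp_normal)
  note h' = unital_homD[OF h]
  have lc: "?l x \<in> carrier ?V" if "x \<in> carrier ?U" for x
    using localization_map_Units[OF mf h hS] that by (simp add: units_of_def)
  have lm: "?l (x \<otimes>\<^bsub>?U\<^esub> y) = ?l x \<otimes>\<^bsub>?V\<^esub> ?l y" if "x \<in> carrier ?U" "y \<in> carrier ?U" for x y
    using localization_map_mult[OF mf h hS, of x y] that by (simp add: units_of_def Units_def)
  have lH: "?l x \<in> ?K" if xH: "x \<in> ?H" for x
  proof -
    obtain a where a: "a \<in> Units M" "x = F.frac a \<one>\<^bsub>M\<^esub>" using xH by (auto simp: frac_units_def)
    then have "?l x = E.frac (h a) \<one>\<^bsub>N\<^esub>"
      using localization_map_frac[OF mf h hS, of a "\<one>\<^bsub>M\<^esub>"] h' by auto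
    then show ?thesis using unital_hom_Units[OF M h] a by (auto simp: frac_units_def)
  qed
  have cm: "cm (?H #>\<^bsub>?U\<^esub> x) = ?K #>\<^bsub>?V\<^esub> ?l x" if x: "x \<in> carrier ?U" for x
  proof
    show "cm (?H #>\<^bsub>?U\<^esub> x) \<subseteq> ?K #>\<^bsub>?V\<^esub> ?l x"
    proof
      fix y assume "y \<in> cm (?H #>\<^bsub>?U\<^esub> x)"
      then obtain k g where kg: "k \<in> ?K" "g \<in> ?H" "y = k \<otimes>\<^bsub>?V\<^esub> ?l (g \<otimes>\<^bsub>?U\<^esub> x)"
        by (auto simp: cm_def set_mult_def r_coset_def)
      have g: "g \<in> carrier ?U" using kg H by (auto dest: subgroup.mem_carrier)
      have "k \<in> carrier ?V" using kg K by (auto dest: subgroup.mem_carrier)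
      then have "y = (k \<otimes>\<^bsub>?V\<^esub> ?l g) \<otimes>\<^bsub>?V\<^esub> ?l x"
        unfolding kg(3) lm[OF g x] using lc x g by (simp add: V.m_assoc)
      moreover have "k \<otimes>\<^bsub>?V\<^esub> ?l g \<in> ?K" using kg lH K by (auto intro: subgroup.m_closed)
      ultimately show "y \<in> ?K #>\<^bsub>?V\<^esub> ?l x" by (auto simp: r_coset_def)
    qed
    have "?l (\<one>\<^bsub>?U\<^esub> \<otimes>\<^bsub>?U\<^esub> x) = ?l x" using x by simp
    moreover have "\<one>\<^bsub>?U\<^esub> \<in> ?H" using H by (rule subgroup.one_closed)
    ultimately have "\<one>\<^bsub>?U\<^esub> \<otimes>\<^bsub>?U\<^esub> x \<in> ?H #>\<^bsub>?U\<^esub> x" by (auto simp: r_coset_def)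
    then have *: "?l x \<in> ?l ` (?H #>\<^bsub>?U\<^esub> x)"
      using \<open>?l (\<one>\<^bsub>?U\<^esub> \<otimes>\<^bsub>?U\<^esub> x) = ?l x\<close> by (metis imageI)
    show "?K #>\<^bsub>?V\<^esub> ?l x \<subseteq> cm (?H #>\<^bsub>?U\<^esub> x)"
    proof
      fix y assume "y \<in> ?K #>\<^bsub>?V\<^esub> ?l x"
      then obtain k where "k \<in> ?K" "y = k \<otimes>\<^bsub>?V\<^esub> ?l x" by (auto simp: r_coset_def)
      with * show "y \<in> cm (?H #>\<^bsub>?U\<^esub> x)" unfolding cm_def set_mult_def by blast
    qed
  qed
  show "cm (?H #>\<^bsub>?U\<^esub> F.frac a \<one>\<^bsub>M\<^esub>) = ?K #>\<^bsub>?V\<^esub> E.frac (h a) \<one>\<^bsub>N\<^esub>" if "a \<in> s_regulars M" for a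
    using cm[of "F.frac a \<one>\<^bsub>M\<^esub>"] localization_map_frac[OF mf h hS, of a "\<one>\<^bsub>M\<^esub>"] h' that
    by (simp add: units_of_def F.frac_Units_iff)
  show "cm \<in> hom (?U Mod ?H) (?V Mod ?K)"
  proof (rule homI)
    fix C assume "C \<in> carrier (?U Mod ?H)"
    then obtain x where x: "x \<in> carrier ?U" "C = ?H #>\<^bsub>?U\<^esub> x" by (auto simp: FactGroup_def RCOSETS_def)
    then show "cm C \<in> carrier (?V Mod ?K)" using lc by (auto simp: cm FactGroup_def RCOSETS_def)
    fix D assume "D \<in> carrier (?U Mod ?H)"
    then obtain y where y: "y \<in> carrier ?U" "D = ?H #>\<^bsub>?U\<^esub> y" by (auto simp: FactGroup_def RCOSETS_def)
    have "C \<otimes>\<^bsub>?U Mod ?H\<^esub> D = ?H #>\<^bsub>?U\<^esub> (x \<otimes>\<^bsub>?U\<^esub> y)"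
      using normal.rcos_sum[OF NH x(1) y(1)] x y by (simp add: FactGroup_def)
    then show "cm (C \<otimes>\<^bsub>?U Mod ?H\<^esub> D) = cm C \<otimes>\<^bsub>?V Mod ?K\<^esub> cm D"
      using normal.rcos_sum[OF NK lc[OF x(1)] lc[OF y(1)]] x y by (simp add: FactGroup_def cm lm)
  qed
qed


section \<open>Sheaves on finite spaces\<close>

text \<open>Defined for every space. That it is open holds in finite spaces, and is assumed or
  proved where it is used.\<close>

definition min_nbhd :: "'p topology \<Rightarrow> 'p \<Rightarrow> 'p set" where
  "min_nbhd T x = \<Inter>{U. openin T U \<and> x \<in> U}"

lemma min_nbhd_subset: "openin T U \<Longrightarrow> x \<in> U \<Longrightarrow> min_nbhd T x \<subseteq> U"
  by (auto simp: min_nbhd_def)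

lemma min_nbhd_self [simp]: "x \<in> min_nbhd T x"
  by (auto simp: min_nbhd_def)

lemma min_nbhd_mono: "z \<in> min_nbhd T x \<Longrightarrow> min_nbhd T z \<subseteq> min_nbhd T x"
  by (auto simp: min_nbhd_def)

lemma min_nbhd_subset_topspace: "x \<in> topspace T \<Longrightarrow> min_nbhd T x \<subseteq> topspace T"
  by (rule min_nbhd_subset) auto

text \<open>The closure of \<open>y\<close> is contained in that of \<open>x\<close> exactly when
  \<open>y\<close> lies in the closure of \<open>x\<close>, that is, when every open set around
  \<open>y\<close> contains \<open>x\<close>.\<close>

lemma point_le_iff: "point_le T x y \<longleftrightarrow> y \<in> topspace T \<and> x \<in> min_nbhd T y"
proof -
  have "T closure_of {y} \<subseteq> T closure_of {x} \<longleftrightarrow> x \<in> min_nbhd T y" if xy: "x \<in> topspace T" "y \<in> topspace T"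
  proof
    assume "T closure_of {y} \<subseteq> T closure_of {x}"
    moreover have "y \<in> T closure_of {y}" using xy by (simp add: in_closure_of)
    ultimately have "y \<in> T closure_of {x}" by blast
    then show "x \<in> min_nbhd T y" by (auto simp: in_closure_of min_nbhd_def)
  next
    assume "x \<in> min_nbhd T y"
    then show "T closure_of {y} \<subseteq> T closure_of {x}"
      by (auto simp: in_closure_of min_nbhd_def)
  qed
  then show ?thesis
    using min_nbhd_subset_topspace[of y T] by (auto simp: point_le_def)
qed

lemma min_nbhd_subtopology:
  assumes "openin T U" "x \<in> U" shows "min_nbhd (subtopology T U) x = min_nbhd T x"
proof
  show "min_nbhd T x \<subseteq> min_nbhd (subtopology T U) x"
    using assms by (auto simp: min_nbhd_def openin_open_subtopology)
  show "min_nbhd (subtopology T U) x \<subseteq> min_nbhd T x"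
  proof
    fix z assume z: "z \<in> min_nbhd (subtopology T U) x"
    show "z \<in> min_nbhd T x" unfolding min_nbhd_def
    proof clarify
      fix V assume "openin T V" "x \<in> V"
      then have "openin (subtopology T U) (V \<inter> U)" "x \<in> V \<inter> U"
        using assms by (auto simp: openin_open_subtopology)
      then show "z \<in> V" using z by (auto simp: min_nbhd_def)
    qed
  qed
qed

locale finite_T0 =
  fixes T :: "'p topology"
  assumes finite_topspace: "finite (topspace T)"
    and open_min_nbhd: "x \<in> topspace T \<Longrightarrow> openin T (min_nbhd T x)"
    and T0: "x \<in> topspace T \<Longrightarrow> y \<in> topspace T \<Longrightarrow> min_nbhd T x = min_nbhd T y \<Longrightarrow> x = y"
begin

lemma openin_iff: "openin T U \<longleftrightarrow> U \<subseteq> topspace T \<and> (\<forall>x\<in>U. min_nbhd T x \<subseteq> U)"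
proof
  show "openin T U \<Longrightarrow> U \<subseteq> topspace T \<and> (\<forall>x\<in>U. min_nbhd T x \<subseteq> U)"
    using min_nbhd_subset openin_subset by metis
  assume U: "U \<subseteq> topspace T \<and> (\<forall>x\<in>U. min_nbhd T x \<subseteq> U)"
  then have "U = (\<Union>x\<in>U. min_nbhd T x)" by auto
  moreover have "openin T (\<Union>x\<in>U. min_nbhd T x)" using U open_min_nbhd by auto
  ultimately show "openin T U" by simp
qed

lemma min_nbhd_antisym:
  "x \<in> topspace T \<Longrightarrow> z \<in> min_nbhd T x \<Longrightarrow> x \<in> min_nbhd T z \<Longrightarrow> z = x"
  using T0 min_nbhd_mono min_nbhd_subset_topspace by (metis subset_antisym subsetD)

text \<open>By T0, no other point of the minimal neighbourhood of \<open>x\<close> has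
  \<open>x\<close> in its own minimal neighbourhood. Hence the punctured neighbourhood is
  open.\<close>

lemma punctured_subset: "x \<in> topspace T \<Longrightarrow> z \<in> min_nbhd T x - {x} \<Longrightarrow> min_nbhd T z \<subseteq> min_nbhd T x - {x}"
  using min_nbhd_antisym min_nbhd_mono by fastforce

lemma openin_punctured: "x \<in> topspace T \<Longrightarrow> openin T (min_nbhd T x - {x})"
  unfolding openin_iff using punctured_subset min_nbhd_subset_topspace by fastforce

end

section \<open>Functors of abelian groups and extension of their sections\<close>

definition group_functor :: "'p topology \<Rightarrow> ('p, 'b) point_functor \<Rightarrow> bool" where
  "group_functor T F \<longleftrightarrow>
     (\<forall>y\<in>topspace T. comm_group (obj F y) \<and> (\<forall>g\<in>carrier (obj F y). arr F y y g = g) \<and>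
        (\<forall>x\<in>min_nbhd T y. arr F y x \<in> hom (obj F y) (obj F x) \<and>
           (\<forall>z\<in>min_nbhd T x. \<forall>g\<in>carrier (obj F y). arr F x z (arr F y x g) = arr F y z g)))"

text \<open>The group \<open>obj F x\<close> takes the place of the sections over the minimal
  neighbourhood of \<open>x\<close>, of which \<open>x\<close> is the largest point.\<close>

definition locally_flasque_at :: "'p topology \<Rightarrow> ('p, 'b) point_functor \<Rightarrow> 'p \<Rightarrow> bool" where
  "locally_flasque_at T F x \<longleftrightarrow>
     (\<exists>\<sigma>\<in>hom (limit_sections T F (min_nbhd T x - {x})) (obj F x).
        \<forall>s\<in>carrier (limit_sections T F (min_nbhd T x - {x})). \<forall>z\<in>min_nbhd T x - {x}.
          arr F x z (\<sigma> s) = s z)"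

lemma carrier_limit_sections:
  assumes "U \<subseteq> topspace T"
  shows "\<sigma> \<in> carrier (limit_sections T F U) \<longleftrightarrow> \<sigma> \<in> (\<Pi>\<^sub>E x\<in>U. carrier (obj F x)) \<and>
    (\<forall>y\<in>U. \<forall>x\<in>U. x \<in> min_nbhd T y \<longrightarrow> arr F y x (\<sigma> y) = \<sigma> x)"
  using assms by (auto simp: limit_sections_def point_le_iff)

lemma mult_limit_sections: "x \<in> U \<Longrightarrow> (\<sigma> \<otimes>\<^bsub>limit_sections T F U\<^esub> \<tau>) x = \<sigma> x \<otimes>\<^bsub>obj F x\<^esub> \<tau> x"
  by (simp add: limit_sections_def)

lemma mult_limit_sections_eq: "\<sigma> \<otimes>\<^bsub>limit_sections T F U\<^esub> \<tau> = (\<lambda>x\<in>U. \<sigma> x \<otimes>\<^bsub>obj F x\<^esub> \<tau> x)"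
  by (simp add: limit_sections_def)

lemma limit_sections_restrict:
  assumes "V \<subseteq> U" "U \<subseteq> topspace T" "s \<in> carrier (limit_sections T F U)"
  shows "restrict s V \<in> carrier (limit_sections T F V)"
proof -
  have "V \<subseteq> topspace T" using assms by auto
  then show ?thesis
    using assms(1,3) unfolding carrier_limit_sections[OF assms(2)] carrier_limit_sections[OF \<open>V \<subseteq> topspace T\<close>]
    by (simp add: PiE_iff subset_iff)
qed

text \<open>In one direction, a splitting for the punctured neighbourhood is followed by evaluation
  at \<open>x\<close>. In the other, the induction is on the number of points missing from
  \<open>U\<close>, and the splittings of the single steps are composed.\<close>

lemma (in finite_T0) s_flasque_sheaf_of_functor_iff:
  assumes F: "group_functor T F"
  shows "s_flasque (sheaf_of_functor T F) \<longleftrightarrow> (\<forall>x\<in>topspace T. locally_flasque_at T F x)"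
proof
  assume sf: "s_flasque (sheaf_of_functor T F)"
  show "\<forall>x\<in>topspace T. locally_flasque_at T F x"
  proof
    fix x assume x: "x \<in> topspace T"
    let ?U = "min_nbhd T x - {x}"
    let ?X = "topspace T"
    have U: "?U \<subseteq> topspace T" using min_nbhd_subset_topspace[OF x] by auto
    obtain \<sigma> where \<sigma>: "\<sigma> \<in> hom (limit_sections T F ?U) (limit_sections T F ?X)"
      "\<forall>s\<in>carrier (limit_sections T F ?U). restrict (\<sigma> s) ?U = s"
      using sf openin_punctured[OF x] unfolding s_flasque_def by (auto simp: sheaf_of_functor_def)
    have c: "\<sigma> s \<in> carrier (limit_sections T F ?X)" if "s \<in> carrier (limit_sections T F ?U)" for s
      using \<sigma>(1) that by (auto simp: hom_def)
    show "locally_flasque_at T F x" unfolding locally_flasque_at_def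
    proof (intro bexI[of _ "\<lambda>s. \<sigma> s x"] ballI homI)
      fix s z assume s: "s \<in> carrier (limit_sections T F ?U)" and z: "z \<in> ?U"
      have "arr F x z (\<sigma> s x) = \<sigma> s z"
        using c[OF s] z x U by (auto simp: carrier_limit_sections)
      also have "\<dots> = restrict (\<sigma> s) ?U z" using z by auto
      finally show "arr F x z (\<sigma> s x) = s z" using \<sigma>(2) s by simp
    next
      fix s assume s: "s \<in> carrier (limit_sections T F ?U)"
      show "\<sigma> s x \<in> carrier (obj F x)" using c[OF s] x by (auto simp: carrier_limit_sections)
      fix t assume t: "t \<in> carrier (limit_sections T F ?U)"
      show "\<sigma> (s \<otimes>\<^bsub>limit_sections T F ?U\<^esub> t) x = \<sigma> s x \<otimes>\<^bsub>obj F x\<^esub> \<sigma> t x"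
        using \<sigma>(1) s t x by (simp add: hom_def mult_limit_sections)
    qed
  qed
next
  assume lf: "\<forall>x\<in>topspace T. locally_flasque_at T F x"
  have ext: "\<exists>\<sigma>\<in>hom (limit_sections T F U) (limit_sections T F V).
      \<forall>s\<in>carrier (limit_sections T F U). restrict (\<sigma> s) U = s"
    if "openin T U" "openin T V" "U \<subseteq> V" "card (V - U) = n" for U V n
    using that
  proof (induction n arbitrary: U)
    case 0
    have "finite (V - U)" using openin_subset[OF 0(2)] finite_topspace by (meson Diff_subset finite_subset)
    then have UV: "U = V" using 0 by auto
    have "(\<lambda>s. s) \<in> hom (limit_sections T F U) (limit_sections T F V)"
      unfolding UV by (simp add: hom_def)
    moreover have "restrict s U = s" if "s \<in> carrier (limit_sections T F U)" for s
      using that by (auto simp: limit_sections_def PiE_def extensional_restrict)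
    ultimately show ?case by (intro bexI[of _ "\<lambda>s. s"]) auto
  next
    case (Suc n)
    have VT: "V \<subseteq> topspace T" and UT: "U \<subseteq> topspace T"
      using openin_subset[OF Suc(3)] openin_subset[OF Suc(2)] by auto
    have fin: "finite (V - U)" using VT finite_topspace finite_subset by blast
    have ne: "V - U \<noteq> {}" using Suc(5) by (intro notI) simp
    \<comment> \<open>A missing point whose neighbourhood has fewest elements is minimal among the
      missing ones, since points strictly below it have strictly smaller neighbourhoods. So its
      punctured neighbourhood lies in \<open>U\<close>.\<close>
    obtain x where x: "x \<in> V - U" and xmin: "\<And>z. z \<in> V - U \<Longrightarrow> card (min_nbhd T x) \<le> card (min_nbhd T z)"
      using ex_min_if_finite[of "(\<lambda>x. card (min_nbhd T x)) ` (V - U)"] fin ne by (force simp: not_less)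
    have xT: "x \<in> topspace T" using x VT by auto
    let ?P = "min_nbhd T x - {x}"
    have PU: "?P \<subseteq> U"
    proof
      fix z assume z: "z \<in> ?P"
      then have zV: "z \<in> V" using x Suc(3) min_nbhd_subset[of T V x] by auto
      have "min_nbhd T z \<subset> min_nbhd T x"
        using punctured_subset[OF xT z] by auto
      then have "card (min_nbhd T z) < card (min_nbhd T x)"
        using finite_topspace min_nbhd_subset_topspace[OF xT] by (meson finite_subset psubset_card_mono)
      then show "z \<in> U" using xmin[of z] zV by auto
    qed
    define U' where "U' = insert x U"
    have U'T: "U' \<subseteq> topspace T" using xT UT by (auto simp: U'_def)
    have oU': "openin T U'"
      using Suc(2) PU xT unfolding openin_iff U'_def by auto
    obtain \<sigma> where \<sigma>: "\<sigma> \<in> hom (limit_sections T F ?P) (obj F x)"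
      "\<And>s z. s \<in> carrier (limit_sections T F ?P) \<Longrightarrow> z \<in> ?P \<Longrightarrow> arr F x z (\<sigma> s) = s z"
      using lf xT unfolding locally_flasque_at_def by blast
    have PT: "?P \<subseteq> topspace T" using PU UT by auto
    have res: "restrict s ?P \<in> carrier (limit_sections T F ?P)" if "s \<in> carrier (limit_sections T F U)" for s
      using limit_sections_restrict[OF PU UT that] .
    \<comment> \<open>The new value depends on \<open>s\<close> only through its restriction to the
      punctured neighbourhood, so \<open>e\<close> is multiplicative because restriction and
      \<open>\<sigma>\<close> are.\<close>
    define e where "e s = (\<lambda>z\<in>U'. if z = x then \<sigma> (restrict s ?P) else s z)" for s
    have eU: "e s z = s z" if "z \<in> U" for s z using that x by (auto simp: e_def U'_def)
    have ex: "e s x = \<sigma> (restrict s ?P)" for s by (simp add: e_def U'_def)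
    have ec: "e s \<in> carrier (limit_sections T F U')" if s: "s \<in> carrier (limit_sections T F U)" for s
      unfolding carrier_limit_sections[OF U'T]
    proof (intro conjI ballI impI PiE_I)
      have sx: "\<sigma> (restrict s ?P) \<in> carrier (obj F x)" using \<sigma>(1) res[OF s] by (auto simp: hom_def)
      fix b assume b: "b \<in> U'"
      show "e s b \<in> carrier (obj F b)"
        using b s sx eU ex UT by (auto simp: U'_def carrier_limit_sections)
      fix a assume a: "a \<in> U'" "a \<in> min_nbhd T b"
      show "arr F b a (e s b) = e s a"
      \<comment> \<open>From a point of \<open>U\<close> only points of \<open>U\<close> are
        reached, because \<open>U\<close> is open. The compatibilities that start at
        \<open>x\<close> are those that \<open>\<sigma>\<close> provides.\<close>
      proof (cases "b = x")
        case False
        then have "b \<in> U" "a \<in> U"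
          using b a min_nbhd_subset[OF Suc(2), of b] by (auto simp: U'_def)
        then show ?thesis using s a eU UT by (auto simp: carrier_limit_sections)
      next
        case bx: True
        show ?thesis
        proof (cases "a = x")
          case True
          then show ?thesis using bx F xT sx by (auto simp: group_functor_def ex)
        next
          case False
          then have "a \<in> ?P" using a bx by auto
          then show ?thesis using \<sigma>(2)[OF res[OF s]] bx PU by (auto simp: ex eU)
        qed
      qed
    next
      fix z assume "z \<notin> U'" then show "e s z = undefined" by (simp add: e_def)
    qed
    have eh: "e \<in> hom (limit_sections T F U) (limit_sections T F U')"
    proof (rule homI)
      fix s t assume s: "s \<in> carrier (limit_sections T F U)" and t: "t \<in> carrier (limit_sections T F U)"
      have r: "restrict (s \<otimes>\<^bsub>limit_sections T F U\<^esub> t) ?P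
          = restrict s ?P \<otimes>\<^bsub>limit_sections T F ?P\<^esub> restrict t ?P"
        using PU by (auto simp: limit_sections_def fun_eq_iff restrict_def)
      show "e (s \<otimes>\<^bsub>limit_sections T F U\<^esub> t) = e s \<otimes>\<^bsub>limit_sections T F U'\<^esub> e t"
      proof
        fix z
        consider "z \<in> U" | "z = x" | "z \<notin> U'" by (auto simp: U'_def)
        then show "e (s \<otimes>\<^bsub>limit_sections T F U\<^esub> t) z = (e s \<otimes>\<^bsub>limit_sections T F U'\<^esub> e t) z"
        proof cases
          case 1
          then show ?thesis by (simp add: eU mult_limit_sections U'_def)
        next
          case 2
          have "(e s \<otimes>\<^bsub>limit_sections T F U'\<^esub> e t) x = e s x \<otimes>\<^bsub>obj F x\<^esub> e t x"
            by (simp add: mult_limit_sections U'_def)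
          then show ?thesis using 2 \<sigma>(1) res[OF s] res[OF t] by (simp add: ex r hom_def)
        next
          case 3
          then show ?thesis by (simp add: e_def mult_limit_sections_eq)
        qed
      qed
    qed (rule ec)
    have "card (V - U') = n"
      using Suc(5) x fin by (simp add: U'_def card_Diff_insert)
    moreover have "U' \<subseteq> V" using x Suc(4) by (auto simp: U'_def)
    ultimately obtain \<tau> where \<tau>: "\<tau> \<in> hom (limit_sections T F U') (limit_sections T F V)"
      "\<And>s. s \<in> carrier (limit_sections T F U') \<Longrightarrow> restrict (\<tau> s) U' = s"
      using Suc(1)[OF oU' Suc(3)] by blast
    have "restrict ((\<tau> \<circ> e) s) U = s" if s: "s \<in> carrier (limit_sections T F U)" for s
    proof
      fix z
      show "restrict ((\<tau> \<circ> e) s) U z = s z"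
      proof (cases "z \<in> U")
        case True
        then have "\<tau> (e s) z = restrict (\<tau> (e s)) U' z" by (simp add: U'_def)
        then show ?thesis using \<tau>(2)[OF ec[OF s]] True by (simp add: eU)
      next
        case False
        then show ?thesis using s by (auto simp: limit_sections_def PiE_def extensional_def)
      qed
    qed
    moreover have "\<tau> \<circ> e \<in> hom (limit_sections T F U) (limit_sections T F V)"
      using eh \<tau>(1) by (rule hom_compose)
    ultimately show ?case by blast
  qed
  show "s_flasque (sheaf_of_functor T F)"
    unfolding s_flasque_def
  proof (intro allI impI)
    fix U assume "openin (base (sheaf_of_functor T F)) U"
    then have "openin T U" "U \<subseteq> topspace T" by (auto simp: sheaf_of_functor_def openin_subset)
    then show "\<exists>\<sigma>\<in>hom (sec (sheaf_of_functor T F) U)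
          (sec (sheaf_of_functor T F) (topspace (base (sheaf_of_functor T F)))).
       \<forall>s\<in>carrier (sec (sheaf_of_functor T F) U).
         res (sheaf_of_functor T F) (topspace (base (sheaf_of_functor T F))) U (\<sigma> s) = s"
      using ext[of U "topspace T"] by (simp add: sheaf_of_functor_def)
  qed
qed

section \<open>Functors of quotients of s-regular elements by units\<close>

text \<open>On the points of \<open>D\<close> the functor \<open>F\<close> is computed from the
  monoids \<open>A\<close> and their restrictions \<open>r\<close> through the maps
  \<open>q\<close>. The set \<open>D\<close> is a parameter so that a model over one minimal
  neighbourhood can be compared with another; the groups of \<open>F\<close> may live on any
  type.\<close>

definition quotient_model ::
    "'p topology \<Rightarrow> 'p set \<Rightarrow> ('p \<Rightarrow> 'a monoid) \<Rightarrow> ('p \<Rightarrow> 'p \<Rightarrow> 'a \<Rightarrow> 'a) \<Rightarrow>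
      ('p, 'b) point_functor \<Rightarrow> ('p \<Rightarrow> 'a \<Rightarrow> 'b) \<Rightarrow> bool" where
  "quotient_model T D A r F q \<longleftrightarrow>
     (\<forall>y\<in>D. comm_monoid (A y) \<and> regular_quotient (A y) (obj F y) (q y) \<and>
       (\<forall>x\<in>min_nbhd T y. arr F y x \<in> hom (obj F y) (obj F x) \<and>
          (\<forall>a\<in>s_regulars (A y). r y x a \<in> s_regulars (A x) \<and> arr F y x (q y a) = q x (r y x a))))"

lemma quotient_modelD:
  assumes "quotient_model T D A r F q" "y \<in> D"
  shows "comm_monoid (A y)" "regular_quotient (A y) (obj F y) (q y)"
    and "x \<in> min_nbhd T y \<Longrightarrow> arr F y x \<in> hom (obj F y) (obj F x)"
    and "x \<in> min_nbhd T y \<Longrightarrow> a \<in> s_regulars (A y) \<Longrightarrow> r y x a \<in> s_regulars (A x)"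
    and "x \<in> min_nbhd T y \<Longrightarrow> a \<in> s_regulars (A y) \<Longrightarrow> arr F y x (q y a) = q x (r y x a)"
  using assms unfolding quotient_model_def by blast+

text \<open>Every \<open>x\<close> in \<open>G\<close> satisfies an equation
  \<open>x q b = q a\<close>, so a homomorphism to a group is determined by its values on the image
  of \<open>q\<close>. Functor laws and naturality squares of models are all checked in this
  way.\<close>

lemma regular_quotient_hom_eqI:
  assumes q: "regular_quotient M G q" and K: "comm_group K" and f: "f \<in> hom G K" and g: "g \<in> hom G K"
    and eq: "\<And>a. a \<in> s_regulars M \<Longrightarrow> f (q a) = g (q a)" and x: "x \<in> carrier G"
  shows "f x = g x"
proof -
  interpret K: comm_group K by fact
  interpret G: comm_group G by (rule regular_quotientD[OF q])
  obtain a b where ab: "a \<in> s_regulars M" "b \<in> s_regulars M" "x \<otimes>\<^bsub>G\<^esub> q b = q a"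
    using regular_quotientD(4)[OF q x] by blast
  have b: "q b \<in> carrier G" using ab regular_quotientD(2)[OF q] by auto
  have c: "f x \<in> carrier K" "g x \<in> carrier K" "g (q b) \<in> carrier K"
    using f g x b by (auto simp: hom_def)
  have "f x \<otimes>\<^bsub>K\<^esub> g (q b) = f (x \<otimes>\<^bsub>G\<^esub> q b)" using hom_mult[OF f x b] eq[OF ab(2)] by simp
  also have "\<dots> = g x \<otimes>\<^bsub>K\<^esub> g (q b)" using eq[OF ab(1)] hom_mult[OF g x b] by (simp add: ab(3))
  finally show ?thesis using c by simp
qed

text \<open>The laws hold on the values of \<open>q\<close> because they hold for the restrictions
  \<open>r\<close>, and therefore everywhere.\<close>

lemma group_functor_quotient_model:
  assumes m: "quotient_model T (topspace T) A r F q"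
    and r1: "\<And>y a. y \<in> topspace T \<Longrightarrow> a \<in> s_regulars (A y) \<Longrightarrow> r y y a = a"
    and r2: "\<And>x y z a. y \<in> topspace T \<Longrightarrow> x \<in> min_nbhd T y \<Longrightarrow> z \<in> min_nbhd T x \<Longrightarrow>
      a \<in> s_regulars (A y) \<Longrightarrow> r x z (r y x a) = r y z a"
  shows "group_functor T F"
  unfolding group_functor_def
proof (intro ballI conjI)
  fix y assume y: "y \<in> topspace T"
  note my = quotient_modelD[OF m y]
  show cg: "comm_group (obj F y)" using my(2) by (rule regular_quotientD)
  fix g assume g: "g \<in> carrier (obj F y)"
  show "arr F y y g = g"
    by (rule regular_quotient_hom_eqI[OF my(2) cg my(3) _ _ g])
       (auto simp: my(5) r1[OF y] hom_def)
next
  fix y x assume y: "y \<in> topspace T" and x: "x \<in> min_nbhd T y"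
  note my = quotient_modelD[OF m y]
  show "arr F y x \<in> hom (obj F y) (obj F x)" using my(3)[OF x] .
  fix z g assume z: "z \<in> min_nbhd T x" and g: "g \<in> carrier (obj F y)"
  have xT: "x \<in> topspace T" and zy: "z \<in> min_nbhd T y"
    using min_nbhd_subset_topspace[OF y] min_nbhd_mono[OF x] x z by auto
  then have zT: "z \<in> topspace T" using min_nbhd_subset_topspace[OF y] by auto
  note mx = quotient_modelD[OF m xT]
  have "(arr F x z \<circ> arr F y x) g = arr F y z g"
  proof (rule regular_quotient_hom_eqI[OF my(2) _ _ my(3)[OF zy] _ g])
    show "comm_group (obj F z)" using quotient_modelD(2)[OF m zT] by (rule regular_quotientD)
    show "arr F x z \<circ> arr F y x \<in> hom (obj F y) (obj F z)"
      using my(3)[OF x] mx(3)[OF z] by (rule hom_compose)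
    fix a assume a: "a \<in> s_regulars (A y)"
    show "(arr F x z \<circ> arr F y x) (q y a) = arr F y z (q y a)"
      using my(4,5)[OF x a] mx(5)[OF z] my(5)[OF zy a] r2[OF y x z a] by simp
  qed
  then show "arr F x z (arr F y x g) = arr F y z g" by simp
qed

text \<open>Two models over the same monoids are isomorphic at each point by
  \<open>regular_quotient_unique\<close>, and the isomorphisms are natural because both functors act
  on the values of their quotient maps through \<open>r\<close>. Conjugation by them turns a
  splitting for \<open>F\<close> into one for \<open>G\<close>. The two spaces may differ away from
  the neighbourhood of \<open>x\<close>.\<close>

lemma locally_flasque_at_transfer:
  assumes F: "quotient_model T (min_nbhd T x) A r F q"
    and G: "quotient_model T' (min_nbhd T' x) A r G p"
    and nb: "\<And>z. z \<in> min_nbhd T x \<Longrightarrow> min_nbhd T' z = min_nbhd T z"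
    and x: "x \<in> topspace T" "x \<in> topspace T'"
    and lf: "locally_flasque_at T F x"
  shows "locally_flasque_at T' G x"
proof -
  let ?D = "min_nbhd T x" let ?P = "min_nbhd T x - {x}"
  have D': "min_nbhd T' x = ?D" using nb by simp
  have DT: "?D \<subseteq> topspace T" "?D \<subseteq> topspace T'"
    using min_nbhd_subset_topspace x D' by metis+
  have PT: "?P \<subseteq> topspace T" "?P \<subseteq> topspace T'" using DT by auto
  note mF = quotient_modelD[OF F]
  have G': "quotient_model T' ?D A r G p" using G D' by simp
  note mG = quotient_modelD[OF G']
  have cgF: "comm_group (obj F z)" and cgG: "comm_group (obj G z)" if "z \<in> ?D" for z
    using mF(2)[OF that] mG(2)[OF that] by (auto dest: regular_quotientD(1))
  have "\<forall>z\<in>?D. \<exists>\<theta>. \<theta> \<in> hom (obj F z) (obj G z) \<and> (\<forall>a\<in>s_regulars (A z). \<theta> (q z a) = p z a)"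
    using regular_quotient_unique mF(1,2) mG(2) by metis
  then obtain \<theta> where th: "\<And>z. z \<in> ?D \<Longrightarrow> \<theta> z \<in> hom (obj F z) (obj G z)"
    "\<And>z a. z \<in> ?D \<Longrightarrow> a \<in> s_regulars (A z) \<Longrightarrow> \<theta> z (q z a) = p z a" by metis
  have "\<forall>z\<in>?D. \<exists>\<theta>. \<theta> \<in> hom (obj G z) (obj F z) \<and> (\<forall>a\<in>s_regulars (A z). \<theta> (p z a) = q z a)"
    using regular_quotient_unique mF(1,2) mG(2) by metis
  then obtain \<eta> where et: "\<And>z. z \<in> ?D \<Longrightarrow> \<eta> z \<in> hom (obj G z) (obj F z)"
    "\<And>z a. z \<in> ?D \<Longrightarrow> a \<in> s_regulars (A z) \<Longrightarrow> \<eta> z (p z a) = q z a" by metis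
  have et_closed: "\<eta> z g \<in> carrier (obj F z)" if "z \<in> ?D" "g \<in> carrier (obj G z)" for z g
    using et(1) that by (auto simp: hom_def)
  have inv: "\<theta> z (\<eta> z g) = g" if z: "z \<in> ?D" and g: "g \<in> carrier (obj G z)" for z g
  proof -
    have "(\<theta> z \<circ> \<eta> z) g = (\<lambda>g. g) g"
      by (rule regular_quotient_hom_eqI[OF mG(2)[OF z] cgG[OF z] hom_compose[OF et(1)[OF z] th(1)[OF z]] _ _ g])
         (auto simp: hom_def th z et)
    then show ?thesis by simp
  qed
  have natF: "arr G z w (\<theta> z g) = \<theta> w (arr F z w g)"
    if z: "z \<in> ?D" and w: "w \<in> min_nbhd T z" and g: "g \<in> carrier (obj F z)" for z w g
  proof -
    have wD: "w \<in> ?D" using min_nbhd_mono[OF z] w by blast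
    have w': "w \<in> min_nbhd T' z" using w nb[OF z] by simp
    have "(arr G z w \<circ> \<theta> z) g = (\<theta> w \<circ> arr F z w) g"
      by (rule regular_quotient_hom_eqI[OF mF(2)[OF z] cgG[OF wD] hom_compose[OF th(1)[OF z] mG(3)[OF z w']]
           hom_compose[OF mF(3)[OF z w] th(1)[OF wD]] _ g])
         (simp add: th[OF z] th[OF wD] mF[OF z] mG[OF z] w w')
    then show ?thesis by simp
  qed
  have natG: "arr F z w (\<eta> z g) = \<eta> w (arr G z w g)"
    if z: "z \<in> ?D" and w: "w \<in> min_nbhd T z" and g: "g \<in> carrier (obj G z)" for z w g
  proof -
    have wD: "w \<in> ?D" using min_nbhd_mono[OF z] w by blast
    have w': "w \<in> min_nbhd T' z" using w nb[OF z] by simp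
    have "(arr F z w \<circ> \<eta> z) g = (\<eta> w \<circ> arr G z w) g"
      by (rule regular_quotient_hom_eqI[OF mG(2)[OF z] cgF[OF wD] hom_compose[OF et(1)[OF z] mF(3)[OF z w]]
           hom_compose[OF mG(3)[OF z w'] et(1)[OF wD]] _ g])
         (simp add: et[OF z] et[OF wD] mF[OF z] mG[OF z] w w')
    then show ?thesis by simp
  qed
  obtain \<sigma> where \<sigma>: "\<sigma> \<in> hom (limit_sections T F ?P) (obj F x)"
    "\<And>s z. s \<in> carrier (limit_sections T F ?P) \<Longrightarrow> z \<in> ?P \<Longrightarrow> arr F x z (\<sigma> s) = s z"
    using lf unfolding locally_flasque_at_def by blast
  define e where "e s = (\<lambda>z\<in>?P. \<eta> z (s z))" for s
  have sc: "s z \<in> carrier (obj G z)" if "s \<in> carrier (limit_sections T' G ?P)" "z \<in> ?P" for s z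
    using that PT by (auto simp: carrier_limit_sections)
  have ec: "e s \<in> carrier (limit_sections T F ?P)" if s: "s \<in> carrier (limit_sections T' G ?P)" for s
    unfolding carrier_limit_sections[OF PT(1)]
  proof (intro conjI ballI impI)
    show "e s \<in> (\<Pi>\<^sub>E x\<in>?P. carrier (obj F x))" using et_closed sc[OF s] by (auto simp: e_def)
    fix b a assume ab: "b \<in> ?P" "a \<in> ?P" "a \<in> min_nbhd T b"
    have "arr G b a (s b) = s a" using s ab nb PT by (auto simp: carrier_limit_sections)
    then show "arr F b a (e s b) = e s a" using natG[of b a "s b"] ab sc[OF s] by (auto simp: e_def)
  qed
  have eh: "e \<in> hom (limit_sections T' G ?P) (limit_sections T F ?P)"
  proof (rule homI)
    fix s t assume s: "s \<in> carrier (limit_sections T' G ?P)" and t: "t \<in> carrier (limit_sections T' G ?P)"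
    show "e (s \<otimes>\<^bsub>limit_sections T' G ?P\<^esub> t) = e s \<otimes>\<^bsub>limit_sections T F ?P\<^esub> e t"
      unfolding mult_limit_sections_eq
    proof (rule ext)
      fix z
      have "\<eta> z (s z \<otimes>\<^bsub>obj G z\<^esub> t z) = \<eta> z (s z) \<otimes>\<^bsub>obj F z\<^esub> \<eta> z (t z)" if "z \<in> ?P"
        using hom_mult[OF et(1)] sc[OF s that] sc[OF t that] that by auto
      then show "e (\<lambda>x\<in>?P. s x \<otimes>\<^bsub>obj G x\<^esub> t x) z = (\<lambda>x\<in>?P. e s x \<otimes>\<^bsub>obj F x\<^esub> e t x) z"
        by (auto simp: e_def)
    qed
  qed (rule ec)
  show ?thesis unfolding locally_flasque_at_def D'
  proof (intro bexI[of _ "\<theta> x \<circ> (\<sigma> \<circ> e)"] ballI)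
    show "\<theta> x \<circ> (\<sigma> \<circ> e) \<in> hom (limit_sections T' G ?P) (obj G x)"
      by (intro hom_compose[OF hom_compose[OF eh \<sigma>(1)]] th) simp
    fix s z assume s: "s \<in> carrier (limit_sections T' G ?P)" and z: "z \<in> ?P"
    have "\<sigma> (e s) \<in> carrier (obj F x)" using \<sigma>(1) ec[OF s] by (auto simp: hom_def)
    then have "arr G x z (\<theta> x (\<sigma> (e s))) = \<theta> z (arr F x z (\<sigma> (e s)))"
      using natF[of x z] z by auto
    also have "\<dots> = \<theta> z (\<eta> z (s z))" using \<sigma>(2)[OF ec[OF s] z] z by (simp add: e_def)
    also have "\<dots> = s z" using inv sc[OF s z] z by auto
    finally show "arr G x z ((\<theta> x \<circ> (\<sigma> \<circ> e)) s) = s z" by simp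
  qed
qed

text \<open>Changes the monoids of a model along isomorphisms and keeps the functor. Functors of
  different schemes become comparable once their monoids have been made the same.\<close>

lemma quotient_model_iso:
  assumes m: "quotient_model T D A r F q"
    and D: "\<And>y x. y \<in> D \<Longrightarrow> x \<in> min_nbhd T y \<Longrightarrow> x \<in> D"
    and B: "\<And>y. y \<in> D \<Longrightarrow> comm_monoid (B y)"
    and i: "\<And>y. y \<in> D \<Longrightarrow> unital_iso (B y) (A y) (i y)"
    and r': "\<And>y x a. y \<in> D \<Longrightarrow> x \<in> min_nbhd T y \<Longrightarrow> a \<in> carrier (B y) \<Longrightarrow>
       r' y x a \<in> carrier (B x) \<and> i x (r' y x a) = r y x (i y a)"
  shows "quotient_model T D B r' F (\<lambda>y. q y \<circ> i y)"
  unfolding quotient_model_def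
proof (intro ballI conjI B)
  fix y assume y: "y \<in> D"
  note my = quotient_modelD[OF m y]
  show "regular_quotient (B y) (obj F y) (q y \<circ> i y)"
    using regular_quotient_unital_iso[OF B[OF y] my(1) i[OF y] my(2)] .
  fix x assume x: "x \<in> min_nbhd T y"
  show "arr F y x \<in> hom (obj F y) (obj F x)" by (rule my(3)[OF x])
  fix a assume a: "a \<in> s_regulars (B y)"
  have ac: "a \<in> carrier (B y)" using a by (auto simp: s_regulars_def s_regular_def)
  have xD: "x \<in> D" using D y x by blast
  have ia: "i y a \<in> s_regulars (A y)"
    using a s_regular_unital_iso[OF B[OF y] my(1) i[OF y] ac] by (simp add: s_regulars_def)
  show "r' y x a \<in> s_regulars (B x)"
    using my(4)[OF x ia] r'[OF y x ac] s_regular_unital_iso[OF B[OF xD] quotient_modelD(1)[OF m xD] i[OF xD], of "r' y x a"]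
    by (simp add: s_regulars_def)
  show "arr F y x ((q y \<circ> i y) a) = (q x \<circ> i x) (r' y x a)"
    using my(5)[OF x ia] r'[OF y x ac] by simp
qed


section \<open>Stalks as sections over minimal neighbourhoods\<close>

abbreviation min_sec :: "('p, 'a) monoid_space \<Rightarrow> 'p \<Rightarrow> 'a monoid" where
  "min_sec X y \<equiv> sec X (min_nbhd (base X) y)"

abbreviation min_res :: "('p, 'a) monoid_space \<Rightarrow> 'p \<Rightarrow> 'p \<Rightarrow> 'a \<Rightarrow> 'a" where
  "min_res X y x \<equiv> res X (min_nbhd (base X) y) (min_nbhd (base X) x)"

lemma presheafD:
  assumes "presheaf_of_monoids X"
  shows "openin (base X) U \<Longrightarrow> comm_monoid (sec X U)"
    and "openin (base X) U \<Longrightarrow> openin (base X) V \<Longrightarrow> V \<subseteq> U \<Longrightarrow> unital_hom (sec X U) (sec X V) (res X U V)"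
    and "openin (base X) U \<Longrightarrow> s \<in> carrier (sec X U) \<Longrightarrow> res X U U s = s"
    and "openin (base X) U \<Longrightarrow> openin (base X) V \<Longrightarrow> openin (base X) W \<Longrightarrow> V \<subseteq> U \<Longrightarrow> W \<subseteq> V \<Longrightarrow>
      s \<in> carrier (sec X U) \<Longrightarrow> res X V W (res X U V s) = res X U W s"
  using assms unfolding presheaf_of_monoids_def unital_hom_def by simp_all

text \<open>At a point whose minimal neighbourhood \<open>N\<close> is open, a germ has exactly one
  representative over \<open>N\<close>, so the stalk is a copy of the sections over
  \<open>N\<close>.\<close>

locale min_presheaf =
  fixes X :: "('p, 'a) monoid_space" and y :: 'p
  assumes presheaf: "presheaf_of_monoids X"
    and y_top: "y \<in> topspace (base X)"
    and open_min: "openin (base X) (min_nbhd (base X) y)"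
begin

abbreviation N where "N \<equiv> min_nbhd (base X) y"
abbreviation g where "g \<equiv> germ X y N"

lemma N_sub: "openin (base X) U \<Longrightarrow> y \<in> U \<Longrightarrow> N \<subseteq> U"
  by (rule min_nbhd_subset)

lemma res_N_closed: "openin (base X) U \<Longrightarrow> y \<in> U \<Longrightarrow> s \<in> carrier (sec X U) \<Longrightarrow> res X U N s \<in> carrier (sec X N)"
  using unital_homD(1)[OF presheafD(2)[OF presheaf _ open_min]] N_sub by blast

text \<open>Any neighbourhood on which two sections agree contains \<open>N\<close>, so they agree
  on \<open>N\<close> as well.\<close>

lemma germ_rel_iff:
  "((U, s), (V, t)) \<in> germ_rel X y \<longleftrightarrow>
     openin (base X) U \<and> y \<in> U \<and> s \<in> carrier (sec X U) \<and>
     openin (base X) V \<and> y \<in> V \<and> t \<in> carrier (sec X V) \<and> res X U N s = res X V N t"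
proof -
  have eq: "res X U N s = res X V N t"
    if U: "openin (base X) U" "s \<in> carrier (sec X U)" and V: "openin (base X) V" "t \<in> carrier (sec X V)"
      and W: "openin (base X) W" "y \<in> W" "W \<subseteq> U" "W \<subseteq> V" and e: "res X U W s = res X V W t" for W
  proof -
    note NW = N_sub[OF W(1,2)]
    have "res X U N s = res X W N (res X U W s)"
      by (rule presheafD(4)[OF presheaf U(1) W(1) open_min W(3) NW U(2), symmetric])
    also have "\<dots> = res X V N t"
      unfolding e by (rule presheafD(4)[OF presheaf V(1) W(1) open_min W(4) NW V(2)])
    finally show ?thesis .
  qed
  show ?thesis
  proof
    assume "((U, s), (V, t)) \<in> germ_rel X y"
    then show "openin (base X) U \<and> y \<in> U \<and> s \<in> carrier (sec X U) \<and>
     openin (base X) V \<and> y \<in> V \<and> t \<in> carrier (sec X V) \<and> res X U N s = res X V N t"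
      unfolding germ_rel_def using eq by auto
  next
    assume *: "openin (base X) U \<and> y \<in> U \<and> s \<in> carrier (sec X U) \<and>
     openin (base X) V \<and> y \<in> V \<and> t \<in> carrier (sec X V) \<and> res X U N s = res X V N t"
    then have "N \<subseteq> U \<inter> V" using N_sub[of U] N_sub[of V] by auto
    then show "((U, s), (V, t)) \<in> germ_rel X y"
      unfolding germ_rel_def using * open_min min_nbhd_self[of y "base X"] by blast
  qed
qed

lemma germ_mem_iff:
  assumes "openin (base X) U" "y \<in> U" "s \<in> carrier (sec X U)"
  shows "(V, t) \<in> germ X y U s \<longleftrightarrow>
    openin (base X) V \<and> y \<in> V \<and> t \<in> carrier (sec X V) \<and> res X V N t = res X U N s"
  using assms by (auto simp: germ_def germ_rel_iff)

lemma germ_eq_g: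
  assumes "openin (base X) U" "y \<in> U" "s \<in> carrier (sec X U)"
  shows "germ X y U s = g (res X U N s)"
proof -
  have "res X U N s \<in> carrier (sec X N)" by (rule res_N_closed[OF assms])
  then show ?thesis
    using assms open_min presheafD(3)[OF presheaf open_min]
    by (auto simp: germ_mem_iff)
qed

lemma g_mem_iff:
  assumes "a \<in> carrier (sec X N)"
  shows "(V, t) \<in> g a \<longleftrightarrow>
    openin (base X) V \<and> y \<in> V \<and> t \<in> carrier (sec X V) \<and> res X V N t = a"
  using germ_mem_iff[OF open_min _ assms] presheafD(3)[OF presheaf open_min assms] by auto

lemma carrier_stalk: "carrier (stalk X y) = g ` carrier (sec X N)"
proof -
  have "carrier (stalk X y) = (\<lambda>(U, s). germ X y U s) ` {(U, s). openin (base X) U \<and> y \<in> U \<and> s \<in> carrier (sec X U)}"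
    by (auto simp: stalk_def quotient_def germ_def)
  also have "\<dots> = g ` carrier (sec X N)"
  proof
    show "(\<lambda>(U, s). germ X y U s) ` {(U, s). openin (base X) U \<and> y \<in> U \<and> s \<in> carrier (sec X U)}
        \<subseteq> g ` carrier (sec X N)"
      using germ_eq_g res_N_closed by auto
    show "g ` carrier (sec X N) \<subseteq>
        (\<lambda>(U, s). germ X y U s) ` {(U, s). openin (base X) U \<and> y \<in> U \<and> s \<in> carrier (sec X U)}"
      using open_min by force
  qed
  finally show ?thesis .
qed

lemma inj_g: "inj_on g (carrier (sec X N))"
proof (rule inj_onI)
  fix a b assume ab: "a \<in> carrier (sec X N)" "b \<in> carrier (sec X N)" "g a = g b"
  note id = presheafD(3)[OF presheaf open_min]
  have "(N, a) \<in> g a" using g_mem_iff[OF ab(1)] ab(1) open_min id by simp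
  then have "(N, a) \<in> g b" by (simp only: ab(3))
  then have "res X N N a = b" unfolding g_mem_iff[OF ab(2)] by blast
  then show "a = b" using id[OF ab(1)] by simp
qed

lemma mult_stalk:
  assumes "a \<in> carrier (sec X N)" "b \<in> carrier (sec X N)"
  shows "g a \<otimes>\<^bsub>stalk X y\<^esub> g b = g (a \<otimes>\<^bsub>sec X N\<^esub> b)"
proof -
  have c: "germ X y (U \<inter> V) (res X U (U \<inter> V) s \<otimes>\<^bsub>sec X (U \<inter> V)\<^esub> res X V (U \<inter> V) t) = g (a \<otimes>\<^bsub>sec X N\<^esub> b)"
    if "(U, s) \<in> g a" "(V, t) \<in> g b" for U s V t
  proof -
    have U: "openin (base X) U" "y \<in> U" "s \<in> carrier (sec X U)" "res X U N s = a"
      and V: "openin (base X) V" "y \<in> V" "t \<in> carrier (sec X V)" "res X V N t = b"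
      using that assms by (auto simp: g_mem_iff)
    have W: "openin (base X) (U \<inter> V)" "y \<in> U \<inter> V" using U V by auto
    have NW: "N \<subseteq> U \<inter> V" using W by (rule N_sub)
    note hU = unital_homD[OF presheafD(2)[OF presheaf U(1) W(1)]]
    note hV = unital_homD[OF presheafD(2)[OF presheaf V(1) W(1)]]
    note hW = unital_homD[OF presheafD(2)[OF presheaf W(1) open_min NW]]
    interpret m: comm_monoid "sec X (U \<inter> V)" by (rule presheafD(1)[OF presheaf W(1)])
    have s: "res X U (U \<inter> V) s \<in> carrier (sec X (U \<inter> V))" "res X V (U \<inter> V) t \<in> carrier (sec X (U \<inter> V))"
      using hU(1) hV(1) U V by auto
    have "res X (U \<inter> V) N (res X U (U \<inter> V) s) = a"
      using presheafD(4)[OF presheaf U(1) W(1) open_min _ NW] U by auto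
    moreover have "res X (U \<inter> V) N (res X V (U \<inter> V) t) = b"
      using presheafD(4)[OF presheaf V(1) W(1) open_min _ NW] V by auto
    ultimately show ?thesis
      using germ_eq_g[OF W m.m_closed[OF s]] hW(2)[OF s] by simp
  qed
  have self: "(N, a) \<in> g a" "(N, b) \<in> g b"
    using assms open_min presheafD(3)[OF presheaf open_min] by (auto simp: g_mem_iff)
  show ?thesis
  proof (rule Set.set_eqI)
    fix x
    have "x \<in> g a \<otimes>\<^bsub>stalk X y\<^esub> g b \<longleftrightarrow> (\<exists>U s V t. (U, s) \<in> g a \<and> (V, t) \<in> g b \<and>
        x \<in> germ X y (U \<inter> V) (res X U (U \<inter> V) s \<otimes>\<^bsub>sec X (U \<inter> V)\<^esub> res X V (U \<inter> V) t))"
      by (auto simp: stalk_def)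
    also have "\<dots> \<longleftrightarrow> x \<in> g (a \<otimes>\<^bsub>sec X N\<^esub> b)"
      using c self by blast
    finally show "x \<in> g a \<otimes>\<^bsub>stalk X y\<^esub> g b \<longleftrightarrow> x \<in> g (a \<otimes>\<^bsub>sec X N\<^esub> b)" .
  qed
qed

lemma one_stalk: "\<one>\<^bsub>stalk X y\<^esub> = g \<one>\<^bsub>sec X N\<^esub>"
proof -
  let ?T = "topspace (base X)"
  interpret m: comm_monoid "sec X ?T" by (rule presheafD(1)[OF presheaf]) simp
  have "\<one>\<^bsub>stalk X y\<^esub> = germ X y ?T \<one>\<^bsub>sec X ?T\<^esub>" by (simp add: stalk_def)
  also have "\<dots> = g (res X ?T N \<one>\<^bsub>sec X ?T\<^esub>)" using y_top by (intro germ_eq_g) auto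
  also have "res X ?T N \<one>\<^bsub>sec X ?T\<^esub> = \<one>\<^bsub>sec X N\<^esub>"
    using y_top by (intro unital_homD(3) presheafD(2)[OF presheaf]) (auto simp: open_min dest: subsetD[OF N_sub, rotated -1])
  finally show ?thesis .
qed

lemma comm_monoid_N: "comm_monoid (sec X N)"
  by (rule presheafD(1)[OF presheaf open_min])

lemma comm_monoid_stalk: "comm_monoid (stalk X y)"
proof -
  interpret m: comm_monoid "sec X N" by (rule comm_monoid_N)
  show ?thesis
    by (rule comm_monoidI) (auto simp: carrier_stalk mult_stalk one_stalk m.m_ac)
qed

lemma unital_iso_stalk: "unital_iso (sec X N) (stalk X y) g"
  using inj_g by (auto simp: unital_iso_def unital_hom_def hom_def bij_betw_def carrier_stalk mult_stalk one_stalk)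

end

lemma min_presheafI:
  assumes "presheaf_of_monoids X" "openin (base X) (min_nbhd (base X) y)"
  shows "min_presheaf X y"
proof -
  have "y \<in> topspace (base X)" by (rule subsetD[OF openin_subset[OF assms(2)] min_nbhd_self])
  then show ?thesis using assms by (simp add: min_presheaf_def)
qed

text \<open>All representatives of a germ at \<open>y\<close> have the same restriction to the
  minimal neighbourhood of \<open>y\<close>, and that neighbourhood contains the one of
  \<open>x\<close>.\<close>

lemma stalk_map_germ:
  assumes X: "presheaf_of_monoids X" and y: "openin (base X) (min_nbhd (base X) y)"
    and x: "openin (base X) (min_nbhd (base X) x)" "x \<in> min_nbhd (base X) y"
    and a: "a \<in> carrier (min_sec X y)"
  shows "stalk_map X x (germ X y (min_nbhd (base X) y) a) = germ X x (min_nbhd (base X) x) (min_res X y x a)"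
proof -
  interpret Y: min_presheaf X y using X y by (rule min_presheafI)
  interpret Z: min_presheaf X x using X x(1) by (rule min_presheafI)
  have xy: "Z.N \<subseteq> Y.N" using x(2) by (rule min_nbhd_mono)
  have c: "germ X x U s = Z.g (min_res X y x a)" if "(U, s) \<in> Y.g a" for U s
  proof -
    have U: "openin (base X) U" "y \<in> U" "s \<in> carrier (sec X U)" "res X U Y.N s = a"
      using that a by (auto simp: Y.g_mem_iff)
    have YU: "Y.N \<subseteq> U" using U by (intro Y.N_sub)
    then have "x \<in> U" using x by auto
    then have "germ X x U s = Z.g (res X U Z.N s)" using U by (intro Z.germ_eq_g) auto
    also have "res X U Z.N s = min_res X y x a"
      using presheafD(4)[OF X U(1) y x(1) YU xy U(3)] U(4) by simp
    finally show ?thesis .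
  qed
  have "(Y.N, a) \<in> Y.g a"
    using a y presheafD(3)[OF X y] by (auto simp: Y.g_mem_iff)
  then show ?thesis using c by (auto simp: stalk_map_def)
qed

text \<open>The minimal neighbourhood of \<open>y\<close> is the spectrum of the finitely generated
  monoid \<open>A y\<close>, with primes replaced by their complements: a point \<open>x\<close>
  corresponds to the face of elements that become invertible at \<open>x\<close>, so smaller points
  have larger faces. The converse of the last clause is \<open>unit_face_mono\<close>.\<close>

definition fg_spectrum_at ::
    "'p topology \<Rightarrow> ('p \<Rightarrow> 'a monoid) \<Rightarrow> ('p \<Rightarrow> 'p \<Rightarrow> 'a \<Rightarrow> 'a) \<Rightarrow> 'p \<Rightarrow> bool" where
  "fg_spectrum_at T A r y \<longleftrightarrow>
     monoid_finitely_generated (A y) \<and>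
     (\<forall>x\<in>min_nbhd T y. is_localization (A y) (A x) (r y x)) \<and>
     inj_on (\<lambda>x. unit_face (A y) (A x) (r y x)) (min_nbhd T y) \<and>
     (\<forall>S. face (A y) S \<longrightarrow> (\<exists>x\<in>min_nbhd T y. unit_face (A y) (A x) (r y x) = S)) \<and>
     (\<forall>x\<in>min_nbhd T y. \<forall>x'\<in>min_nbhd T y.
        unit_face (A y) (A x') (r y x') \<subseteq> unit_face (A y) (A x) (r y x) \<longrightarrow> x \<in> min_nbhd T x')"

lemma fg_spectrum_atD:
  assumes "fg_spectrum_at T A r y"
  shows "monoid_finitely_generated (A y)"
    and "x \<in> min_nbhd T y \<Longrightarrow> is_localization (A y) (A x) (r y x)"
    and "x \<in> min_nbhd T y \<Longrightarrow> x' \<in> min_nbhd T y \<Longrightarrow>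
      unit_face (A y) (A x) (r y x) = unit_face (A y) (A x') (r y x') \<Longrightarrow> x = x'"
    and "face (A y) S \<Longrightarrow> \<exists>x\<in>min_nbhd T y. unit_face (A y) (A x) (r y x) = S"
    and "x \<in> min_nbhd T y \<Longrightarrow> x' \<in> min_nbhd T y \<Longrightarrow>
        unit_face (A y) (A x') (r y x') \<subseteq> unit_face (A y) (A x) (r y x) \<Longrightarrow> x \<in> min_nbhd T x'"
proof -
  note a = assms[unfolded fg_spectrum_at_def]
  show "monoid_finitely_generated (A y)" using a by (rule conjunct1)
  note b = a[THEN conjunct2]
  show "x \<in> min_nbhd T y \<Longrightarrow> is_localization (A y) (A x) (r y x)" using b[THEN conjunct1] by (rule bspec)
  note c = b[THEN conjunct2]
  show "unit_face (A y) (A x) (r y x) = unit_face (A y) (A x') (r y x') \<Longrightarrow> x = x'"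
    if "x \<in> min_nbhd T y" "x' \<in> min_nbhd T y"
    using inj_onD[OF c[THEN conjunct1] _ that] .
  note d = c[THEN conjunct2]
  show "face (A y) S \<Longrightarrow> \<exists>x\<in>min_nbhd T y. unit_face (A y) (A x) (r y x) = S"
    using d[THEN conjunct1] by simp
  show "x \<in> min_nbhd T y \<Longrightarrow> x' \<in> min_nbhd T y \<Longrightarrow>
        unit_face (A y) (A x') (r y x') \<subseteq> unit_face (A y) (A x) (r y x) \<Longrightarrow> x \<in> min_nbhd T x'"
    using d[THEN conjunct2] by simp
qed

text \<open>For a sheaf this is equivalent to being a monoid scheme of finite type.\<close>

definition stalkwise_scheme :: "('p, 'a) monoid_space \<Rightarrow> bool" where
  "stalkwise_scheme X \<longleftrightarrow> sheaf_of_monoids X \<and> finite (topspace (base X)) \<and>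
     (\<forall>y\<in>topspace (base X). openin (base X) (min_nbhd (base X) y) \<and>
        fg_spectrum_at (base X) (min_sec X) (min_res X) y)"

locale stalkwise =
  fixes X :: "('p, 'a) monoid_space"
  assumes stalkwise: "stalkwise_scheme X"
begin

abbreviation T where "T \<equiv> base X"

lemma sheaf: "sheaf_of_monoids X" and presheaf: "presheaf_of_monoids X"
  and finT: "finite (topspace T)"
  and open_nb: "y \<in> topspace T \<Longrightarrow> openin T (min_nbhd T y)"
  and spectrum: "y \<in> topspace T \<Longrightarrow> fg_spectrum_at T (min_sec X) (min_res X) y"
  using stalkwise by (auto simp: stalkwise_scheme_def sheaf_of_monoids_def)

lemma cm: "y \<in> topspace T \<Longrightarrow> comm_monoid (min_sec X y)"
  by (rule presheafD(1)[OF presheaf open_nb])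

lemma mem_top: "y \<in> topspace T \<Longrightarrow> x \<in> min_nbhd T y \<Longrightarrow> x \<in> topspace T"
  by (rule subsetD[OF min_nbhd_subset_topspace])

lemma res_hom: "y \<in> topspace T \<Longrightarrow> x \<in> min_nbhd T y \<Longrightarrow> unital_hom (min_sec X y) (min_sec X x) (min_res X y x)"
  using presheafD(2)[OF presheaf open_nb open_nb min_nbhd_mono] mem_top by blast

lemma res_res:
  assumes "y \<in> topspace T" "x \<in> min_nbhd T y" "z \<in> min_nbhd T x" "a \<in> carrier (min_sec X y)"
  shows "min_res X x z (min_res X y x a) = min_res X y z a"
proof -
  have x: "x \<in> topspace T" using assms mem_top by blast
  then have z: "z \<in> topspace T" using assms mem_top by blast
  show ?thesis
    by (rule presheafD(4)[OF presheaf open_nb[OF assms(1)] open_nb[OF x] open_nb[OF z]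
          min_nbhd_mono[OF assms(2)] min_nbhd_mono[OF assms(3)] assms(4)])
qed

lemma res_id: "y \<in> topspace T \<Longrightarrow> a \<in> carrier (min_sec X y) \<Longrightarrow> min_res X y y a = a"
  by (rule presheafD(3)[OF presheaf open_nb])

lemma unit_face_mono:
  assumes "y \<in> topspace T" "x' \<in> min_nbhd T y" "x \<in> min_nbhd T x'"
  shows "unit_face (min_sec X y) (min_sec X x') (min_res X y x')
     \<subseteq> unit_face (min_sec X y) (min_sec X x) (min_res X y x)"
proof
  fix a assume "a \<in> unit_face (min_sec X y) (min_sec X x') (min_res X y x')"
  then have a: "a \<in> carrier (min_sec X y)" "min_res X y x' a \<in> Units (min_sec X x')"
    by (auto simp: unit_face_def)
  have x': "x' \<in> topspace T" using assms mem_top by blast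
  have "min_res X x' x (min_res X y x' a) \<in> Units (min_sec X x)"
    by (rule unital_hom_Units[OF cm[OF x'] res_hom[OF x' assms(3)] a(2)])
  then show "a \<in> unit_face (min_sec X y) (min_sec X x) (min_res X y x)"
    using res_res[OF assms a(1)] a(1) by (simp add: unit_face_def)
qed

text \<open>Points with equal neighbourhoods lie below each other, hence have the same face, and
  faces tell points below a common point apart.\<close>

sublocale finite_T0 T
proof
  show "finite (topspace T)" by (rule finT)
  fix x assume x: "x \<in> topspace T"
  show "openin T (min_nbhd T x)" by (rule open_nb[OF x])
  fix y assume y: "y \<in> topspace T" and eq: "min_nbhd T x = min_nbhd T y"
  have xy: "x \<in> min_nbhd T y" "y \<in> min_nbhd T x" using eq min_nbhd_self by metis+
  have "unit_face (min_sec X y) (min_sec X x) (min_res X y x)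
     = unit_face (min_sec X y) (min_sec X y) (min_res X y y)"
    using unit_face_mono[OF y xy(1) xy(2)] unit_face_mono[OF y min_nbhd_self xy(1)] by blast
  then show "x = y" using fg_spectrum_atD(3)[OF spectrum[OF y]] xy by auto
qed

text \<open>The whole monoid is a face. The point of the neighbourhood at which everything becomes
  invertible has the largest face and therefore lies below all the others.\<close>

lemma generic_point:
  assumes y: "y \<in> topspace T"
  obtains e where "e \<in> min_nbhd T y" "\<And>x. x \<in> min_nbhd T y \<Longrightarrow> e \<in> min_nbhd T x"
proof -
  interpret M: comm_monoid "min_sec X y" by (rule cm[OF y])
  have "face (min_sec X y) (carrier (min_sec X y))" by (auto simp: face_def)
  then obtain e where e: "e \<in> min_nbhd T y"
    "unit_face (min_sec X y) (min_sec X e) (min_res X y e) = carrier (min_sec X y)"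
    using fg_spectrum_atD(4)[OF spectrum[OF y]] by blast
  have "e \<in> min_nbhd T x" if "x \<in> min_nbhd T y" for x
    by (rule fg_spectrum_atD(5)[OF spectrum[OF y] e(1) that]) (unfold e(2), auto simp: unit_face_def)
  then show ?thesis using e that by blast
qed

lemma min_pre: "y \<in> topspace T \<Longrightarrow> min_presheaf X y"
  using min_presheafI[OF presheaf open_nb] .

abbreviation gm where "gm y \<equiv> germ X y (min_nbhd T y)"

lemma gm_iso: "y \<in> topspace T \<Longrightarrow> unital_iso (min_sec X y) (stalk X y) (gm y)"
  using min_presheaf.unital_iso_stalk[OF min_pre] .

lemma cm_stalk: "y \<in> topspace T \<Longrightarrow> comm_monoid (stalk X y)"
  using min_presheaf.comm_monoid_stalk[OF min_pre] .

lemma carrier_stalk: "y \<in> topspace T \<Longrightarrow> carrier (stalk X y) = gm y ` carrier (min_sec X y)"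
  using min_presheaf.carrier_stalk[OF min_pre] .

lemma stalk_map_gm:
  "y \<in> topspace T \<Longrightarrow> x \<in> min_nbhd T y \<Longrightarrow> a \<in> carrier (min_sec X y) \<Longrightarrow>
    stalk_map X x (gm y a) = gm x (min_res X y x a)"
  using stalk_map_germ[OF presheaf open_nb open_nb] mem_top by blast

text \<open>Stalks are exchanged for sections over minimal neighbourhoods, a language shared by a
  space and its open subspaces.\<close>

lemma s_cancellative_iff:
  "s_cancellative X \<longleftrightarrow>
     (\<forall>y\<in>topspace T. \<forall>x\<in>min_nbhd T y. inj_on (min_res X y x) (Units (min_sec X y)))"
proof -
  have "inj_on (stalk_map X x) (Units (stalk X y)) \<longleftrightarrow> inj_on (min_res X y x) (Units (min_sec X y))"
    if y: "y \<in> topspace T" and x: "x \<in> min_nbhd T y" for x y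
  proof -
    have xT: "x \<in> topspace T" using y x by (rule mem_top)
    interpret M: comm_monoid "min_sec X y" by (rule cm[OF y])
    interpret S: comm_monoid "stalk X y" by (rule cm_stalk[OF y])
    have injx: "inj_on (gm x) (carrier (min_sec X x))" and injy: "inj_on (gm y) (carrier (min_sec X y))"
      using gm_iso[OF xT] gm_iso[OF y] by (auto simp: unital_iso_def bij_betw_def)
    have U: "Units (stalk X y) = gm y ` Units (min_sec X y)"
    proof (rule Set.set_eqI)
      fix b
      have "b \<in> Units (stalk X y) \<longleftrightarrow> (\<exists>a\<in>carrier (min_sec X y). b = gm y a \<and> gm y a \<in> Units (stalk X y))"
        using S.Units_closed carrier_stalk[OF y] by auto
      also have "\<dots> \<longleftrightarrow> b \<in> gm y ` Units (min_sec X y)"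
        using unital_iso_Units[OF cm[OF y] cm_stalk[OF y] gm_iso[OF y]] by auto
      finally show "b \<in> Units (stalk X y) \<longleftrightarrow> b \<in> gm y ` Units (min_sec X y)" .
    qed
    have inU: "inj_on (gm y) (Units (min_sec X y))"
      using injy by (rule inj_on_subset) auto
    have "inj_on (stalk_map X x) (Units (stalk X y)) \<longleftrightarrow> inj_on (stalk_map X x \<circ> gm y) (Units (min_sec X y))"
      unfolding U using inU comp_inj_on_iff by blast
    also have "\<dots> \<longleftrightarrow> inj_on (gm x \<circ> min_res X y x) (Units (min_sec X y))"
      by (intro inj_on_cong) (simp add: stalk_map_gm[OF y x] M.Units_closed)
    also have "\<dots> \<longleftrightarrow> inj_on (min_res X y x) (Units (min_sec X y))"
    proof
      have "min_res X y x ` Units (min_sec X y) \<subseteq> carrier (min_sec X x)"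
        using unital_homD(1)[OF res_hom[OF y x]] by auto
      then have *: "inj_on (gm x) (min_res X y x ` Units (min_sec X y))" using injx inj_on_subset by blast
      show "inj_on (gm x \<circ> min_res X y x) (Units (min_sec X y)) \<Longrightarrow> inj_on (min_res X y x) (Units (min_sec X y))"
        by (rule inj_on_imageI2)
      show "inj_on (min_res X y x) (Units (min_sec X y)) \<Longrightarrow> inj_on (gm x \<circ> min_res X y x) (Units (min_sec X y))"
        using * by (rule comp_inj_on[rotated])
    qed
    finally show ?thesis .
  qed
  then show ?thesis by (auto simp: s_cancellative_def point_le_iff)
qed

section \<open>The functor of s-regular fractions modulo units\<close>

abbreviation QF where "QF \<equiv> quotient_functor (units_functor (sM_functor X)) (O_units X)"

definition QF_proj where
  "QF_proj y a = O_units X y #>\<^bsub>obj (units_functor (sM_functor X)) y\<^esub>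
     fraction (stalk X y) (s_regulars (stalk X y)) a \<one>\<^bsub>stalk X y\<^esub>"

text \<open>Up to the isomorphisms \<open>gm\<close>, the stalk map is the restriction between
  minimal neighbourhoods. This is a localization, so \<open>s_regular_localization\<close>
  applies.\<close>

lemma stalk_map_unital_hom:
  assumes y: "y \<in> topspace T" and x: "x \<in> min_nbhd T y"
  shows "unital_hom (stalk X y) (stalk X x) (stalk_map X x)"
    and "stalk_map X x ` s_regulars (stalk X y) \<subseteq> s_regulars (stalk X x)"
proof -
  have xT: "x \<in> topspace T" using y x by (rule mem_top)
  interpret M: comm_monoid "min_sec X y" by (rule cm[OF y])
  interpret N: comm_monoid "min_sec X x" by (rule cm[OF xT])
  note gy = gm_iso[OF y, unfolded unital_iso_def, THEN conjunct1]
  note gx = gm_iso[OF xT, unfolded unital_iso_def, THEN conjunct1]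
  note hr = unital_homD[OF res_hom[OF y x]]
  note sm = stalk_map_gm[OF y x]
  have 1: "stalk_map X x \<one>\<^bsub>stalk X y\<^esub> = \<one>\<^bsub>stalk X x\<^esub>"
    using sm[OF M.one_closed] hr(3) unital_homD(3)[OF gy] unital_homD(3)[OF gx] by simp
  show "unital_hom (stalk X y) (stalk X x) (stalk_map X x)"
    unfolding unital_hom_def
  proof (intro conjI homI 1)
    fix u assume "u \<in> carrier (stalk X y)"
    then obtain a where a: "a \<in> carrier (min_sec X y)" "u = gm y a" using carrier_stalk[OF y] by auto
    show "stalk_map X x u \<in> carrier (stalk X x)"
      using sm[OF a(1)] a(2) unital_homD(1)[OF gx hr(1)[OF a(1)]] by simp
    fix v assume "v \<in> carrier (stalk X y)"
    then obtain b where b: "b \<in> carrier (min_sec X y)" "v = gm y b" using carrier_stalk[OF y] by auto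
    have "stalk_map X x (u \<otimes>\<^bsub>stalk X y\<^esub> v) = stalk_map X x (gm y (a \<otimes>\<^bsub>min_sec X y\<^esub> b))"
      using unital_homD(2)[OF gy a(1) b(1)] a b by simp
    also have "\<dots> = gm x (min_res X y x a \<otimes>\<^bsub>min_sec X x\<^esub> min_res X y x b)"
      using sm[of "a \<otimes>\<^bsub>min_sec X y\<^esub> b"] a b hr(2) by simp
    also have "\<dots> = stalk_map X x u \<otimes>\<^bsub>stalk X x\<^esub> stalk_map X x v"
      using unital_homD(2)[OF gx hr(1)[OF a(1)] hr(1)[OF b(1)]] sm a b by simp
    finally show "stalk_map X x (u \<otimes>\<^bsub>stalk X y\<^esub> v) = stalk_map X x u \<otimes>\<^bsub>stalk X x\<^esub> stalk_map X x v" .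
  qed
  show "stalk_map X x ` s_regulars (stalk X y) \<subseteq> s_regulars (stalk X x)"
  proof
    fix w assume "w \<in> stalk_map X x ` s_regulars (stalk X y)"
    then obtain u where u: "s_regular (stalk X y) u" "w = stalk_map X x u" by (auto simp: s_regulars_def)
    then have "u \<in> carrier (stalk X y)" by (simp add: s_regular_def)
    then obtain a where a: "a \<in> carrier (min_sec X y)" "u = gm y a" using carrier_stalk[OF y] by auto
    have "s_regular (min_sec X y) a"
      using s_regular_unital_iso[OF cm[OF y] cm_stalk[OF y] gm_iso[OF y] a(1)] u a by simp
    then have "s_regular (min_sec X x) (min_res X y x a)"
      using s_regular_localization[OF cm[OF y] cm[OF xT] fg_spectrum_atD(2)[OF spectrum[OF y] x]] by blast
    then have "s_regular (stalk X x) (gm x (min_res X y x a))"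
      using s_regular_unital_iso[OF cm[OF xT] cm_stalk[OF xT] gm_iso[OF xT] hr(1)[OF a(1)]] by simp
    then show "w \<in> s_regulars (stalk X x)" using sm[OF a(1)] u a by (simp add: s_regulars_def)
  qed
qed

lemma quotient_model_stalk:
  "quotient_model T (topspace T) (stalk X) (\<lambda>y x. stalk_map X x) QF QF_proj"
proof -
  have U: "obj (units_functor (sM_functor X)) y = regular_fractions (stalk X y)" for y
    by (simp add: units_functor_def sM_functor_def)
  have H: "O_units X y = frac_units (stalk X y)" for y
    by (simp add: O_units_def frac_units_def)
  have O: "obj QF y = regular_fractions (stalk X y) Mod frac_units (stalk X y)" for y
    by (simp add: quotient_functor_def U H)
  have P: "QF_proj y = (\<lambda>a. frac_units (stalk X y) #>\<^bsub>regular_fractions (stalk X y)\<^esub>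
       fraction (stalk X y) (s_regulars (stalk X y)) a \<one>\<^bsub>stalk X y\<^esub>)" for y
    by (simp add: QF_proj_def U H fun_eq_iff)
  have A: "arr QF y x = (\<lambda>C. frac_units (stalk X x) <#>\<^bsub>regular_fractions (stalk X x)\<^esub>
      (localization_map (stalk X x) (s_regulars (stalk X x)) (stalk_map X x) ` C))" for y x
    by (simp add: quotient_functor_def U H) (simp add: units_functor_def sM_functor_def)
  show ?thesis unfolding quotient_model_def
  proof (intro ballI conjI)
    fix y assume y: "y \<in> topspace T"
    show "comm_monoid (stalk X y)" by (rule cm_stalk[OF y])
    show "regular_quotient (stalk X y) (obj QF y) (QF_proj y)"
      unfolding O P by (rule regular_quotient_canonical[OF cm_stalk[OF y]])
    fix x assume x: "x \<in> min_nbhd T y"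
    have xT: "x \<in> topspace T" using y x by (rule mem_top)
    note m = regular_quotient_map[OF cm_stalk[OF y] cm_stalk[OF xT] stalk_map_unital_hom[OF y x]]
    show "arr QF y x \<in> hom (obj QF y) (obj QF x)" unfolding O A by (rule m)
    fix a assume a: "a \<in> s_regulars (stalk X y)"
    show "stalk_map X x a \<in> s_regulars (stalk X x)" using a stalk_map_unital_hom(2)[OF y x] by auto
    show "arr QF y x (QF_proj y a) = QF_proj x (stalk_map X x a)"
      unfolding A P by (rule m(2)[OF a])
  qed
qed

text \<open>Germs depend on the ambient space, sections over a minimal neighbourhood do not. Models
  over the latter can be compared across spaces.\<close>

lemma quotient_model_min:
  "quotient_model T (topspace T) (min_sec X) (min_res X) QF (\<lambda>y. QF_proj y \<circ> gm y)"
  by (rule quotient_model_iso[OF quotient_model_stalk mem_top cm gm_iso])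
     (auto simp: stalk_map_gm intro!: unital_homD(1)[OF res_hom])

lemma group_functor_QF: "group_functor T QF"
  by (rule group_functor_quotient_model[OF quotient_model_min])
     (auto simp: s_regulars_def s_regular_def res_id res_res)

lemma s_flasque_iff:
  "s_flasque (sM_units_mod_O_units X) \<longleftrightarrow> (\<forall>x\<in>topspace T. locally_flasque_at T QF x)"
  unfolding sM_units_mod_O_units_def by (rule s_flasque_sheaf_of_functor_iff[OF group_functor_QF])

end

lemma quotient_model_subset:
  "quotient_model T D A r F q \<Longrightarrow> D' \<subseteq> D \<Longrightarrow> quotient_model T D' A r F q"
  by (auto simp: quotient_model_def)


section \<open>Finitely generated monoids\<close>

definition monoid_generators :: "('a, 'm) monoid_scheme \<Rightarrow> 'a set \<Rightarrow> bool" where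
  "monoid_generators M A \<longleftrightarrow> A \<subseteq> carrier M \<and> (\<forall>H. submonoid H M \<longrightarrow> A \<subseteq> H \<longrightarrow> carrier M \<subseteq> H)"

lemma monoid_finitely_generated_iff:
  assumes "comm_monoid M"
  shows "monoid_finitely_generated M \<longleftrightarrow> (\<exists>A. finite A \<and> monoid_generators M A)"
proof -
  interpret M: comm_monoid M by fact
  have sub: "submonoid (carrier M) M" by (simp add: submonoid_def)
  have "\<Inter>{H. submonoid H M \<and> A \<subseteq> H} = carrier M \<longleftrightarrow> (\<forall>H. submonoid H M \<longrightarrow> A \<subseteq> H \<longrightarrow> carrier M \<subseteq> H)"
    if "A \<subseteq> carrier M" for A
    using sub that by blast
  then show ?thesis unfolding monoid_finitely_generated_def monoid_generators_def by meson
qed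

lemma monoid_generators_induct:
  assumes "comm_monoid M" "monoid_generators M A"
    and "Q \<one>\<^bsub>M\<^esub>" "\<And>a. a \<in> A \<Longrightarrow> Q a"
    and "\<And>a b. a \<in> carrier M \<Longrightarrow> b \<in> carrier M \<Longrightarrow> Q a \<Longrightarrow> Q b \<Longrightarrow> Q (a \<otimes>\<^bsub>M\<^esub> b)"
    and "x \<in> carrier M"
  shows "Q x"
proof -
  interpret M: comm_monoid M by fact
  have "submonoid {a \<in> carrier M. Q a} M"
    using assms(3,5) by (auto simp: submonoid_def)
  moreover have "A \<subseteq> {a \<in> carrier M. Q a}" using assms(2,4) by (auto simp: monoid_generators_def)
  ultimately show ?thesis using assms(2,6) unfolding monoid_generators_def by blast
qed

text \<open>The images of the generators suffice together with the inverses of those that become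
  invertible: a face contains the factors of its elements, so every denominator is a product of
  generators that lie in the unit face.\<close>

lemma monoid_finitely_generated_localization:
  assumes M: "comm_monoid M" and N: "comm_monoid N" and h: "is_localization M N h"
    and fg: "monoid_finitely_generated M"
  shows "monoid_finitely_generated N"
proof -
  interpret M: comm_monoid M by fact
  interpret N: comm_monoid N by fact
  obtain A where A: "finite A" "monoid_generators M A"
    using fg monoid_finitely_generated_iff[OF M] by blast
  have Ac: "A \<subseteq> carrier M" using A by (simp add: monoid_generators_def)
  have hh: "unital_hom M N h" using h by (rule is_localizationD)
  note h' = unital_homD[OF hh]
  note S = faceD[OF face_unit_face[OF M N hh]]
  let ?S = "unit_face M N h"
  define B where "B = h ` A \<union> (\<lambda>a. inv\<^bsub>N\<^esub> h a) ` (A \<inter> ?S)"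
  have Bc: "B \<subseteq> carrier N" using Ac h' by (auto simp: B_def unit_face_def)
  have "carrier N \<subseteq> H" if H: "submonoid H N" "B \<subseteq> H" for H
  proof
    fix n assume n: "n \<in> carrier N"
    obtain a s where as: "a \<in> carrier M" "s \<in> carrier M" "h s \<in> Units N" "n \<otimes>\<^bsub>N\<^esub> h s = h a"
      using is_localizationD(2)[OF h n] by blast
    have 1: "h a \<in> H"
      by (rule monoid_generators_induct[OF M A(2), where Q = "\<lambda>x. h x \<in> H"])
         (use as H h' in \<open>auto simp: B_def submonoid.one_closed submonoid.m_closed\<close>)
    \<comment> \<open>The induction is on an implication, because generators outside the unit face
      need not become invertible.\<close>
    have "s \<in> ?S \<longrightarrow> inv\<^bsub>N\<^esub> h s \<in> H"
    proof (rule monoid_generators_induct[OF M A(2), where Q = "\<lambda>x. x \<in> ?S \<longrightarrow> inv\<^bsub>N\<^esub> h x \<in> H"])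
      show "\<one>\<^bsub>M\<^esub> \<in> ?S \<longrightarrow> inv\<^bsub>N\<^esub> h \<one>\<^bsub>M\<^esub> \<in> H" using H h' by (simp add: submonoid.one_closed)
      show "a \<in> ?S \<longrightarrow> inv\<^bsub>N\<^esub> h a \<in> H" if "a \<in> A" for a using that H by (auto simp: B_def)
      fix a b assume ab: "a \<in> carrier M" "b \<in> carrier M"
        "a \<in> ?S \<longrightarrow> inv\<^bsub>N\<^esub> h a \<in> H" "b \<in> ?S \<longrightarrow> inv\<^bsub>N\<^esub> h b \<in> H"
      show "a \<otimes>\<^bsub>M\<^esub> b \<in> ?S \<longrightarrow> inv\<^bsub>N\<^esub> h (a \<otimes>\<^bsub>M\<^esub> b) \<in> H"
      proof
        assume "a \<otimes>\<^bsub>M\<^esub> b \<in> ?S"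
        then have S': "a \<in> ?S" "b \<in> ?S" using S(3)[OF ab(1,2)] by auto
        then have u: "h a \<in> Units N" "h b \<in> Units N" by (auto simp: unit_face_def)
        have "inv\<^bsub>N\<^esub> (h a \<otimes>\<^bsub>N\<^esub> h b) = inv\<^bsub>N\<^esub> h a \<otimes>\<^bsub>N\<^esub> inv\<^bsub>N\<^esub> h b"
        proof (rule N.inv_unique'[symmetric])
          have "(h a \<otimes>\<^bsub>N\<^esub> h b) \<otimes>\<^bsub>N\<^esub> (inv\<^bsub>N\<^esub> h a \<otimes>\<^bsub>N\<^esub> inv\<^bsub>N\<^esub> h b)
              = (h a \<otimes>\<^bsub>N\<^esub> inv\<^bsub>N\<^esub> h a) \<otimes>\<^bsub>N\<^esub> (h b \<otimes>\<^bsub>N\<^esub> inv\<^bsub>N\<^esub> h b)"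
            using u N.Units_closed N.Units_inv_closed by (simp add: N.m_ac)
          then show *: "(h a \<otimes>\<^bsub>N\<^esub> h b) \<otimes>\<^bsub>N\<^esub> (inv\<^bsub>N\<^esub> h a \<otimes>\<^bsub>N\<^esub> inv\<^bsub>N\<^esub> h b) = \<one>\<^bsub>N\<^esub>"
            using u by simp
          then show "(inv\<^bsub>N\<^esub> h a \<otimes>\<^bsub>N\<^esub> inv\<^bsub>N\<^esub> h b) \<otimes>\<^bsub>N\<^esub> (h a \<otimes>\<^bsub>N\<^esub> h b) = \<one>\<^bsub>N\<^esub>"
            using u by (metis N.Units_closed N.Units_inv_closed N.m_closed N.m_comm)
        qed (use u N.Units_closed N.Units_inv_closed in auto)
        then show "inv\<^bsub>N\<^esub> h (a \<otimes>\<^bsub>M\<^esub> b) \<in> H"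
          using ab S' H h' by (simp add: submonoid.m_closed)
      qed
    qed (rule as(2))
    then have 2: "inv\<^bsub>N\<^esub> h s \<in> H" using as by (simp add: unit_face_def)
    have "h a \<otimes>\<^bsub>N\<^esub> inv\<^bsub>N\<^esub> h s = n \<otimes>\<^bsub>N\<^esub> (h s \<otimes>\<^bsub>N\<^esub> inv\<^bsub>N\<^esub> h s)"
      unfolding as(4)[symmetric] using as(3) n by (simp add: N.m_assoc N.Units_closed del: N.Units_r_inv)
    also have "\<dots> = n" using as(3) n by simp
    finally have "n = h a \<otimes>\<^bsub>N\<^esub> inv\<^bsub>N\<^esub> h s" by simp
    then show "n \<in> H" using 1 2 H(1) by (simp add: submonoid.m_closed)
  qed
  then have "monoid_generators N B" using Bc by (auto simp: monoid_generators_def)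
  moreover have "finite B" using A by (simp add: B_def)
  ultimately show ?thesis using monoid_finitely_generated_iff[OF N] by blast
qed

section \<open>Spectra\<close>

lemma monoid_primeD:
  assumes "monoid_prime M P"
  shows "P \<subseteq> carrier M" "\<one>\<^bsub>M\<^esub> \<in> carrier M \<Longrightarrow> \<one>\<^bsub>M\<^esub> \<notin> P"
  using assms by (auto simp: monoid_prime_def submonoid_def)

lemma monoid_face_prime:
  "comm_monoid M \<Longrightarrow> monoid_prime M P \<Longrightarrow> monoid_face M (carrier M - P)"
  by (simp add: monoid_face_def monoid_face_axioms_def monoid_prime_iff_face)

context
  fixes M :: "('a, 'm) monoid_scheme" (structure)
  assumes M: "comm_monoid M"
begin

interpretation M: comm_monoid M by (rule M)

lemma topspace_Spec: "topspace (Spec_topology M) = {P. monoid_prime M P}"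
proof -
  have "monoid_prime M P \<Longrightarrow> P \<in> basic_open M \<one>" for P
    using monoid_primeD(2) by (auto simp: basic_open_def)
  then show ?thesis
    by (auto simp: Spec_topology_def basic_open_def intro: M.one_closed)
qed

lemma openin_basic_open: "a \<in> carrier M \<Longrightarrow> openin (Spec_topology M) (basic_open M a)"
  by (auto simp: Spec_topology_def intro: topology_generated_by_Basis)

text \<open>The generating sets are closed under passing to smaller primes; intersections and unions
  inherit this.\<close>

lemma openin_Spec_down:
  assumes "openin (Spec_topology M) V" "P \<in> V" "monoid_prime M Q" "Q \<subseteq> P"
  shows "Q \<in> V"
proof -
  have "generate_topology_on (basic_open M ` carrier M) V"
    using assms(1) by (simp add: Spec_topology_def openin_topology_generated_by_iff)
  then show ?thesis using assms(2)
  proof (induction)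
    case (Basis s) then show ?case using assms(3,4) by (auto simp: basic_open_def)
  qed auto
qed

lemma min_nbhd_Spec:
  assumes P: "monoid_prime M P"
  shows "min_nbhd (Spec_topology M) P = {Q. monoid_prime M Q \<and> Q \<subseteq> P}"
proof
  show "{Q. monoid_prime M Q \<and> Q \<subseteq> P} \<subseteq> min_nbhd (Spec_topology M) P"
    using openin_Spec_down by (auto simp: min_nbhd_def)
  show "min_nbhd (Spec_topology M) P \<subseteq> {Q. monoid_prime M Q \<and> Q \<subseteq> P}"
  proof
    fix Q assume Q: "Q \<in> min_nbhd (Spec_topology M) P"
    then have prime: "monoid_prime M Q"
      using P min_nbhd_subset_topspace[of P "Spec_topology M"] topspace_Spec by auto
    have "a \<notin> Q" if "a \<in> carrier M" "a \<notin> P" for a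
      using min_nbhd_subset[OF openin_basic_open[OF that(1)], of P] P Q that(2) by (auto simp: basic_open_def)
    then show "Q \<in> {Q. monoid_prime M Q \<and> Q \<subseteq> P}" using prime monoid_primeD(1)[OF prime] by auto
  qed
qed

lemma monoid_prime_mult_iff:
  assumes "monoid_prime M P" "a \<in> carrier M" "b \<in> carrier M"
  shows "a \<otimes> b \<in> P \<longleftrightarrow> a \<in> P \<or> b \<in> P"
proof -
  have "face M (carrier M - P)" using assms(1) monoid_prime_iff_face[OF M] by blast
  then show ?thesis using faceD(3)[of M "carrier M - P" a b] assms(2,3) by auto
qed

text \<open>A prime ideal is determined by the generators it contains, because a product lies in it
  only if a factor does. The minimal neighbourhood of \<open>P\<close> is cut out by the finitely
  many generators outside \<open>P\<close>.\<close>

lemma finite_Spec: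
  assumes fg: "monoid_finitely_generated M"
  shows "finite (topspace (Spec_topology M))"
    and "monoid_prime M P \<Longrightarrow> openin (Spec_topology M) (min_nbhd (Spec_topology M) P)"
proof -
  obtain A where A: "finite A" "monoid_generators M A"
    using fg monoid_finitely_generated_iff[OF M] by blast
  have Ac: "A \<subseteq> carrier M" using A by (simp add: monoid_generators_def)
  have sub: "Q \<subseteq> P" if P: "monoid_prime M P" and Q: "monoid_prime M Q" and AQ: "A \<inter> Q \<subseteq> P" for P Q
  proof
    fix x assume x: "x \<in> Q"
    have "x \<in> Q \<longrightarrow> x \<in> P"
    proof (rule monoid_generators_induct[OF M A(2), where Q = "\<lambda>x. x \<in> Q \<longrightarrow> x \<in> P"])
      show "\<one> \<in> Q \<longrightarrow> \<one> \<in> P" using monoid_primeD(2)[OF Q] by simp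
      show "x \<in> carrier M" using x monoid_primeD(1)[OF Q] by auto
    qed (use AQ in \<open>auto simp: monoid_prime_mult_iff[OF P] monoid_prime_mult_iff[OF Q]\<close>)
    then show "x \<in> P" using x by simp
  qed
  have "inj_on (\<lambda>P. A \<inter> P) {P. monoid_prime M P}"
  proof (rule inj_onI)
    fix P Q assume PQ: "P \<in> {P. monoid_prime M P}" "Q \<in> {P. monoid_prime M P}" "A \<inter> P = A \<inter> Q"
    have "Q \<subseteq> P" using sub[of P Q] PQ by auto
    moreover have "P \<subseteq> Q" using sub[of Q P] PQ by auto
    ultimately show "P = Q" by auto
  qed
  moreover have "finite ((\<lambda>P. A \<inter> P) ` {P. monoid_prime M P})"
    by (rule finite_subset[of _ "Pow A"]) (use A in auto)
  ultimately show "finite (topspace (Spec_topology M))"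
    using topspace_Spec finite_imageD by metis
  assume P: "monoid_prime M P"
  have "min_nbhd (Spec_topology M) P = topspace (Spec_topology M) \<inter> \<Inter>(basic_open M ` (A - P))"
    unfolding min_nbhd_Spec[OF P] topspace_Spec
    using sub[OF P] Ac by (auto simp: basic_open_def)
  moreover have "openin (Spec_topology M) (topspace (Spec_topology M) \<inter> \<Inter>(basic_open M ` (A - P)))"
  \<comment> \<open>If all generators lie in \<open>P\<close>, the intersection is over the empty
    family and the whole space remains.\<close>
  proof (cases "A - P = {}")
    case True
    then show ?thesis by (simp only: image_empty Inf_empty openin_topspace inf_top_right)
  next
    case False
    then show ?thesis
      using A Ac by (intro openin_Int openin_topspace openin_Inter) (auto intro: openin_basic_open)
  qed
  ultimately show "openin (Spec_topology M) (min_nbhd (Spec_topology M) P)" by simp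
qed

section \<open>Sections of the structure sheaf of a spectrum\<close>

lemma sec_Spec: "sec (Spec M) = Spec_sections M" and base_Spec: "base (Spec M) = Spec_topology M"
  and res_Spec: "res (Spec M) U V \<sigma> = restrict \<sigma> V"
  by (simp_all add: Spec_def)

lemma mult_Spec_sections:
  "\<sigma> \<otimes>\<^bsub>Spec_sections M U\<^esub> \<tau> = (\<lambda>P\<in>U. \<sigma> P \<otimes>\<^bsub>localization M (carrier M - P)\<^esub> \<tau> P)"
  by (simp add: Spec_sections_def)

lemma one_Spec_sections:
  "\<one>\<^bsub>Spec_sections M U\<^esub> = (\<lambda>P\<in>U. fraction M (carrier M - P) \<one> \<one>)"
  by (simp add: Spec_sections_def localization_def)

text \<open>A fraction whose denominator avoids the prime already lies in the localization there, so
  the local representation accounts for the membership of the values.\<close>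

lemma carrier_Spec_sections:
  assumes "U \<subseteq> {P. monoid_prime M P}"
  shows "\<sigma> \<in> carrier (Spec_sections M U) \<longleftrightarrow> \<sigma> \<in> extensional U \<and>
        (\<forall>P\<in>U. \<exists>V a f. openin (Spec_topology M) V \<and> P \<in> V \<and> V \<subseteq> U \<and>
          a \<in> carrier M \<and> f \<in> carrier M \<and>
          (\<forall>Q\<in>V. f \<notin> Q \<and> \<sigma> Q = fraction M (carrier M - Q) a f))"
proof -
  have "\<sigma> P \<in> carrier (localization M (carrier M - P))"
    if h: "P \<in> U" "a \<in> carrier M" "f \<in> carrier M" "f \<notin> P" "\<sigma> P = fraction M (carrier M - P) a f" for a f P
    unfolding h(5)
    by (rule monoid_face.frac_closed[OF monoid_face_prime[OF M]]) (use h assms in auto)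
  then have "\<forall>P\<in>U. \<sigma> P \<in> carrier (localization M (carrier M - P))"
    if "\<forall>P\<in>U. \<exists>V a f. openin (Spec_topology M) V \<and> P \<in> V \<and> V \<subseteq> U \<and>
          a \<in> carrier M \<and> f \<in> carrier M \<and>
          (\<forall>Q\<in>V. f \<notin> Q \<and> \<sigma> Q = fraction M (carrier M - Q) a f)"
    using that by meson
  then show ?thesis by (auto simp: Spec_sections_def PiE_iff)
qed

definition Spec_frac where "Spec_frac U a f = (\<lambda>P\<in>U. fraction M (carrier M - P) a f)"

lemma Spec_frac_closed:
  assumes "openin (Spec_topology M) U" "a \<in> carrier M" "f \<in> carrier M" "\<And>P. P \<in> U \<Longrightarrow> f \<notin> P"
  shows "Spec_frac U a f \<in> carrier (Spec_sections M U)"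
proof -
  have U: "U \<subseteq> {P. monoid_prime M P}" using openin_subset[OF assms(1)] topspace_Spec by auto
  show ?thesis
    unfolding carrier_Spec_sections[OF U]
  proof (intro conjI ballI)
    fix P assume P: "P \<in> U"
    show "\<exists>V b g. openin (Spec_topology M) V \<and> P \<in> V \<and> V \<subseteq> U \<and> b \<in> carrier M \<and> g \<in> carrier M \<and>
        (\<forall>Q\<in>V. g \<notin> Q \<and> Spec_frac U a f Q = fraction M (carrier M - Q) b g)"
      by (rule exI[of _ U], rule exI[of _ a], rule exI[of _ f]) (use P assms in \<open>auto simp: Spec_frac_def\<close>)
  qed (simp add: Spec_frac_def)
qed

lemma Spec_frac_mult:
  assumes "U \<subseteq> {P. monoid_prime M P}" "a \<in> carrier M" "f \<in> carrier M" "\<And>P. P \<in> U \<Longrightarrow> f \<notin> P"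
    "b \<in> carrier M" "g \<in> carrier M" "\<And>P. P \<in> U \<Longrightarrow> g \<notin> P"
  shows "Spec_frac U a f \<otimes>\<^bsub>Spec_sections M U\<^esub> Spec_frac U b g = Spec_frac U (a \<otimes> b) (f \<otimes> g)"
  unfolding mult_Spec_sections Spec_frac_def
proof (rule restrict_ext)
  fix P assume P: "P \<in> U"
  have prime: "monoid_prime M P" using P assms(1) by auto
  interpret P: monoid_face M "carrier M - P" by (rule monoid_face_prime[OF M prime])
  show "(\<lambda>P\<in>U. fraction M (carrier M - P) a f) P \<otimes>\<^bsub>P.L\<^esub> (\<lambda>P\<in>U. fraction M (carrier M - P) b g) P = P.frac (a \<otimes> b) (f \<otimes> g)"
    using P assms by simp
qed

lemma comm_monoid_Spec_sections:
  assumes "openin (Spec_topology M) U"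
  shows "comm_monoid (Spec_sections M U)"
proof -
  have U: "U \<subseteq> {P. monoid_prime M P}" using openin_subset[OF assms(1)] topspace_Spec by auto
  note carr = carrier_Spec_sections[OF U]
  have L: "comm_monoid (localization M (carrier M - P))" if "P \<in> U" for P
    using that U monoid_face.comm_monoid_L[OF monoid_face_prime[OF M]] by auto
  have cl: "\<sigma> P \<in> carrier (localization M (carrier M - P))" if "\<sigma> \<in> carrier (Spec_sections M U)" "P \<in> U" for \<sigma> P
    using that by (auto simp: Spec_sections_def)
  have ex: "\<sigma> \<in> extensional U" if "\<sigma> \<in> carrier (Spec_sections M U)" for \<sigma>
    using that carr by auto
  show ?thesis
  proof (rule comm_monoidI)
    fix x y assume x: "x \<in> carrier (Spec_sections M U)" and y: "y \<in> carrier (Spec_sections M U)"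
    show "x \<otimes>\<^bsub>Spec_sections M U\<^esub> y = y \<otimes>\<^bsub>Spec_sections M U\<^esub> x"
      unfolding mult_Spec_sections
      by (rule restrict_ext) (use comm_monoid.m_comm[OF L] cl[OF x] cl[OF y] in auto)
    show "x \<otimes>\<^bsub>Spec_sections M U\<^esub> y \<in> carrier (Spec_sections M U)"
      unfolding carr
    proof (intro conjI ballI)
      show "x \<otimes>\<^bsub>Spec_sections M U\<^esub> y \<in> extensional U" by (simp add: mult_Spec_sections)
      fix P assume P: "P \<in> U"
      obtain V a f where V: "openin (Spec_topology M) V" "P \<in> V" "V \<subseteq> U" "a \<in> carrier M" "f \<in> carrier M"
        "\<And>Q. Q \<in> V \<Longrightarrow> f \<notin> Q \<and> x Q = fraction M (carrier M - Q) a f"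
        using x P carr by meson
      obtain W b g where W: "openin (Spec_topology M) W" "P \<in> W" "W \<subseteq> U" "b \<in> carrier M" "g \<in> carrier M"
        "\<And>Q. Q \<in> W \<Longrightarrow> g \<notin> Q \<and> y Q = fraction M (carrier M - Q) b g"
        using y P carr by meson
      show "\<exists>V a f. openin (Spec_topology M) V \<and> P \<in> V \<and> V \<subseteq> U \<and> a \<in> carrier M \<and> f \<in> carrier M \<and>
           (\<forall>Q\<in>V. f \<notin> Q \<and> (x \<otimes>\<^bsub>Spec_sections M U\<^esub> y) Q = fraction M (carrier M - Q) a f)"
      proof (intro exI conjI ballI)
        show "openin (Spec_topology M) (V \<inter> W)" "P \<in> V \<inter> W" "V \<inter> W \<subseteq> U" "a \<otimes> b \<in> carrier M" "f \<otimes> g \<in> carrier M"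
          using V W by auto
        fix Q assume Q: "Q \<in> V \<inter> W"
        then have prime: "monoid_prime M Q" using V(3) U by auto
        interpret Q: monoid_face M "carrier M - Q" by (rule monoid_face_prime[OF M prime])
        have fg: "f \<in> carrier M - Q" "g \<in> carrier M - Q" using V(5,6) W(5,6) Q by auto
        show "f \<otimes> g \<notin> Q" using fg monoid_prime_mult_iff[OF prime] by auto
        show "(x \<otimes>\<^bsub>Spec_sections M U\<^esub> y) Q = Q.frac (a \<otimes> b) (f \<otimes> g)"
          using V W Q fg by (auto simp: mult_Spec_sections)
      qed
    qed
    fix z assume z: "z \<in> carrier (Spec_sections M U)"
    show "x \<otimes>\<^bsub>Spec_sections M U\<^esub> y \<otimes>\<^bsub>Spec_sections M U\<^esub> z
       = x \<otimes>\<^bsub>Spec_sections M U\<^esub> (y \<otimes>\<^bsub>Spec_sections M U\<^esub> z)"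
      unfolding mult_Spec_sections
      by (rule restrict_ext)
         (use monoid.m_assoc[OF comm_monoid.axioms(1)[OF L]] cl[OF x] cl[OF y] cl[OF z] in auto)
  next
    have "\<one>\<^bsub>Spec_sections M U\<^esub> = Spec_frac U \<one> \<one>" by (simp add: one_Spec_sections Spec_frac_def)
    then show "\<one>\<^bsub>Spec_sections M U\<^esub> \<in> carrier (Spec_sections M U)"
      using Spec_frac_closed[OF assms M.one_closed M.one_closed] U monoid_primeD(2) by auto
  next
    fix x assume x: "x \<in> carrier (Spec_sections M U)"
    have "(\<lambda>P\<in>U. \<one>\<^bsub>Spec_sections M U\<^esub> P \<otimes>\<^bsub>localization M (carrier M - P)\<^esub> x P) = restrict x U"
      by (rule restrict_ext)
         (use monoid.l_one[OF comm_monoid.axioms(1)[OF L]] cl[OF x] in \<open>auto simp: Spec_sections_def\<close>)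
    then show "\<one>\<^bsub>Spec_sections M U\<^esub> \<otimes>\<^bsub>Spec_sections M U\<^esub> x = x"
      using ex[OF x] by (simp add: mult_Spec_sections extensional_restrict)
  qed
qed

text \<open>A neighbourhood of \<open>P\<close> inside the minimal one is all of it. So a section
  over it is a single fraction with denominator outside \<open>P\<close>, and the sections form the
  localization of \<open>M\<close> at the complement of \<open>P\<close>.\<close>

lemma Spec_min_nbhd_localization:
  assumes P: "monoid_prime M P" and op: "openin (Spec_topology M) (min_nbhd (Spec_topology M) P)"
  defines "D \<equiv> min_nbhd (Spec_topology M) P"
  shows "is_localization M (Spec_sections M D) (\<lambda>a. Spec_frac D a \<one>)"
    and "unit_face M (Spec_sections M D) (\<lambda>a. Spec_frac D a \<one>) = carrier M - P"
proof -
  have D: "D = {Q. monoid_prime M Q \<and> Q \<subseteq> P}" unfolding D_def by (rule min_nbhd_Spec[OF P])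
  have DU: "D \<subseteq> {P. monoid_prime M P}" and PD: "P \<in> D" using P by (auto simp: D)
  interpret S: comm_monoid "Spec_sections M D"
    unfolding D_def by (rule comm_monoid_Spec_sections[OF op])
  interpret P: monoid_face M "carrier M - P" by (rule monoid_face_prime[OF M P])
  let ?h = "\<lambda>a. Spec_frac D a \<one>"
  have one: "\<one> \<notin> Q" if "Q \<in> D" for Q using that monoid_primeD(2) by (auto simp: D)
  have nin: "f \<notin> Q" if "f \<notin> P" "Q \<in> D" for f Q using that by (auto simp: D)
  have closed: "Spec_frac D a f \<in> carrier (Spec_sections M D)" if "a \<in> carrier M" "f \<in> carrier M" "f \<notin> P" for a f
    using Spec_frac_closed[of D a f] op that nin by (auto simp: D_def)
  have oneP: "\<one> \<notin> P" using one[OF PD] .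
  have mult: "Spec_frac D a f \<otimes>\<^bsub>Spec_sections M D\<^esub> Spec_frac D b g = Spec_frac D (a \<otimes> b) (f \<otimes> g)"
    if "a \<in> carrier M" "f \<in> carrier M" "f \<notin> P" "b \<in> carrier M" "g \<in> carrier M" "g \<notin> P" for a f b g
    using Spec_frac_mult[OF DU that(1,2) _ that(4,5)] nin that by auto
  have hh: "unital_hom M (Spec_sections M D) ?h"
    using closed mult oneP by (auto simp: unital_hom_def hom_def one_Spec_sections Spec_frac_def)
  \<comment> \<open>Equality is decided at the largest point \<open>P\<close>: a witness outside
    \<open>P\<close> is outside every smaller prime too.\<close>
  have eq: "Spec_frac D a f = Spec_frac D b g \<longleftrightarrow> P.frac a f = P.frac b g"
    if h: "a \<in> carrier M" "f \<in> carrier M" "f \<notin> P" "b \<in> carrier M" "g \<in> carrier M" "g \<notin> P" for a f b g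
  proof
    assume "Spec_frac D a f = Spec_frac D b g"
    then have "Spec_frac D a f P = Spec_frac D b g P" by simp
    then show "P.frac a f = P.frac b g" using PD by (simp add: Spec_frac_def)
  next
    assume "P.frac a f = P.frac b g"
    then obtain u where u: "u \<in> carrier M - P" "u \<otimes> (a \<otimes> g) = u \<otimes> (b \<otimes> f)"
      using h P.frac_eq_iff[of a b f g] by auto
    show "Spec_frac D a f = Spec_frac D b g" unfolding Spec_frac_def
    proof (rule restrict_ext)
      fix Q assume Q: "Q \<in> D"
      have prime: "monoid_prime M Q" using Q D by auto
      interpret Q: monoid_face M "carrier M - Q" by (rule monoid_face_prime[OF M prime])
      show "Q.frac a f = Q.frac b g"
        using Q.frac_eq_iff[of a b f g] u h nin[OF _ Q] by blast
    qed
  qed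
  \<comment> \<open>Invertibility is tested at \<open>P\<close>. Conversely, for \<open>a\<close>
    outside \<open>P\<close> the fraction \<open>1 / a\<close> is defined on all of \<open>D\<close>
    and inverts \<open>a / 1\<close>.\<close>
  show uf: "unit_face M (Spec_sections M D) ?h = carrier M - P"
  proof
    show "unit_face M (Spec_sections M D) ?h \<subseteq> carrier M - P"
    proof
      fix a assume "a \<in> unit_face M (Spec_sections M D) ?h"
      then obtain \<tau> where a: "a \<in> carrier M" "\<tau> \<in> carrier (Spec_sections M D)"
        "\<tau> \<otimes>\<^bsub>Spec_sections M D\<^esub> ?h a = \<one>\<^bsub>Spec_sections M D\<^esub>"
        by (auto simp: unit_face_def Units_def)
      have "\<tau> P \<otimes>\<^bsub>P.L\<^esub> P.frac a \<one> = (\<tau> \<otimes>\<^bsub>Spec_sections M D\<^esub> ?h a) P"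
        using PD by (simp add: mult_Spec_sections Spec_frac_def)
      also have "\<dots> = \<one>\<^bsub>P.L\<^esub>" using PD a(3) by (simp add: Spec_sections_def)
      finally have e: "\<tau> P \<otimes>\<^bsub>P.L\<^esub> P.frac a \<one> = \<one>\<^bsub>P.L\<^esub>" .
      have t: "\<tau> P \<in> carrier P.L" using a(2) PD by (auto simp: Spec_sections_def)
      interpret L: comm_monoid P.L by (rule P.comm_monoid_L)
      have fa: "P.frac a \<one> \<in> carrier P.L" by (rule P.frac_closed[OF a(1) P.S_one])
      then have "P.frac a \<one> \<otimes>\<^bsub>P.L\<^esub> \<tau> P = \<one>\<^bsub>P.L\<^esub>" using e t L.m_comm by metis
      then have "P.frac a \<one> \<in> Units P.L" using e t fa unfolding Units_def by blast
      then show "a \<in> carrier M - P" using P.frac_Units_iff a(1) P.S_one by blast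
    qed
    show "carrier M - P \<subseteq> unit_face M (Spec_sections M D) ?h"
    proof
      fix a assume a: "a \<in> carrier M - P"
      have "P.frac a a = P.frac \<one> \<one>" using a P.frac_eqI[OF _ _ a P.S_one, of a \<one>] by simp
      then have 1: "Spec_frac D a a = \<one>\<^bsub>Spec_sections M D\<^esub>"
        using eq[of a a \<one> \<one>] a oneP by (simp add: one_Spec_sections Spec_frac_def)
      have "?h a \<otimes>\<^bsub>Spec_sections M D\<^esub> Spec_frac D \<one> a = \<one>\<^bsub>Spec_sections M D\<^esub>"
        "Spec_frac D \<one> a \<otimes>\<^bsub>Spec_sections M D\<^esub> ?h a = \<one>\<^bsub>Spec_sections M D\<^esub>"
        using mult[of a \<one> \<one> a] mult[of \<one> a a \<one>] a oneP 1 by auto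
      moreover have "?h a \<in> carrier (Spec_sections M D)" "Spec_frac D \<one> a \<in> carrier (Spec_sections M D)"
        using closed a oneP by auto
      ultimately have "?h a \<in> Units (Spec_sections M D)" unfolding Units_def by blast
      then show "a \<in> unit_face M (Spec_sections M D) ?h" using a by (simp add: unit_face_def)
    qed
  qed
  show "is_localization M (Spec_sections M D) ?h"
    unfolding is_localization_def uf
  proof (intro conjI ballI impI hh)
    fix \<sigma> assume "\<sigma> \<in> carrier (Spec_sections M D)"
    then obtain V a f where V: "openin (Spec_topology M) V" "P \<in> V" "V \<subseteq> D" "a \<in> carrier M" "f \<in> carrier M"
        "\<And>Q. Q \<in> V \<Longrightarrow> f \<notin> Q \<and> \<sigma> Q = fraction M (carrier M - Q) a f" and e: "\<sigma> \<in> extensional D"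
      using PD carrier_Spec_sections[OF DU] by meson
    have "V = D" using V(3) min_nbhd_subset[OF V(1,2)] by (auto simp: D_def)
    then have s: "\<sigma> = Spec_frac D a f" using V(6) e by (auto simp: Spec_frac_def extensional_def fun_eq_iff)
    have fP: "f \<notin> P" using V by auto
    have "\<sigma> \<otimes>\<^bsub>Spec_sections M D\<^esub> ?h f = Spec_frac D (a \<otimes> f) f"
      using mult[of a f f \<one>] V fP oneP s by simp
    also have "\<dots> = ?h a"
      using eq[of "a \<otimes> f" f a \<one>] V fP oneP by (auto simp: P.frac_eq_iff)
    finally have "\<sigma> \<otimes>\<^bsub>Spec_sections M D\<^esub> ?h f = ?h a" .
    then show "\<exists>a\<in>carrier M. \<exists>s\<in>carrier M - P. \<sigma> \<otimes>\<^bsub>Spec_sections M D\<^esub> ?h s = ?h a"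
      using V(4,5) fP by blast
  next
    fix a b assume "a \<in> carrier M" "b \<in> carrier M" "?h a = ?h b"
    then show "\<exists>u\<in>carrier M - P. u \<otimes> a = u \<otimes> b"
      using eq[of a \<one> b \<one>] oneP by (auto simp: P.frac_eq_iff)
  qed
qed

end


section \<open>Affine charts\<close>

lemma homeomorphic_map_min_nbhd:
  assumes f: "homeomorphic_map S T f" and x: "x \<in> topspace S" and y: "y \<in> topspace S"
  shows "f x \<in> min_nbhd T (f y) \<longleftrightarrow> x \<in> min_nbhd S y"
proof
  assume l: "f x \<in> min_nbhd T (f y)"
  show "x \<in> min_nbhd S y" unfolding min_nbhd_def
  proof clarify
    fix W assume W: "openin S W" "y \<in> W"
    then have "openin T (f ` W)" using homeomorphic_map_openness_eq[OF f] by auto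
    then have "f x \<in> f ` W" using l W min_nbhd_subset[of T "f ` W" "f y"] by auto
    then obtain w where "w \<in> W" "f x = f w" by auto
    moreover have "w \<in> topspace S" using W \<open>w \<in> W\<close> openin_subset by auto
    ultimately show "x \<in> W"
      using homeomorphic_imp_injective_map[OF f] x by (auto simp: inj_on_def)
  qed
next
  assume r: "x \<in> min_nbhd S y"
  show "f x \<in> min_nbhd T (f y)" unfolding min_nbhd_def
  proof clarify
    fix V assume V: "openin T V" "f y \<in> V"
    have "openin S {x \<in> topspace S. f x \<in> V}"
      using homeomorphic_imp_continuous_map[OF f] V(1) by (rule openin_continuous_map_preimage)
    then show "f x \<in> V" using r y V(2) min_nbhd_subset[of S "{x \<in> topspace S. f x \<in> V}" y] by auto
  qed
qed

lemma homeomorphic_map_image_min_nbhd: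
  assumes f: "homeomorphic_map S T f" and y: "y \<in> topspace S"
  shows "f ` min_nbhd S y = min_nbhd T (f y)"
proof -
  have i: "f ` topspace S = topspace T" using f by (rule homeomorphic_imp_surjective_map)
  have "f y \<in> topspace T" using i y by auto
  then have "min_nbhd T (f y) \<subseteq> f ` topspace S" using min_nbhd_subset_topspace i by metis
  then show ?thesis
    using homeomorphic_map_min_nbhd[OF f _ y] min_nbhd_subset_topspace[OF y] by auto
qed

lemma open_subspace_simps [simp]:
  "base (open_subspace X U) = subtopology (base X) U"
  "sec (open_subspace X U) = sec X" "res (open_subspace X U) = res X"
  by (simp_all add: open_subspace_def)

text \<open>What an isomorphism between an open set and the spectrum of \<open>M\<close> yields
  point by point: \<open>f\<close> sends a point to its prime, and \<open>g y\<close> sends an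
  element of \<open>M\<close> to its section around \<open>y\<close>. The monoid \<open>M\<close>
  has a type of its own, as the charts of smooth schemes require.\<close>

definition affine_chart ::
    "('p, 'a) monoid_space \<Rightarrow> 'p set \<Rightarrow> ('b, 'm) monoid_scheme \<Rightarrow> ('p \<Rightarrow> 'b set) \<Rightarrow> ('p \<Rightarrow> 'b \<Rightarrow> 'a) \<Rightarrow> bool" where
  "affine_chart X U M f g \<longleftrightarrow>
     bij_betw f U {P. monoid_prime M P} \<and>
     (\<forall>x\<in>U. \<forall>y\<in>U. x \<in> min_nbhd (base X) y \<longleftrightarrow> f x \<subseteq> f y) \<and>
     (\<forall>y\<in>U. is_localization M (min_sec X y) (g y) \<and> unit_face M (min_sec X y) (g y) = carrier M - f y) \<and>
     (\<forall>y\<in>U. \<forall>x\<in>min_nbhd (base X) y. \<forall>a\<in>carrier M. min_res X y x (g y a) = g x a)"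

lemma affine_chartD:
  assumes "affine_chart X U M f g"
  shows "bij_betw f U {P. monoid_prime M P}"
    and "x \<in> U \<Longrightarrow> y \<in> U \<Longrightarrow> x \<in> min_nbhd (base X) y \<longleftrightarrow> f x \<subseteq> f y"
    and "y \<in> U \<Longrightarrow> is_localization M (min_sec X y) (g y)"
    and "y \<in> U \<Longrightarrow> unit_face M (min_sec X y) (g y) = carrier M - f y"
    and "y \<in> U \<Longrightarrow> x \<in> min_nbhd (base X) y \<Longrightarrow> a \<in> carrier M \<Longrightarrow> min_res X y x (g y a) = g x a"
  using assms by (simp_all add: affine_chart_def)

text \<open>The map \<open>g y\<close> sends \<open>a\<close> to the section \<open>a / 1\<close>
  over the minimal neighbourhood of the prime \<open>f y\<close>, followed by the isomorphism of
  sheaves; \<open>Spec_min_nbhd_localization\<close> makes it a localization.\<close>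

lemma affine_chart_exists:
  assumes X: "presheaf_of_monoids X" and U: "openin (base X) U" and M: "comm_monoid M"
    and iso: "isomorphic_spaces (open_subspace X U) (Spec M)"
    and nb: "\<And>y. y \<in> U \<Longrightarrow> openin (base X) (min_nbhd (base X) y)"
  shows "\<exists>f g. affine_chart X U M f g"
proof -
  interpret M: comm_monoid M by fact
  let ?S = "Spec_topology M"
  have tU: "topspace (subtopology (base X) U) = U" using openin_subset[OF U] by auto
  obtain f \<phi> where F: "homeomorphic_map (subtopology (base X) U) ?S f \<and>
      (\<forall>V. openin ?S V \<longrightarrow> \<phi> V \<in> iso (Spec_sections M V) (sec X {x \<in> U. f x \<in> V})) \<and>
      (\<forall>V W. openin ?S V \<longrightarrow> openin ?S W \<longrightarrow> W \<subseteq> V \<longrightarrow> (\<forall>s\<in>carrier (Spec_sections M V).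
         res X {x \<in> U. f x \<in> V} {x \<in> U. f x \<in> W} (\<phi> V s) = \<phi> W (restrict s W)))"
    using iso unfolding isomorphic_spaces_def open_subspace_simps tU sec_Spec[OF M] base_Spec[OF M] res_Spec[OF M]
    by (elim exE) (rule that)
  have f: "homeomorphic_map (subtopology (base X) U) ?S f" using F by (rule conjunct1)
  have iso: "\<phi> V \<in> iso (Spec_sections M V) (sec X {x \<in> U. f x \<in> V})" if "openin ?S V" for V
    using F[THEN conjunct2, THEN conjunct1] that by simp
  have nat: "res X {x \<in> U. f x \<in> V} {x \<in> U. f x \<in> W} (\<phi> V s) = \<phi> W (restrict s W)"
    if "openin ?S V" "openin ?S W" "W \<subseteq> V" "s \<in> carrier (Spec_sections M V)" for V W s
    using F[THEN conjunct2, THEN conjunct2] that by simp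
  have bij: "bij_betw f U {P. monoid_prime M P}"
    using homeomorphic_imp_surjective_map[OF f] homeomorphic_imp_injective_map[OF f]
    unfolding tU topspace_Spec[OF M] bij_betw_def by auto
  have prime: "monoid_prime M (f y)" if "y \<in> U" for y using bij that by (auto simp: bij_betw_def)
  have NU: "min_nbhd (base X) y \<subseteq> U" if "y \<in> U" for y using min_nbhd_subset[OF U that] .
  define D where "D y = min_nbhd ?S (f y)" for y
  have D: "D y = {Q. monoid_prime M Q \<and> Q \<subseteq> f y}" if "y \<in> U" for y
    unfolding D_def by (rule min_nbhd_Spec[OF M prime[OF that]])
  have ord: "x \<in> min_nbhd (base X) y \<longleftrightarrow> f x \<in> D y" if "x \<in> U" "y \<in> U" for x y
    using homeomorphic_map_min_nbhd[OF f, of x y] that min_nbhd_subtopology[OF U that(2)]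
    unfolding tU D_def by simp
  have ord': "x \<in> min_nbhd (base X) y \<longleftrightarrow> f x \<subseteq> f y" if "x \<in> U" "y \<in> U" for x y
    using ord[OF that] D[OF that(2)] prime[OF that(1)] by auto
  have pre: "{x \<in> U. f x \<in> D y} = min_nbhd (base X) y" if "y \<in> U" for y
    using ord[OF _ that] NU[OF that] by auto
  have oD: "openin ?S (D y)" if y: "y \<in> U" for y
  proof -
    have "f ` min_nbhd (base X) y = D y"
      using homeomorphic_map_image_min_nbhd[OF f, unfolded tU, OF y] min_nbhd_subtopology[OF U y]
      unfolding D_def by simp
    moreover have "openin (subtopology (base X) U) (min_nbhd (base X) y)"
      using nb[OF y] NU[OF y] U by (simp add: openin_open_subtopology)
    ultimately show ?thesis using homeomorphic_map_openness_eq[OF f] by metis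
  qed
  define g where "g y a = \<phi> (D y) (Spec_frac M (D y) a \<one>\<^bsub>M\<^esub>)" for y a
  have loc: "is_localization M (min_sec X y) (g y) \<and> unit_face M (min_sec X y) (g y) = carrier M - f y"
    if y: "y \<in> U" for y
  proof -
    have cS: "comm_monoid (Spec_sections M (D y))" by (rule comm_monoid_Spec_sections[OF M oD[OF y]])
    have cN: "comm_monoid (min_sec X y)" by (rule presheafD(1)[OF X nb[OF y]])
    have "unital_iso (Spec_sections M (D y)) (min_sec X y) (\<phi> (D y))"
      using unital_isoI_iso[OF cS cN] iso[OF oD[OF y]] pre[OF y] by simp
    note * = is_localization_comp_iso[OF M cS cN _ this]
    note ** = Spec_min_nbhd_localization[OF M prime[OF y], folded D_def, OF oD[OF y]]
    have "g y = \<phi> (D y) \<circ> (\<lambda>a. Spec_frac M (D y) a \<one>\<^bsub>M\<^esub>)" by (auto simp: g_def)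
    then show ?thesis using *[OF **(1)] **(2) by simp
  qed
  have "min_res X y x (g y a) = g x a" if y: "y \<in> U" and x: "x \<in> min_nbhd (base X) y" and a: "a \<in> carrier M" for y x a
  proof -
    have xU: "x \<in> U" using NU[OF y] x by auto
    have DD: "D x \<subseteq> D y" using ord'[OF xU y] x D[OF xU] D[OF y] by auto
    have cl: "Spec_frac M (D y) a \<one>\<^bsub>M\<^esub> \<in> carrier (Spec_sections M (D y))"
      using Spec_frac_closed[OF M oD[OF y] a M.one_closed] D[OF y] monoid_primeD(2) by blast
    have "min_res X y x (g y a) = \<phi> (D x) (restrict (Spec_frac M (D y) a \<one>\<^bsub>M\<^esub>) (D x))"
      using nat[OF oD[OF y] oD[OF xU] DD cl] by (simp add: pre[OF y] pre[OF xU] g_def)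
    also have "restrict (Spec_frac M (D y) a \<one>\<^bsub>M\<^esub>) (D x) = Spec_frac M (D x) a \<one>\<^bsub>M\<^esub>"
      using DD by (auto simp: Spec_frac_def[OF M] fun_eq_iff)
    finally show ?thesis by (simp add: g_def)
  qed
  then have "affine_chart X U M f g"
    unfolding affine_chart_def using bij ord' loc by blast
  then show ?thesis by blast
qed

text \<open>A face of the sections at \<open>y\<close> pulls back along \<open>g y\<close> to a face
  of \<open>M\<close> containing the complement of \<open>f y\<close>. Its complement is a prime
  inside \<open>f y\<close>, and such primes are the points below \<open>y\<close>.\<close>

lemma fg_spectrum_at_chart:
  assumes X: "presheaf_of_monoids X" and U: "openin (base X) U" and M: "comm_monoid M"
    and chart: "affine_chart X U M f g" and y: "y \<in> U"
    and nb: "\<And>y. y \<in> U \<Longrightarrow> openin (base X) (min_nbhd (base X) y)"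
    and fg: "monoid_finitely_generated M"
  shows "fg_spectrum_at (base X) (min_sec X) (min_res X) y"
proof -
  note c = affine_chartD[OF chart]
  interpret M: comm_monoid M by fact
  let ?N = "min_sec X y"
  interpret N: comm_monoid ?N by (rule presheafD(1)[OF X nb[OF y]])
  have xU: "x \<in> U" if "x \<in> min_nbhd (base X) y" for x using min_nbhd_subset[OF U y] that by auto
  have cK: "comm_monoid (min_sec X x)" if "x \<in> min_nbhd (base X) y" for x
    by (rule presheafD(1)[OF X nb[OF xU[OF that]]])
  have hom: "unital_hom ?N (min_sec X x) (min_res X y x)" if x: "x \<in> min_nbhd (base X) y" for x
    by (rule presheafD(2)[OF X nb[OF y] nb[OF xU[OF x]] min_nbhd_mono[OF x]])
  note gy = unital_homD[OF is_localizationD(1)[OF c(3)[OF y]]]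
  let ?uf = "\<lambda>x. unit_face ?N (min_sec X x) (min_res X y x)"
  have gu: "g x a \<in> Units (min_sec X x) \<longleftrightarrow> a \<notin> f x" if "x \<in> U" "a \<in> carrier M" for x a
    using c(4)[OF that(1)] that(2) by (auto simp: unit_face_def)
  have fx: "f x \<subseteq> carrier M" if "x \<in> U" for x
    using c(1) that monoid_primeD(1)[of M "f x"] by (auto simp: bij_betw_def)
  have mem: "g y a \<in> ?uf x \<longleftrightarrow> a \<notin> f x" if x: "x \<in> min_nbhd (base X) y" and a: "a \<in> carrier M" for x a
    using c(5)[OF y x a] gu[OF xU[OF x] a] gy(1)[OF a] by (simp add: unit_face_def)
  have sub: "f x \<subseteq> f x'" if x: "x \<in> min_nbhd (base X) y" "x' \<in> min_nbhd (base X) y" and s: "?uf x' \<subseteq> ?uf x" for x x'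
  proof
    fix a assume a: "a \<in> f x"
    then have "a \<in> carrier M" using fx xU x by blast
    then show "a \<in> f x'" using mem[OF x(1)] mem[OF x(2)] s a by blast
  qed
  show ?thesis
    unfolding fg_spectrum_at_def
  proof (intro conjI ballI impI allI)
    show "monoid_finitely_generated ?N"
      by (rule monoid_finitely_generated_localization[OF M N.comm_monoid_axioms c(3)[OF y] fg])
  next
    fix x assume x: "x \<in> min_nbhd (base X) y"
    show "is_localization ?N (min_sec X x) (min_res X y x)"
      by (rule is_localization_cancel[OF M N.comm_monoid_axioms cK[OF x] c(3)[OF y] c(3)[OF xU[OF x]] hom[OF x] c(5)[OF y x]])
  next
    show "inj_on ?uf (min_nbhd (base X) y)"
    proof (rule inj_onI)
      fix x x' assume x: "x \<in> min_nbhd (base X) y" "x' \<in> min_nbhd (base X) y" "?uf x = ?uf x'"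
      have "f x = f x'" using sub[OF x(1,2)] sub[OF x(2,1)] x(3) by simp
      then show "x = x'" using c(1) xU x by (auto simp: bij_betw_def inj_on_def)
    qed
  next
    fix x x' assume x: "x \<in> min_nbhd (base X) y" "x' \<in> min_nbhd (base X) y" "?uf x' \<subseteq> ?uf x"
    show "x \<in> min_nbhd (base X) x'"
      using sub[OF x] c(2)[OF xU[OF x(1)] xU[OF x(2)]] by simp
  next
    fix S' assume S': "face ?N S'"
    note fS = faceD[OF S']
    define Q where "Q = {a \<in> carrier M. g y a \<notin> S'}"
    have "carrier M - Q = {a \<in> carrier M. g y a \<in> S'}" by (auto simp: Q_def)
    then have "face M (carrier M - Q)"
      using gy fS(2,3) by (simp add: face_def)
    then have prime: "monoid_prime M Q" by (simp add: monoid_prime_iff_face[OF M] Q_def)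
    then have "Q \<in> f ` U" using c(1) by (simp add: bij_betw_def)
    then obtain x where x: "x \<in> U" "f x = Q" by blast
    \<comment> \<open>Elements outside \<open>f y\<close> become units at \<open>y\<close>, and
      every face contains the units.\<close>
    have "Q \<subseteq> f y"
    proof
      fix a assume a: "a \<in> Q"
      show "a \<in> f y"
      proof (rule ccontr)
        assume "a \<notin> f y"
        then have "g y a \<in> Units ?N" using gu[OF y] a by (auto simp: Q_def)
        then show False using N.Units_subset_face[OF S'] a by (auto simp: Q_def)
      qed
    qed
    then have xy: "x \<in> min_nbhd (base X) y" using c(2)[OF x(1) y] x(2) by simp
    interpret K: comm_monoid "min_sec X x" by (rule cK[OF xy])
    note fu = faceD[OF face_unit_face[OF N.comm_monoid_axioms K.comm_monoid_axioms hom[OF xy]]]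
    \<comment> \<open>Up to the unit \<open>g y s\<close>, which lies in both faces,
      \<open>n\<close> is the image of \<open>a\<close>. So the two faces can be compared on the
      image of \<open>M\<close>.\<close>
    have "n \<in> ?uf x \<longleftrightarrow> n \<in> S'" if n: "n \<in> carrier ?N" for n
    proof -
      obtain a s where as: "a \<in> carrier M" "s \<in> carrier M" "g y s \<in> Units ?N" "n \<otimes>\<^bsub>?N\<^esub> g y s = g y a"
        using is_localizationD(2)[OF c(3)[OF y] n] by blast
      have s: "g y s \<in> ?uf x" "g y s \<in> S'"
        using N.Units_subset_face[OF face_unit_face[OF N.comm_monoid_axioms K.comm_monoid_axioms hom[OF xy]]]
          N.Units_subset_face[OF S'] as(3) by auto
      have "n \<in> ?uf x \<longleftrightarrow> g y a \<in> ?uf x" using fu(3)[OF n gy(1)[OF as(2)]] s as(4) by simp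
      also have "\<dots> \<longleftrightarrow> g y a \<in> S'" using mem[OF xy as(1)] as(1) by (simp add: x(2) Q_def)
      also have "\<dots> \<longleftrightarrow> n \<in> S'" using fS(3)[OF n gy(1)[OF as(2)]] s as(4) by simp
      finally show ?thesis .
    qed
    then have "?uf x = S'" using fS(1) fu(1) by blast
    then show "\<exists>x\<in>min_nbhd (base X) y. ?uf x = S'" using xy by blast
  qed
qed

text \<open>Both claims hold on an affine piece by \<open>finite_Spec\<close> and pass through the
  homeomorphism, as the minimal neighbourhood of a point is the same in an open subspace.\<close>

lemma finite_type_min_nbhd:
  assumes "finite_type X"
  shows "finite (topspace (base X))" and "y \<in> topspace (base X) \<Longrightarrow> openin (base X) (min_nbhd (base X) y)"
proof -
  obtain \<U> where \<U>: "finite \<U>" "\<forall>U\<in>\<U>. openin (base X) U" "\<Union>\<U> = topspace (base X)"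
    and af: "\<forall>U\<in>\<U>. \<exists>M :: 'b monoid. comm_monoid M \<and> monoid_finitely_generated M \<and>
           isomorphic_spaces (open_subspace X U) (Spec M)"
    using assms unfolding finite_type_def by blast
  have U: "finite U \<and> (\<forall>y\<in>U. openin (base X) (min_nbhd (base X) y))" if UU: "U \<in> \<U>" for U
  proof -
    obtain M :: "'b monoid" where M: "comm_monoid M" "monoid_finitely_generated M"
      "isomorphic_spaces (open_subspace X U) (Spec M)" using af UU by blast
    have oU: "openin (base X) U" using \<U> UU by auto
    have tU: "topspace (subtopology (base X) U) = U" using openin_subset[OF oU] by auto
    obtain f where f: "homeomorphic_map (subtopology (base X) U) (Spec_topology M) f"
      using M(3) unfolding isomorphic_spaces_def by (auto simp: base_Spec[OF M(1)])
    have im: "f ` U = topspace (Spec_topology M)" using homeomorphic_imp_surjective_map[OF f] tU by simp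
    have inj: "inj_on f U" using homeomorphic_imp_injective_map[OF f] tU by simp
    have "finite U" using finite_Spec(1)[OF M(1,2)] im inj finite_imageD by metis
    moreover have "openin (base X) (min_nbhd (base X) y)" if y: "y \<in> U" for y
    proof -
      have "monoid_prime M (f y)" using im y topspace_Spec[OF M(1)] by auto
      then have "openin (Spec_topology M) (min_nbhd (Spec_topology M) (f y))" by (rule finite_Spec(2)[OF M(1,2)])
      moreover have "f ` min_nbhd (base X) y = min_nbhd (Spec_topology M) (f y)"
        using homeomorphic_map_image_min_nbhd[OF f, unfolded tU, OF y] min_nbhd_subtopology[OF oU y] by simp
      moreover have "min_nbhd (base X) y \<subseteq> topspace (subtopology (base X) U)"
        using min_nbhd_subset[OF oU y] tU by simp
      ultimately have "openin (subtopology (base X) U) (min_nbhd (base X) y)"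
        using homeomorphic_map_openness_eq[OF f] by simp
      then show ?thesis using oU by (simp add: openin_open_subtopology)
    qed
    ultimately show ?thesis by blast
  qed
  then show "finite (topspace (base X))" unfolding \<U>(3)[symmetric] using \<U>(1) by auto
  show "y \<in> topspace (base X) \<Longrightarrow> openin (base X) (min_nbhd (base X) y)"
    unfolding \<U>(3)[symmetric] using U by auto
qed

lemma stalkwise_scheme_of_finite_type:
  fixes X :: "('p, 'a) monoid_space"
  assumes X: "is_monoid_scheme X" and fin: "finite_type X"
  shows "stalkwise_scheme X"
proof -
  have sh: "sheaf_of_monoids X" using X by (simp add: is_monoid_scheme_def)
  then have psh: "presheaf_of_monoids X" by (simp add: sheaf_of_monoids_def)
  note nb = finite_type_min_nbhd[OF fin]
  obtain \<U> where \<U>: "finite \<U>" "\<forall>U\<in>\<U>. openin (base X) U" "\<Union>\<U> = topspace (base X)"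
    and af: "\<forall>U\<in>\<U>. \<exists>M :: 'a monoid. comm_monoid M \<and> monoid_finitely_generated M \<and>
           isomorphic_spaces (open_subspace X U) (Spec M)"
    using fin unfolding finite_type_def by blast
  have "fg_spectrum_at (base X) (min_sec X) (min_res X) y" if y: "y \<in> topspace (base X)" for y
  proof -
    obtain U where U: "U \<in> \<U>" "y \<in> U" using y \<U>(3) by auto
    obtain M :: "'a monoid" where M: "comm_monoid M" "monoid_finitely_generated M"
      "isomorphic_spaces (open_subspace X U) (Spec M)" using af U by blast
    have oU: "openin (base X) U" using \<U> U by auto
    have nbU: "openin (base X) (min_nbhd (base X) y)" if "y \<in> U" for y
      using nb(2) that openin_subset[OF oU] by auto
    obtain f g where "affine_chart X U M f g" using affine_chart_exists[OF psh oU M(1,3) nbU] by blast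
    then show ?thesis using fg_spectrum_at_chart[OF psh oU M(1) _ U(2) nbU M(2)] by blast
  qed
  then show ?thesis using sh nb by (simp add: stalkwise_scheme_def)
qed


section \<open>Reconstructing a scheme from the sections over minimal neighbourhoods\<close>

text \<open>The isomorphism is specified by \<open>e (a / s) h s = h a\<close>, an equation without
  inverses that determines the value because \<open>h s\<close> is a unit. The two clauses of
  \<open>is_localization\<close> give surjectivity and injectivity.\<close>

lemma localization_unital_iso_exists:
  assumes "comm_monoid M" "comm_monoid N" and h: "is_localization M N h"
    and S: "unit_face M N h = S"
  shows "\<exists>e. unital_iso (localization M S) N e \<and>
    (\<forall>a\<in>carrier M. \<forall>s\<in>S. e (fraction M S a s) \<otimes>\<^bsub>N\<^esub> h s = h a)"
proof -
  interpret N: comm_monoid N by fact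
  have hh: "unital_hom M N h" using h by (rule is_localizationD)
  note h' = unital_homD[OF hh]
  have face: "face M S" using face_unit_face[OF assms(1,2) hh] S by simp
  interpret F: monoid_face M S using assms(1) face by (simp add: monoid_face_def monoid_face_axioms_def)
  interpret L: comm_monoid F.L by (rule F.comm_monoid_L)
  have hS: "h s \<in> Units N" "h s \<in> carrier N" if "s \<in> S" for s
    using that S h' by (auto simp: unit_face_def)
  have "\<forall>C\<in>carrier F.L. \<exists>n\<in>carrier N. \<exists>a\<in>carrier M. \<exists>s\<in>S. C = F.frac a s \<and> n \<otimes>\<^bsub>N\<^esub> h s = h a"
  proof
    fix C assume "C \<in> carrier F.L"
    then obtain a s where as: "a \<in> carrier M" "s \<in> S" "C = F.frac a s" by (rule F.L_cases)
    have "(h a \<otimes>\<^bsub>N\<^esub> inv\<^bsub>N\<^esub> h s) \<otimes>\<^bsub>N\<^esub> h s = h a"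
      using as hS[OF as(2)] h' by (simp add: N.m_assoc N.Units_inv_closed)
    then show "\<exists>n\<in>carrier N. \<exists>a\<in>carrier M. \<exists>s\<in>S. C = F.frac a s \<and> n \<otimes>\<^bsub>N\<^esub> h s = h a"
      using as hS[OF as(2)] h' by (intro bexI[of _ "h a \<otimes>\<^bsub>N\<^esub> inv\<^bsub>N\<^esub> h s"]) auto
  qed
  \<comment> \<open>The value on a class is chosen through one representative; \<open>eq\<close>
    shows that all representatives force the same value.\<close>
  then obtain e where e: "\<And>C. C \<in> carrier F.L \<Longrightarrow> e C \<in> carrier N \<and>
      (\<exists>a\<in>carrier M. \<exists>s\<in>S. C = F.frac a s \<and> e C \<otimes>\<^bsub>N\<^esub> h s = h a)" by metis
  have eq: "n = m" if C: "F.frac a s = F.frac b t" "a \<in> carrier M" "b \<in> carrier M" "s \<in> S" "t \<in> S"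
    and nm: "n \<in> carrier N" "m \<in> carrier N" "n \<otimes>\<^bsub>N\<^esub> h s = h a" "m \<otimes>\<^bsub>N\<^esub> h t = h b" for a b s t n m
  proof -
    obtain u where u: "u \<in> S" "u \<otimes>\<^bsub>M\<^esub> (a \<otimes>\<^bsub>M\<^esub> t) = u \<otimes>\<^bsub>M\<^esub> (b \<otimes>\<^bsub>M\<^esub> s)"
      using C F.frac_eq_iff by auto
    have "n \<otimes>\<^bsub>N\<^esub> (h u \<otimes>\<^bsub>N\<^esub> (h s \<otimes>\<^bsub>N\<^esub> h t)) = h u \<otimes>\<^bsub>N\<^esub> ((n \<otimes>\<^bsub>N\<^esub> h s) \<otimes>\<^bsub>N\<^esub> h t)"
      using nm(1) u(1) C hS by (simp add: N.m_ac)
    also have "\<dots> = h (u \<otimes>\<^bsub>M\<^esub> (a \<otimes>\<^bsub>M\<^esub> t))" using nm(3) u(1) C by (simp add: h')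
    also have "\<dots> = h u \<otimes>\<^bsub>N\<^esub> ((m \<otimes>\<^bsub>N\<^esub> h t) \<otimes>\<^bsub>N\<^esub> h s)" unfolding u(2) using nm(4) u(1) C by (simp add: h')
    also have "\<dots> = m \<otimes>\<^bsub>N\<^esub> (h u \<otimes>\<^bsub>N\<^esub> (h s \<otimes>\<^bsub>N\<^esub> h t))"
      using nm(2) u(1) C hS by (simp add: N.m_ac)
    finally have *: "n \<otimes>\<^bsub>N\<^esub> (h u \<otimes>\<^bsub>N\<^esub> (h s \<otimes>\<^bsub>N\<^esub> h t)) = m \<otimes>\<^bsub>N\<^esub> (h u \<otimes>\<^bsub>N\<^esub> (h s \<otimes>\<^bsub>N\<^esub> h t))" .
    show "n = m" by (rule N.Units_cancel[OF _ nm(1,2) *]) (use hS u(1) C in auto)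
  qed
  have ev: "e (F.frac a s) \<otimes>\<^bsub>N\<^esub> h s = h a" if as: "a \<in> carrier M" "s \<in> S" for a s
  proof -
    have C: "F.frac a s \<in> carrier F.L" using as by simp
    obtain b t where bt: "b \<in> carrier M" "t \<in> S" "F.frac a s = F.frac b t" "e (F.frac a s) \<otimes>\<^bsub>N\<^esub> h t = h b"
      using e[OF C] by blast
    have "(h a \<otimes>\<^bsub>N\<^esub> inv\<^bsub>N\<^esub> h s) \<otimes>\<^bsub>N\<^esub> h s = h a" "h a \<otimes>\<^bsub>N\<^esub> inv\<^bsub>N\<^esub> h s \<in> carrier N"
      using as hS[OF as(2)] h' by (simp_all add: N.m_assoc N.Units_inv_closed)
    moreover from this have "h a \<otimes>\<^bsub>N\<^esub> inv\<^bsub>N\<^esub> h s = e (F.frac a s)"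
      using eq[OF bt(3) as(1) bt(1) as(2) bt(2)] e[OF C] bt(4) by blast
    ultimately show ?thesis by simp
  qed
  have ec: "e C \<in> carrier N" if "C \<in> carrier F.L" for C using e that by blast
  have hom: "unital_hom F.L N e"
    unfolding unital_hom_def
  proof (intro conjI homI ec)
    fix C D assume CD: "C \<in> carrier F.L" "D \<in> carrier F.L"
    obtain a s where as: "a \<in> carrier M" "s \<in> S" "C = F.frac a s" using CD(1) by (rule F.L_cases)
    obtain b t where bt: "b \<in> carrier M" "t \<in> S" "D = F.frac b t" using CD(2) by (rule F.L_cases)
    have 1: "(e C \<otimes>\<^bsub>N\<^esub> e D) \<otimes>\<^bsub>N\<^esub> h (s \<otimes>\<^bsub>M\<^esub> t) = h (a \<otimes>\<^bsub>M\<^esub> b)"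
    proof -
      have "(e C \<otimes>\<^bsub>N\<^esub> e D) \<otimes>\<^bsub>N\<^esub> h (s \<otimes>\<^bsub>M\<^esub> t) = (e C \<otimes>\<^bsub>N\<^esub> h s) \<otimes>\<^bsub>N\<^esub> (e D \<otimes>\<^bsub>N\<^esub> h t)"
        using as(1,2) bt(1,2) ec CD hS by (simp add: h' N.m_ac)
      then show ?thesis using ev as bt by (simp add: h')
    qed
    have 2: "e (C \<otimes>\<^bsub>F.L\<^esub> D) \<otimes>\<^bsub>N\<^esub> h (s \<otimes>\<^bsub>M\<^esub> t) = h (a \<otimes>\<^bsub>M\<^esub> b)"
      using ev[of "a \<otimes>\<^bsub>M\<^esub> b" "s \<otimes>\<^bsub>M\<^esub> t"] as bt by simp
    show "e (C \<otimes>\<^bsub>F.L\<^esub> D) = e C \<otimes>\<^bsub>N\<^esub> e D"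
      by (rule N.Units_cancel[of "h (s \<otimes>\<^bsub>M\<^esub> t)"]) (use 1 2 as bt hS CD ec in auto)
  next
    show "e \<one>\<^bsub>F.L\<^esub> = \<one>\<^bsub>N\<^esub>" using ev[of "\<one>\<^bsub>M\<^esub>" "\<one>\<^bsub>M\<^esub>"] ec[of "\<one>\<^bsub>F.L\<^esub>"] by (simp add: F.L_one h')
  qed
  have inj: "inj_on e (carrier F.L)"
  proof (rule inj_onI)
    fix C D assume CD: "C \<in> carrier F.L" "D \<in> carrier F.L" "e C = e D"
    obtain a s where as: "a \<in> carrier M" "s \<in> S" "C = F.frac a s" using CD(1) by (rule F.L_cases)
    obtain b t where bt: "b \<in> carrier M" "t \<in> S" "D = F.frac b t" using CD(2) by (rule F.L_cases)
    have "h (a \<otimes>\<^bsub>M\<^esub> t) = (e C \<otimes>\<^bsub>N\<^esub> h s) \<otimes>\<^bsub>N\<^esub> h t" using ev[OF as(1,2)] as bt by (simp add: h')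
    also have "\<dots> = (e D \<otimes>\<^bsub>N\<^esub> h t) \<otimes>\<^bsub>N\<^esub> h s"
      unfolding CD(3) using ec[OF CD(2)] hS as(2) bt(2) by (simp add: N.m_ac)
    also have "\<dots> = h (b \<otimes>\<^bsub>M\<^esub> s)" using ev[OF bt(1,2)] as bt by (simp add: h')
    finally obtain u where "u \<in> S" "u \<otimes>\<^bsub>M\<^esub> (a \<otimes>\<^bsub>M\<^esub> t) = u \<otimes>\<^bsub>M\<^esub> (b \<otimes>\<^bsub>M\<^esub> s)"
      using is_localizationD(3)[OF h, of "a \<otimes>\<^bsub>M\<^esub> t" "b \<otimes>\<^bsub>M\<^esub> s"] as bt S by (auto simp: unit_face_def)
    then show "C = D" unfolding as(3) bt(3) using F.frac_eq_iff[OF as(1) bt(1) as(2) bt(2)] by blast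
  qed
  have "\<exists>C\<in>carrier F.L. e C = n" if n: "n \<in> carrier N" for n
  proof -
    obtain a s where as: "a \<in> carrier M" "s \<in> carrier M" "h s \<in> Units N" "n \<otimes>\<^bsub>N\<^esub> h s = h a"
      using is_localizationD(2)[OF h n] by blast
    then have s: "s \<in> S" using S by (auto simp: unit_face_def)
    have "e (F.frac a s) = n"
      by (rule N.Units_cancel[of "h s"]) (use ev as s n ec in auto)
    then show ?thesis using as(1) s F.frac_closed by blast
  qed
  then have "e ` carrier F.L = carrier N" using ec by blast
  then show ?thesis using hom ev inj by (auto simp: unital_iso_def bij_betw_def)
qed

lemma sheaf_separated:
  assumes "sheaf_of_monoids X" "\<And>U. U \<in> \<U> \<Longrightarrow> openin (base X) U" "W = \<Union>\<U>"
    "s \<in> carrier (sec X W)" "t \<in> carrier (sec X W)" "\<And>U. U \<in> \<U> \<Longrightarrow> res X W U s = res X W U t"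
  shows "s = t"
proof -
  have *: "\<forall>\<U>. (\<forall>U\<in>\<U>. openin (base X) U) \<longrightarrow>
        (\<forall>s\<in>carrier (sec X (\<Union>\<U>)). \<forall>t\<in>carrier (sec X (\<Union>\<U>)).
           (\<forall>U\<in>\<U>. res X (\<Union>\<U>) U s = res X (\<Union>\<U>) U t) \<longrightarrow> s = t)"
    using assms(1) unfolding sheaf_of_monoids_def by (elim conjE)
  show ?thesis using *[THEN spec, of \<U>] assms(2,4-) unfolding assms(3) by blast
qed

lemma sheaf_glue:
  assumes "sheaf_of_monoids X" "\<And>U. U \<in> \<U> \<Longrightarrow> openin (base X) U \<and> s U \<in> carrier (sec X U)"
    "\<And>U V. U \<in> \<U> \<Longrightarrow> V \<in> \<U> \<Longrightarrow> res X U (U \<inter> V) (s U) = res X V (U \<inter> V) (s V)"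
  shows "\<exists>t\<in>carrier (sec X (\<Union>\<U>)). \<forall>U\<in>\<U>. res X (\<Union>\<U>) U t = s U"
proof -
  have *: "\<forall>\<U> s. (\<forall>U\<in>\<U>. openin (base X) U \<and> s U \<in> carrier (sec X U)) \<longrightarrow>
        (\<forall>U\<in>\<U>. \<forall>V\<in>\<U>. res X U (U \<inter> V) (s U) = res X V (U \<inter> V) (s V)) \<longrightarrow>
        (\<exists>t\<in>carrier (sec X (\<Union>\<U>)). \<forall>U\<in>\<U>. res X (\<Union>\<U>) U t = s U)"
    using assms(1) unfolding sheaf_of_monoids_def by (elim conjE)
  show ?thesis using *[THEN spec, THEN spec, of \<U> s] assms(2,3) by blast
qed

section \<open>Gluing over minimal neighbourhoods\<close>

context stalkwise
begin

lemma union_min_nbhd: "openin T W \<Longrightarrow> W = \<Union>(min_nbhd T ` W)"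
  using min_nbhd_subset[of T W] by auto

lemma open_top: "openin T W \<Longrightarrow> x \<in> W \<Longrightarrow> x \<in> topspace T"
  using openin_subset by blast

lemma section_eqI:
  assumes W: "openin T W" and s: "s \<in> carrier (sec X W)" and t: "t \<in> carrier (sec X W)"
    and eq: "\<And>x. x \<in> W \<Longrightarrow> res X W (min_nbhd T x) s = res X W (min_nbhd T x) t"
  shows "s = t"
  by (rule sheaf_separated[OF sheaf _ union_min_nbhd[OF W] s t])
     (use eq open_nb open_top[OF W] in auto)

lemma res_W:
  assumes W: "openin T W" and x: "x \<in> W"
  shows "unital_hom (sec X W) (min_sec X x) (res X W (min_nbhd T x))"
    and "z \<in> min_nbhd T x \<Longrightarrow> t \<in> carrier (sec X W) \<Longrightarrow>
      min_res X x z (res X W (min_nbhd T x) t) = res X W (min_nbhd T z) t"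
proof -
  have xT: "x \<in> topspace T" by (rule open_top[OF W x])
  have xW: "min_nbhd T x \<subseteq> W" by (rule min_nbhd_subset[OF W x])
  show "unital_hom (sec X W) (min_sec X x) (res X W (min_nbhd T x))"
    by (rule presheafD(2)[OF presheaf W open_nb[OF xT] xW])
  show "min_res X x z (res X W (min_nbhd T x) t) = res X W (min_nbhd T z) t"
    if z: "z \<in> min_nbhd T x" and t: "t \<in> carrier (sec X W)"
    by (rule presheafD(4)[OF presheaf W open_nb[OF xT] open_nb[OF mem_top[OF xT z]] xW min_nbhd_mono[OF z] t])
qed

text \<open>Sections over an open set are the compatible families of sections over minimal
  neighbourhoods. The overlap of two such neighbourhoods is in general not of this kind, so
  agreement on it is reduced to the minimal neighbourhoods of its points by
  \<open>section_eqI\<close>.\<close>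

lemma glue:
  assumes W: "openin T W" and s: "\<And>x. x \<in> W \<Longrightarrow> s x \<in> carrier (min_sec X x)"
    and compat: "\<And>x z. x \<in> W \<Longrightarrow> z \<in> min_nbhd T x \<Longrightarrow> min_res X x z (s x) = s z"
  shows "\<exists>!t. t \<in> carrier (sec X W) \<and> (\<forall>x\<in>W. res X W (min_nbhd T x) t = s x)"
proof (rule ex_ex1I)
  \<comment> \<open>The gluing axiom indexes sections by open sets. By T0 a point can be recovered
    from its minimal neighbourhood.\<close>
  define p where "p = inv_into W (min_nbhd T)"
  have inj: "inj_on (min_nbhd T) W" using T0 open_top[OF W] by (auto simp: inj_on_def)
  have p: "p (min_nbhd T x) = x" if "x \<in> W" for x using inj that by (simp add: p_def)
  have "\<exists>t\<in>carrier (sec X (\<Union>(min_nbhd T ` W))). \<forall>U\<in>min_nbhd T ` W.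
      res X (\<Union>(min_nbhd T ` W)) U t = s (p U)"
  proof (rule sheaf_glue[OF sheaf])
    fix U assume "U \<in> min_nbhd T ` W"
    then show "openin T U \<and> s (p U) \<in> carrier (sec X U)"
      using s p open_nb open_top[OF W] by auto
  next
    fix U V assume "U \<in> min_nbhd T ` W" "V \<in> min_nbhd T ` W"
    then obtain x y where x: "x \<in> W" "U = min_nbhd T x" and y: "y \<in> W" "V = min_nbhd T y" by auto
    have oU: "openin T U" and oV: "openin T V" using x y open_nb open_top[OF W] by auto
    then have oI: "openin T (U \<inter> V)" by auto
    have sU: "s x \<in> carrier (sec X U)" and sV: "s y \<in> carrier (sec X V)" using s x y by auto
    have "res X U (U \<inter> V) (s x) = res X V (U \<inter> V) (s y)"
    proof (rule section_eqI[OF oI])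
      show "res X U (U \<inter> V) (s x) \<in> carrier (sec X (U \<inter> V))"
        by (rule unital_homD(1)[OF presheafD(2)[OF presheaf oU oI] sU]) simp
      show "res X V (U \<inter> V) (s y) \<in> carrier (sec X (U \<inter> V))"
        by (rule unital_homD(1)[OF presheafD(2)[OF presheaf oV oI] sV]) simp
      fix z assume z: "z \<in> U \<inter> V"
      have oz: "openin T (min_nbhd T z)" using open_nb open_top[OF oI z] by auto
      have zI: "min_nbhd T z \<subseteq> U \<inter> V" by (rule min_nbhd_subset[OF oI z])
      have "res X (U \<inter> V) (min_nbhd T z) (res X U (U \<inter> V) (s x)) = s z"
        using presheafD(4)[OF presheaf oU oI oz _ zI sU] compat[OF x(1), of z] x(2) z by simp
      moreover have "res X (U \<inter> V) (min_nbhd T z) (res X V (U \<inter> V) (s y)) = s z"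
        using presheafD(4)[OF presheaf oV oI oz _ zI sV] compat[OF y(1), of z] y(2) z by simp
      ultimately show "res X (U \<inter> V) (min_nbhd T z) (res X U (U \<inter> V) (s x))
        = res X (U \<inter> V) (min_nbhd T z) (res X V (U \<inter> V) (s y))" by simp
    qed
    then show "res X U (U \<inter> V) (s (p U)) = res X V (U \<inter> V) (s (p V))"
      using x y p by simp
  qed
  then show "\<exists>t. t \<in> carrier (sec X W) \<and> (\<forall>x\<in>W. res X W (min_nbhd T x) t = s x)"
    unfolding union_min_nbhd[OF W, symmetric] using p by auto
next
  fix t u assume "t \<in> carrier (sec X W) \<and> (\<forall>x\<in>W. res X W (min_nbhd T x) t = s x)"
    "u \<in> carrier (sec X W) \<and> (\<forall>x\<in>W. res X W (min_nbhd T x) u = s x)"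
  then show "t = u" using section_eqI[OF W] by simp
qed

text \<open>A point \<open>x\<close> below \<open>y\<close> is sent to the prime of elements that do
  not become invertible at \<open>x\<close>. A section of the spectrum is a family of fractions;
  \<open>localization_unital_iso_exists\<close> carries each of them to the sections around the
  corresponding point, and the resulting family is glued.\<close>

lemma isomorphic_Spec:
  assumes y: "y \<in> topspace T"
  shows "isomorphic_spaces (open_subspace X (min_nbhd T y)) (Spec (min_sec X y))"
proof -
  define U where "U = min_nbhd T y"
  define M where "M = min_sec X y"
  define k where "k x = min_res X y x" for x
  define pr where "pr x = carrier M - unit_face M (min_sec X x) (k x)" for x
  note sp = fg_spectrum_atD[OF spectrum[OF y], folded k_def, folded M_def, folded U_def]
  have cM: "comm_monoid M" unfolding M_def by (rule cm[OF y])
  interpret M: comm_monoid M by (rule cM)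
  have oU: "openin T U" unfolding U_def by (rule open_nb[OF y])
  have UT: "x \<in> topspace T" if "x \<in> U" for x using open_top[OF oU that] .
  have nU: "min_nbhd T x \<subseteq> U" if "x \<in> U" for x by (rule min_nbhd_subset[OF oU that])
  have cN: "comm_monoid (min_sec X x)" if "x \<in> U" for x by (rule cm[OF UT[OF that]])
  have kh: "unital_hom M (min_sec X x) (k x)" if "x \<in> U" for x
    unfolding M_def k_def by (rule res_hom[OF y]) (use that in \<open>simp add: U_def\<close>)
  have kk: "min_res X x z (k x a) = k z a" if "x \<in> U" "z \<in> min_nbhd T x" "a \<in> carrier M" for x z a
    unfolding k_def by (rule res_res[OF y]) (use that in \<open>simp_all add: U_def M_def\<close>)
  have ufc: "unit_face M (min_sec X x) (k x) = carrier M - pr x" for x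
    by (auto simp: pr_def unit_face_def)
  have prime: "monoid_prime M (pr x)" if "x \<in> U" for x
    unfolding monoid_prime_iff_face[OF cM] ufc[symmetric]
    using face_unit_face[OF cM cN[OF that] kh[OF that]] by (auto simp: pr_def)
  have mono: "pr z \<subseteq> pr x" if "x \<in> U" "z \<in> min_nbhd T x" for x z
    using unit_face_mono[OF y, of x z] that by (auto simp: pr_def k_def M_def U_def)
  have refl: "z \<in> min_nbhd T x" if "x \<in> U" "z \<in> U" "pr z \<subseteq> pr x" for x z
  proof (rule sp(5)[OF that(2,1)])
    show "unit_face M (min_sec X x) (k x) \<subseteq> unit_face M (min_sec X z) (k z)"
      unfolding ufc using that(3) by auto
  qed
  have inj: "inj_on pr U"
  proof (rule inj_onI)
    fix x z assume "x \<in> U" "z \<in> U" "pr x = pr z"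
    then show "x = z" using sp(3)[of x z] ufc[of x] ufc[of z] by simp
  qed
  have surj: "\<exists>x\<in>U. pr x = Q" if Q: "monoid_prime M Q" for Q
  proof -
    obtain x where "x \<in> U" "unit_face M (min_sec X x) (k x) = carrier M - Q"
      using sp(4)[of "carrier M - Q"] Q by (auto simp: monoid_prime_iff_face[OF cM])
    then show ?thesis using monoid_primeD(1)[OF Q] by (auto simp: pr_def)
  qed
  have im: "pr ` U = {P. monoid_prime M P}" using prime surj by auto
  have im_nb: "pr ` min_nbhd T x = min_nbhd (Spec_topology M) (pr x)" if x: "x \<in> U" for x
  proof -
    have "pr z \<in> min_nbhd (Spec_topology M) (pr x)" if "z \<in> min_nbhd T x" for z
      using mono[OF x that] prime nU[OF x] that by (auto simp: min_nbhd_Spec[OF cM prime[OF x]])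
    moreover have "Q \<in> pr ` min_nbhd T x" if "Q \<in> min_nbhd (Spec_topology M) (pr x)" for Q
      using that surj[of Q] refl[OF x] by (auto simp: min_nbhd_Spec[OF cM prime[OF x]])
    ultimately show ?thesis by blast
  qed
  have oS: "openin (Spec_topology M) (min_nbhd (Spec_topology M) P)" if "monoid_prime M P" for P
    by (rule finite_Spec(2)[OF cM sp(1) that])
  define pre where "pre V = {x \<in> U. pr x \<in> V}" for V
  have opre: "openin T (pre V)" if V: "openin (Spec_topology M) V" for V
    unfolding openin_iff
  proof (intro conjI ballI subsetI)
    show "x \<in> topspace T" if "x \<in> pre V" for x using that UT by (auto simp: pre_def)
    fix x z assume x: "x \<in> pre V" and z: "z \<in> min_nbhd T x"
    then have "x \<in> U" "z \<in> U" using nU by (auto simp: pre_def)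
    then show "z \<in> pre V"
      using openin_Spec_down[OF cM V, of "pr x" "pr z"] x mono[of x z] z prime by (auto simp: pre_def)
  qed
  have tU: "topspace (subtopology T U) = U" using openin_subset[OF oU] by auto
  have homeo: "homeomorphic_map (subtopology T U) (Spec_topology M) pr"
  proof (rule bijective_open_imp_homeomorphic_map)
    show "continuous_map (subtopology T U) (Spec_topology M) pr"
      unfolding continuous_map_def tU
    proof (intro conjI allI impI)
      show "pr \<in> U \<rightarrow> topspace (Spec_topology M)" using prime topspace_Spec[OF cM] by auto
      fix V assume "openin (Spec_topology M) V"
      then show "openin (subtopology T U) {x \<in> U. pr x \<in> V}"
        using opre[of V] oU by (auto simp: openin_open_subtopology pre_def)
    qed
    show "open_map (subtopology T U) (Spec_topology M) pr"
      unfolding open_map_def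
    proof (intro allI impI)
      fix W assume "openin (subtopology T U) W"
      then have W: "openin T W" "W \<subseteq> U" using oU by (auto simp: openin_open_subtopology)
      have "pr ` W = pr ` \<Union>(min_nbhd T ` W)" using union_min_nbhd[OF W(1)] by simp
      also have "\<dots> = (\<Union>x\<in>W. pr ` min_nbhd T x)" by blast
      also have "\<dots> = (\<Union>x\<in>W. min_nbhd (Spec_topology M) (pr x))"
        by (rule SUP_cong) (use im_nb W(2) in auto)
      finally have "pr ` W = (\<Union>x\<in>W. min_nbhd (Spec_topology M) (pr x))" .
      moreover have "openin (Spec_topology M) (\<Union>x\<in>W. min_nbhd (Spec_topology M) (pr x))"
        using oS prime W(2) by auto
      ultimately show "openin (Spec_topology M) (pr ` W)" by simp
    qed
  qed (use im inj tU topspace_Spec[OF cM] in auto)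
  have "\<forall>x\<in>U. \<exists>e. unital_iso (localization M (carrier M - pr x)) (min_sec X x) e \<and>
    (\<forall>a\<in>carrier M. \<forall>s\<in>carrier M - pr x. e (fraction M (carrier M - pr x) a s) \<otimes>\<^bsub>min_sec X x\<^esub> k x s = k x a)"
    using localization_unital_iso_exists[OF cM cN sp(2) ufc] by blast
  then obtain e where e: "\<And>x. x \<in> U \<Longrightarrow> unital_iso (localization M (carrier M - pr x)) (min_sec X x) (e x)"
    and ev: "\<And>x a s. x \<in> U \<Longrightarrow> a \<in> carrier M \<Longrightarrow> s \<in> carrier M - pr x \<Longrightarrow>
       e x (fraction M (carrier M - pr x) a s) \<otimes>\<^bsub>min_sec X x\<^esub> k x s = k x a" by metis
  have eh: "unital_hom (localization M (carrier M - pr x)) (min_sec X x) (e x)"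
    and eb: "bij_betw (e x) (carrier (localization M (carrier M - pr x))) (carrier (min_sec X x))" if "x \<in> U" for x
    using e[OF that] by (auto simp: unital_iso_def)
  \<comment> \<open>The isomorphism \<open>e x\<close> is handled through its equation alone: a
    section whose product with the image of \<open>s\<close> is the image of \<open>a\<close> must
    be the value at \<open>a / s\<close>.\<close>
  have ev_eq: "e x (fraction M (carrier M - pr x) a s) = n"
    if x: "x \<in> U" and a: "a \<in> carrier M" and s: "s \<in> carrier M" "s \<notin> pr x" and n: "n \<in> carrier (min_sec X x)"
      "n \<otimes>\<^bsub>min_sec X x\<^esub> k x s = k x a" for x a s n
  proof -
    interpret N: comm_monoid "min_sec X x" by (rule cN[OF x])
    interpret F: monoid_face M "carrier M - pr x" by (rule monoid_face_prime[OF cM prime[OF x]])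
    have s': "s \<in> carrier M - pr x" using s by simp
    then have u: "k x s \<in> Units (min_sec X x)" using ufc[of x] by (auto simp: unit_face_def)
    have "e x (F.frac a s) \<in> carrier (min_sec X x)"
      using unital_homD(1)[OF eh[OF x]] F.frac_closed[OF a s'] .
    then show ?thesis using N.Units_cancel[OF u _ n(1)] ev[OF x a s'] n(2) by simp
  qed
  have VU: "V \<subseteq> {P. monoid_prime M P}" if "openin (Spec_topology M) V" for V
    using openin_subset[OF that] topspace_Spec[OF cM] by auto
  have cs: "\<sigma> (pr x) \<in> carrier (localization M (carrier M - pr x))"
    if "\<sigma> \<in> carrier (Spec_sections M V)" "x \<in> pre V" for \<sigma> V x
    using that by (auto simp: Spec_sections_def pre_def)
  \<comment> \<open>Gluing is unique, so the map on sections can be defined by prescribing the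
    restrictions to minimal neighbourhoods. Multiplicativity and naturality are then checked on
    these restrictions.\<close>
  define \<phi> where "\<phi> V \<sigma> = (THE t. t \<in> carrier (sec X (pre V)) \<and>
     (\<forall>x\<in>pre V. res X (pre V) (min_nbhd T x) t = e x (\<sigma> (pr x))))" for V \<sigma>
  have ex1: "\<exists>!t. t \<in> carrier (sec X (pre V)) \<and>
     (\<forall>x\<in>pre V. res X (pre V) (min_nbhd T x) t = e x (\<sigma> (pr x)))"
    if V: "openin (Spec_topology M) V" and \<sigma>: "\<sigma> \<in> carrier (Spec_sections M V)" for V \<sigma>
  proof (rule glue[OF opre[OF V]])
    fix x assume x: "x \<in> pre V"
    then have xU: "x \<in> U" and xV: "pr x \<in> V" by (auto simp: pre_def)
    show c: "e x (\<sigma> (pr x)) \<in> carrier (min_sec X x)"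
      using unital_homD(1)[OF eh[OF xU]] cs[OF \<sigma> x] .
    fix z assume z: "z \<in> min_nbhd T x"
    have zU: "z \<in> U" using nU[OF xU] z by auto
    obtain V' a f where V': "openin (Spec_topology M) V'" "pr x \<in> V'" "V' \<subseteq> V" "a \<in> carrier M" "f \<in> carrier M"
      and *: "\<And>Q. Q \<in> V' \<Longrightarrow> f \<notin> Q \<and> \<sigma> Q = fraction M (carrier M - Q) a f"
      using \<sigma> xV unfolding carrier_Spec_sections[OF cM VU[OF V]] by meson
    \<comment> \<open>The fraction that represents \<open>\<sigma>\<close> near \<open>pr x\<close>
      also represents it at \<open>pr z\<close>, since open sets contain the smaller primes.\<close>
    have zV': "pr z \<in> V'" using openin_Spec_down[OF cM V'(1,2) prime[OF zU] mono[OF xU z]] .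
    have rh: "unital_hom (min_sec X x) (min_sec X z) (min_res X x z)" by (rule res_hom[OF UT[OF xU] z])
    have kf: "k x f \<in> carrier (min_sec X x)" using unital_homD(1)[OF kh[OF xU] V'(5)] .
    have "min_res X x z (e x (\<sigma> (pr x))) \<otimes>\<^bsub>min_sec X z\<^esub> k z f
       = min_res X x z (e x (\<sigma> (pr x)) \<otimes>\<^bsub>min_sec X x\<^esub> k x f)"
      using unital_homD(2)[OF rh c kf] kk[OF xU z V'(5)] by simp
    also have "e x (\<sigma> (pr x)) \<otimes>\<^bsub>min_sec X x\<^esub> k x f = k x a"
      using ev[OF xU V'(4), of f] *[OF V'(2)] V'(5) by simp
    also have "min_res X x z (k x a) = k z a" by (rule kk[OF xU z V'(4)])
    finally have "e z (fraction M (carrier M - pr z) a f) = min_res X x z (e x (\<sigma> (pr x)))"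
      using ev_eq[OF zU V'(4,5) _ unital_homD(1)[OF rh c]] *[OF zV'] by blast
    then show "min_res X x z (e x (\<sigma> (pr x))) = e z (\<sigma> (pr z))" using *[OF zV'] by simp
  qed
  have \<phi>: "\<phi> V \<sigma> \<in> carrier (sec X (pre V))"
    "\<And>x. x \<in> pre V \<Longrightarrow> res X (pre V) (min_nbhd T x) (\<phi> V \<sigma>) = e x (\<sigma> (pr x))"
    if V: "openin (Spec_topology M) V" and \<sigma>: "\<sigma> \<in> carrier (Spec_sections M V)" for V \<sigma>
    using theI'[OF ex1[OF V \<sigma>], folded \<phi>_def] by blast+
  have \<phi>_eq: "\<phi> V \<sigma> = t"
    if V: "openin (Spec_topology M) V" and \<sigma>: "\<sigma> \<in> carrier (Spec_sections M V)"
      and t: "t \<in> carrier (sec X (pre V))"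
      "\<And>x. x \<in> pre V \<Longrightarrow> res X (pre V) (min_nbhd T x) t = e x (\<sigma> (pr x))" for V \<sigma> t
    by (rule section_eqI[OF opre[OF V] \<phi>(1)[OF V \<sigma>] t(1)]) (simp add: \<phi>(2)[OF V \<sigma>] t(2))
  have iso: "\<phi> V \<in> iso (Spec_sections M V) (sec X (pre V))" if V: "openin (Spec_topology M) V" for V
  proof -
    interpret S: comm_monoid "Spec_sections M V" by (rule comm_monoid_Spec_sections[OF cM V])
    interpret N: comm_monoid "sec X (pre V)" by (rule presheafD(1)[OF presheaf opre[OF V]])
    have "\<phi> V \<in> hom (Spec_sections M V) (sec X (pre V))"
    proof (rule homI)
      fix \<sigma> \<tau> assume st: "\<sigma> \<in> carrier (Spec_sections M V)" "\<tau> \<in> carrier (Spec_sections M V)"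
      show "\<phi> V (\<sigma> \<otimes>\<^bsub>Spec_sections M V\<^esub> \<tau>) = \<phi> V \<sigma> \<otimes>\<^bsub>sec X (pre V)\<^esub> \<phi> V \<tau>"
      proof (rule \<phi>_eq[OF V])
        fix x assume x: "x \<in> pre V"
        then have xU: "x \<in> U" and xV: "pr x \<in> V" by (auto simp: pre_def)
        show "res X (pre V) (min_nbhd T x) (\<phi> V \<sigma> \<otimes>\<^bsub>sec X (pre V)\<^esub> \<phi> V \<tau>)
            = e x ((\<sigma> \<otimes>\<^bsub>Spec_sections M V\<^esub> \<tau>) (pr x))"
          using unital_homD(2)[OF res_W(1)[OF opre[OF V] x] \<phi>(1)[OF V st(1)] \<phi>(1)[OF V st(2)]]
            unital_homD(2)[OF eh[OF xU] cs[OF st(1) x] cs[OF st(2) x]] xV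
          by (simp add: \<phi>(2)[OF V st(1) x] \<phi>(2)[OF V st(2) x] mult_Spec_sections[OF cM])
      qed (use st \<phi>(1)[OF V] in auto)
    qed (rule \<phi>(1)[OF V])
    moreover have "inj_on (\<phi> V) (carrier (Spec_sections M V))"
    proof (rule inj_onI)
      fix \<sigma> \<tau> assume st: "\<sigma> \<in> carrier (Spec_sections M V)" "\<tau> \<in> carrier (Spec_sections M V)" "\<phi> V \<sigma> = \<phi> V \<tau>"
      have ext: "\<sigma> \<in> extensional V" "\<tau> \<in> extensional V"
        using st carrier_Spec_sections[OF cM VU[OF V]] by auto
      show "\<sigma> = \<tau>"
      proof (rule extensionalityI[OF ext])
        fix P assume P: "P \<in> V"
        then obtain x where x: "x \<in> U" "pr x = P" using VU[OF V] surj by blast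
        then have xp: "x \<in> pre V" using P by (simp add: pre_def)
        have "e x (\<sigma> (pr x)) = e x (\<tau> (pr x))"
          using \<phi>(2)[OF V st(1) xp] \<phi>(2)[OF V st(2) xp] st(3) by simp
        then have "\<sigma> (pr x) = \<tau> (pr x)"
          using eb[OF x(1)] cs[OF st(1) xp] cs[OF st(2) xp] by (auto simp: bij_betw_def inj_on_def)
        then show "\<sigma> P = \<tau> P" using x by simp
      qed
    qed
    \<comment> \<open>Surjectivity: the inverses of the maps \<open>e x\<close> turn a section
      \<open>t\<close> into a family of fractions. Around \<open>pr x\<close> the family is given by
      one fraction, because \<open>t\<close> is a fraction over the minimal neighbourhood of
      \<open>x\<close> and restricting it keeps numerator and denominator.\<close>
    moreover have "t \<in> \<phi> V ` carrier (Spec_sections M V)" if t: "t \<in> carrier (sec X (pre V))" for t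
    proof -
      let ?r = "\<lambda>x. res X (pre V) (min_nbhd T x) t"
      define w where "w = inv_into U pr"
      have w: "w (pr x) = x" if "x \<in> U" for x using inj that by (simp add: w_def)
      define c where "c x = inv_into (carrier (localization M (carrier M - pr x))) (e x) (?r x)" for x
      have rc: "?r x \<in> carrier (min_sec X x)" if "x \<in> pre V" for x
        using unital_homD(1)[OF res_W(1)[OF opre[OF V] that] t] .
      have ec: "e x (c x) = ?r x" if x: "x \<in> pre V" for x
        unfolding c_def by (rule f_inv_into_f) (use eb[of x] rc[OF x] x in \<open>auto simp: bij_betw_def pre_def\<close>)
      have c_eq: "c x = C" if x: "x \<in> pre V" and "C \<in> carrier (localization M (carrier M - pr x))" "e x C = ?r x" for x C
      proof -
        have "inj_on (e x) (carrier (localization M (carrier M - pr x)))"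
          using eb[of x] x by (auto simp: bij_betw_def pre_def)
        then show ?thesis using that(2) unfolding c_def that(3)[symmetric] by (rule inv_into_f_f)
      qed
      define \<sigma> where "\<sigma> = (\<lambda>P\<in>V. c (w P))"
      have \<sigma>w: "\<sigma> (pr x) = c x" if "x \<in> pre V" for x using that w by (auto simp: \<sigma>_def pre_def)
      have "\<sigma> \<in> carrier (Spec_sections M V)"
        unfolding carrier_Spec_sections[OF cM VU[OF V]]
      proof (intro conjI ballI)
        show "\<sigma> \<in> extensional V" by (simp add: \<sigma>_def)
        fix P assume P: "P \<in> V"
        then obtain x where x: "x \<in> U" "pr x = P" using VU[OF V] surj by blast
        then have xp: "x \<in> pre V" using P by (simp add: pre_def)
        obtain a s where as: "a \<in> carrier M" "s \<in> carrier M" "k x s \<in> Units (min_sec X x)"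
          "?r x \<otimes>\<^bsub>min_sec X x\<^esub> k x s = k x a"
          using is_localizationD(2)[OF sp(2)[OF x(1)] rc[OF xp]] by blast
        have s: "s \<notin> pr x" using as ufc[of x] by (auto simp: unit_face_def)
        show "\<exists>V' a f. openin (Spec_topology M) V' \<and> P \<in> V' \<and> V' \<subseteq> V \<and> a \<in> carrier M \<and> f \<in> carrier M \<and>
           (\<forall>Q\<in>V'. f \<notin> Q \<and> \<sigma> Q = fraction M (carrier M - Q) a f)"
        proof (intro exI conjI ballI)
          let ?V = "min_nbhd (Spec_topology M) P"
          show "openin (Spec_topology M) ?V" using oS prime x by auto
          show "P \<in> ?V" by simp
          show "?V \<subseteq> V" by (rule min_nbhd_subset[OF V P])
          show "a \<in> carrier M" "s \<in> carrier M" by fact+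
          fix Q assume "Q \<in> ?V"
          then have "Q \<in> pr ` min_nbhd T x" using im_nb[OF x(1)] x(2) by simp
          then obtain z where z: "z \<in> min_nbhd T x" "Q = pr z" by blast
          have zU: "z \<in> U" using nU[OF x(1)] z by auto
          have zp: "z \<in> pre V" using zU z \<open>Q \<in> ?V\<close> \<open>?V \<subseteq> V\<close> by (auto simp: pre_def)
          show "s \<notin> Q" using mono[OF x(1) z(1)] s z(2) by auto
          then have sz: "s \<notin> pr z" using z by simp
          interpret F: monoid_face M "carrier M - pr z" by (rule monoid_face_prime[OF cM prime[OF zU]])
          have "?r z \<otimes>\<^bsub>min_sec X z\<^esub> k z s = min_res X x z (?r x \<otimes>\<^bsub>min_sec X x\<^esub> k x s)"
            using unital_homD(2)[OF res_hom[OF UT[OF x(1)] z(1)] rc[OF xp] unital_homD(1)[OF kh[OF x(1)] as(2)]]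
              res_W(2)[OF opre[OF V] xp z(1) t] kk[OF x(1) z(1) as(2)] by simp
          also have "\<dots> = k z a" unfolding as(4) by (rule kk[OF x(1) z(1) as(1)])
          finally have "e z (F.frac a s) = ?r z" using ev_eq[OF zU as(1,2) sz rc[OF zp]] by blast
          then have "c z = F.frac a s" using as sz by (intro c_eq[OF zp]) auto
          then show "\<sigma> Q = fraction M (carrier M - Q) a s" using \<sigma>w[OF zp] z by simp
        qed
      qed
      moreover from this have "\<phi> V \<sigma> = t"
        by (rule \<phi>_eq[OF V _ t]) (simp add: \<sigma>w ec)
      ultimately show ?thesis by blast
    qed
    ultimately show ?thesis using \<phi>(1)[OF V] unfolding iso_def bij_betw_def by blast
  qed
  have nat: "res X (pre V) (pre W) (\<phi> V \<sigma>) = \<phi> W (restrict \<sigma> W)"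
    if V: "openin (Spec_topology M) V" and W: "openin (Spec_topology M) W" and WV: "W \<subseteq> V"
      and \<sigma>: "\<sigma> \<in> carrier (Spec_sections M V)" for V W \<sigma>
  proof -
    have pp: "pre W \<subseteq> pre V" using WV by (auto simp: pre_def)
    have rW: "restrict \<sigma> W \<in> carrier (Spec_sections M W)"
      unfolding carrier_Spec_sections[OF cM VU[OF W]]
    proof (intro conjI ballI)
      fix P assume P: "P \<in> W"
      then have PV: "P \<in> V" using WV by auto
      obtain V' a f where V': "openin (Spec_topology M) V'" "P \<in> V'" "V' \<subseteq> V" "a \<in> carrier M" "f \<in> carrier M"
        and *: "\<And>Q. Q \<in> V' \<Longrightarrow> f \<notin> Q \<and> \<sigma> Q = fraction M (carrier M - Q) a f"
        using \<sigma> PV unfolding carrier_Spec_sections[OF cM VU[OF V]] by meson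
      show "\<exists>V' a f. openin (Spec_topology M) V' \<and> P \<in> V' \<and> V' \<subseteq> W \<and> a \<in> carrier M \<and> f \<in> carrier M \<and>
           (\<forall>Q\<in>V'. f \<notin> Q \<and> restrict \<sigma> W Q = fraction M (carrier M - Q) a f)"
        by (rule exI[of _ "V' \<inter> W"], rule exI[of _ a], rule exI[of _ f]) (use V' W P * in auto)
    qed simp
    have op: "openin T (pre V)" "openin T (pre W)" using opre V W by auto
    have "\<phi> W (restrict \<sigma> W) = res X (pre V) (pre W) (\<phi> V \<sigma>)"
    proof (rule \<phi>_eq[OF W rW])
      show "res X (pre V) (pre W) (\<phi> V \<sigma>) \<in> carrier (sec X (pre W))"
        by (rule unital_homD(1)[OF presheafD(2)[OF presheaf op pp] \<phi>(1)[OF V \<sigma>]])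
      fix x assume x: "x \<in> pre W"
      then have xV: "x \<in> pre V" using pp by auto
      have "res X (pre W) (min_nbhd T x) (res X (pre V) (pre W) (\<phi> V \<sigma>)) = res X (pre V) (min_nbhd T x) (\<phi> V \<sigma>)"
        by (rule presheafD(4)[OF presheaf op open_nb[OF open_top[OF op(2) x]] pp min_nbhd_subset[OF op(2) x] \<phi>(1)[OF V \<sigma>]])
      then show "res X (pre W) (min_nbhd T x) (res X (pre V) (pre W) (\<phi> V \<sigma>)) = e x (restrict \<sigma> W (pr x))"
        using \<phi>(2)[OF V \<sigma> xV] x by (simp add: pre_def)
    qed
    then show ?thesis by simp
  qed
  show ?thesis
    unfolding isomorphic_spaces_def M_def[symmetric]
    unfolding U_def[symmetric] open_subspace_simps sec_Spec[OF cM] base_Spec[OF cM] res_Spec[OF cM] tU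
    by (rule exI[of _ pr], rule exI[of _ \<phi>], intro conjI allI impI ballI) (simp_all add: homeo iso[unfolded pre_def] nat[unfolded pre_def])
qed

lemma is_monoid_scheme: "is_monoid_scheme X"
  unfolding is_monoid_scheme_def
proof (intro conjI ballI sheaf)
  fix x assume x: "x \<in> topspace T"
  show "\<exists>U. openin T U \<and> x \<in> U \<and> (\<exists>M :: 'a monoid. comm_monoid M \<and> isomorphic_spaces (open_subspace X U) (Spec M))"
    by (rule exI[of _ "min_nbhd T x"], intro conjI exI[of _ "min_sec X x"])
       (use open_nb[OF x] cm[OF x] isomorphic_Spec[OF x] in simp_all)
qed

lemma finite_type: "finite_type X"
  unfolding finite_type_def
proof (intro exI[of _ "min_nbhd T ` topspace T"] conjI ballI)
  show "\<Union>(min_nbhd T ` topspace T) = topspace T" using union_min_nbhd[of "topspace T"] by simp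
  fix U assume "U \<in> min_nbhd T ` topspace T"
  then obtain x where x: "x \<in> topspace T" "U = min_nbhd T x" by auto
  show "openin T U" using open_nb x by simp
  show "\<exists>M :: 'a monoid. comm_monoid M \<and> monoid_finitely_generated M \<and> isomorphic_spaces (open_subspace X U) (Spec M)"
    by (intro exI[of _ "min_sec X x"] conjI)
       (use cm[OF x(1)] isomorphic_Spec[OF x(1)] fg_spectrum_atD(1)[OF spectrum[OF x(1)]] x(2) in simp_all)
qed (simp add: finT)

end

theorem stalkwise_scheme_iff:
  "stalkwise_scheme X \<longleftrightarrow> is_monoid_scheme X \<and> finite_type X"
  using stalkwise_scheme_of_finite_type stalkwise.is_monoid_scheme stalkwise.finite_type
  by (auto simp: stalkwise_def)

text \<open>Every condition is now attached to a single point and the points below it, the form in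
  which it can be passed between spaces.\<close>

lemma s_smooth_iff:
  "s_smooth X \<longleftrightarrow> stalkwise_scheme X \<and>
     (\<forall>y\<in>topspace (base X). \<forall>x\<in>min_nbhd (base X) y. inj_on (min_res X y x) (Units (min_sec X y))) \<and>
     (\<forall>x\<in>topspace (base X).
        locally_flasque_at (base X) (quotient_functor (units_functor (sM_functor X)) (O_units X)) x)"
  using stalkwise.s_cancellative_iff[of X] stalkwise.s_flasque_iff[of X] stalkwise_scheme_iff[of X]
  unfolding s_smooth_def stalkwise_def by blast


section \<open>Open subschemes\<close>

lemma sheaf_open_subspace:
  assumes "sheaf_of_monoids X" "openin (base X) U"
  shows "sheaf_of_monoids (open_subspace X U)"
proof -
  have o: "openin (subtopology (base X) U) V \<Longrightarrow> openin (base X) V" for V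
    using assms(2) by (simp add: openin_open_subtopology)
  have psh: "presheaf_of_monoids X" using assms(1) by (simp add: sheaf_of_monoids_def)
  have "presheaf_of_monoids (open_subspace X U)"
    using psh o unfolding presheaf_of_monoids_def open_subspace_simps by simp
  moreover have "s = t" if "\<forall>V\<in>\<U>. openin (subtopology (base X) U) V"
    "s \<in> carrier (sec X (\<Union>\<U>))" "t \<in> carrier (sec X (\<Union>\<U>))"
    "\<forall>V\<in>\<U>. res X (\<Union>\<U>) V s = res X (\<Union>\<U>) V t" for \<U> s t
    by (rule sheaf_separated[OF assms(1) _ refl that(2,3)]) (use that o in auto)
  moreover have "\<exists>t\<in>carrier (sec X (\<Union>\<U>)). \<forall>V\<in>\<U>. res X (\<Union>\<U>) V t = s V"
    if "\<forall>V\<in>\<U>. openin (subtopology (base X) U) V \<and> s V \<in> carrier (sec X V)"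
      "\<forall>V\<in>\<U>. \<forall>W\<in>\<U>. res X V (V \<inter> W) (s V) = res X W (V \<inter> W) (s W)" for \<U> s
    by (rule sheaf_glue[OF assms(1)]) (use that o in auto)
  ultimately show ?thesis unfolding sheaf_of_monoids_def open_subspace_simps by blast
qed

text \<open>The definition of \<open>fg_spectrum_at\<close> refers only to the points below
  \<open>y\<close>.\<close>

lemma fg_spectrum_at_cong:
  assumes sp: "fg_spectrum_at T A r y"
    and "\<And>z. z \<in> min_nbhd T y \<Longrightarrow> min_nbhd T' z = min_nbhd T z \<and> A' z = A z \<and> r' y z = r y z"
  shows "fg_spectrum_at T' A' r' y"
proof -
  have y: "min_nbhd T' y = min_nbhd T y" "A' y = A y" using assms(2)[of y] by auto
  have uf: "unit_face (A' y) (A' z) (r' y z) = unit_face (A y) (A z) (r y z)" if "z \<in> min_nbhd T y" for z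
    using assms(2)[OF that] y by simp
  note s = fg_spectrum_atD[OF sp]
  show ?thesis
    unfolding fg_spectrum_at_def y(1)
  proof (intro conjI ballI allI impI inj_onI)
    show "monoid_finitely_generated (A' y)" using s(1) y by simp
    show "is_localization (A' y) (A' x) (r' y x)" if "x \<in> min_nbhd T y" for x
      using s(2)[OF that] assms(2)[OF that] y by simp
    show "x = x'" if "x \<in> min_nbhd T y" "x' \<in> min_nbhd T y"
      "unit_face (A' y) (A' x) (r' y x) = unit_face (A' y) (A' x') (r' y x')" for x x'
      using s(3)[OF that(1,2)] that(3) uf[OF that(1)] uf[OF that(2)] by simp
    show "\<exists>x\<in>min_nbhd T y. unit_face (A' y) (A' x) (r' y x) = S" if "face (A' y) S" for S
      using s(4)[of S] that uf y(2) by auto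
    show "x \<in> min_nbhd T' x'" if "x \<in> min_nbhd T y" "x' \<in> min_nbhd T y"
      "unit_face (A' y) (A' x') (r' y x') \<subseteq> unit_face (A' y) (A' x) (r' y x)" for x x'
      using s(5)[OF that(1,2)] that(3) uf[OF that(1)] uf[OF that(2)] assms(2)[OF that(2)] by simp
  qed
qed

context stalkwise
begin

lemma min_open_subspace:
  assumes U: "openin T U" and x: "x \<in> U"
  shows "min_nbhd (subtopology T U) x = min_nbhd T x" "min_sec (open_subspace X U) x = min_sec X x"
    and "y \<in> U \<Longrightarrow> min_res (open_subspace X U) y x = min_res X y x"
  using min_nbhd_subtopology[OF U] x by simp_all

lemma stalkwise_open_subspace:
  assumes U: "openin T U"
  shows "stalkwise (open_subspace X U)"
proof -
  have tU: "topspace (subtopology T U) = U" using openin_subset[OF U] by auto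
  have "openin (subtopology T U) (min_nbhd (subtopology T U) y)"
    "fg_spectrum_at (subtopology T U) (min_sec (open_subspace X U)) (min_res (open_subspace X U)) y"
    if y: "y \<in> U" for y
  proof -
    have yT: "y \<in> topspace T" by (rule open_top[OF U y])
    show "openin (subtopology T U) (min_nbhd (subtopology T U) y)"
      using U open_nb[OF yT] min_nbhd_subset[OF U y]
      by (simp add: min_nbhd_subtopology[OF U y] openin_open_subtopology)
    show "fg_spectrum_at (subtopology T U) (min_sec (open_subspace X U)) (min_res (open_subspace X U)) y"
      using min_open_subspace[OF U] min_nbhd_subset[OF U y] y
      by (intro fg_spectrum_at_cong[OF spectrum[OF yT]]) blast
  qed
  moreover have "finite U" using finT openin_subset[OF U] finite_subset by blast
  ultimately show ?thesis
    using sheaf_open_subspace[OF sheaf U] unfolding stalkwise_def stalkwise_scheme_def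
    by (simp add: tU[simplified])
qed

text \<open>The two functors are not equal, because germs in \<open>U\<close> and in
  \<open>X\<close> are different sets. Both are models over the sections of \<open>X\<close> on
  minimal neighbourhoods, so \<open>locally_flasque_at_transfer\<close> applies in both
  directions.\<close>

lemma locally_flasque_open_subspace:
  assumes U: "openin T U" and x: "x \<in> U"
  shows "locally_flasque_at (subtopology T U)
       (quotient_functor (units_functor (sM_functor (open_subspace X U))) (O_units (open_subspace X U))) x
     \<longleftrightarrow> locally_flasque_at T QF x"
proof -
  interpret S: stalkwise "open_subspace X U" by (rule stalkwise_open_subspace[OF U])
  let ?D = "min_nbhd T x"
  have xT: "x \<in> topspace T" by (rule open_top[OF U x])
  have DU: "?D \<subseteq> U" by (rule min_nbhd_subset[OF U x])
  have tU: "topspace (subtopology T U) = U" using openin_subset[OF U] by auto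
  note m = min_open_subspace[OF U]
  have 1: "quotient_model T ?D (min_sec X) (min_res X) QF (\<lambda>y. QF_proj y \<circ> gm y)"
    by (rule quotient_model_subset[OF quotient_model_min min_nbhd_subset_topspace[OF xT]])
  have 2: "quotient_model (subtopology T U) ?D (min_sec (open_subspace X U)) (min_res (open_subspace X U))
     S.QF (\<lambda>y. S.QF_proj y \<circ> S.gm y)"
    using quotient_model_subset[OF S.quotient_model_min, of ?D] DU tU min_nbhd_subset_topspace[OF xT] by simp
  \<comment> \<open>The monoids of the subspace agree with those of \<open>X\<close> only at the
    points of \<open>U\<close>, so a transport along the identity takes the place of
    rewriting.\<close>
  have 3: "quotient_model (subtopology T U) ?D (min_sec X) (min_res X)
     S.QF (\<lambda>y. (S.QF_proj y \<circ> S.gm y) \<circ> (\<lambda>a. a))"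
  proof (rule quotient_model_iso[OF 2])
    fix y z assume y: "y \<in> ?D" and z: "z \<in> min_nbhd (subtopology T U) y"
    have yU: "y \<in> U" using y DU by auto
    have z': "z \<in> min_nbhd T y" using z m(1)[OF yU] by simp
    then show zD: "z \<in> ?D" using min_nbhd_mono[OF y] by auto
    fix a assume a: "a \<in> carrier (min_sec X y)"
    have zU: "z \<in> U" using zD DU by auto
    show "min_res X y z a \<in> carrier (min_sec X z) \<and>
      min_res X y z a = min_res (open_subspace X U) y z a"
      using unital_homD(1)[OF res_hom[OF open_top[OF U yU] z'] a] m(3)[OF zU yU] by simp
  next
    fix y assume y: "y \<in> ?D"
    then have yU: "y \<in> U" using DU by auto
    show "comm_monoid (min_sec X y)" by (rule cm[OF open_top[OF U yU]])
    show "unital_iso (min_sec X y) (min_sec (open_subspace X U) y) (\<lambda>a. a)"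
      unfolding m(2)[OF yU] by (simp add: unital_iso_def unital_hom_def hom_def bij_betw_def)
  qed
  have nb: "min_nbhd (subtopology T U) z = min_nbhd T z" if "z \<in> ?D" for z
    using m(1) that DU by blast
  have nbx: "min_nbhd (subtopology T U) x = ?D" using m(1)[OF x] .
  show ?thesis
  proof
    assume "locally_flasque_at T QF x"
    then show "locally_flasque_at (subtopology T U) S.QF x"
      using locally_flasque_at_transfer[OF 1 3[folded nbx] nb xT] x xT tU by simp
  next
    assume "locally_flasque_at (subtopology T U) S.QF x"
    then show "locally_flasque_at T QF x"
      using locally_flasque_at_transfer[OF 3[folded nbx] 1 nb[symmetric]] x tU xT nbx by simp
  qed
qed

lemma s_smooth_local:
  assumes U: "\<And>i. i \<in> I \<Longrightarrow> openin T (U i)" and cover: "(\<Union>i\<in>I. U i) = topspace T"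
  shows "s_smooth X \<longleftrightarrow> (\<forall>i\<in>I. s_smooth (open_subspace X (U i)))"
proof -
  have tU: "topspace (subtopology T (U i)) = U i" if "i \<in> I" for i
    using openin_subset[OF U[OF that]] by auto
  have "s_smooth (open_subspace X (U i)) \<longleftrightarrow>
     (\<forall>y\<in>U i. \<forall>x\<in>min_nbhd T y. inj_on (min_res X y x) (Units (min_sec X y))) \<and>
     (\<forall>x\<in>U i. locally_flasque_at T QF x)" if i: "i \<in> I" for i
  proof -
    have st: "stalkwise_scheme (open_subspace X (U i))"
      using stalkwise_open_subspace[OF U[OF i]] by (simp add: stalkwise_def)
    note m = min_open_subspace[OF U[OF i]]
    have "inj_on (min_res (open_subspace X (U i)) y x) (Units (min_sec (open_subspace X (U i)) y))
       \<longleftrightarrow> inj_on (min_res X y x) (Units (min_sec X y))" if y: "y \<in> U i" and x: "x \<in> min_nbhd T y" for x y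
    proof -
      have "x \<in> U i" using min_nbhd_subset[OF U[OF i] y] x by auto
      then show ?thesis using m(2)[OF y] m(3)[OF _ y] by simp
    qed
    then show ?thesis
      unfolding s_smooth_iff open_subspace_simps(1) tU[OF i]
      using st m(1) locally_flasque_open_subspace[OF U[OF i]] by (metis (no_types, lifting))
  qed
  then show ?thesis
    unfolding s_smooth_iff cover[symmetric] using stalkwise by auto
qed

end

section \<open>Smooth monoid schemes\<close>

lemma carrier_free_NZ: "a \<in> carrier (free_NZ r s) \<longleftrightarrow> fst a \<in> extensional {..<r} \<and> snd a \<in> extensional {..<s}"
  by (cases a) (simp add: free_NZ_def nat_monoid_def PiE_def)

lemma mult_free_NZ:
  "a \<otimes>\<^bsub>free_NZ r s\<^esub> b = ((\<lambda>i\<in>{..<r}. fst a i + fst b i), (\<lambda>i\<in>{..<s}. snd a i + snd b i))"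
  by (cases a; cases b) (simp add: free_NZ_def nat_monoid_def product_group_def)

lemma one_free_NZ: "\<one>\<^bsub>free_NZ r s\<^esub> = ((\<lambda>i\<in>{..<r}. 0), (\<lambda>i\<in>{..<s}. 0))"
  by (simp add: free_NZ_def nat_monoid_def product_group_def)

lemma free_NZ_eqI:
  assumes "a \<in> carrier (free_NZ r s)" "b \<in> carrier (free_NZ r s)"
    "\<And>i. i < r \<Longrightarrow> fst a i = fst b i" "\<And>i. i < s \<Longrightarrow> snd a i = snd b i"
  shows "a = b"
  using assms unfolding carrier_free_NZ
  by (intro prod_eqI extensionalityI[of _ "{..<r}"] extensionalityI[of _ "{..<s}"]) auto

lemma comm_monoid_free_NZ: "comm_monoid (free_NZ r s)"
proof (rule comm_monoidI)
  fix a assume "a \<in> carrier (free_NZ r s)"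
  then show "\<one>\<^bsub>free_NZ r s\<^esub> \<otimes>\<^bsub>free_NZ r s\<^esub> a = a"
    by (intro free_NZ_eqI[of _ r s]) (auto simp: carrier_free_NZ mult_free_NZ one_free_NZ)
qed (auto simp: carrier_free_NZ mult_free_NZ one_free_NZ fun_eq_iff)

lemma free_NZ_cancel:
  assumes "a \<in> carrier (free_NZ r s)" "b \<in> carrier (free_NZ r s)" "c \<in> carrier (free_NZ r s)"
    "c \<otimes>\<^bsub>free_NZ r s\<^esub> a = c \<otimes>\<^bsub>free_NZ r s\<^esub> b"
  shows "a = b"
proof (rule free_NZ_eqI[OF assms(1,2)])
  show "fst a i = fst b i" if "i < r" for i
    using fun_cong[OF arg_cong[OF assms(4), of fst], of i] that by (simp add: mult_free_NZ)
  show "snd a i = snd b i" if "i < s" for i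
    using fun_cong[OF arg_cong[OF assms(4), of snd], of i] that by (simp add: mult_free_NZ)
qed

lemma pow_free_NZ:
  assumes "a \<in> carrier (free_NZ r s)" "i < r"
  shows "fst (a [^]\<^bsub>free_NZ r s\<^esub> (n::nat)) i = n * fst a i"
proof -
  interpret M: comm_monoid "free_NZ r s" by (rule comm_monoid_free_NZ)
  show ?thesis using assms(2) by (induction n) (auto simp: one_free_NZ mult_free_NZ)
qed

text \<open>For a face \<open>S\<close> these are the coordinates not inverted by localizing at
  \<open>S\<close>, equivalently those whose unit vectors generate the complementary prime
  ideal.\<close>

definition vanishing :: "nat \<Rightarrow> ((nat \<Rightarrow> nat) \<times> (nat \<Rightarrow> int)) set \<Rightarrow> nat set" where
  "vanishing r S = {i. i < r \<and> (\<forall>a\<in>S. fst a i = 0)}"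

text \<open>Multiplying one element of \<open>S\<close> for each coordinate outside
  \<open>vanishing r S\<close> gives some \<open>b\<close> in \<open>S\<close> that is positive at
  all of them. An element \<open>a\<close> that is zero on \<open>vanishing r S\<close> divides a
  power of \<open>b\<close>, and \<open>S\<close> is closed under divisors.\<close>

lemma face_free_NZ_iff:
  assumes S: "face (free_NZ r s) S" and a: "a \<in> carrier (free_NZ r s)"
  shows "a \<in> S \<longleftrightarrow> (\<forall>i\<in>vanishing r S. fst a i = 0)"
proof
  show "a \<in> S \<Longrightarrow> \<forall>i\<in>vanishing r S. fst a i = 0" by (auto simp: vanishing_def)
  assume *: "\<forall>i\<in>vanishing r S. fst a i = 0"
  interpret M: comm_monoid "free_NZ r s" by (rule comm_monoid_free_NZ)
  note fS = faceD[OF S]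
  have "\<exists>b\<in>S. \<forall>j\<in>J. 0 < fst b j" if "finite J" "J \<subseteq> {..<r} - vanishing r S" for J
    using that
  proof (induction J rule: finite_induct)
    case empty
    show ?case using fS(2) by (intro bexI[of _ "\<one>\<^bsub>free_NZ r s\<^esub>"]) auto
  next
    case (insert j J)
    then obtain b where b: "b \<in> S" "\<forall>j\<in>J. 0 < fst b j" by auto
    obtain c where c: "c \<in> S" "0 < fst c j" using insert(4) by (auto simp: vanishing_def)
    have "b \<otimes>\<^bsub>free_NZ r s\<^esub> c \<in> S" using fS(1,3) b c by blast
    moreover have "0 < fst (b \<otimes>\<^bsub>free_NZ r s\<^esub> c) i" if "i \<in> insert j J" for i
      using that b c insert(4) by (auto simp: mult_free_NZ)
    ultimately show ?case by blast
  qed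
  then obtain b where b: "b \<in> S" "\<And>j. j < r \<Longrightarrow> j \<notin> vanishing r S \<Longrightarrow> 0 < fst b j"
    by (metis Diff_iff finite_Diff finite_lessThan lessThan_iff subset_refl)
  have bc: "b \<in> carrier (free_NZ r s)" using fS(1) b by blast
  \<comment> \<open>The sum bounds every natural coordinate of \<open>a\<close>, so the
    \<open>n\<close>-th power of \<open>b\<close> dominates \<open>a\<close>.\<close>
  define n where "n = (\<Sum>i<r. fst a i)"
  define p where "p = b [^]\<^bsub>free_NZ r s\<^esub> n"
  have "b [^]\<^bsub>free_NZ r s\<^esub> (k::nat) \<in> S" for k
    by (induction k) (use fS bc b in auto)
  then have pS: "p \<in> S" by (simp add: p_def)
  then have pc: "p \<in> carrier (free_NZ r s)" by (rule fS(1))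
  have le: "fst a i \<le> fst p i" if i: "i < r" for i
  proof (cases "i \<in> vanishing r S")
    case False
    then have "1 \<le> fst b i" using b(2)[OF i] by simp
    moreover have "fst a i \<le> n" unfolding n_def using i by (intro member_le_sum) auto
    ultimately have "fst a i * 1 \<le> n * fst b i" by (intro mult_mono) auto
    then show ?thesis using pow_free_NZ[OF bc i] by (simp add: p_def)
  qed (use * in auto)
  \<comment> \<open>Truncated subtraction is exact in the first component by \<open>le\<close>. The
    second component is a group, where differences always exist.\<close>
  define c where "c = ((\<lambda>i\<in>{..<r}. fst p i - fst a i), (\<lambda>i\<in>{..<s}. snd p i - snd a i))"
  have cc: "c \<in> carrier (free_NZ r s)" by (simp add: c_def carrier_free_NZ)
  have "a \<otimes>\<^bsub>free_NZ r s\<^esub> c = p"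
    by (rule free_NZ_eqI[OF _ pc]) (use a cc le in \<open>auto simp: mult_free_NZ c_def carrier_free_NZ\<close>)
  then show "a \<in> S" using fS(3)[OF a cc] pS by simp
qed

lemma face_coordinate:
  "i < r \<Longrightarrow> face (free_NZ r s) {a \<in> carrier (free_NZ r s). fst a i = 0}"
  by (auto simp: face_def carrier_free_NZ one_free_NZ mult_free_NZ)

text \<open>For any other coordinate \<open>j\<close>, the unit vector at \<open>j\<close> lies in
  this face and excludes \<open>j\<close>.\<close>

lemma vanishing_coordinate:
  assumes "i < r"
  shows "vanishing r {a \<in> carrier (free_NZ r s). fst a i = 0} = {i}"
proof -
  have "((\<lambda>k\<in>{..<r}. if k = j then 1 else 0), (\<lambda>k\<in>{..<s}. 0)) \<in> {a \<in> carrier (free_NZ r s). fst a i = 0}"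
    if "j < r" "j \<noteq> i" for j
    using that assms by (auto simp: carrier_free_NZ)
  then show ?thesis using assms by (fastforce simp: vanishing_def)
qed


text \<open>The group \<open>\<int>^E\<close>, as functions on all indices that are zero off
  \<open>E\<close>. Passing to a smaller set is then truncation within one type.\<close>

definition supported_group :: "nat set \<Rightarrow> (nat \<Rightarrow> int) monoid" where
  "supported_group E =
     \<lparr>carrier = {h. \<forall>i. i \<notin> E \<longrightarrow> h i = 0}, mult = (\<lambda>h k i. h i + k i), one = (\<lambda>_. 0)\<rparr>"

lemma supported_group_simps [simp]:
  "h \<in> carrier (supported_group E) \<longleftrightarrow> (\<forall>i. i \<notin> E \<longrightarrow> h i = 0)"
  "h \<otimes>\<^bsub>supported_group E\<^esub> k = (\<lambda>i. h i + k i)"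
  "\<one>\<^bsub>supported_group E\<^esub> = (\<lambda>_. 0)"
  by (simp_all add: supported_group_def)

lemma comm_group_supported_group: "comm_group (supported_group E)"
proof (rule comm_groupI)
  fix h assume "h \<in> carrier (supported_group E)"
  then show "\<exists>k\<in>carrier (supported_group E). k \<otimes>\<^bsub>supported_group E\<^esub> h = \<one>\<^bsub>supported_group E\<^esub>"
    by (intro bexI[of _ "\<lambda>i. - h i"]) auto
qed (auto simp: fun_eq_iff)

context stalkwise
begin

text \<open>Cancellation in the free monoid makes the localization maps injective, which gives the
  first claim. For the second, the exponents at the coordinates in \<open>E z\<close> identify the
  stalk at \<open>z\<close> with \<open>\<int>^E\<close> for \<open>E = E z\<close>, and restriction
  forgets the coordinates that become invertible.\<close>

lemma free_NZ_chart:
  assumes U: "openin T U" and chart: "affine_chart X U (free_NZ r s) f g" and y: "y \<in> U"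
  shows "x \<in> min_nbhd T y \<Longrightarrow> inj_on (min_res X y x) (carrier (min_sec X y))"
    and "locally_flasque_at T QF y"
proof -
  define M where "M = free_NZ r s"
  note c = affine_chartD[OF chart, folded M_def]
  have cM: "comm_monoid M" unfolding M_def by (rule comm_monoid_free_NZ)
  interpret M: comm_monoid M by (rule cM)
  note cancel = free_NZ_cancel[of _ r s, folded M_def]
  have UT: "z \<in> topspace T" if "z \<in> U" for z using open_top[OF U that] .
  have nU: "w \<in> U" if "z \<in> U" "w \<in> min_nbhd T z" for z w using min_nbhd_subset[OF U that(1)] that(2) by auto
  have cN: "comm_monoid (min_sec X z)" if "z \<in> U" for z by (rule cm[OF UT[OF that]])
  have gh: "unital_hom M (min_sec X z) (g z)" if "z \<in> U" for z by (rule is_localizationD(1)[OF c(3)[OF that]])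
  have rh: "unital_hom (min_sec X z) (min_sec X w) (min_res X z w)" if "z \<in> U" "w \<in> min_nbhd T z" for z w
    by (rule res_hom[OF UT[OF that(1)] that(2)])
  have ginj: "a = b" if z: "z \<in> U" and ab: "a \<in> carrier M" "b \<in> carrier M" and e: "g z a = g z b" for z a b
  proof -
    obtain u where "u \<in> carrier M" "u \<otimes>\<^bsub>M\<^esub> a = u \<otimes>\<^bsub>M\<^esub> b"
      using is_localizationD(3)[OF c(3)[OF z] ab e] by blast
    then show ?thesis using cancel[OF ab] by simp
  qed
  have rep: "\<exists>a s. a \<in> carrier M \<and> s \<in> carrier M \<and> g z s \<in> Units (min_sec X z) \<and> n \<otimes>\<^bsub>min_sec X z\<^esub> g z s = g z a"
    if "z \<in> U" "n \<in> carrier (min_sec X z)" for z n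
    using is_localizationD(2)[OF c(3)[OF that(1)] that(2)] .
  show "inj_on (min_res X y x) (carrier (min_sec X y))" if x: "x \<in> min_nbhd T y"
  proof (rule inj_onI)
    fix n m assume nm: "n \<in> carrier (min_sec X y)" "m \<in> carrier (min_sec X y)" "min_res X y x n = min_res X y x m"
    have xU: "x \<in> U" by (rule nU[OF y x])
    interpret N: comm_monoid "min_sec X y" by (rule cN[OF y])
    interpret K: comm_monoid "min_sec X x" by (rule cN[OF xU])
    note g' = unital_homD[OF gh[OF y]] and gx = unital_homD[OF gh[OF xU]] and r' = unital_homD[OF rh[OF y x]]
    obtain a s where a: "a \<in> carrier M" "s \<in> carrier M" "g y s \<in> Units (min_sec X y)" "n \<otimes>\<^bsub>min_sec X y\<^esub> g y s = g y a"
      using rep[OF y nm(1)] by blast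
    obtain b t where b: "b \<in> carrier M" "t \<in> carrier M" "g y t \<in> Units (min_sec X y)" "m \<otimes>\<^bsub>min_sec X y\<^esub> g y t = g y b"
      using rep[OF y nm(2)] by blast
    have rn: "min_res X y x n \<otimes>\<^bsub>min_sec X x\<^esub> g x s = g x a"
      using r'(2)[OF nm(1) g'(1)[OF a(2)]] a c(5)[OF y x] by simp
    have rm: "min_res X y x n \<otimes>\<^bsub>min_sec X x\<^esub> g x t = g x b"
      using r'(2)[OF nm(2) g'(1)[OF b(2)]] b c(5)[OF y x] nm(3) by simp
    have rc: "min_res X y x n \<in> carrier (min_sec X x)" using r'(1) nm by simp
    have "g x (a \<otimes>\<^bsub>M\<^esub> t) = min_res X y x n \<otimes>\<^bsub>min_sec X x\<^esub> g x s \<otimes>\<^bsub>min_sec X x\<^esub> g x t"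
      using a b by (simp add: gx rn)
    also have "\<dots> = min_res X y x n \<otimes>\<^bsub>min_sec X x\<^esub> g x t \<otimes>\<^bsub>min_sec X x\<^esub> g x s"
      using rc gx(1)[OF a(2)] gx(1)[OF b(2)] by (simp add: K.m_ac)
    also have "\<dots> = g x (b \<otimes>\<^bsub>M\<^esub> s)" using a b by (simp add: gx rm)
    \<comment> \<open>The map \<open>g x\<close> is injective by cancellation, so the relation
      between numerators and denominators holds in \<open>M\<close> itself and can be mapped back to
      the sections at \<open>y\<close>.\<close>
    finally have e: "a \<otimes>\<^bsub>M\<^esub> t = b \<otimes>\<^bsub>M\<^esub> s" using ginj[OF xU] a b by simp
    have "n \<otimes>\<^bsub>min_sec X y\<^esub> (g y s \<otimes>\<^bsub>min_sec X y\<^esub> g y t) = g y (a \<otimes>\<^bsub>M\<^esub> t)"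
      using nm(1) a b g'(1)[OF a(2)] g'(1)[OF b(2)] by (simp add: g'(2) flip: a(4) N.m_assoc)
    also have "\<dots> = m \<otimes>\<^bsub>min_sec X y\<^esub> (g y t \<otimes>\<^bsub>min_sec X y\<^esub> g y s)"
      unfolding e using nm(2) a b g'(1)[OF a(2)] g'(1)[OF b(2)] by (simp add: g'(2) flip: b(4) N.m_assoc)
    also have "\<dots> = m \<otimes>\<^bsub>min_sec X y\<^esub> (g y s \<otimes>\<^bsub>min_sec X y\<^esub> g y t)"
      using g'(1)[OF a(2)] g'(1)[OF b(2)] by (simp add: N.m_comm)
    finally have *: "n \<otimes>\<^bsub>min_sec X y\<^esub> (g y s \<otimes>\<^bsub>min_sec X y\<^esub> g y t)
      = m \<otimes>\<^bsub>min_sec X y\<^esub> (g y s \<otimes>\<^bsub>min_sec X y\<^esub> g y t)" .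
    show "n = m" by (rule N.Units_cancel[OF _ nm(1,2) *]) (use a(3) b(3) in auto)
  qed
  \<comment> \<open>The coordinates that are not invertible at \<open>z\<close>; smaller points have
    fewer of them.\<close>
  define E where "E z = vanishing r (carrier M - f z)" for z
  have prime: "monoid_prime M (f z)" if "z \<in> U" for z using c(1) that by (auto simp: bij_betw_def)
  have face: "face M (carrier M - f z)" if "z \<in> U" for z
    using prime[OF that] by (simp add: monoid_prime_iff_face[OF cM])
  have unit: "g z a \<in> Units (min_sec X z) \<longleftrightarrow> (\<forall>i\<in>E z. fst a i = 0)" if z: "z \<in> U" and a: "a \<in> carrier M" for z a
  proof -
    have "g z a \<in> Units (min_sec X z) \<longleftrightarrow> a \<in> carrier M - f z" using c(4)[OF z] a by (auto simp: unit_face_def)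
    then show ?thesis using face_free_NZ_iff[of r s "carrier M - f z" a] face[OF z] a by (simp add: M_def E_def)
  qed
  have Er: "i < r" if "i \<in> E z" for i z using that by (auto simp: E_def vanishing_def)
  have Emono: "E w \<subseteq> E z" if "z \<in> U" "w \<in> min_nbhd T z" for z w
    using c(2)[OF nU[OF that] that(1)] that(2) by (auto simp: E_def vanishing_def)
  have "\<forall>z\<in>U. \<forall>n\<in>carrier (min_sec X z). \<exists>a. \<exists>s. a \<in> carrier M \<and> s \<in> carrier M \<and> g z s \<in> Units (min_sec X z) \<and>
       n \<otimes>\<^bsub>min_sec X z\<^esub> g z s = g z a"
    using rep by blast
  then obtain ra where ra: "\<And>z n. z \<in> U \<Longrightarrow> n \<in> carrier (min_sec X z) \<Longrightarrow> \<exists>s. ra z n \<in> carrier M \<and> s \<in> carrier M \<and>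
       g z s \<in> Units (min_sec X z) \<and> n \<otimes>\<^bsub>min_sec X z\<^esub> g z s = g z (ra z n)" by metis
  \<comment> \<open>The exponents of the chosen numerator. Denominators are units at
    \<open>z\<close> and have exponent zero on \<open>E z\<close>, so by the next fact
    \<open>v\<close> any other fraction gives the same value.\<close>
  define v where "v z n = (\<lambda>i. if i \<in> E z then int (fst (ra z n) i) else 0)" for z n
  have mult_fst: "fst (a \<otimes>\<^bsub>M\<^esub> b) i = fst a i + fst b i" if "i \<in> E z" for a b i z
    using Er[OF that] by (simp add: M_def mult_free_NZ)
  have v: "v z n = (\<lambda>i. if i \<in> E z then int (fst a i) else 0)"
    if z: "z \<in> U" and n: "n \<in> carrier (min_sec X z)" and a: "a \<in> carrier M" "s \<in> carrier M"
      "g z s \<in> Units (min_sec X z)" "n \<otimes>\<^bsub>min_sec X z\<^esub> g z s = g z a" for z n a s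
  proof -
    interpret N: comm_monoid "min_sec X z" by (rule cN[OF z])
    note g' = unital_homD[OF gh[OF z]]
    obtain t where b: "ra z n \<in> carrier M" "t \<in> carrier M" "g z t \<in> Units (min_sec X z)"
      "n \<otimes>\<^bsub>min_sec X z\<^esub> g z t = g z (ra z n)" using ra[OF z n] by blast
    have "g z (a \<otimes>\<^bsub>M\<^esub> t) = n \<otimes>\<^bsub>min_sec X z\<^esub> g z s \<otimes>\<^bsub>min_sec X z\<^esub> g z t" using a b by (simp add: g'(2))
    also have "\<dots> = n \<otimes>\<^bsub>min_sec X z\<^esub> g z t \<otimes>\<^bsub>min_sec X z\<^esub> g z s"
      using n g'(1)[OF a(2)] g'(1)[OF b(2)] by (simp add: N.m_ac)
    also have "\<dots> = g z (ra z n \<otimes>\<^bsub>M\<^esub> s)" using a b by (simp add: g'(2))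
    finally have e: "a \<otimes>\<^bsub>M\<^esub> t = ra z n \<otimes>\<^bsub>M\<^esub> s" using ginj[OF z] a b by simp
    have "fst a i = fst (ra z n) i" if i: "i \<in> E z" for i
    proof -
      have "fst (a \<otimes>\<^bsub>M\<^esub> t) i = fst (ra z n \<otimes>\<^bsub>M\<^esub> s) i" by (simp only: e)
      moreover have "fst t i = 0" "fst s i = 0" using unit[OF z] a b i by auto
      ultimately show ?thesis using mult_fst[OF i] by simp
    qed
    then show ?thesis by (auto simp: v_def)
  qed
  define F where "F = \<lparr>obj = (\<lambda>z. supported_group (E z)), arr = (\<lambda>z w h i. if i \<in> E w then h i else (0::int))\<rparr>"
  have vg: "v z (g z a) = (\<lambda>i. if i \<in> E z then int (fst a i) else 0)" if z: "z \<in> U" and a: "a \<in> carrier M" for z a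
  proof -
    interpret N: comm_monoid "min_sec X z" by (rule cN[OF z])
    note g' = unital_homD[OF gh[OF z]]
    show ?thesis by (rule v[OF z g'(1)[OF a] a M.one_closed]) (use g' a in auto)
  qed
  have vmult: "v z (n \<otimes>\<^bsub>min_sec X z\<^esub> m) = (\<lambda>i. v z n i + v z m i)"
    if z: "z \<in> U" and nm: "n \<in> carrier (min_sec X z)" "m \<in> carrier (min_sec X z)" for z n m
  proof -
    interpret N: comm_monoid "min_sec X z" by (rule cN[OF z])
    note g' = unital_homD[OF gh[OF z]]
    obtain a s where a: "a \<in> carrier M" "s \<in> carrier M" "g z s \<in> Units (min_sec X z)" "n \<otimes>\<^bsub>min_sec X z\<^esub> g z s = g z a"
      using rep[OF z nm(1)] by blast
    obtain b t where b: "b \<in> carrier M" "t \<in> carrier M" "g z t \<in> Units (min_sec X z)" "m \<otimes>\<^bsub>min_sec X z\<^esub> g z t = g z b"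
      using rep[OF z nm(2)] by blast
    have "(n \<otimes>\<^bsub>min_sec X z\<^esub> m) \<otimes>\<^bsub>min_sec X z\<^esub> g z (s \<otimes>\<^bsub>M\<^esub> t)
        = (n \<otimes>\<^bsub>min_sec X z\<^esub> g z s) \<otimes>\<^bsub>min_sec X z\<^esub> (m \<otimes>\<^bsub>min_sec X z\<^esub> g z t)"
      using nm a(2) b(2) g'(1)[OF a(2)] g'(1)[OF b(2)] by (simp add: g'(2) N.m_ac)
    also have "\<dots> = g z (a \<otimes>\<^bsub>M\<^esub> b)" using a b by (simp add: g'(2))
    finally have "v z (n \<otimes>\<^bsub>min_sec X z\<^esub> m) = (\<lambda>i. if i \<in> E z then int (fst (a \<otimes>\<^bsub>M\<^esub> b) i) else 0)"
      by (intro v[OF z, of _ _ "s \<otimes>\<^bsub>M\<^esub> t"]) (use nm a b g' in auto)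
    then show ?thesis using v[OF z nm(1) a] v[OF z nm(2) b] mult_fst by (auto simp: fun_eq_iff)
  qed
  have "s_regulars M = carrier M" by (rule M.s_regulars_cancellative) (rule cancel)
  then have Mreg: "s_regular M a" if "a \<in> carrier M" for a
    using that unfolding s_regulars_def by blast
  have rq: "regular_quotient (min_sec X z) (supported_group (E z)) (v z)" if z: "z \<in> U" for z
  proof -
    interpret N: comm_monoid "min_sec X z" by (rule cN[OF z])
    let ?N = "min_sec X z"
    note g' = unital_homD[OF gh[OF z]]
    have reg: "g z a \<in> s_regulars ?N" if "a \<in> carrier M" for a
      using s_regular_localization[OF cM N.comm_monoid_axioms c(3)[OF z] Mreg[OF that]] by (simp add: s_regulars_def)
    have rc: "a \<in> carrier ?N" if "a \<in> s_regulars ?N" for a using that by (simp add: s_regulars_def s_regular_def)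
    show ?thesis
      unfolding regular_quotient_def
    proof (intro conjI ballI)
      show "comm_group (supported_group (E z))" by (rule comm_group_supported_group)
    next
      fix n assume n: "n \<in> s_regulars ?N"
      show "v z n \<in> carrier (supported_group (E z))" by (simp add: v_def)
      fix m assume m: "m \<in> s_regulars ?N"
      show "v z (n \<otimes>\<^bsub>?N\<^esub> m) = v z n \<otimes>\<^bsub>supported_group (E z)\<^esub> v z m"
        using vmult[OF z rc[OF n] rc[OF m]] by simp
      show "v z n = v z m \<longleftrightarrow> (\<exists>u\<in>s_regulars ?N. \<exists>c\<in>Units ?N. u \<otimes>\<^bsub>?N\<^esub> n = u \<otimes>\<^bsub>?N\<^esub> (m \<otimes>\<^bsub>?N\<^esub> c))"
      proof
        assume eq: "v z n = v z m"
        obtain a s where a: "a \<in> carrier M" "s \<in> carrier M" "g z s \<in> Units ?N" "n \<otimes>\<^bsub>?N\<^esub> g z s = g z a"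
          using rep[OF z rc[OF n]] by blast
        obtain b t where b: "b \<in> carrier M" "t \<in> carrier M" "g z t \<in> Units ?N" "m \<otimes>\<^bsub>?N\<^esub> g z t = g z b"
          using rep[OF z rc[OF m]] by blast
        \<comment> \<open>With \<open>w\<close> and \<open>w'\<close> the elements \<open>a\<close>
          and \<open>b\<close> reach a common multiple: the maximum in the natural coordinates, the
          sum in the integral ones. As \<open>a\<close> and \<open>b\<close> agree on
          \<open>E z\<close>, both cofactors are zero there and become units.\<close>
        define w where "w = ((\<lambda>i\<in>{..<r}. fst b i - fst a i), snd b)"
        define w' where "w' = ((\<lambda>i\<in>{..<r}. fst a i - fst b i), snd a)"
        have wc: "w \<in> carrier M" "w' \<in> carrier M"
          using a(1) b(1) by (auto simp: w_def w'_def M_def carrier_free_NZ)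
        have abE: "fst a i = fst b i" if "i \<in> E z" for i
          using fun_cong[OF eq, of i] v[OF z rc[OF n] a] v[OF z rc[OF m] b] that by simp
        have wu: "g z w \<in> Units ?N" "g z w' \<in> Units ?N"
          unfolding unit[OF z wc(1)] unit[OF z wc(2)] using abE Er by (auto simp: w_def w'_def)
        have "a \<otimes>\<^bsub>M\<^esub> w = b \<otimes>\<^bsub>M\<^esub> w'"
          unfolding M_def by (rule free_NZ_eqI)
            (auto simp: mult_free_NZ carrier_free_NZ w_def w'_def)
        then have gw: "g z a \<otimes>\<^bsub>?N\<^esub> g z w = g z b \<otimes>\<^bsub>?N\<^esub> g z w'"
          using g'(2)[OF a(1) wc(1)] g'(2)[OF b(1) wc(2)] by simp
        define p where "p = g z s \<otimes>\<^bsub>?N\<^esub> g z w"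
        define q where "q = g z t \<otimes>\<^bsub>?N\<^esub> g z w'"
        have pq: "p \<in> Units ?N" "q \<in> Units ?N" using a b wu by (auto simp: p_def q_def)
        have np: "n \<otimes>\<^bsub>?N\<^esub> p = m \<otimes>\<^bsub>?N\<^esub> q"
          using gw a(3) b(3) wu rc[OF n] rc[OF m] N.Units_closed
          by (simp add: p_def q_def flip: a(4) b(4) N.m_assoc)
        have ip: "inv\<^bsub>?N\<^esub> p \<in> Units ?N" using pq by simp
        have "m \<otimes>\<^bsub>?N\<^esub> (q \<otimes>\<^bsub>?N\<^esub> inv\<^bsub>?N\<^esub> p) = (n \<otimes>\<^bsub>?N\<^esub> p) \<otimes>\<^bsub>?N\<^esub> inv\<^bsub>?N\<^esub> p"
          unfolding np using pq ip rc[OF m] N.Units_closed by (simp add: N.m_assoc)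
        also have "\<dots> = n" using pq ip rc[OF n] N.Units_closed by (simp add: N.m_assoc)
        finally have "n = m \<otimes>\<^bsub>?N\<^esub> (q \<otimes>\<^bsub>?N\<^esub> inv\<^bsub>?N\<^esub> p)" by simp
        moreover have "q \<otimes>\<^bsub>?N\<^esub> inv\<^bsub>?N\<^esub> p \<in> Units ?N" using pq ip by simp
        moreover have "\<one>\<^bsub>?N\<^esub> \<in> s_regulars ?N" using faceD(2)[OF N.face_s_regulars] .
        ultimately show "\<exists>u\<in>s_regulars ?N. \<exists>c\<in>Units ?N. u \<otimes>\<^bsub>?N\<^esub> n = u \<otimes>\<^bsub>?N\<^esub> (m \<otimes>\<^bsub>?N\<^esub> c)" by metis
      next
        assume "\<exists>u\<in>s_regulars ?N. \<exists>c\<in>Units ?N. u \<otimes>\<^bsub>?N\<^esub> n = u \<otimes>\<^bsub>?N\<^esub> (m \<otimes>\<^bsub>?N\<^esub> c)"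
        then obtain u k where u: "u \<in> carrier ?N" and k: "k \<in> Units ?N" and e: "u \<otimes>\<^bsub>?N\<^esub> n = u \<otimes>\<^bsub>?N\<^esub> (m \<otimes>\<^bsub>?N\<^esub> k)"
          using rc by blast
        have kc: "k \<in> carrier ?N" using k by auto
        obtain a s where a: "a \<in> carrier M" "s \<in> carrier M" "g z s \<in> Units ?N" "k \<otimes>\<^bsub>?N\<^esub> g z s = g z a"
          using rep[OF z kc] by blast
        have "g z a \<in> Units ?N" using k a(3) by (simp flip: a(4))
        then have "v z k = (\<lambda>_. 0)" using v[OF z kc a] unit[OF z a(1)] by (auto simp: fun_eq_iff)
        then have "(\<lambda>i. v z u i + v z n i) = (\<lambda>i. v z u i + v z m i)"
          using vmult[OF z u rc[OF n]] vmult[OF z u, of "m \<otimes>\<^bsub>?N\<^esub> k"] vmult[OF z rc[OF m] kc] e rc[OF m] kc by simp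
        then show "v z n = v z m" by (simp add: fun_eq_iff)
      qed
    next
      fix h assume h: "h \<in> carrier (supported_group (E z))"
      \<comment> \<open>The positive and the negative part of \<open>h\<close> are the exponents of
        two elements of \<open>M\<close>, whose classes have quotient \<open>h\<close>.\<close>
      define a where "a = ((\<lambda>i\<in>{..<r}. nat (h i)), (\<lambda>i\<in>{..<s}. 0::int))"
      define b where "b = ((\<lambda>i\<in>{..<r}. nat (- h i)), (\<lambda>i\<in>{..<s}. 0::int))"
      have ab: "a \<in> carrier M" "b \<in> carrier M" by (auto simp: a_def b_def M_def carrier_free_NZ)
      have "h \<otimes>\<^bsub>supported_group (E z)\<^esub> v z (g z b) = v z (g z a)"
        unfolding vg[OF z ab(1)] vg[OF z ab(2)] using h Er by (auto simp: a_def b_def fun_eq_iff)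
      then show "\<exists>a\<in>s_regulars ?N. \<exists>b\<in>s_regulars ?N. h \<otimes>\<^bsub>supported_group (E z)\<^esub> v z b = v z a"
        using reg ab by blast
    qed
  qed
  have yT: "y \<in> topspace T" by (rule UT[OF y])
  have mF: "quotient_model T (min_nbhd T y) (min_sec X) (min_res X) F v"
    unfolding quotient_model_def
  proof (intro ballI conjI)
    fix z assume "z \<in> min_nbhd T y"
    then have z: "z \<in> U" by (rule nU[OF y])
    show "comm_monoid (min_sec X z)" by (rule cN[OF z])
    show "regular_quotient (min_sec X z) (obj F z) (v z)" using rq[OF z] by (simp add: F_def)
    fix w assume w: "w \<in> min_nbhd T z"
    have wU: "w \<in> U" by (rule nU[OF z w])
    show "arr F z w \<in> hom (obj F z) (obj F w)" by (auto simp: F_def hom_def fun_eq_iff)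
    fix n assume n: "n \<in> s_regulars (min_sec X z)"
    then have nc: "n \<in> carrier (min_sec X z)" by (simp add: s_regulars_def s_regular_def)
    show "min_res X z w n \<in> s_regulars (min_sec X w)"
      using s_regular_localization[OF cN[OF z] cN[OF wU] fg_spectrum_atD(2)[OF spectrum[OF UT[OF z]] w]] n
      by (simp add: s_regulars_def)
    note r' = unital_homD[OF rh[OF z w]]
    obtain a s where a: "a \<in> carrier M" "s \<in> carrier M" "g z s \<in> Units (min_sec X z)" "n \<otimes>\<^bsub>min_sec X z\<^esub> g z s = g z a"
      using rep[OF z nc] by blast
    have gsu: "g w s \<in> Units (min_sec X w)"
      using unital_hom_Units[OF cN[OF z] rh[OF z w] a(3)] c(5)[OF z w a(2)] by simp
    have "min_res X z w n \<otimes>\<^bsub>min_sec X w\<^esub> g w s = g w a"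
      using r'(2)[OF nc unital_homD(1)[OF gh[OF z] a(2)]] a(4) c(5)[OF z w a(1)] c(5)[OF z w a(2)] by simp
    then have "v w (min_res X z w n) = (\<lambda>i. if i \<in> E w then int (fst a i) else 0)"
      by (intro v[OF wU r'(1)[OF nc] a(1,2) gsu])
    then show "arr F z w (v z n) = v w (min_res X z w n)"
      using v[OF z nc a] Emono[OF z w] by (auto simp: F_def fun_eq_iff)
  qed
  \<comment> \<open>The elements with exponent zero at \<open>i\<close> form a face, and
    \<open>i\<close> is the only coordinate that vanishes on it.\<close>
  have "\<forall>i\<in>E y. \<exists>z\<in>U. E z = {i}"
  proof
    fix i assume "i \<in> E y"
    then have i: "i < r" by (rule Er)
    let ?S = "{a \<in> carrier M. fst a i = 0}"
    have f1: "face M ?S" using face_coordinate[OF i] by (simp add: M_def)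
    have "carrier M - (carrier M - ?S) = ?S" by auto
    then have "monoid_prime M (carrier M - ?S)"
      using f1 by (simp only: monoid_prime_iff_face[OF cM]) auto
    then have "carrier M - ?S \<in> f ` U" using c(1) by (simp add: bij_betw_def)
    then obtain z where z: "z \<in> U" "f z = carrier M - ?S" by auto
    have "E z = vanishing r ?S" unfolding E_def z(2) by (simp add: double_diff)
    then show "\<exists>z\<in>U. E z = {i}" using z(1) vanishing_coordinate[OF i] by (auto simp: M_def)
  qed
  then obtain pt where pt: "\<And>i. i \<in> E y \<Longrightarrow> pt i \<in> U \<and> E (pt i) = {i}" by metis
  \<comment> \<open>A prime with \<open>i\<close> among its coordinates contains the prime that
    belongs to \<open>i\<close> alone.\<close>
  have pt_nb: "pt i \<in> min_nbhd T z" if z: "z \<in> min_nbhd T y" and i: "i \<in> E z" for z i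
  proof -
    have zU: "z \<in> U" by (rule nU[OF y z])
    have iy: "i \<in> E y" using Emono[OF y z] i by auto
    have p: "pt i \<in> U" "E (pt i) = {i}" using pt[OF iy] by auto
    have "f (pt i) \<subseteq> f z"
    proof
      fix a assume a: "a \<in> f (pt i)"
      have ac: "a \<in> carrier M" using a monoid_primeD(1)[OF prime[OF p(1)]] by auto
      show "a \<in> f z"
      proof (rule ccontr)
        assume "a \<notin> f z"
        then have "\<forall>j\<in>E z. fst a j = 0"
          using face_free_NZ_iff[of r s "carrier M - f z" a] face[OF zU] ac by (simp add: M_def E_def)
        then have "\<forall>j\<in>E (pt i). fst a j = 0" using i p(2) by auto
        then show False
          using face_free_NZ_iff[of r s "carrier M - f (pt i)" a] face[OF p(1)] ac a by (simp add: M_def E_def)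
      qed
    qed
    then show ?thesis using c(2)[OF p(1) zU] by simp
  qed
  let ?P = "min_nbhd T y - {y}"
  have PT: "?P \<subseteq> topspace T" using min_nbhd_subset_topspace[OF yT] by auto
  have lf: "locally_flasque_at T F y"
    unfolding locally_flasque_at_def
  \<comment> \<open>If \<open>pt i\<close> is \<open>y\<close> itself, it is absent from the
    punctured neighbourhood and the coordinate is set to 0. No point of that neighbourhood has
    \<open>i\<close> in its set then, since \<open>y\<close> would lie below it.\<close>
  proof (intro bexI[of _ "\<lambda>\<sigma> i. if i \<in> E y \<and> pt i \<noteq> y then \<sigma> (pt i) i else 0"] ballI homI)
    fix \<sigma> z assume \<sigma>: "\<sigma> \<in> carrier (limit_sections T F ?P)" and z: "z \<in> ?P"
    have zU: "z \<in> U" using nU[OF y] z by auto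
    have Ez: "E z \<subseteq> E y" using Emono[OF y] z by auto
    have sz: "\<sigma> z i = 0" if "i \<notin> E z" for i
    proof -
      have "\<sigma> z \<in> carrier (obj F z)" using \<sigma> z by (auto simp: carrier_limit_sections[OF PT] PiE_iff)
      then show ?thesis using that by (simp add: F_def)
    qed
    have "pt i \<noteq> y \<and> \<sigma> (pt i) i = \<sigma> z i" if i: "i \<in> E z" for i
    proof -
      have n: "pt i \<in> min_nbhd T z" using pt_nb i z by auto
      then have pP: "pt i \<in> ?P" using punctured_subset[OF yT z] by auto
      then have "arr F z (pt i) (\<sigma> z) = \<sigma> (pt i)" using \<sigma> z n by (simp add: carrier_limit_sections[OF PT])
      then have "\<sigma> (pt i) i = arr F z (pt i) (\<sigma> z) i" by simp
      also have "\<dots> = \<sigma> z i" using pt[of i] i Ez by (auto simp: F_def)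
      finally show ?thesis using pP by auto
    qed
    then show "arr F y z (\<lambda>i. if i \<in> E y \<and> pt i \<noteq> y then \<sigma> (pt i) i else 0) = \<sigma> z"
      using sz Ez by (auto simp: F_def fun_eq_iff)
  next
    fix \<sigma> \<tau>
    show "(\<lambda>i. if i \<in> E y \<and> pt i \<noteq> y then \<sigma> (pt i) i else 0) \<in> carrier (obj F y)"
      by (simp add: F_def)
    have "pt i \<in> ?P" if "i \<in> E y" "pt i \<noteq> y" for i using pt_nb[OF min_nbhd_self that(1)] that(2) by simp
    then show "(\<lambda>i. if i \<in> E y \<and> pt i \<noteq> y then (\<sigma> \<otimes>\<^bsub>limit_sections T F ?P\<^esub> \<tau>) (pt i) i else 0)
       = (\<lambda>i. if i \<in> E y \<and> pt i \<noteq> y then \<sigma> (pt i) i else 0) \<otimes>\<^bsub>obj F y\<^esub>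
         (\<lambda>i. if i \<in> E y \<and> pt i \<noteq> y then \<tau> (pt i) i else 0)"
      by (auto simp: mult_limit_sections F_def fun_eq_iff)
  qed
  show "locally_flasque_at T QF y"
    by (rule locally_flasque_at_transfer[OF mF
          quotient_model_subset[OF quotient_model_min min_nbhd_subset_topspace[OF yT]] refl yT yT lf])
qed

end

lemma s_smooth_of_smooth:
  fixes X :: "('p, 'a) monoid_space"
  assumes "smooth X" shows "s_smooth X"
proof -
  have X: "is_monoid_scheme X" "finite_type X" using assms by (auto simp: smooth_def)
  interpret stalkwise X using stalkwise_scheme_of_finite_type[OF X] by (simp add: stalkwise_def)
  obtain \<U> where \<U>: "\<forall>U\<in>\<U>. openin T U" "\<Union>\<U> = topspace T"
    "\<forall>U\<in>\<U>. \<exists>r s. isomorphic_spaces (open_subspace X U) (Spec (free_NZ r s))"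
    using assms unfolding smooth_def by blast
  have "(\<forall>x\<in>min_nbhd T y. inj_on (min_res X y x) (Units (min_sec X y))) \<and> locally_flasque_at T QF y"
    if y: "y \<in> topspace T" for y
  proof -
    obtain U where U: "U \<in> \<U>" "y \<in> U" using y \<U>(2) by auto
    have oU: "openin T U" using \<U>(1) U by auto
    obtain r s where "isomorphic_spaces (open_subspace X U) (Spec (free_NZ r s))" using \<U>(3) U by blast
    then obtain f g where chart: "affine_chart X U (free_NZ r s) f g"
      using affine_chart_exists[OF presheaf oU comm_monoid_free_NZ] open_nb open_top[OF oU] by blast
    have "Units (min_sec X y) \<subseteq> carrier (min_sec X y)" by (auto simp: Units_def)
    then show ?thesis using free_NZ_chart[OF oU chart U(2)] inj_on_subset by blast
  qed
  then show ?thesis using stalkwise unfolding s_smooth_iff by blast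
qed


section \<open>Flasqueness of external products\<close>

definition pullback_functor :: "('z \<Rightarrow> 'p) \<Rightarrow> ('p, 'b) point_functor \<Rightarrow> ('z, 'b) point_functor" where
  "pullback_functor \<pi> F = \<lparr>obj = (\<lambda>z. obj F (\<pi> z)), arr = (\<lambda>z w. arr F (\<pi> z) (\<pi> w))\<rparr>"

text \<open>The section \<open>\<iota>\<close> of the projection \<open>\<pi>\<close> picks the generic point of each fibre, so sections of the
  pullback are determined by their values on the image of \<open>\<iota>\<close>.\<close>

lemma locally_flasque_at_pullback:
  fixes T :: "'z topology" and S :: "'p topology" and \<pi> :: "'z \<Rightarrow> 'p" and F :: "('p, 'b) point_functor"
  assumes T: "finite_T0 T" and z: "z \<in> topspace T"
    and F: "group_functor S F" and \<pi>z: "\<pi> z \<in> topspace S"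
    and lf: "locally_flasque_at S F (\<pi> z)"
    and \<pi>: "\<And>w w'. w \<in> min_nbhd T z \<Longrightarrow> w' \<in> min_nbhd T w \<Longrightarrow> \<pi> w' \<in> min_nbhd S (\<pi> w)"
    and \<iota>: "\<And>x. x \<in> min_nbhd S (\<pi> z) \<Longrightarrow> \<iota> x \<in> min_nbhd T z \<and> \<pi> (\<iota> x) = x"
    and \<iota>\<pi>: "\<And>w. w \<in> min_nbhd T z \<Longrightarrow> \<iota> (\<pi> w) \<in> min_nbhd T w"
    and \<iota>_mono: "\<And>x x'. x \<in> min_nbhd S (\<pi> z) \<Longrightarrow> x' \<in> min_nbhd S x \<Longrightarrow> \<iota> x' \<in> min_nbhd T (\<iota> x)"
  shows "locally_flasque_at T (pullback_functor \<pi> F) z"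
proof -
  interpret finite_T0 T by (rule T)
  let ?P = "min_nbhd T z - {z}"
  let ?F = "pullback_functor \<pi> F"
  let ?Q = "min_nbhd S (\<pi> z) - {\<pi> z}"
  have PT: "?P \<subseteq> topspace T" using min_nbhd_subset_topspace[OF z] by auto
  have QS: "?Q \<subseteq> topspace S" using min_nbhd_subset_topspace[OF \<pi>z] by auto
  have ne: "w' \<noteq> z" if "w \<in> ?P" "w' \<in> min_nbhd T w" for w w'
    using punctured_subset[OF z that(1)] that(2) by auto
  have \<pi>S: "\<pi> w \<in> min_nbhd S (\<pi> z)" if "w \<in> min_nbhd T z" for w using \<pi>[OF min_nbhd_self that] .
  have \<pi>top: "\<pi> w \<in> topspace S" if "w \<in> min_nbhd T z" for w
    using \<pi>S[OF that] min_nbhd_subset_topspace[OF \<pi>z] by auto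
  have mem: "s w \<in> carrier (obj F (\<pi> w))" if "s \<in> carrier (limit_sections T ?F ?P)" "w \<in> ?P" for s w
    using that by (auto simp: carrier_limit_sections[OF PT] PiE_iff pullback_functor_def)
  have compat: "arr F (\<pi> w) (\<pi> w') (s w) = s w'"
    if "s \<in> carrier (limit_sections T ?F ?P)" "w \<in> ?P" "w' \<in> ?P" "w' \<in> min_nbhd T w" for s w w'
    using that by (auto simp: carrier_limit_sections[OF PT] pullback_functor_def)
  \<comment> \<open>The generic point of the fibre through \<open>w\<close> lies below
    \<open>w\<close> and has the same image under \<open>\<pi>\<close>, so the restriction between
    the two is the identity. It differs from \<open>z\<close> because \<open>z\<close> is not below
    \<open>w\<close>.\<close>
  have key: "s (\<iota> (\<pi> w)) = s w" "\<iota> (\<pi> w) \<in> ?P" if s: "s \<in> carrier (limit_sections T ?F ?P)" and w: "w \<in> ?P" for s w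
  proof -
    have n: "\<iota> (\<pi> w) \<in> min_nbhd T w" using \<iota>\<pi> w by auto
    show P: "\<iota> (\<pi> w) \<in> ?P" using \<iota>[OF \<pi>S] w ne[OF w n] by auto
    have "\<pi> (\<iota> (\<pi> w)) = \<pi> w" using \<iota>[OF \<pi>S] w by auto
    then have "arr F (\<pi> w) (\<pi> w) (s w) = s (\<iota> (\<pi> w))" using compat[OF s w P n] by simp
    moreover have "arr F (\<pi> w) (\<pi> w) (s w) = s w"
      using F \<pi>top[of w] mem[OF s w] w by (auto simp: group_functor_def)
    ultimately show "s (\<iota> (\<pi> w)) = s w" by simp
  qed
  show ?thesis
  \<comment> \<open>If \<open>z\<close> is not generic in its fibre, the generic point lies in the
    punctured neighbourhood, and the value of the section there is already an element of the stalk
    at \<open>z\<close>. Otherwise the punctured neighbourhood of \<open>z\<close> maps into that of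
    \<open>\<pi> z\<close>, and the splitting of \<open>F\<close> is used.\<close>
  proof (cases "\<iota> (\<pi> z) = z")
    case False
    have P: "\<iota> (\<pi> z) \<in> ?P" using \<iota>[OF min_nbhd_self] False by auto
    have \<pi>P: "\<pi> (\<iota> (\<pi> z)) = \<pi> z" using \<iota>[OF min_nbhd_self] by auto
    show ?thesis unfolding locally_flasque_at_def
    proof (intro bexI[of _ "\<lambda>s. s (\<iota> (\<pi> z))"] ballI homI)
      fix s w assume s: "s \<in> carrier (limit_sections T ?F ?P)" and w: "w \<in> ?P"
      have "\<iota> (\<pi> w) \<in> min_nbhd T (\<iota> (\<pi> z))" using \<iota>_mono[OF min_nbhd_self \<pi>S] w by auto
      then have "arr F (\<pi> (\<iota> (\<pi> z))) (\<pi> (\<iota> (\<pi> w))) (s (\<iota> (\<pi> z))) = s (\<iota> (\<pi> w))"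
        using compat[OF s P key(2)[OF s w]] by simp
      then show "arr ?F z w (s (\<iota> (\<pi> z))) = s w"
        using \<pi>P \<iota>[OF \<pi>S] w key(1)[OF s w] by (auto simp: pullback_functor_def)
    next
      fix s assume s: "s \<in> carrier (limit_sections T ?F ?P)"
      show "s (\<iota> (\<pi> z)) \<in> carrier (obj ?F z)" using mem[OF s P] \<pi>P by (simp add: pullback_functor_def)
      fix t
      show "(s \<otimes>\<^bsub>limit_sections T ?F ?P\<^esub> t) (\<iota> (\<pi> z)) = s (\<iota> (\<pi> z)) \<otimes>\<^bsub>obj ?F z\<^esub> t (\<iota> (\<pi> z))"
        using \<pi>P by (subst mult_limit_sections[OF P]) (simp add: pullback_functor_def)
    qed
  next
    case True
    obtain \<sigma> where \<sigma>: "\<sigma> \<in> hom (limit_sections S F ?Q) (obj F (\<pi> z))"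
      "\<And>s x. s \<in> carrier (limit_sections S F ?Q) \<Longrightarrow> x \<in> ?Q \<Longrightarrow> arr F (\<pi> z) x (\<sigma> s) = s x"
      using lf unfolding locally_flasque_at_def by blast
    define e where "e s = (\<lambda>x\<in>?Q. s (\<iota> x))" for s :: "'z \<Rightarrow> 'b"
    have \<iota>P: "\<iota> x \<in> ?P" if "x \<in> ?Q" for x using \<iota>[of x] that by auto
    have \<pi>Q: "\<pi> w \<in> ?Q" if w: "w \<in> ?P" for w
    proof -
      have "\<iota> (\<pi> w) \<noteq> z" using ne[OF w] \<iota>\<pi> w by auto
      then have "\<pi> w \<noteq> \<pi> z" using True by metis
      then show ?thesis using \<pi>S w by auto
    qed
    have ec: "e s \<in> carrier (limit_sections S F ?Q)" if s: "s \<in> carrier (limit_sections T ?F ?P)" for s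
      unfolding carrier_limit_sections[OF QS]
    proof (intro conjI ballI impI PiE_I)
      fix x assume x: "x \<in> ?Q"
      show "e s x \<in> carrier (obj F x)" using mem[OF s \<iota>P[OF x]] \<iota>[of x] x by (simp add: e_def)
      fix x' assume x': "x' \<in> ?Q" "x' \<in> min_nbhd S x"
      have "arr F (\<pi> (\<iota> x)) (\<pi> (\<iota> x')) (s (\<iota> x)) = s (\<iota> x')"
        using compat[OF s \<iota>P[OF x] \<iota>P[OF x'(1)]] \<iota>_mono x x' by auto
      then show "arr F x x' (e s x) = e s x'" using \<iota>[of x] \<iota>[of x'] x x' by (simp add: e_def)
    qed (auto simp: e_def restrict_def)
    have eh: "e \<in> hom (limit_sections T ?F ?P) (limit_sections S F ?Q)"
    proof (rule homI)
      fix s t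
      show "e (s \<otimes>\<^bsub>limit_sections T ?F ?P\<^esub> t) = e s \<otimes>\<^bsub>limit_sections S F ?Q\<^esub> e t"
      proof
        fix x
        show "e (s \<otimes>\<^bsub>limit_sections T ?F ?P\<^esub> t) x = (e s \<otimes>\<^bsub>limit_sections S F ?Q\<^esub> e t) x"
        proof (cases "x \<in> ?Q")
          case True
          then have "\<pi> (\<iota> x) = x" using \<iota> by auto
          then show ?thesis using True mult_limit_sections[OF \<iota>P[OF True], of T ?F s t]
            by (simp add: mult_limit_sections e_def pullback_functor_def)
        next
          case False
          then show ?thesis unfolding mult_limit_sections_eq e_def restrict_def by (simp only: if_False)
        qed
      qed
    qed (rule ec)
    show ?thesis unfolding locally_flasque_at_def
    proof (intro bexI[of _ "\<sigma> \<circ> e"] ballI)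
      show "\<sigma> \<circ> e \<in> hom (limit_sections T ?F ?P) (obj ?F z)"
        using hom_compose[OF eh \<sigma>(1)] by (simp add: pullback_functor_def)
      fix s w assume s: "s \<in> carrier (limit_sections T ?F ?P)" and w: "w \<in> ?P"
      have "arr F (\<pi> z) (\<pi> w) (\<sigma> (e s)) = e s (\<pi> w)" by (rule \<sigma>(2)[OF ec[OF s] \<pi>Q[OF w]])
      also have "\<dots> = s w" using \<pi>Q[OF w] key(1)[OF s w] by (simp add: e_def)
      finally show "arr ?F z w ((\<sigma> \<circ> e) s) = s w" by (simp add: pullback_functor_def)
    qed
  qed
qed

section \<open>Direct sums of functors\<close>

definition DirProd_functor ::
    "('z, 'b) point_functor \<Rightarrow> ('z, 'c) point_functor \<Rightarrow> ('z, 'b \<times> 'c) point_functor" where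
  "DirProd_functor F G =
     \<lparr>obj = (\<lambda>z. obj F z \<times>\<times> obj G z), arr = (\<lambda>z w. map_prod (arr F z w) (arr G z w))\<rparr>"

lemma DirProd_functor_simps [simp]:
  "obj (DirProd_functor F G) z = obj F z \<times>\<times> obj G z"
  "arr (DirProd_functor F G) z w = map_prod (arr F z w) (arr G z w)"
  by (simp_all add: DirProd_functor_def)

lemma locally_flasque_at_DirProd:
  fixes F :: "('z, 'b) point_functor" and G :: "('z, 'c) point_functor"
  assumes z: "z \<in> topspace T" and F: "locally_flasque_at T F z" and G: "locally_flasque_at T G z"
  shows "locally_flasque_at T (DirProd_functor F G) z"
proof -
  let ?P = "min_nbhd T z - {z}" and ?H = "DirProd_functor F G"
  have PT: "?P \<subseteq> topspace T" using min_nbhd_subset_topspace[OF z] by auto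
  define p where "p s = (\<lambda>w\<in>?P. fst (s w))" for s :: "'z \<Rightarrow> 'b \<times> 'c"
  define q where "q s = (\<lambda>w\<in>?P. snd (s w))" for s :: "'z \<Rightarrow> 'b \<times> 'c"
  have mem: "s w \<in> carrier (obj F w \<times>\<times> obj G w)" if "s \<in> carrier (limit_sections T ?H ?P)" "w \<in> ?P" for s w
    using that by (auto simp: carrier_limit_sections[OF PT] PiE_iff)
  have compat: "map_prod (arr F w w') (arr G w w') (s w) = s w'"
    if "s \<in> carrier (limit_sections T ?H ?P)" "w \<in> ?P" "w' \<in> ?P" "w' \<in> min_nbhd T w" for s w w'
    using that by (auto simp: carrier_limit_sections[OF PT])
  have pc: "p s \<in> carrier (limit_sections T F ?P)" if s: "s \<in> carrier (limit_sections T ?H ?P)" for s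
    unfolding carrier_limit_sections[OF PT]
  proof (intro conjI ballI impI PiE_I)
    fix w assume w: "w \<in> ?P"
    show "p s w \<in> carrier (obj F w)" using mem[OF s w] w by (auto simp: p_def)
    fix w' assume "w' \<in> ?P" "w' \<in> min_nbhd T w"
    then show "arr F w w' (p s w) = p s w'" using arg_cong[OF compat[OF s w], of w' fst] w by (simp add: p_def)
  qed (auto simp: p_def restrict_def)
  have qc: "q s \<in> carrier (limit_sections T G ?P)" if s: "s \<in> carrier (limit_sections T ?H ?P)" for s
    unfolding carrier_limit_sections[OF PT]
  proof (intro conjI ballI impI PiE_I)
    fix w assume w: "w \<in> ?P"
    show "q s w \<in> carrier (obj G w)" using mem[OF s w] w by (auto simp: q_def)
    fix w' assume "w' \<in> ?P" "w' \<in> min_nbhd T w"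
    then show "arr G w w' (q s w) = q s w'" using arg_cong[OF compat[OF s w], of w' snd] w by (simp add: q_def)
  qed (auto simp: q_def restrict_def)
  have ph: "p \<in> hom (limit_sections T ?H ?P) (limit_sections T F ?P)"
    by (intro homI pc) (auto simp: p_def mult_limit_sections_eq fun_eq_iff DirProd_def split_beta)
  have qh: "q \<in> hom (limit_sections T ?H ?P) (limit_sections T G ?P)"
    by (intro homI qc) (auto simp: q_def mult_limit_sections_eq fun_eq_iff DirProd_def split_beta)
  obtain \<sigma> where \<sigma>: "\<sigma> \<in> hom (limit_sections T F ?P) (obj F z)"
    "\<And>s w. s \<in> carrier (limit_sections T F ?P) \<Longrightarrow> w \<in> ?P \<Longrightarrow> arr F z w (\<sigma> s) = s w"
    using F unfolding locally_flasque_at_def by blast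
  obtain \<tau> where \<tau>: "\<tau> \<in> hom (limit_sections T G ?P) (obj G z)"
    "\<And>s w. s \<in> carrier (limit_sections T G ?P) \<Longrightarrow> w \<in> ?P \<Longrightarrow> arr G z w (\<tau> s) = s w"
    using G unfolding locally_flasque_at_def by blast
  have 1: "\<sigma> \<circ> p \<in> hom (limit_sections T ?H ?P) (obj F z)" and 2: "\<tau> \<circ> q \<in> hom (limit_sections T ?H ?P) (obj G z)"
    using hom_compose[OF ph \<sigma>(1)] hom_compose[OF qh \<tau>(1)] .
  show ?thesis unfolding locally_flasque_at_def
  proof (intro bexI[of _ "\<lambda>s. ((\<sigma> \<circ> p) s, (\<tau> \<circ> q) s)"] ballI homI)
    fix s w assume s: "s \<in> carrier (limit_sections T ?H ?P)" and w: "w \<in> ?P"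
    have "arr F z w (\<sigma> (p s)) = fst (s w)" "arr G z w (\<tau> (q s)) = snd (s w)"
      using \<sigma>(2)[OF pc[OF s] w] \<tau>(2)[OF qc[OF s] w] w by (simp_all add: p_def q_def)
    then show "arr ?H z w ((\<sigma> \<circ> p) s, (\<tau> \<circ> q) s) = s w" by simp
  next
    fix s assume s: "s \<in> carrier (limit_sections T ?H ?P)"
    show "((\<sigma> \<circ> p) s, (\<tau> \<circ> q) s) \<in> carrier (obj ?H z)" using hom_in_carrier[OF 1 s] hom_in_carrier[OF 2 s] by simp
    fix t assume t: "t \<in> carrier (limit_sections T ?H ?P)"
    show "((\<sigma> \<circ> p) (s \<otimes>\<^bsub>limit_sections T ?H ?P\<^esub> t), (\<tau> \<circ> q) (s \<otimes>\<^bsub>limit_sections T ?H ?P\<^esub> t))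
      = ((\<sigma> \<circ> p) s, (\<tau> \<circ> q) s) \<otimes>\<^bsub>obj ?H z\<^esub> ((\<sigma> \<circ> p) t, (\<tau> \<circ> q) t)"
      using hom_mult[OF 1 s t] hom_mult[OF 2 s t] by simp
  qed
qed

section \<open>Spectra of products\<close>

lemma monoid_finitely_generated_DirProd:
  assumes M: "comm_monoid M" and N: "comm_monoid N"
    and fM: "monoid_finitely_generated M" and fN: "monoid_finitely_generated N"
  shows "monoid_finitely_generated (M \<times>\<times> N)"
proof -
  interpret M: comm_monoid M by fact
  interpret N: comm_monoid N by fact
  obtain A where A: "finite A" "monoid_generators M A" using fM monoid_finitely_generated_iff[OF M] by blast
  obtain B where B: "finite B" "monoid_generators N B" using fN monoid_finitely_generated_iff[OF N] by blast
  let ?C = "A \<times> {\<one>\<^bsub>N\<^esub>} \<union> {\<one>\<^bsub>M\<^esub>} \<times> B"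
  have Cc: "?C \<subseteq> carrier (M \<times>\<times> N)" using A B by (auto simp: monoid_generators_def)
  have "carrier (M \<times>\<times> N) \<subseteq> H" if H: "submonoid H (M \<times>\<times> N)" "?C \<subseteq> H" for H
  proof
    fix x assume "x \<in> carrier (M \<times>\<times> N)"
    then obtain a b where x: "x = (a, b)" "a \<in> carrier M" "b \<in> carrier N" by auto
    have cl: "u \<otimes>\<^bsub>M \<times>\<times> N\<^esub> v \<in> H" if "u \<in> H" "v \<in> H" for u v using submonoid.m_closed[OF H(1) that] .
    have 1: "(\<one>\<^bsub>M\<^esub>, \<one>\<^bsub>N\<^esub>) \<in> H" using submonoid.one_closed[OF H(1)] by simp
    have "(a, \<one>\<^bsub>N\<^esub>) \<in> H"
    proof (rule monoid_generators_induct[OF M A(2), where Q = "\<lambda>a. (a, \<one>\<^bsub>N\<^esub>) \<in> H"])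
      show "(a \<otimes>\<^bsub>M\<^esub> b, \<one>\<^bsub>N\<^esub>) \<in> H" if "(a, \<one>\<^bsub>N\<^esub>) \<in> H" "(b, \<one>\<^bsub>N\<^esub>) \<in> H" for a b using cl[OF that] by simp
    qed (use 1 H x in auto)
    moreover have "(\<one>\<^bsub>M\<^esub>, b) \<in> H"
    proof (rule monoid_generators_induct[OF N B(2), where Q = "\<lambda>b. (\<one>\<^bsub>M\<^esub>, b) \<in> H"])
      show "(\<one>\<^bsub>M\<^esub>, a \<otimes>\<^bsub>N\<^esub> b) \<in> H" if "(\<one>\<^bsub>M\<^esub>, a) \<in> H" "(\<one>\<^bsub>M\<^esub>, b) \<in> H" for a b using cl[OF that] by simp
    qed (use 1 H x in auto)
    ultimately have "(a, \<one>\<^bsub>N\<^esub>) \<otimes>\<^bsub>M \<times>\<times> N\<^esub> (\<one>\<^bsub>M\<^esub>, b) \<in> H" by (rule cl)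
    then show "x \<in> H" using x by simp
  qed
  then have "monoid_generators (M \<times>\<times> N) ?C" using Cc unfolding monoid_generators_def by blast
  moreover have "finite ?C" using A B by auto
  ultimately show ?thesis using monoid_finitely_generated_iff[OF comm_monoid_DirProd[OF M N]] by blast
qed

lemma unital_hom_DirProd:
  assumes "unital_hom M M' h" "unital_hom N N' k"
  shows "unital_hom (M \<times>\<times> N) (M' \<times>\<times> N') (map_prod h k)"
  using unital_homD[OF assms(1)] unital_homD[OF assms(2)] by (auto simp: unital_hom_def hom_def)

lemma unit_face_DirProd:
  "unit_face (M \<times>\<times> N) (M' \<times>\<times> N') (map_prod h k) = unit_face M M' h \<times> unit_face N N' k"
  by (auto simp: unit_face_def Units_DirProd)

lemma is_localization_DirProd:
  assumes h: "is_localization M M' h" and k: "is_localization N N' k"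
  shows "is_localization (M \<times>\<times> N) (M' \<times>\<times> N') (map_prod h k)"
  unfolding is_localization_def unit_face_DirProd
proof (intro conjI ballI impI)
  show "unital_hom (M \<times>\<times> N) (M' \<times>\<times> N') (map_prod h k)"
    using h k by (intro unital_hom_DirProd is_localizationD(1))
next
  fix n assume "n \<in> carrier (M' \<times>\<times> N')"
  then obtain n1 n2 where n: "n = (n1, n2)" "n1 \<in> carrier M'" "n2 \<in> carrier N'" by auto
  obtain a s where a: "a \<in> carrier M" "s \<in> unit_face M M' h" "n1 \<otimes>\<^bsub>M'\<^esub> h s = h a"
    using h n unfolding is_localization_def by blast
  obtain b t where b: "b \<in> carrier N" "t \<in> unit_face N N' k" "n2 \<otimes>\<^bsub>N'\<^esub> k t = k b"
    using k n unfolding is_localization_def by blast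
  show "\<exists>a\<in>carrier (M \<times>\<times> N). \<exists>s\<in>unit_face M M' h \<times> unit_face N N' k.
      n \<otimes>\<^bsub>M' \<times>\<times> N'\<^esub> map_prod h k s = map_prod h k a"
    by (rule bexI[of _ "(a, b)"], rule bexI[of _ "(s, t)"]) (use a b n in auto)
next
  fix x y assume xy: "x \<in> carrier (M \<times>\<times> N)" "y \<in> carrier (M \<times>\<times> N)" "map_prod h k x = map_prod h k y"
  obtain a b c d where [simp]: "x = (a, b)" "y = (c, d)" by (meson surj_pair)
  obtain u where u: "u \<in> unit_face M M' h" "u \<otimes>\<^bsub>M\<^esub> a = u \<otimes>\<^bsub>M\<^esub> c"
    using is_localizationD(3)[OF h, of a c] xy by (auto simp: unit_face_def)
  obtain w where w: "w \<in> unit_face N N' k" "w \<otimes>\<^bsub>N\<^esub> b = w \<otimes>\<^bsub>N\<^esub> d"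
    using is_localizationD(3)[OF k, of b d] xy by (auto simp: unit_face_def)
  show "\<exists>u\<in>unit_face M M' h \<times> unit_face N N' k. u \<otimes>\<^bsub>M \<times>\<times> N\<^esub> x = u \<otimes>\<^bsub>M \<times>\<times> N\<^esub> y"
    by (rule bexI[of _ "(u, w)"]) (use u w in auto)
qed

text \<open>Since \<open>(a, b) = (a, 1)(1, b)\<close>, a face contains a pair exactly when it
  contains both factors, so it is the product of its traces. This is why points of a product are
  pairs of points.\<close>

lemma face_DirProd:
  assumes "comm_monoid M" "comm_monoid N" "face (M \<times>\<times> N) S"
  obtains S1 S2 where "face M S1" "face N S2" "S = S1 \<times> S2"
proof -
  interpret M: comm_monoid M by fact
  interpret N: comm_monoid N by fact
  note S = faceD[OF assms(3)]
  let ?S1 = "{a \<in> carrier M. (a, \<one>\<^bsub>N\<^esub>) \<in> S}" and ?S2 = "{b \<in> carrier N. (\<one>\<^bsub>M\<^esub>, b) \<in> S}"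
  have "face M ?S1" using S(2) S(3)[of "(_, \<one>\<^bsub>N\<^esub>)" "(_, \<one>\<^bsub>N\<^esub>)"] by (simp add: face_def)
  moreover have "face N ?S2" using S(2) S(3)[of "(\<one>\<^bsub>M\<^esub>, _)" "(\<one>\<^bsub>M\<^esub>, _)"] by (simp add: face_def)
  moreover have "S = ?S1 \<times> ?S2"
  proof -
    have "(a, b) \<in> S \<longleftrightarrow> a \<in> ?S1 \<and> b \<in> ?S2" if "a \<in> carrier M" "b \<in> carrier N" for a b
      using S(3)[of "(a, \<one>\<^bsub>N\<^esub>)" "(\<one>\<^bsub>M\<^esub>, b)"] that by simp
    moreover have "S \<subseteq> carrier M \<times> carrier N" using S(1) by auto
    ultimately show ?thesis by blast
  qed
  ultimately show ?thesis by (rule that)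
qed

text \<open>Faces of the product are products of faces. Equality and inclusion of such products can
  be read off in each factor because a face contains the unit and so is not empty.\<close>

lemma fg_spectrum_at_DirProd:
  assumes A: "fg_spectrum_at TX A rA x" and B: "fg_spectrum_at TY B rB y"
    and cA: "\<And>x'. x' \<in> min_nbhd TX x \<Longrightarrow> comm_monoid (A x')"
    and cB: "\<And>y'. y' \<in> min_nbhd TY y \<Longrightarrow> comm_monoid (B y')"
    and nb: "\<And>x' y'. x' \<in> min_nbhd TX x \<Longrightarrow> y' \<in> min_nbhd TY y \<Longrightarrow>
      min_nbhd TZ (x', y') = min_nbhd TX x' \<times> min_nbhd TY y'"
  shows "fg_spectrum_at TZ (\<lambda>z. A (fst z) \<times>\<times> B (snd z))
     (\<lambda>z w. map_prod (rA (fst z) (fst w)) (rB (snd z) (snd w))) (x, y)"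
proof -
  note a = fg_spectrum_atD[OF A] and b = fg_spectrum_atD[OF B]
  let ?u = "\<lambda>x'. unit_face (A x) (A x') (rA x x')" and ?v = "\<lambda>y'. unit_face (B y) (B y') (rB y y')"
  have nbz: "min_nbhd TZ (x, y) = min_nbhd TX x \<times> min_nbhd TY y" by (rule nb) auto
  have ne: "\<one>\<^bsub>A x\<^esub> \<in> ?u x'" if "x' \<in> min_nbhd TX x" for x'
    by (rule faceD(2)[OF face_unit_face[OF cA[OF min_nbhd_self] cA[OF that] is_localizationD(1)[OF a(2)[OF that]]]])
  have ne': "\<one>\<^bsub>B y\<^esub> \<in> ?v y'" if "y' \<in> min_nbhd TY y" for y'
    by (rule faceD(2)[OF face_unit_face[OF cB[OF min_nbhd_self] cB[OF that] is_localizationD(1)[OF b(2)[OF that]]]])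
  show ?thesis
    unfolding fg_spectrum_at_def nbz unit_face_DirProd fst_conv snd_conv
  proof (intro conjI ballI impI allI inj_onI)
    show "monoid_finitely_generated (A x \<times>\<times> B y)"
      by (rule monoid_finitely_generated_DirProd[OF cA[OF min_nbhd_self] cB[OF min_nbhd_self] a(1) b(1)])
  next
    fix z assume "z \<in> min_nbhd TX x \<times> min_nbhd TY y"
    then show "is_localization (A x \<times>\<times> B y) (A (fst z) \<times>\<times> B (snd z)) (map_prod (rA x (fst z)) (rB y (snd z)))"
      by (intro is_localization_DirProd a(2) b(2)) auto
  next
    fix z w assume z: "z \<in> min_nbhd TX x \<times> min_nbhd TY y" and w: "w \<in> min_nbhd TX x \<times> min_nbhd TY y"
      and eq: "?u (fst z) \<times> ?v (snd z) = ?u (fst w) \<times> ?v (snd w)"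
    have "?u (fst z) = ?u (fst w)" "?v (snd z) = ?v (snd w)"
      using eq ne[of "fst z"] ne'[of "snd z"] z by (auto simp: times_eq_iff)
    then have "fst z = fst w" "snd z = snd w" using a(3)[of "fst z" "fst w"] b(3)[of "snd z" "snd w"] z w by auto
    then show "z = w" by (rule prod_eqI)
  next
    fix S assume "face (A x \<times>\<times> B y) S"
    then obtain S1 S2 where S: "face (A x) S1" "face (B y) S2" "S = S1 \<times> S2"
      using face_DirProd[OF cA[OF min_nbhd_self] cB[OF min_nbhd_self]] by metis
    obtain x' where x': "x' \<in> min_nbhd TX x" "?u x' = S1" using a(4)[OF S(1)] by blast
    obtain y' where y': "y' \<in> min_nbhd TY y" "?v y' = S2" using b(4)[OF S(2)] by blast
    show "\<exists>z\<in>min_nbhd TX x \<times> min_nbhd TY y. ?u (fst z) \<times> ?v (snd z) = S"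
      by (rule bexI[of _ "(x', y')"]) (use x' y' S in auto)
  next
    fix z w assume z: "z \<in> min_nbhd TX x \<times> min_nbhd TY y" and w: "w \<in> min_nbhd TX x \<times> min_nbhd TY y"
      and sub: "?u (fst w) \<times> ?v (snd w) \<subseteq> ?u (fst z) \<times> ?v (snd z)"
    have "?u (fst w) \<subseteq> ?u (fst z)" "?v (snd w) \<subseteq> ?v (snd z)"
      using sub[unfolded times_subset_iff] ne[of "fst w"] ne'[of "snd w"] w by auto
    then have "fst z \<in> min_nbhd TX (fst w)" "snd z \<in> min_nbhd TY (snd w)"
      using a(5)[of "fst z" "fst w"] b(5)[of "snd z" "snd w"] z w by auto
    moreover have "min_nbhd TZ w = min_nbhd TX (fst w) \<times> min_nbhd TY (snd w)"
      using nb[of "fst w" "snd w"] w by auto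
    ultimately show "z \<in> min_nbhd TZ w" by (simp add: mem_Times_iff)
  qed
qed

text \<open>Faces are moved along the isomorphism at \<open>y\<close>, and the isomorphisms at the
  other points preserve which elements become units.\<close>

lemma fg_spectrum_at_iso:
  assumes sp: "fg_spectrum_at T A r y"
    and cA: "\<And>z. z \<in> min_nbhd T y \<Longrightarrow> comm_monoid (A z)"
    and cB: "\<And>z. z \<in> min_nbhd T y \<Longrightarrow> comm_monoid (B z)"
    and i: "\<And>z. z \<in> min_nbhd T y \<Longrightarrow> unital_iso (A z) (B z) (i z)"
    and r': "\<And>z. z \<in> min_nbhd T y \<Longrightarrow> unital_hom (B y) (B z) (r' y z)"
    and nat: "\<And>z a. z \<in> min_nbhd T y \<Longrightarrow> a \<in> carrier (A y) \<Longrightarrow> r' y z (i y a) = i z (r y z a)"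
  shows "fg_spectrum_at T B r' y"
proof -
  note s = fg_spectrum_atD[OF sp]
  have y: "y \<in> min_nbhd T y" by simp
  have iy: "unital_hom (A y) (B y) (i y)" and iyb: "bij_betw (i y) (carrier (A y)) (carrier (B y))"
    using i[OF y] by (auto simp: unital_iso_def)
  have loc: "is_localization (A y) (B y) (i y)" by (rule is_localization_unital_iso[OF cA[OF y] cB[OF y] i[OF y]])
  let ?u = "\<lambda>z. unit_face (A y) (A z) (r y z)" and ?v = "\<lambda>z. unit_face (B y) (B z) (r' y z)"
  have mem: "i y a \<in> ?v z \<longleftrightarrow> a \<in> ?u z" if z: "z \<in> min_nbhd T y" and a: "a \<in> carrier (A y)" for z a
  proof -
    have "r y z a \<in> carrier (A z)" using unital_homD(1)[OF is_localizationD(1)[OF s(2)[OF z]] a] .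
    then show ?thesis
      using unital_iso_Units[OF cA[OF z] cB[OF z] i[OF z]] nat[OF z a] a unital_homD(1)[OF iy a]
      by (simp add: unit_face_def)
  qed
  have u_eq: "?u z = {a \<in> carrier (A y). i y a \<in> ?v z}" if "z \<in> min_nbhd T y" for z
    using mem[OF that] by (auto simp: unit_face_def)
  show ?thesis unfolding fg_spectrum_at_def
  proof (intro conjI ballI impI allI inj_onI)
    show "monoid_finitely_generated (B y)"
      by (rule monoid_finitely_generated_localization[OF cA[OF y] cB[OF y] loc s(1)])
  next
    fix z assume z: "z \<in> min_nbhd T y"
    have l: "is_localization (A y) (B z) (i z \<circ> r y z)"
      by (rule is_localization_comp_iso(1)[OF cA[OF y] cA[OF z] cB[OF z] s(2)[OF z] i[OF z]])
    show "is_localization (B y) (B z) (r' y z)"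
      by (rule is_localization_cancel[OF cA[OF y] cB[OF y] cB[OF z] loc l r'[OF z]]) (simp add: nat[OF z])
  next
    fix z w assume zw: "z \<in> min_nbhd T y" "w \<in> min_nbhd T y" and eq: "?v z = ?v w"
    show "z = w" by (rule s(3)[OF zw]) (simp add: u_eq zw eq)
  next
    fix z w assume zw: "z \<in> min_nbhd T y" "w \<in> min_nbhd T y" and sub: "?v w \<subseteq> ?v z"
    show "z \<in> min_nbhd T w" by (rule s(5)[OF zw]) (use sub in \<open>auto simp: u_eq zw\<close>)
  next
    fix S assume S: "face (B y) S"
    note fS = faceD[OF S] note i' = unital_homD[OF iy]
    have "face (A y) {a \<in> carrier (A y). i y a \<in> S}"
      using fS(2,3) i' comm_monoid.axioms(1)[OF cA[OF y]] by (auto simp: face_def monoid.one_closed monoid.m_closed)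
    then obtain z where z: "z \<in> min_nbhd T y" "?u z = {a \<in> carrier (A y). i y a \<in> S}" using s(4) by blast
    have "b \<in> ?v z \<longleftrightarrow> b \<in> S" if "b \<in> carrier (B y)" for b
    proof -
      obtain a where a: "a \<in> carrier (A y)" "b = i y a" using iyb \<open>b \<in> carrier (B y)\<close> by (auto simp: bij_betw_def)
      then show ?thesis using mem[OF z(1) a(1)] z(2) by auto
    qed
    then have "?v z = S" using fS(1) by (auto simp: unit_face_def)
    then show "\<exists>x\<in>min_nbhd T y. ?v x = S" using z(1) by blast
  qed
qed


section \<open>Products of monoid schemes\<close>

lemma product_space_simps [simp]:
  "base (product_space X Y) = prod_topology (base X) (base Y)"
  "sec (product_space X Y) = product_sections X Y"
  "res (product_space X Y) U V \<sigma> = restrict \<sigma> V"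
  by (simp_all add: product_space_def)

locale stalkwise_pair = X: stalkwise X + Y: stalkwise Y
  for X :: "('p, 'a) monoid_space" and Y :: "('q, 'b) monoid_space"
begin

abbreviation Z where "Z \<equiv> product_space X Y"
abbreviation TZ where "TZ \<equiv> prod_topology X.T Y.T"
abbreviation St where "St z \<equiv> stalk X (fst z) \<times>\<times> stalk Y (snd z)"
abbreviation A where "A z \<equiv> min_sec X (fst z) \<times>\<times> min_sec Y (snd z)"
abbreviation r where "r z w \<equiv> map_prod (min_res X (fst z) (fst w)) (min_res Y (snd z) (snd w))"
abbreviation gz where "gz z \<equiv> map_prod (X.gm (fst z)) (Y.gm (snd z))"

text \<open>The product of two minimal neighbourhoods is open, and every open set around
  \<open>(x, y)\<close> contains a product of open sets around \<open>x\<close> and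
  \<open>y\<close>.\<close>

lemma min_nbhd_TZ:
  assumes "x \<in> topspace X.T" "y \<in> topspace Y.T"
  shows "min_nbhd TZ (x, y) = min_nbhd X.T x \<times> min_nbhd Y.T y"
proof
  have "openin TZ (min_nbhd X.T x \<times> min_nbhd Y.T y)"
    using X.open_nb Y.open_nb assms by (simp add: openin_prod_Times_iff)
  then show "min_nbhd TZ (x, y) \<subseteq> min_nbhd X.T x \<times> min_nbhd Y.T y"
    by (rule min_nbhd_subset) auto
  show "min_nbhd X.T x \<times> min_nbhd Y.T y \<subseteq> min_nbhd TZ (x, y)"
    unfolding min_nbhd_def[of TZ]
  proof (intro Inter_greatest subsetI)
    fix W w assume W: "W \<in> {U. openin TZ U \<and> (x, y) \<in> U}" and w: "w \<in> min_nbhd X.T x \<times> min_nbhd Y.T y"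
    obtain U V where UV: "openin X.T U" "openin Y.T V" "x \<in> U" "y \<in> V" "U \<times> V \<subseteq> W"
      using W unfolding openin_prod_topology_alt by blast
    then show "w \<in> W" using w min_nbhd_subset[OF UV(1,3)] min_nbhd_subset[OF UV(2,4)] by auto
  qed
qed

lemma min_nbhd_TZ': "z \<in> topspace TZ \<Longrightarrow> min_nbhd TZ z = min_nbhd X.T (fst z) \<times> min_nbhd Y.T (snd z)"
  using min_nbhd_TZ[of "fst z" "snd z"] by auto

lemma topD: "z \<in> topspace TZ \<Longrightarrow> fst z \<in> topspace X.T" "z \<in> topspace TZ \<Longrightarrow> snd z \<in> topspace Y.T"
  by auto

lemma nbD:
  "z \<in> topspace TZ \<Longrightarrow> w \<in> min_nbhd TZ z \<Longrightarrow> fst w \<in> min_nbhd X.T (fst z)"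
  "z \<in> topspace TZ \<Longrightarrow> w \<in> min_nbhd TZ z \<Longrightarrow> snd w \<in> min_nbhd Y.T (snd z)"
  using min_nbhd_TZ' by auto

lemma nb_top: "z \<in> topspace TZ \<Longrightarrow> w \<in> min_nbhd TZ z \<Longrightarrow> w \<in> topspace TZ"
  by (rule subsetD[OF min_nbhd_subset_topspace])

lemma open_TZ: "z \<in> topspace TZ \<Longrightarrow> openin TZ (min_nbhd TZ z)"
  using X.open_nb Y.open_nb by (auto simp: min_nbhd_TZ' openin_prod_Times_iff)

lemma cA: "z \<in> topspace TZ \<Longrightarrow> comm_monoid (A z)"
  by (intro comm_monoid_DirProd X.cm Y.cm topD)

lemma cSt: "z \<in> topspace TZ \<Longrightarrow> comm_monoid (St z)"
  by (intro comm_monoid_DirProd X.cm_stalk Y.cm_stalk topD)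

lemma gz_iso: "z \<in> topspace TZ \<Longrightarrow> unital_iso (A z) (St z) (gz z)"
  using X.gm_iso[of "fst z"] Y.gm_iso[of "snd z"]
  by (auto simp: unital_iso_def DirProd_def intro!: unital_hom_DirProd[unfolded DirProd_def] bij_betw_map_prod)

lemma r_hom:
  assumes "z \<in> topspace TZ" "w \<in> min_nbhd TZ z"
  shows "unital_hom (A z) (A w) (r z w)"
  using assms by (intro unital_hom_DirProd X.res_hom Y.res_hom topD nbD)

lemma r_r:
  assumes "z \<in> topspace TZ" "w \<in> min_nbhd TZ z" "v \<in> min_nbhd TZ w" "a \<in> carrier (A z)"
  shows "r w v (r z w a) = r z v a"
proof -
  have w: "w \<in> topspace TZ" using nb_top assms by blast
  show ?thesis
    using X.res_res[OF topD(1)[OF assms(1)] nbD(1)[OF assms(1,2)] nbD(1)[OF w assms(3)]]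
      Y.res_res[OF topD(2)[OF assms(1)] nbD(2)[OF assms(1,2)] nbD(2)[OF w assms(3)]] assms(4)
    by (cases a) simp
qed

lemma r_id: "z \<in> topspace TZ \<Longrightarrow> a \<in> carrier (A z) \<Longrightarrow> r z z a = a"
  using X.res_id Y.res_id by (cases a) auto

text \<open>The family of germs induced on \<open>W\<close> by a pair of sections around
  \<open>z\<close>. It is applied to the minimal neighbourhood of \<open>z\<close>, where it
  produces all sections.\<close>

definition spread where "spread W z a = (\<lambda>w\<in>W. gz w (r z w a))"

text \<open>A representation over \<open>U \<times> V\<close> can be restricted to the minimal
  neighbourhood of \<open>z\<close>, itself a product, where the two sections form an element of
  \<open>A z\<close>. Membership thus becomes a condition on functions at each point, and the sheaf
  axioms reduce to restricting and patching functions.\<close>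

lemma carrier_product_sections:
  assumes W: "openin TZ W"
  shows "\<sigma> \<in> carrier (product_sections X Y W) \<longleftrightarrow> \<sigma> \<in> extensional W \<and>
    (\<forall>z\<in>W. \<exists>a\<in>carrier (A z). \<forall>w\<in>min_nbhd TZ z. \<sigma> w = gz w (r z w a))"
    (is "_ \<longleftrightarrow> _ \<and> ?R")
proof -
  have WT: "z \<in> topspace TZ" if "z \<in> W" for z using openin_subset[OF W] that by blast
  show ?thesis
  proof
    assume s: "\<sigma> \<in> carrier (product_sections X Y W)"
    have "\<sigma> \<in> extensional W" using s by (auto simp: product_sections_def PiE_def)
    moreover have ?R
    proof
      fix z assume z: "z \<in> W"
      obtain U V a b where U: "openin X.T U" "openin Y.T V" "z \<in> U \<times> V" "U \<times> V \<subseteq> W"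
        "a \<in> carrier (sec X U)" "b \<in> carrier (sec Y V)"
        and eq: "\<forall>x\<in>U. \<forall>y\<in>V. \<sigma> (x, y) = (germ X x U a, germ Y y V b)"
        using s z unfolding product_sections_def by (simp) meson
      have zU: "fst z \<in> U" "snd z \<in> V" using U(3) by auto
      let ?a = "res X U (min_nbhd X.T (fst z)) a" and ?b = "res Y V (min_nbhd Y.T (snd z)) b"
      have c: "(?a, ?b) \<in> carrier (A z)"
        using unital_homD(1)[OF X.res_W(1)[OF U(1) zU(1)] U(5)] unital_homD(1)[OF Y.res_W(1)[OF U(2) zU(2)] U(6)] by simp
      have "\<sigma> w = gz w (r z w (?a, ?b))" if w: "w \<in> min_nbhd TZ z" for w
      proof -
        have n: "fst w \<in> min_nbhd X.T (fst z)" "snd w \<in> min_nbhd Y.T (snd z)" using nbD[OF WT[OF z] w] by auto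
        have wU: "fst w \<in> U" "snd w \<in> V"
          using n min_nbhd_subset[OF U(1) zU(1)] min_nbhd_subset[OF U(2) zU(2)] by auto
        have "germ X (fst w) U a = X.gm (fst w) (res X U (min_nbhd X.T (fst w)) a)"
          by (rule min_presheaf.germ_eq_g[OF X.min_pre[OF X.open_top[OF U(1) wU(1)]] U(1) wU(1) U(5)])
        moreover have "germ Y (snd w) V b = Y.gm (snd w) (res Y V (min_nbhd Y.T (snd w)) b)"
          by (rule min_presheaf.germ_eq_g[OF Y.min_pre[OF Y.open_top[OF U(2) wU(2)]] U(2) wU(2) U(6)])
        moreover have "\<sigma> w = (germ X (fst w) U a, germ Y (snd w) V b)"
          using eq wU by (metis prod.collapse)
        ultimately show ?thesis
          using X.res_W(2)[OF U(1) zU(1) n(1) U(5)] Y.res_W(2)[OF U(2) zU(2) n(2) U(6)] by simp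
      qed
      then show "\<exists>a\<in>carrier (A z). \<forall>w\<in>min_nbhd TZ z. \<sigma> w = gz w (r z w a)" using c by blast
    qed
    ultimately show "\<sigma> \<in> extensional W \<and> ?R" by blast
  next
    assume *: "\<sigma> \<in> extensional W \<and> ?R"
    show "\<sigma> \<in> carrier (product_sections X Y W)"
      unfolding product_sections_def partial_object.simps
    proof (intro CollectI conjI ballI PiE_I)
      fix z assume z: "z \<in> W"
      obtain a where a: "a \<in> carrier (A z)" "\<And>w. w \<in> min_nbhd TZ z \<Longrightarrow> \<sigma> w = gz w (r z w a)" using * z by blast
      have zT: "z \<in> topspace TZ" by (rule WT[OF z])
      have "\<sigma> z = gz z a" using a(2)[OF min_nbhd_self] r_id[OF zT a(1)] by simp
      then show "\<sigma> z \<in> carrier (St z)"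
        using gz_iso[OF zT] unital_homD(1)[of "A z" "St z" "gz z"] a(1) by (auto simp: unital_iso_def)
      have nb: "min_nbhd TZ z = min_nbhd X.T (fst z) \<times> min_nbhd Y.T (snd z)" by (rule min_nbhd_TZ'[OF zT])
      show "\<exists>U V a b. openin X.T U \<and> openin Y.T V \<and> z \<in> U \<times> V \<and> U \<times> V \<subseteq> W \<and>
          a \<in> carrier (sec X U) \<and> b \<in> carrier (sec Y V) \<and>
          (\<forall>x\<in>U. \<forall>y\<in>V. \<sigma> (x, y) = (germ X x U a, germ Y y V b))"
      proof (intro exI conjI ballI)
        show "openin X.T (min_nbhd X.T (fst z))" "openin Y.T (min_nbhd Y.T (snd z))"
          using X.open_nb Y.open_nb topD[OF zT] by auto
        show "z \<in> min_nbhd X.T (fst z) \<times> min_nbhd Y.T (snd z)" by (simp add: mem_Times_iff)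
        show "min_nbhd X.T (fst z) \<times> min_nbhd Y.T (snd z) \<subseteq> W" using min_nbhd_subset[OF W z] nb by simp
        show "fst a \<in> carrier (min_sec X (fst z))" "snd a \<in> carrier (min_sec Y (snd z))" using a(1) by auto
        fix x y assume xy: "x \<in> min_nbhd X.T (fst z)" "y \<in> min_nbhd Y.T (snd z)"
        have "germ X x (min_nbhd X.T (fst z)) (fst a) = X.gm x (min_res X (fst z) x (fst a))"
          by (rule min_presheaf.germ_eq_g[OF X.min_pre[OF X.mem_top[OF topD(1)[OF zT] xy(1)]] X.open_nb[OF topD(1)[OF zT]] xy(1)])
             (use a(1) in auto)
        moreover have "germ Y y (min_nbhd Y.T (snd z)) (snd a) = Y.gm y (min_res Y (snd z) y (snd a))"
          by (rule min_presheaf.germ_eq_g[OF Y.min_pre[OF Y.mem_top[OF topD(2)[OF zT] xy(2)]] Y.open_nb[OF topD(2)[OF zT]] xy(2)])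
             (use a(1) in auto)
        ultimately show "\<sigma> (x, y) = (germ X x (min_nbhd X.T (fst z)) (fst a), germ Y y (min_nbhd Y.T (snd z)) (snd a))"
          using a(2)[of "(x, y)"] xy nb by (simp add: map_prod_def split_beta)
      qed
    next
      fix z assume "z \<notin> W"
      then show "\<sigma> z = undefined" by (rule extensional_arb[OF conjunct1[OF *]])
    qed
  qed
qed

lemma mult_product_sections: "\<sigma> \<otimes>\<^bsub>product_sections X Y W\<^esub> \<tau> = (\<lambda>z\<in>W. \<sigma> z \<otimes>\<^bsub>St z\<^esub> \<tau> z)"
  and one_product_sections: "\<one>\<^bsub>product_sections X Y W\<^esub> = (\<lambda>z\<in>W. \<one>\<^bsub>St z\<^esub>)"
  by (simp_all add: product_sections_def)

lemma gz_hom: "z \<in> topspace TZ \<Longrightarrow> unital_hom (A z) (St z) (gz z)"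
  using gz_iso by (simp add: unital_iso_def)

lemma comm_monoid_product_sections:
  assumes W: "openin TZ W"
  shows "comm_monoid (product_sections X Y W)"
proof -
  note c = carrier_product_sections[OF W]
  have WT: "z \<in> topspace TZ" if "z \<in> W" for z using openin_subset[OF W] that by blast
  have St: "\<sigma> z \<in> carrier (St z)" if "\<sigma> \<in> carrier (product_sections X Y W)" "z \<in> W" for \<sigma> z
    using that by (auto simp: product_sections_def PiE_iff)
  have WN: "w \<in> W" if "z \<in> W" "w \<in> min_nbhd TZ z" for z w using min_nbhd_subset[OF W that(1)] that(2) by blast
  show ?thesis
  proof (rule comm_monoidI)
    fix \<sigma> \<tau> assume s: "\<sigma> \<in> carrier (product_sections X Y W)" and t: "\<tau> \<in> carrier (product_sections X Y W)"
    show "\<sigma> \<otimes>\<^bsub>product_sections X Y W\<^esub> \<tau> = \<tau> \<otimes>\<^bsub>product_sections X Y W\<^esub> \<sigma>"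
      unfolding mult_product_sections
      by (rule restrict_ext) (rule comm_monoid.m_comm[OF cSt[OF WT] St[OF s] St[OF t]])
    show "\<sigma> \<otimes>\<^bsub>product_sections X Y W\<^esub> \<tau> \<in> carrier (product_sections X Y W)"
      unfolding c
    proof (intro conjI ballI)
      show "\<sigma> \<otimes>\<^bsub>product_sections X Y W\<^esub> \<tau> \<in> extensional W" by (simp add: mult_product_sections)
      fix z assume z: "z \<in> W"
      obtain a where a: "a \<in> carrier (A z)" "\<And>w. w \<in> min_nbhd TZ z \<Longrightarrow> \<sigma> w = gz w (r z w a)" using s c z by blast
      obtain b where b: "b \<in> carrier (A z)" "\<And>w. w \<in> min_nbhd TZ z \<Longrightarrow> \<tau> w = gz w (r z w b)" using t c z by blast
      have "(\<sigma> \<otimes>\<^bsub>product_sections X Y W\<^esub> \<tau>) w = gz w (r z w (a \<otimes>\<^bsub>A z\<^esub> b))" if w: "w \<in> min_nbhd TZ z" for w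
      proof -
        note rh = unital_homD[OF r_hom[OF WT[OF z] w]]
        note gh = unital_homD[OF gz_hom[OF WT[OF WN[OF z w]]]]
        show ?thesis
          unfolding rh(2)[OF a(1) b(1)] gh(2)[OF rh(1)[OF a(1)] rh(1)[OF b(1)]] a(2)[OF w, symmetric] b(2)[OF w, symmetric]
          using WN[OF z w] by (simp add: mult_product_sections)
      qed
      then show "\<exists>a\<in>carrier (A z). \<forall>w\<in>min_nbhd TZ z. (\<sigma> \<otimes>\<^bsub>product_sections X Y W\<^esub> \<tau>) w = gz w (r z w a)"
        using monoid.m_closed[OF comm_monoid.axioms(1)[OF cA[OF WT[OF z]]] a(1) b(1)] by blast
    qed
    fix \<rho> assume u: "\<rho> \<in> carrier (product_sections X Y W)"
    show "\<sigma> \<otimes>\<^bsub>product_sections X Y W\<^esub> \<tau> \<otimes>\<^bsub>product_sections X Y W\<^esub> \<rho>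
      = \<sigma> \<otimes>\<^bsub>product_sections X Y W\<^esub> (\<tau> \<otimes>\<^bsub>product_sections X Y W\<^esub> \<rho>)"
      unfolding mult_product_sections
      by (rule restrict_ext)
         (simp add: monoid.m_assoc[OF comm_monoid.axioms(1)[OF cSt[OF WT]] St[OF s] St[OF t] St[OF u]] del: mult_DirProd)
  next
    show "\<one>\<^bsub>product_sections X Y W\<^esub> \<in> carrier (product_sections X Y W)"
      unfolding c
    proof (intro conjI ballI)
      show "\<one>\<^bsub>product_sections X Y W\<^esub> \<in> extensional W" by (simp add: one_product_sections)
      fix z assume z: "z \<in> W"
      have "\<one>\<^bsub>product_sections X Y W\<^esub> w = gz w (r z w \<one>\<^bsub>A z\<^esub>)" if w: "w \<in> min_nbhd TZ z" for w
        unfolding unital_homD(3)[OF r_hom[OF WT[OF z] w]] unital_homD(3)[OF gz_hom[OF WT[OF WN[OF z w]]]]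
        using WN[OF z w] by (simp add: one_product_sections)
      then show "\<exists>a\<in>carrier (A z). \<forall>w\<in>min_nbhd TZ z. \<one>\<^bsub>product_sections X Y W\<^esub> w = gz w (r z w a)"
        using monoid.one_closed[OF comm_monoid.axioms(1)[OF cA[OF WT[OF z]]]] by blast
    qed
  next
    fix \<sigma> assume s: "\<sigma> \<in> carrier (product_sections X Y W)"
    have "(\<lambda>z\<in>W. (\<lambda>z\<in>W. \<one>\<^bsub>St z\<^esub>) z \<otimes>\<^bsub>St z\<^esub> \<sigma> z) = restrict \<sigma> W"
      by (rule restrict_ext)
         (simp add: monoid.l_one[OF comm_monoid.axioms(1)[OF cSt[OF WT]] St[OF s]] del: mult_DirProd one_DirProd)
    then show "\<one>\<^bsub>product_sections X Y W\<^esub> \<otimes>\<^bsub>product_sections X Y W\<^esub> \<sigma> = \<sigma>"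
      unfolding mult_product_sections one_product_sections using s c by (simp add: extensional_restrict)
  qed
qed

lemma restrict_product_sections:
  assumes "openin TZ W" "openin TZ V" "V \<subseteq> W" "\<sigma> \<in> carrier (product_sections X Y W)"
  shows "restrict \<sigma> V \<in> carrier (product_sections X Y V)"
  unfolding carrier_product_sections[OF assms(2)]
proof (intro conjI ballI)
  fix z assume z: "z \<in> V"
  then obtain a where a: "a \<in> carrier (A z)" "\<forall>w\<in>min_nbhd TZ z. \<sigma> w = gz w (r z w a)"
    using assms carrier_product_sections[OF assms(1)] by blast
  have "\<forall>w\<in>min_nbhd TZ z. restrict \<sigma> V w = gz w (r z w a)"
    using a(2) min_nbhd_subset[OF assms(2) z] by (auto simp: restrict_def)
  then show "\<exists>a\<in>carrier (A z). \<forall>w\<in>min_nbhd TZ z. restrict \<sigma> V w = gz w (r z w a)" using a(1) by blast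
qed simp

lemma sheaf_product: "sheaf_of_monoids Z"
proof -
  have psh: "presheaf_of_monoids Z"
    unfolding presheaf_of_monoids_def product_space_simps(1,2)
  proof (intro conjI allI impI ballI)
    show "comm_monoid (product_sections X Y U)" if "openin TZ U" for U
      by (rule comm_monoid_product_sections[OF that])
    show "res Z U V \<in> hom (product_sections X Y U) (product_sections X Y V)"
      if UV: "openin TZ U" "openin TZ V" "V \<subseteq> U" for U V
    proof (rule homI)
      fix s t assume st: "s \<in> carrier (product_sections X Y U)" "t \<in> carrier (product_sections X Y U)"
      show "res Z U V s \<in> carrier (product_sections X Y V)"
        using restrict_product_sections[OF UV st(1)] by simp
      show "res Z U V (s \<otimes>\<^bsub>product_sections X Y U\<^esub> t) = res Z U V s \<otimes>\<^bsub>product_sections X Y V\<^esub> res Z U V t"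
        using UV(3) by (auto simp: mult_product_sections restrict_def fun_eq_iff)
    qed
    show "res Z U V \<one>\<^bsub>product_sections X Y U\<^esub> = \<one>\<^bsub>product_sections X Y V\<^esub>"
      if "openin TZ U" "openin TZ V" "V \<subseteq> U" for U V
      using that(3) by (auto simp: one_product_sections restrict_def fun_eq_iff)
    show "res Z U U s = s" if "openin TZ U" "s \<in> carrier (product_sections X Y U)" for U s
      using that carrier_product_sections[OF that(1)] by (simp add: extensional_restrict)
    show "res Z V W (res Z U V s) = res Z U W s" if "W \<subseteq> V"
      for U V W and s :: "'p \<times> 'q \<Rightarrow> ('p set \<times> 'a) set \<times> ('q set \<times> 'b) set"
      using that by (auto simp: restrict_def fun_eq_iff)
  qed
  have sep: "s = t"
    if "\<forall>U\<in>\<U>. openin TZ U" "s \<in> carrier (product_sections X Y (\<Union>\<U>))" "t \<in> carrier (product_sections X Y (\<Union>\<U>))"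
      "\<forall>U\<in>\<U>. restrict s U = restrict t U" for \<U> s t
  proof -
    have o: "openin TZ (\<Union>\<U>)" using that(1) by auto
    show ?thesis
    proof (rule extensionalityI[of _ "\<Union>\<U>"])
      show "s \<in> extensional (\<Union>\<U>)" "t \<in> extensional (\<Union>\<U>)" using that carrier_product_sections[OF o] by auto
      fix z assume "z \<in> \<Union>\<U>"
      then obtain U where "U \<in> \<U>" "z \<in> U" by auto
      then show "s z = t z" using that(4) by (metis restrict_apply')
    qed
  qed
  have glue: "\<exists>t\<in>carrier (product_sections X Y (\<Union>\<U>)). \<forall>U\<in>\<U>. restrict t U = s U"
    if s: "\<forall>U\<in>\<U>. openin TZ U \<and> s U \<in> carrier (product_sections X Y U)"
      and comp: "\<forall>U\<in>\<U>. \<forall>V\<in>\<U>. restrict (s U) (U \<inter> V) = restrict (s V) (U \<inter> V)" for \<U> s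
  proof -
    have o: "openin TZ (\<Union>\<U>)" using s by auto
    \<comment> \<open>Any member of the cover that contains \<open>z\<close> may serve, because the
      given sections agree on overlaps.\<close>
    define t where "t = (\<lambda>z\<in>\<Union>\<U>. s (SOME U. U \<in> \<U> \<and> z \<in> U) z)"
    have t: "t z = s U z" if U: "U \<in> \<U>" "z \<in> U" for U z
    proof -
      have V: "(SOME U. U \<in> \<U> \<and> z \<in> U) \<in> \<U> \<and> z \<in> (SOME U. U \<in> \<U> \<and> z \<in> U)" (is "?V \<in> \<U> \<and> _")
        by (rule someI[of _ U]) (use U in auto)
      then have "restrict (s ?V) (?V \<inter> U) z = restrict (s U) (?V \<inter> U) z" using comp U by simp
      then show ?thesis using V U by (auto simp: t_def)
    qed
    have "t \<in> carrier (product_sections X Y (\<Union>\<U>))"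
      unfolding carrier_product_sections[OF o]
    proof (intro conjI ballI)
      show "t \<in> extensional (\<Union>\<U>)" by (simp add: t_def)
      fix z assume "z \<in> \<Union>\<U>"
      then obtain U where U: "U \<in> \<U>" "z \<in> U" by auto
      have oU: "openin TZ U" using s U by auto
      obtain a where a: "a \<in> carrier (A z)" "\<forall>w\<in>min_nbhd TZ z. s U w = gz w (r z w a)"
        using s U carrier_product_sections[OF oU] by blast
      have "\<forall>w\<in>min_nbhd TZ z. t w = gz w (r z w a)"
        using a(2) t[OF U(1)] min_nbhd_subset[OF oU U(2)] by auto
      then show "\<exists>a\<in>carrier (A z). \<forall>w\<in>min_nbhd TZ z. t w = gz w (r z w a)" using a(1) by blast
    qed
    moreover have "restrict t U = s U" if U: "U \<in> \<U>" for U
    proof -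
      have "openin TZ U" "s U \<in> carrier (product_sections X Y U)" using s U by auto
      then have "s U \<in> extensional U" using carrier_product_sections by auto
      then show ?thesis using t[OF U] by (auto simp: restrict_def extensional_def fun_eq_iff)
    qed
    ultimately show ?thesis by blast
  qed
  show ?thesis
    unfolding sheaf_of_monoids_def product_space_simps using psh sep glue by blast
qed

text \<open>A section over the minimal neighbourhood of \<open>z\<close> is the spread of the
  element of \<open>A z\<close> that represents it around \<open>z\<close>. This element is unique
  because its value at \<open>z\<close> determines it through the bijection
  \<open>gz z\<close>.\<close>

lemma spread_iso:
  assumes z: "z \<in> topspace TZ"
  shows "unital_iso (A z) (min_sec Z z) (spread (min_nbhd TZ z) z)"
proof -
  let ?N = "min_nbhd TZ z"
  let ?s = "spread ?N z"
  have oN: "openin TZ ?N" by (rule open_TZ[OF z])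
  have NT: "w \<in> topspace TZ" if "w \<in> ?N" for w using nb_top[OF z that] .
  note c = carrier_product_sections[OF oN]
  have s: "?s a w = gz w (r z w a)" if "w \<in> ?N" for a w using that by (simp add: spread_def)
  have cl: "?s a \<in> carrier (product_sections X Y ?N)" if a: "a \<in> carrier (A z)" for a
    unfolding c
  proof (intro conjI ballI)
    show "?s a \<in> extensional ?N" by (simp add: spread_def)
    fix w assume w: "w \<in> ?N"
    have "?s a v = gz v (r w v (r z w a))" if v: "v \<in> min_nbhd TZ w" for v
    proof -
      have "v \<in> ?N" using min_nbhd_mono[OF w] v by auto
      then show ?thesis unfolding r_r[OF z w v a] by (rule s)
    qed
    then show "\<exists>b\<in>carrier (A w). \<forall>v\<in>min_nbhd TZ w. ?s a v = gz v (r w v b)"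
      using unital_homD(1)[OF r_hom[OF z w] a] by blast
  qed
  have hom: "unital_hom (A z) (product_sections X Y ?N) ?s"
    unfolding unital_hom_def
  proof (intro conjI homI cl)
    fix a b assume ab: "a \<in> carrier (A z)" "b \<in> carrier (A z)"
    show "?s (a \<otimes>\<^bsub>A z\<^esub> b) = ?s a \<otimes>\<^bsub>product_sections X Y ?N\<^esub> ?s b"
      unfolding mult_product_sections spread_def
    proof (rule restrict_ext)
      fix w assume w: "w \<in> ?N"
      note rh = unital_homD[OF r_hom[OF z w]]
      note gh = unital_homD[OF gz_hom[OF NT[OF w]]]
      have "gz w (r z w (a \<otimes>\<^bsub>A z\<^esub> b)) = gz w (r z w a) \<otimes>\<^bsub>St w\<^esub> gz w (r z w b)"
        unfolding rh(2)[OF ab] gh(2)[OF rh(1)[OF ab(1)] rh(1)[OF ab(2)]] ..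
      then show "gz w (r z w (a \<otimes>\<^bsub>A z\<^esub> b)) = (\<lambda>w\<in>?N. gz w (r z w a)) w \<otimes>\<^bsub>St w\<^esub> (\<lambda>w\<in>?N. gz w (r z w b)) w"
        using w by simp
    qed
  next
    show "?s \<one>\<^bsub>A z\<^esub> = \<one>\<^bsub>product_sections X Y ?N\<^esub>"
      unfolding one_product_sections spread_def
    proof (rule restrict_ext)
      fix w assume w: "w \<in> ?N"
      show "gz w (r z w \<one>\<^bsub>A z\<^esub>) = \<one>\<^bsub>St w\<^esub>"
        unfolding unital_homD(3)[OF r_hom[OF z w]] unital_homD(3)[OF gz_hom[OF NT[OF w]]] ..
    qed
  qed
  have gb: "bij_betw (gz z) (carrier (A z)) (carrier (St z))" using gz_iso[OF z] by (simp add: unital_iso_def)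
  have "inj_on ?s (carrier (A z))"
  proof (rule inj_onI)
    fix a b assume ab: "a \<in> carrier (A z)" "b \<in> carrier (A z)" "?s a = ?s b"
    have "gz z a = gz z b"
      using fun_cong[OF ab(3), of z] s[OF min_nbhd_self] r_id[OF z ab(1)] r_id[OF z ab(2)] by simp
    then show "a = b" using inj_onD[OF bij_betw_imp_inj_on[OF gb] _ ab(1,2)] by blast
  qed
  moreover have "\<sigma> \<in> ?s ` carrier (A z)" if t: "\<sigma> \<in> carrier (product_sections X Y ?N)" for \<sigma>
  proof -
    obtain a where a: "a \<in> carrier (A z)" "\<forall>w\<in>?N. \<sigma> w = gz w (r z w a)" 
      using bspec[OF conjunct2[OF t[unfolded c]] min_nbhd_self] by (elim bexE) (rule that)
    have "\<sigma> = ?s a"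
      by (rule extensionalityI[of _ ?N]) (use t c a(2) s in \<open>auto simp: spread_def\<close>)
    then show ?thesis using a(1) by blast
  qed
  ultimately have "bij_betw ?s (carrier (A z)) (carrier (product_sections X Y ?N))"
    using cl unfolding bij_betw_def by blast
  then show ?thesis using hom by (simp add: unital_iso_def)
qed

lemma spread_nat:
  assumes "z \<in> topspace TZ" "w \<in> min_nbhd TZ z" "a \<in> carrier (A z)"
  shows "min_res Z z w (spread (min_nbhd TZ z) z a) = spread (min_nbhd TZ w) w (r z w a)"
proof -
  have "restrict (spread (min_nbhd TZ z) z a) (min_nbhd TZ w) v = spread (min_nbhd TZ w) w (r z w a) v" for v
    using r_r[OF assms(1,2) _ assms(3), of v] min_nbhd_mono[OF assms(2)]
    by (cases "v \<in> min_nbhd TZ w") (auto simp: spread_def)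
  then show ?thesis by (simp add: fun_eq_iff)
qed

lemma stalkwise_product: "stalkwise Z"
proof -
  have psh: "presheaf_of_monoids Z" using sheaf_product by (simp add: sheaf_of_monoids_def)
  have "fg_spectrum_at TZ (min_sec Z) (min_res Z) z" if z: "z \<in> topspace TZ" for z
  proof (rule fg_spectrum_at_iso)
    have "fg_spectrum_at TZ A r (fst z, snd z)"
    proof (rule fg_spectrum_at_DirProd)
      show "fg_spectrum_at X.T (min_sec X) (min_res X) (fst z)" by (rule X.spectrum[OF topD(1)[OF z]])
      show "fg_spectrum_at Y.T (min_sec Y) (min_res Y) (snd z)" by (rule Y.spectrum[OF topD(2)[OF z]])
      show "comm_monoid (min_sec X x')" if "x' \<in> min_nbhd X.T (fst z)" for x'
        by (rule X.cm[OF X.mem_top[OF topD(1)[OF z] that]])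
      show "comm_monoid (min_sec Y y')" if "y' \<in> min_nbhd Y.T (snd z)" for y'
        by (rule Y.cm[OF Y.mem_top[OF topD(2)[OF z] that]])
      show "min_nbhd TZ (x', y') = min_nbhd X.T x' \<times> min_nbhd Y.T y'"
        if "x' \<in> min_nbhd X.T (fst z)" "y' \<in> min_nbhd Y.T (snd z)" for x' y'
        by (rule min_nbhd_TZ[OF X.mem_top[OF topD(1)[OF z] that(1)] Y.mem_top[OF topD(2)[OF z] that(2)]])
    qed
    then show "fg_spectrum_at TZ A r z" by simp
    fix w assume w: "w \<in> min_nbhd TZ z"
    have wT: "w \<in> topspace TZ" by (rule nb_top[OF z w])
    show "comm_monoid (A w)" by (rule cA[OF wT])
    show "comm_monoid (min_sec Z w)" using comm_monoid_product_sections[OF open_TZ[OF wT]] by simp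
    show "unital_iso (A w) (min_sec Z w) (spread (min_nbhd TZ w) w)" by (rule spread_iso[OF wT])
    show "unital_hom (min_sec Z z) (min_sec Z w) (min_res Z z w)"
      using presheafD(2)[OF psh, of "min_nbhd TZ z" "min_nbhd TZ w"] open_TZ[OF z] open_TZ[OF wT] min_nbhd_mono[OF w] by simp
    show "min_res Z z w (spread (min_nbhd TZ z) z a) = spread (min_nbhd TZ w) w (r z w a)" if "a \<in> carrier (A z)" for a
      by (rule spread_nat[OF z w that])
  qed
  moreover have "finite (topspace TZ)" using X.finT Y.finT by simp
  ultimately show ?thesis
    using sheaf_product open_TZ unfolding stalkwise_def stalkwise_scheme_def product_space_simps by blast
qed

text \<open>The functor of the product and the sum of the two pulled back functors are both models
  over the monoids \<open>A z\<close>. The second splits at every point because the factors do, and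
  the splitting is transferred to the first.\<close>

lemma s_smooth_product:
  assumes sX: "s_smooth X" and sY: "s_smooth Y"
  shows "s_smooth Z"
proof -
  interpret Z: stalkwise Z by (rule stalkwise_product)
  note mX = sX[unfolded s_smooth_iff] and mY = sY[unfolded s_smooth_iff]
  have canc: "inj_on (min_res Z z w) (Units (min_sec Z z))" if z: "z \<in> topspace TZ" and w: "w \<in> min_nbhd TZ z" for z w
  proof (rule inj_onI)
    fix s t assume st: "s \<in> Units (min_sec Z z)" "t \<in> Units (min_sec Z z)" "min_res Z z w s = min_res Z z w t"
    have wT: "w \<in> topspace TZ" by (rule nb_top[OF z w])
    have czs: "comm_monoid (min_sec Z z)" using comm_monoid_product_sections[OF open_TZ[OF z]] by simp
    note iso = spread_iso[OF z]
    have ex: "\<exists>a\<in>carrier (A z). u = spread (min_nbhd TZ z) z a \<and> a \<in> Units (A z)" if u: "u \<in> Units (min_sec Z z)" for u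
    proof -
      have "u \<in> carrier (min_sec Z z)" using u by (auto simp: Units_def)
      then have "u \<in> spread (min_nbhd TZ z) z ` carrier (A z)"
        using iso by (auto simp: unital_iso_def bij_betw_def)
      then show ?thesis using unital_iso_Units[OF cA[OF z] czs iso] u by blast
    qed
    obtain a where a: "a \<in> carrier (A z)" "s = spread (min_nbhd TZ z) z a" "a \<in> Units (A z)" using ex[OF st(1)] by blast
    obtain b where b: "b \<in> carrier (A z)" "t = spread (min_nbhd TZ z) z b" "b \<in> Units (A z)" using ex[OF st(2)] by blast
    have "spread (min_nbhd TZ w) w (r z w a) = spread (min_nbhd TZ w) w (r z w b)"
      using spread_nat[OF z w a(1)] spread_nat[OF z w b(1)] st(3) a(2) b(2) by simp
    then have e: "r z w a = r z w b"
      using spread_iso[OF wT] unital_homD(1)[OF r_hom[OF z w] a(1)] unital_homD(1)[OF r_hom[OF z w] b(1)]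
      unfolding unital_iso_def bij_betw_def inj_on_def by blast
    have iX: "inj_on (min_res X (fst z) (fst w)) (Units (min_sec X (fst z)))"
      using mX topD(1)[OF z] nbD(1)[OF z w] by blast
    have iY: "inj_on (min_res Y (snd z) (snd w)) (Units (min_sec Y (snd z)))"
      using mY topD(2)[OF z] nbD(2)[OF z w] by blast
    obtain a1 a2 b1 b2 where ab: "a = (a1, a2)" "b = (b1, b2)" by (meson surj_pair)
    have "a1 = b1" using inj_onD[OF iX, of a1 b1] e a(3) b(3) by (simp add: ab Units_DirProd)
    moreover have "a2 = b2" using inj_onD[OF iY, of a2 b2] e a(3) b(3) by (simp add: ab Units_DirProd)
    ultimately show "s = t" using a(2) b(2) ab by simp
  qed
  define F where "F = DirProd_functor (pullback_functor fst X.QF) (pullback_functor snd Y.QF)"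
  define q where "q z = map_prod (X.QF_proj (fst z) \<circ> X.gm (fst z)) (Y.QF_proj (snd z) \<circ> Y.gm (snd z))" for z
  have objF: "obj F z = obj X.QF (fst z) \<times>\<times> obj Y.QF (snd z)" for z
    by (simp add: F_def pullback_functor_def)
  have arrF: "arr F z w = map_prod (arr X.QF (fst z) (fst w)) (arr Y.QF (snd z) (snd w))" for z w
    by (simp add: F_def pullback_functor_def)
  have modF: "quotient_model TZ (topspace TZ) A r F q"
    unfolding quotient_model_def
  proof (intro ballI conjI cA)
    fix z assume z: "z \<in> topspace TZ"
    note qX = quotient_modelD[OF X.quotient_model_min topD(1)[OF z]]
    note qY = quotient_modelD[OF Y.quotient_model_min topD(2)[OF z]]
    show "regular_quotient (A z) (obj F z) (q z)"
      unfolding objF q_def by (rule regular_quotient_DirProd[OF qX(1) qY(1) qX(2) qY(2)])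
    fix w assume w: "w \<in> min_nbhd TZ z"
    note nX = nbD(1)[OF z w] and nY = nbD(2)[OF z w]
    show "arr F z w \<in> hom (obj F z) (obj F w)"
      unfolding objF arrF using qX(3)[OF nX] qY(3)[OF nY] by (auto simp: hom_def)
    fix a assume "a \<in> s_regulars (A z)"
    then obtain a1 a2 where a: "a = (a1, a2)" "a1 \<in> s_regulars (min_sec X (fst z))" "a2 \<in> s_regulars (min_sec Y (snd z))"
      using s_regulars_DirProd[OF qX(1) qY(1)] by auto
    have wT: "w \<in> topspace TZ" by (rule nb_top[OF z w])
    show "r z w a \<in> s_regulars (A w)"
      unfolding s_regulars_DirProd[OF X.cm[OF topD(1)[OF wT]] Y.cm[OF topD(2)[OF wT]]]
      using qX(4)[OF nX a(2)] qY(4)[OF nY a(3)] a(1) by simp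
    show "arr F z w (q z a) = q w (r z w a)"
      unfolding arrF q_def using qX(5)[OF nX a(2)] qY(5)[OF nY a(3)] a(1) by simp
  qed
  \<comment> \<open>The monoids are changed along \<open>spread\<close> from sections on the product
    to pairs of sections, to match \<open>modF\<close>.\<close>
  have modZ: "quotient_model TZ (topspace TZ) A r Z.QF (\<lambda>z. (Z.QF_proj z \<circ> Z.gm z) \<circ> spread (min_nbhd TZ z) z)"
  proof (rule quotient_model_iso)
    show "quotient_model TZ (topspace TZ) (min_sec Z) (min_res Z) Z.QF (\<lambda>z. Z.QF_proj z \<circ> Z.gm z)"
      using Z.quotient_model_min by simp
    show "w \<in> topspace TZ" if "z \<in> topspace TZ" "w \<in> min_nbhd TZ z" for z w by (rule nb_top[OF that])
    show "comm_monoid (A z)" if "z \<in> topspace TZ" for z by (rule cA[OF that])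
    show "unital_iso (A z) (min_sec Z z) (spread (min_nbhd TZ z) z)" if "z \<in> topspace TZ" for z by (rule spread_iso[OF that])
    show "r z w a \<in> carrier (A w) \<and> spread (min_nbhd TZ w) w (r z w a) = min_res Z z w (spread (min_nbhd TZ z) z a)"
      if "z \<in> topspace TZ" "w \<in> min_nbhd TZ z" "a \<in> carrier (A z)" for z w a
      using unital_homD(1)[OF r_hom[OF that(1,2)] that(3)] spread_nat[OF that] by simp
  qed
  have T0: "finite_T0 TZ" using Z.finite_T0_axioms by simp
  have flasque: "locally_flasque_at TZ Z.QF z" if z: "z \<in> topspace TZ" for z
  proof -
    obtain x y where xy: "z = (x, y)" by (meson surj_pair)
    have x: "x \<in> topspace X.T" and y: "y \<in> topspace Y.T" using z xy by auto
    obtain ex where ex: "ex \<in> min_nbhd X.T x" "\<And>x'. x' \<in> min_nbhd X.T x \<Longrightarrow> ex \<in> min_nbhd X.T x'"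
      using X.generic_point[OF x] by blast
    obtain ey where ey: "ey \<in> min_nbhd Y.T y" "\<And>y'. y' \<in> min_nbhd Y.T y \<Longrightarrow> ey \<in> min_nbhd Y.T y'"
      using Y.generic_point[OF y] by blast
    note n = min_nbhd_TZ'
    \<comment> \<open>Inside the neighbourhood of \<open>z\<close>, the fibre of the first
      projection over \<open>x'\<close> is a copy of the neighbourhood of \<open>y\<close>, and its
      generic point is \<open>(x', ey)\<close>.\<close>
    have 1: "locally_flasque_at TZ (pullback_functor fst X.QF) z"
    proof (rule locally_flasque_at_pullback[OF T0 z X.group_functor_QF, where \<iota> = "\<lambda>x'. (x', ey)"])
      show "fst z \<in> topspace X.T" using x xy by simp
      show "locally_flasque_at X.T X.QF (fst z)" using mX x xy by simp
      show "fst w' \<in> min_nbhd X.T (fst w)" if "w \<in> min_nbhd TZ z" "w' \<in> min_nbhd TZ w" for w w'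
        by (rule nbD(1)[OF nb_top[OF z that(1)] that(2)])
      show "(x', ey) \<in> min_nbhd TZ z \<and> fst (x', ey) = x'" if "x' \<in> min_nbhd X.T (fst z)" for x'
        using n[OF z] ey(1) xy that by simp
      show "(fst w, ey) \<in> min_nbhd TZ w" if "w \<in> min_nbhd TZ z" for w
        using n[OF nb_top[OF z that]] ey(2) nbD(2)[OF z that] xy by simp
      show "(x'', ey) \<in> min_nbhd TZ (x', ey)" if "x' \<in> min_nbhd X.T (fst z)" "x'' \<in> min_nbhd X.T x'" for x' x''
        using min_nbhd_TZ[OF X.mem_top[OF x] Y.mem_top[OF y ey(1)], of x'] that xy by simp
    qed
    have 2: "locally_flasque_at TZ (pullback_functor snd Y.QF) z"
    proof (rule locally_flasque_at_pullback[OF T0 z Y.group_functor_QF, where \<iota> = "\<lambda>y'. (ex, y')"])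
      show "snd z \<in> topspace Y.T" using y xy by simp
      show "locally_flasque_at Y.T Y.QF (snd z)" using mY y xy by simp
      show "snd w' \<in> min_nbhd Y.T (snd w)" if "w \<in> min_nbhd TZ z" "w' \<in> min_nbhd TZ w" for w w'
        by (rule nbD(2)[OF nb_top[OF z that(1)] that(2)])
      show "(ex, y') \<in> min_nbhd TZ z \<and> snd (ex, y') = y'" if "y' \<in> min_nbhd Y.T (snd z)" for y'
        using n[OF z] ex(1) xy that by simp
      show "(ex, snd w) \<in> min_nbhd TZ w" if "w \<in> min_nbhd TZ z" for w
        using n[OF nb_top[OF z that]] ex(2) nbD(1)[OF z that] xy by simp
      show "(ex, y'') \<in> min_nbhd TZ (ex, y')" if "y' \<in> min_nbhd Y.T (snd z)" "y'' \<in> min_nbhd Y.T y'" for y' y''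
        using min_nbhd_TZ[OF X.mem_top[OF x ex(1)] Y.mem_top[OF y], of y'] that xy by simp
    qed
    have F: "locally_flasque_at TZ F z" unfolding F_def by (rule locally_flasque_at_DirProd[OF z 1 2])
    have sub: "min_nbhd TZ z \<subseteq> topspace TZ" by (rule min_nbhd_subset_topspace[OF z])
    show ?thesis
      by (rule locally_flasque_at_transfer[OF quotient_model_subset[OF modF sub] quotient_model_subset[OF modZ sub] refl z z F])
  qed
  show ?thesis
    unfolding s_smooth_iff product_space_simps(1)
    using Z.stalkwise canc flasque by (simp add: product_space_simps(1))
qed

end

theorem proposition7p4:
  shows
    "(\<forall>(X :: ('p, 'a) monoid_space) (I :: 'i set) (U :: 'i \<Rightarrow> 'p set).
        is_monoid_scheme X \<longrightarrow> finite_type X \<longrightarrow>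
        (\<forall>i\<in>I. openin (base X) (U i)) \<longrightarrow> (\<Union>i\<in>I. U i) = topspace (base X) \<longrightarrow>
        (s_smooth X \<longleftrightarrow> (\<forall>i\<in>I. s_smooth (open_subspace X (U i)))))
     \<and> (\<forall>(X :: ('p, 'a) monoid_space) (Y :: ('q, 'b) monoid_space).
        s_smooth X \<longrightarrow> s_smooth Y \<longrightarrow> s_smooth (product_space X Y))
     \<and> (\<forall>X :: ('p, 'a) monoid_space. smooth X \<longrightarrow> s_smooth X)"
proof (intro conjI allI impI)
  fix X :: "('p, 'a) monoid_space" and I :: "'i set" and U :: "'i \<Rightarrow> 'p set"
  assume "is_monoid_scheme X" "finite_type X"
    and U: "\<forall>i\<in>I. openin (base X) (U i)" "(\<Union>i\<in>I. U i) = topspace (base X)"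
  then interpret stalkwise X by (simp add: stalkwise_def stalkwise_scheme_iff)
  show "s_smooth X \<longleftrightarrow> (\<forall>i\<in>I. s_smooth (open_subspace X (U i)))"
    by (rule s_smooth_local) (use U in auto)
next
  fix X :: "('p, 'a) monoid_space" and Y :: "('q, 'b) monoid_space"
  assume s: "s_smooth X" "s_smooth Y"
  then have "stalkwise_pair X Y" by (simp add: s_smooth_iff stalkwise_pair_def stalkwise_def)
  then show "s_smooth (product_space X Y)" using s by (rule stalkwise_pair.s_smooth_product)
qed (rule s_smooth_of_smooth)

end
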